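(* Let $S\subset\mathcal V_k$ be finite and let $\mathfrak g$ be an $\mathfrak o_S$-form of a non-abelian finite-dimensional Lie $k$-algebra of maximal class. Then $\alpha_{\mathfrak g} = 2$.
   Context: $k$ is a number field, $\mathcal V_k$ its set of non-Archimedean places, and for $S\subset\mathcal V_k$, $\mathfrak o_S$ is the ring of $S$-integers of $k$ (elements of $k$ that are $v$-integral for all $v\in\mathcal V_k\setminus S$). For a finite-dimensional Lie $k$-algebra $\boldsymbol{\mathfrak g}$, an $\mathfrak o_S$-form of $\boldsymbol{\mathfrak g}$ is a Lie $\mathfrak o_S$-algebra $\mathfrak g$ whose underlying $\mathfrak o_S$-module is free and such that $\mathfrak g\otimes_{\mathfrak o_S}k$ is isomorphic to $\boldsymbol{\mathfrak g}$ over $k$. A finite-dimensional Lie $k$-algebra $\boldsymbol{\mathfrak g}$ has maximal class if it is nilpotent of class $\dim_k(\boldsymbol{\mathfrak g})-1$. The ideal zeta function of $\mathfrak g$ is $\zeta_{\mathfrak g}(s)=\sum_{I}|\mathfrak g:I|^{-s}$, where $I$ ranges over the ideals of $\mathfrak g$ (Lie ideals that are $\mathfrak o_S$-submodules) of finite additive index, and $\alpha_{\mathfrak g}$ denotes its abscissa of convergence. *)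

theory Defs
  imports
    "HOL-Analysis.Analysis"
    "HOL-Algebra.Algebra"
    "HOL-Algebra.Algebraic_Closure_Type"
begin

section \<open>Number fields, non-Archimedean places and S-integers\<close>

definition number_field :: "'k::field_char_0 itself \<Rightarrow> bool" where
  "number_field _ \<longleftrightarrow>
     (\<exists>B::'k set. finite_dimensional_vector_space (\<lambda>q x. of_rat q * x) B)"

definition nonarch_abs_value :: "('k::field_char_0 \<Rightarrow> real) \<Rightarrow> bool" where
  "nonarch_abs_value f \<longleftrightarrow>
     (\<forall>x. 0 \<le> f x) \<and> (\<forall>x. f x = 0 \<longleftrightarrow> x = 0) \<and>
     (\<forall>x y. f (x * y) = f x * f y) \<and>
     (\<forall>x y. f (x + y) \<le> max (f x) (f y)) \<and>
     (\<exists>x. x \<noteq> 0 \<and> f x \<noteq> 1)"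

definition abs_value_equiv :: "(('k::field_char_0 \<Rightarrow> real) \<times> ('k \<Rightarrow> real)) set" where
  "abs_value_equiv = {(f, g). nonarch_abs_value f \<and> nonarch_abs_value g \<and>
     (\<exists>c>0. \<forall>x. g x = f x powr c)}"

text \<open>A place is an equivalence class of nontrivial absolute values.\<close>

definition nonarch_places :: "('k::field_char_0 \<Rightarrow> real) set set" where
  "nonarch_places = {f. nonarch_abs_value f} // abs_value_equiv"

definition place_integral :: "('k::field_char_0 \<Rightarrow> real) set \<Rightarrow> 'k \<Rightarrow> bool" where
  "place_integral v x \<longleftrightarrow> (\<forall>f\<in>v. f x \<le> 1)"

definition field_ring :: "'k::field_char_0 ring" where
  "field_ring = ring_of_type_algebra"

definition S_integers :: "('k::field_char_0 \<Rightarrow> real) set set \<Rightarrow> 'k ring" where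
  "S_integers S =
     field_ring\<lparr>carrier := {x. \<forall>v \<in> nonarch_places - S. place_integral v x}\<rparr>"


section \<open>Lie algebras over commutative rings\<close>

text \<open>As for modules in HOL-Algebra, the fields \<open>mult\<close> and \<open>one\<close> that the record
  inherits from \<open>ring\<close> play no role; the Lie bracket is a separate field.\<close>

record ('a, 'b) lie_alg = "('a, 'b) module" +
  bracket :: "'b \<Rightarrow> 'b \<Rightarrow> 'b"

locale lie_algebra = Module.module R L
  for R :: "('a, 'm) ring_scheme" (structure) and L :: "('a, 'b, 'n) lie_alg_scheme" (structure) +
  assumes bracket_closed:
      "\<lbrakk>x \<in> carrier L; y \<in> carrier L\<rbrakk> \<Longrightarrow> bracket L x y \<in> carrier L"
    and bracket_add_left:
      "\<lbrakk>x \<in> carrier L; y \<in> carrier L; z \<in> carrier L\<rbrakk> \<Longrightarrow>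
       bracket L (x \<oplus>\<^bsub>L\<^esub> y) z = bracket L x z \<oplus>\<^bsub>L\<^esub> bracket L y z"
    and bracket_add_right:
      "\<lbrakk>x \<in> carrier L; y \<in> carrier L; z \<in> carrier L\<rbrakk> \<Longrightarrow>
       bracket L x (y \<oplus>\<^bsub>L\<^esub> z) = bracket L x y \<oplus>\<^bsub>L\<^esub> bracket L x z"
    and bracket_smult_left:
      "\<lbrakk>a \<in> carrier R; x \<in> carrier L; y \<in> carrier L\<rbrakk> \<Longrightarrow>
       bracket L (a \<odot>\<^bsub>L\<^esub> x) y = a \<odot>\<^bsub>L\<^esub> bracket L x y"
    and bracket_smult_right:
      "\<lbrakk>a \<in> carrier R; x \<in> carrier L; y \<in> carrier L\<rbrakk> \<Longrightarrow>
       bracket L x (a \<odot>\<^bsub>L\<^esub> y) = a \<odot>\<^bsub>L\<^esub> bracket L x y"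
    and bracket_self:
      "x \<in> carrier L \<Longrightarrow> bracket L x x = \<zero>\<^bsub>L\<^esub>"
    and jacobi:
      "\<lbrakk>x \<in> carrier L; y \<in> carrier L; z \<in> carrier L\<rbrakk> \<Longrightarrow>
       bracket L x (bracket L y z) \<oplus>\<^bsub>L\<^esub> bracket L y (bracket L z x)
         \<oplus>\<^bsub>L\<^esub> bracket L z (bracket L x y) = \<zero>\<^bsub>L\<^esub>"

definition lie_abelian :: "('a, 'b, 'n) lie_alg_scheme \<Rightarrow> bool" where
  "lie_abelian L \<longleftrightarrow> (\<forall>x\<in>carrier L. \<forall>y\<in>carrier L. bracket L x y = \<zero>\<^bsub>L\<^esub>)"

definition lie_iso ::
  "('a, 'm) ring_scheme \<Rightarrow> ('a, 'b, 'n) lie_alg_scheme \<Rightarrow> ('a, 'c, 'p) lie_alg_scheme \<Rightarrow> bool" where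
  "lie_iso R L M \<longleftrightarrow> (\<exists>\<phi>. bij_betw \<phi> (carrier L) (carrier M) \<and>
     (\<forall>x\<in>carrier L. \<forall>y\<in>carrier L. \<phi> (x \<oplus>\<^bsub>L\<^esub> y) = \<phi> x \<oplus>\<^bsub>M\<^esub> \<phi> y) \<and>
     (\<forall>a\<in>carrier R. \<forall>x\<in>carrier L. \<phi> (a \<odot>\<^bsub>L\<^esub> x) = a \<odot>\<^bsub>M\<^esub> \<phi> x) \<and>
     (\<forall>x\<in>carrier L. \<forall>y\<in>carrier L. \<phi> (bracket L x y) = bracket M (\<phi> x) (\<phi> y)))"

definition module_basis ::
  "('a, 'm) ring_scheme \<Rightarrow> ('a, 'b, 'n) module_scheme \<Rightarrow> 'b set \<Rightarrow> bool" where
  "module_basis R M B \<longleftrightarrow> B \<subseteq> carrier M \<and>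
     (\<forall>x\<in>carrier M. \<exists>!c. c \<in> B \<rightarrow>\<^sub>E carrier R \<and> finite {b \<in> B. c b \<noteq> \<zero>\<^bsub>R\<^esub>} \<and>
        x = (\<Oplus>\<^bsub>M\<^esub> b \<in> {b \<in> B. c b \<noteq> \<zero>\<^bsub>R\<^esub>}. c b \<odot>\<^bsub>M\<^esub> b))"

definition free_module :: "('a, 'm) ring_scheme \<Rightarrow> ('a, 'b, 'n) module_scheme \<Rightarrow> bool" where
  "free_module R M \<longleftrightarrow> (\<exists>B. module_basis R M B)"

definition submodule_span ::
  "('a, 'm) ring_scheme \<Rightarrow> ('a, 'b, 'n) module_scheme \<Rightarrow> 'b set \<Rightarrow> 'b set" where
  "submodule_span R M A = (\<lambda>N. submodule N R M) hull A"

text \<open>The term with index \<open>0\<close> is the whole algebra, usually written \<open>\<gamma>\<^sub>1\<close>.\<close>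

primrec lower_central ::
  "('a, 'm) ring_scheme \<Rightarrow> ('a, 'b, 'n) lie_alg_scheme \<Rightarrow> nat \<Rightarrow> 'b set" where
  "lower_central R L 0 = carrier L"
| "lower_central R L (Suc n) =
     submodule_span R L {bracket L x y | x y. x \<in> lower_central R L n \<and> y \<in> carrier L}"

definition nilpotent_of_class ::
  "('a, 'm) ring_scheme \<Rightarrow> ('a, 'b, 'n) lie_alg_scheme \<Rightarrow> nat \<Rightarrow> bool" where
  "nilpotent_of_class R L c \<longleftrightarrow>
     lower_central R L c = {\<zero>\<^bsub>L\<^esub>} \<and> (\<forall>j<c. lower_central R L j \<noteq> {\<zero>\<^bsub>L\<^esub>})"

text \<open>Written as \<open>dim = c + 1\<close> to avoid truncated subtraction for the zero algebra.\<close>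

definition maximal_class ::
  "('a, 'm) ring_scheme \<Rightarrow> ('a, 'b, 'n) lie_alg_scheme \<Rightarrow> bool" where
  "maximal_class K L \<longleftrightarrow>
     (\<exists>B c. finite B \<and> module_basis K L B \<and> nilpotent_of_class K L c \<and> card B = c + 1)"


section \<open>Extension of scalars and forms\<close>

text \<open>The tensor product of an \<open>R\<close>-module \<open>L\<close> with an extension ring \<open>K\<close> of \<open>R\<close> is the
  free abelian group on pairs modulo the subgroup generated by the bilinearity relations.
  Its elements are cosets; scalar multiplication and bracket are induced by
  \<open>a (x \<otimes> b) = x \<otimes> ab\<close> and \<open>[x \<otimes> a, y \<otimes> b] = [x, y] \<otimes> ab\<close>. The unions below
  range over all representatives of the given cosets, which all yield the same coset.\<close>

definition tensor_relations ::
  "('k, 'm) ring_scheme \<Rightarrow> ('k, 'r) ring_scheme \<Rightarrow> ('k, 'b, 'n) lie_alg_scheme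
     \<Rightarrow> ('b \<times> 'k \<Rightarrow>\<^sub>0 int) set" where
  "tensor_relations R K L = generate (free_Abelian_group (carrier L \<times> carrier K))
     ({frag_of (x \<oplus>\<^bsub>L\<^esub> y, a) - frag_of (x, a) - frag_of (y, a) | x y a.
         x \<in> carrier L \<and> y \<in> carrier L \<and> a \<in> carrier K} \<union>
      {frag_of (x, a \<oplus>\<^bsub>K\<^esub> b) - frag_of (x, a) - frag_of (x, b) | x a b.
         x \<in> carrier L \<and> a \<in> carrier K \<and> b \<in> carrier K} \<union>
      {frag_of (r \<odot>\<^bsub>L\<^esub> x, a) - frag_of (x, r \<otimes>\<^bsub>K\<^esub> a) | r x a.
         r \<in> carrier R \<and> x \<in> carrier L \<and> a \<in> carrier K})"

definition scalar_extension ::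
  "('k, 'm) ring_scheme \<Rightarrow> ('k, 'r) ring_scheme \<Rightarrow> ('k, 'b, 'n) lie_alg_scheme
     \<Rightarrow> ('k, ('b \<times> 'k \<Rightarrow>\<^sub>0 int) set) lie_alg" where
  "scalar_extension R K L =
     (let F = free_Abelian_group (carrier L \<times> carrier K);
          H = tensor_relations R K L
      in \<lparr> carrier = carrier (F Mod H),
           monoid.mult = undefined,
           one = undefined,
           ring.zero = \<one>\<^bsub>F Mod H\<^esub>,
           add = (\<lambda>C D. C \<otimes>\<^bsub>F Mod H\<^esub> D),
           smult = (\<lambda>a C. \<Union>z\<in>C.
             H #>\<^bsub>F\<^esub> frag_extend (\<lambda>(x, b). frag_of (x, a \<otimes>\<^bsub>K\<^esub> b)) z),
           bracket = (\<lambda>C D. \<Union>z\<in>C. \<Union>w\<in>D.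
             H #>\<^bsub>F\<^esub> frag_extend (\<lambda>(x, a).
               frag_extend (\<lambda>(y, b). frag_of (bracket L x y, a \<otimes>\<^bsub>K\<^esub> b)) w) z) \<rparr>)"

definition lie_form ::
  "('k, 'm) ring_scheme \<Rightarrow> ('k, 'r) ring_scheme \<Rightarrow> ('k, 'b, 'n) lie_alg_scheme
     \<Rightarrow> ('k, 'c, 'p) lie_alg_scheme \<Rightarrow> bool" where
  "lie_form R K L M \<longleftrightarrow>
     lie_algebra R L \<and> free_module R L \<and> lie_iso K (scalar_extension R K L) M"


section \<open>The ideal zeta function\<close>

definition lie_ideal ::
  "('a, 'm) ring_scheme \<Rightarrow> ('a, 'b, 'n) lie_alg_scheme \<Rightarrow> 'b set \<Rightarrow> bool" where
  "lie_ideal R L I \<longleftrightarrow>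
     submodule I R L \<and> (\<forall>x\<in>carrier L. \<forall>y\<in>I. bracket L x y \<in> I)"

definition finite_index_ideals ::
  "('a, 'm) ring_scheme \<Rightarrow> ('a, 'b, 'n) lie_alg_scheme \<Rightarrow> 'b set set" where
  "finite_index_ideals R L = {I. lie_ideal R L I \<and> finite (a_rcosets\<^bsub>L\<^esub> I)}"

definition ideal_zeta_term ::
  "('a, 'b, 'n) lie_alg_scheme \<Rightarrow> complex \<Rightarrow> 'b set \<Rightarrow> complex" where
  "ideal_zeta_term L s I = of_nat (card (a_rcosets\<^bsub>L\<^esub> I)) powr (- s)"

definition ideal_zeta ::
  "('a, 'm) ring_scheme \<Rightarrow> ('a, 'b, 'n) lie_alg_scheme \<Rightarrow> complex \<Rightarrow> complex" where
  "ideal_zeta R L s = (\<Sum>\<^sub>\<infinity>I\<in>finite_index_ideals R L. ideal_zeta_term L s I)"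

text \<open>The infimum of all real \<open>\<sigma>\<close> such that the series \<^const>\<open>ideal_zeta\<close> converges on the
  half-plane \<open>Re s > \<sigma>\<close>. Unordered summation does not change this abscissa, because the
  series has nonnegative Dirichlet coefficients.\<close>

definition ideal_zeta_abscissa ::
  "('a, 'm) ring_scheme \<Rightarrow> ('a, 'b, 'n) lie_alg_scheme \<Rightarrow> ereal" where
  "ideal_zeta_abscissa R L = Inf {ereal \<sigma> | \<sigma>.
     \<forall>s. Re s > \<sigma> \<longrightarrow> ideal_zeta_term L s summable_on finite_index_ideals R L}"

end

(* Let R be the ring of S-integers and n the rank of g. Choosing generic generators x, y of the
   ambient algebra yields a basis x, y, [x,y], [x,[x,y]], ... on which ad x is a shift, so that,
   after clearing denominators, an ideal of g is a shift-invariant submodule of R^n up to a twist in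
   the leading coordinate. Intersecting with the coordinate flag, such a submodule J is determined by
   its trace J' one step down, the ideal c of its leading coefficients, and a lift of the leading
   coefficients that commutes with the shift modulo J'. There are boundedly many lifts for each
   element of R/c', where c' is the leading ideal of J', so that summing over c loses exactly one
   factor of the index of c' and the ideal sum converges for s > 2. Conversely, the conditions
   v_x = t v_y mod a on the coordinates of x and y define, for a and t in boxes of the order A,
   enough ideals of small index to make the sum diverge for s < 2.
   Ideals of R are handled without class groups or unique factorization: by the pigeonhole principle
   each one contains an element of a box of the right size, hence a principal ideal of bounded
   index. That R lies in A[1/N] for some N uses absolute values constructed at all but finitely many
   primes p, where A/pA is reduced and a power of Frobenius acts as the identity. *)

theory Submission
  imports Defs "HOL-Library.Function_Algebras"
begin

section \<open>Indices of additive subgroups\<close>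

text \<open>The abscissa ignores bounded factors, so comparisons up to finite index are allowed: an
  arbitrary order for the maximal one, coordinates up to a denominator, an ideal up to a principal
  subideal. Each loss must be uniform in the ideal; hence constants such as \<open>fact K\<close>,
  which depend only on a bound K for an index. For the upper bound only stability under ad x is
  kept, so more submodules are counted than there are ideals. The step along the flag works because
  the number of lifts is known exactly: on the finite quotient by a shift-invariant J the shift has
  kernel and cokernel of equal size, and the cokernel is R modulo the leading ideal. So the weight
  \<open>tr j J\<close> that the next step costs is an index which the present step can pay for, and
  exponent s - 1 > 1 remains for each leading ideal. For the lower bound the quotient by the
  commutator algebra is enough: it is two-dimensional, every submodule containing all brackets is an
  ideal, and submodules of a module of rank two already produce abscissa 2.\<close>

definition subgrp :: "'a::ab_group_add set \<Rightarrow> bool" where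
  "subgrp H \<longleftrightarrow> 0 \<in> H \<and> (\<forall>x\<in>H. \<forall>y\<in>H. x - y \<in> H)"

lemma subgrp_0: "subgrp H \<Longrightarrow> 0 \<in> H"
  by (simp add: subgrp_def)

lemma subgrp_diff: "subgrp H \<Longrightarrow> x \<in> H \<Longrightarrow> y \<in> H \<Longrightarrow> x - y \<in> H"
  by (simp add: subgrp_def)

lemma subgrp_minus: "subgrp H \<Longrightarrow> x \<in> H \<Longrightarrow> - x \<in> H"
  by (metis subgrp_0 subgrp_diff diff_0)

lemma subgrp_add: "subgrp H \<Longrightarrow> x \<in> H \<Longrightarrow> y \<in> H \<Longrightarrow> x + y \<in> H"
  by (metis subgrp_minus subgrp_diff diff_minus_eq_add)

lemma subgrp_Int: "subgrp H \<Longrightarrow> subgrp K \<Longrightarrow> subgrp (H \<inter> K)"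
  by (simp add: subgrp_def)

lemma subgrp_sum: "subgrp H \<Longrightarrow> (\<And>i. i \<in> I \<Longrightarrow> f i \<in> H) \<Longrightarrow> sum f I \<in> H"
  by (induction I rule: infinite_finite_induct) (auto simp: subgrp_0 subgrp_add)

definition coset_set :: "'a::ab_group_add set \<Rightarrow> 'a set \<Rightarrow> 'a set set" where
  "coset_set G H = (\<lambda>x. (+) x ` H) ` G"

text \<open>Infinite indices are given the value 0, so bounds on \<open>idx\<close> come with a finiteness statement.\<close>

definition idx :: "'a::ab_group_add set \<Rightarrow> 'a set \<Rightarrow> nat" where
  "idx G H = card (coset_set G H)"

lemma coset_eq_iff:
  assumes "subgrp H"
  shows "(+) x ` H = (+) y ` H \<longleftrightarrow> x - y \<in> H"
proof
  assume "(+) x ` H = (+) y ` H"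
  then have "x + 0 \<in> (+) y ` H"
    using subgrp_0[OF assms] by blast
  then show "x - y \<in> H" by auto
next
  have sub: "(+) x ` H \<subseteq> (+) y ` H" if "x - y \<in> H" for x y
  proof
    fix z assume "z \<in> (+) x ` H"
    then obtain h where h: "h \<in> H" "z = x + h" by auto
    then have "z = y + ((x - y) + h)" by simp
    then show "z \<in> (+) y ` H"
      using subgrp_add[OF assms that h(1)] by blast
  qed
  assume "x - y \<in> H"
  moreover then have "y - x \<in> H"
    using subgrp_minus[OF assms] by (metis minus_diff_eq)
  ultimately show "(+) x ` H = (+) y ` H"
    using sub by blast
qed

lemma idx_pos:
  assumes "finite (coset_set G H)" "subgrp G"
  shows "idx G H \<ge> 1"
proof -
  have "coset_set G H \<noteq> {}" using subgrp_0[OF assms(2)] by (auto simp: coset_set_def)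
  then show ?thesis using assms(1) by (simp add: idx_def Suc_leI card_gt_0_iff)
qed

text \<open>Preservation of congruences makes the induced map on cosets well defined, reflection
  makes it injective, and meeting every class makes it onto. The two lemmas that follow read off
  inequality and equality of indices.\<close>

lemma coset_hom_inj:
  assumes H: "subgrp H" "subgrp H'"
    and f: "\<And>x y. x \<in> G \<Longrightarrow> y \<in> G \<Longrightarrow> x - y \<in> H \<longleftrightarrow> f x - f y \<in> H'"
    and sub: "f ` G \<subseteq> G'"
  shows "\<exists>F. inj_on F (coset_set G H) \<and> F ` coset_set G H \<subseteq> coset_set G' H' \<and>
           ((\<forall>y\<in>G'. \<exists>x\<in>G. f x - y \<in> H') \<longrightarrow> F ` coset_set G H = coset_set G' H')"
proof -
  define r where "r C = (SOME x. x \<in> G \<and> C = (+) x ` H)" for C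
  have r: "r C \<in> G \<and> C = (+) (r C) ` H" if "C \<in> coset_set G H" for C
    unfolding r_def by (rule someI_ex) (use that in \<open>auto simp: coset_set_def\<close>)
  define F where "F C = (+) (f (r C)) ` H'" for C
  have F: "F ((+) x ` H) = (+) (f x) ` H'" if "x \<in> G" for x
  proof -
    have C: "(+) x ` H \<in> coset_set G H" using that by (auto simp: coset_set_def)
    have "x - r ((+) x ` H) \<in> H"
      using r[OF C] coset_eq_iff[OF H(1)] by blast
    then have "f x - f (r ((+) x ` H)) \<in> H'" using f r[OF C] that by blast
    then show ?thesis unfolding F_def using coset_eq_iff[OF H(2)] by metis
  qed
  have "inj_on F (coset_set G H)"
  proof (rule inj_onI)
    fix C D assume CD: "C \<in> coset_set G H" "D \<in> coset_set G H" "F C = F D"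
    then have "f (r C) - f (r D) \<in> H'" unfolding F_def using coset_eq_iff[OF H(2)] by blast
    then have "r C - r D \<in> H" using f r CD by blast
    then show "C = D" using r CD coset_eq_iff[OF H(1)] by metis
  qed
  moreover have "F ` coset_set G H \<subseteq> coset_set G' H'"
    using F sub by (fastforce simp: coset_set_def)
  moreover have "F ` coset_set G H = coset_set G' H'" if *: "\<forall>y\<in>G'. \<exists>x\<in>G. f x - y \<in> H'"
  proof
    show "coset_set G' H' \<subseteq> F ` coset_set G H"
    proof
      fix D assume "D \<in> coset_set G' H'"
      then obtain y where y: "y \<in> G'" "D = (+) y ` H'" by (auto simp: coset_set_def)
      then obtain x where x: "x \<in> G" "f x - y \<in> H'" using * by blast
      then have "F ((+) x ` H) = D" using F y coset_eq_iff[OF H(2)] by metis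
      then show "D \<in> F ` coset_set G H" using x by (auto simp: coset_set_def)
    qed
  qed fact
  ultimately show ?thesis by blast
qed

lemma idx_hom_le:
  assumes "subgrp H" "subgrp H'"
    and "\<And>x y. x \<in> G \<Longrightarrow> y \<in> G \<Longrightarrow> x - y \<in> H \<longleftrightarrow> f x - f y \<in> H'"
    and "f ` G \<subseteq> G'" and "finite (coset_set G' H')"
  shows "finite (coset_set G H)" "idx G H \<le> idx G' H'"
proof -
  obtain F where F: "inj_on F (coset_set G H)" "F ` coset_set G H \<subseteq> coset_set G' H'"
    using coset_hom_inj[OF assms(1-4)] by blast
  show "finite (coset_set G H)" using inj_on_finite[OF F assms(5)] .
  show "idx G H \<le> idx G' H'" using card_inj_on_le[OF F assms(5)] by (simp add: idx_def)
qed

lemma idx_hom_eq: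
  assumes "subgrp H" "subgrp H'"
    and "\<And>x y. x \<in> G \<Longrightarrow> y \<in> G \<Longrightarrow> x - y \<in> H \<longleftrightarrow> f x - f y \<in> H'"
    and "f ` G \<subseteq> G'" and "\<And>y. y \<in> G' \<Longrightarrow> \<exists>x\<in>G. f x - y \<in> H'"
  shows "finite (coset_set G H) \<longleftrightarrow> finite (coset_set G' H')" "idx G H = idx G' H'"
proof -
  obtain F where "inj_on F (coset_set G H)" "F ` coset_set G H = coset_set G' H'"
    using coset_hom_inj[OF assms(1-4)] assms(5) by blast
  then have "bij_betw F (coset_set G H) (coset_set G' H')" by (simp add: bij_betw_def)
  then show "finite (coset_set G H) \<longleftrightarrow> finite (coset_set G' H')" "idx G H = idx G' H'"
    using bij_betw_finite bij_betw_same_card by (auto simp: idx_def)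
qed

lemma idx_mono:
  assumes "subgrp H" "G1 \<subseteq> G" "finite (coset_set G H)"
  shows "finite (coset_set G1 H)" "idx G1 H \<le> idx G H"
proof -
  have sub: "coset_set G1 H \<subseteq> coset_set G H" using assms(2) by (auto simp: coset_set_def)
  show "finite (coset_set G1 H)" using finite_subset[OF sub assms(3)] .
  show "idx G1 H \<le> idx G H" using card_mono[OF assms(3) sub] by (simp add: idx_def)
qed

lemma idx_tower:
  assumes sub: "subgrp G" "subgrp K" "subgrp H" and le: "H \<subseteq> K" "K \<subseteq> G"
  shows "finite (coset_set G H) \<longleftrightarrow> finite (coset_set G K) \<and> finite (coset_set K H)"
    and "idx G H = idx G K * idx K H"
proof -
  define r where "r C = (SOME x. x \<in> G \<and> C = (+) x ` K)" for C
  have r: "r C \<in> G \<and> C = (+) (r C) ` K" if "C \<in> coset_set G K" for C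
    unfolding r_def by (rule someI_ex) (use that in \<open>auto simp: coset_set_def\<close>)
  \<comment> \<open>The coset r C + D determines C as the K-coset around it, and then D by
    translating back. The bijection is purely set-theoretic, so the product formula also covers
    infinite indices, which count as 0.\<close>
  define P where "P = (\<lambda>(C, D). (+) (r C) ` D)"
  have bij: "bij_betw P (coset_set G K \<times> coset_set K H) (coset_set G H)"
    unfolding bij_betw_def
  proof
    show "inj_on P (coset_set G K \<times> coset_set K H)"
    proof (rule inj_onI, clarify)
      fix C D C' D'
      assume C: "C \<in> coset_set G K" "C' \<in> coset_set G K"
        and D: "D \<in> coset_set K H" "D' \<in> coset_set K H" and eq: "P (C, D) = P (C', D')"
      obtain x x' where x: "x \<in> K" "D = (+) x ` H" "x' \<in> K" "D' = (+) x' ` H"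
        using D by (auto simp: coset_set_def)
      have "(+) (r C + x) ` H = (+) (r C' + x') ` H"
        using eq x by (simp add: P_def image_image add.assoc)
      then have d: "(r C + x) - (r C' + x') \<in> H" using coset_eq_iff[OF sub(3)] by blast
      have "r C - r C' = ((r C + x) - (r C' + x')) + (x' - x)" by simp
      then have "r C - r C' \<in> K" using d le x sub by (metis subgrp_add subgrp_diff subsetD)
      then have "C = C'" using r[OF C(1)] r[OF C(2)] coset_eq_iff[OF sub(2)] by metis
      then show "C = C' \<and> D = D'" using d x coset_eq_iff[OF sub(3)] by simp
    qed
    show "P ` (coset_set G K \<times> coset_set K H) = coset_set G H"
    proof (intro equalityI subsetI)
      fix E assume "E \<in> P ` (coset_set G K \<times> coset_set K H)"
      then obtain C x where "C \<in> coset_set G K" "x \<in> K" "E = (+) (r C) ` (+) x ` H"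
        by (auto simp: P_def coset_set_def)
      then have "r C + x \<in> G" "E = (+) (r C + x) ` H"
        using r le sub by (auto simp: image_image add.assoc intro: subgrp_add)
      then show "E \<in> coset_set G H" by (auto simp: coset_set_def)
    next
      fix E assume "E \<in> coset_set G H"
      then obtain z where z: "z \<in> G" "E = (+) z ` H" by (auto simp: coset_set_def)
      define C where "C = (+) z ` K"
      have C: "C \<in> coset_set G K" using z by (auto simp: C_def coset_set_def)
      have "z - r C \<in> K" using r[OF C] coset_eq_iff[OF sub(2)] C_def by blast
      moreover have "E = P (C, (+) (z - r C) ` H)"
        by (simp add: P_def z image_image add.assoc)
      ultimately show "E \<in> P ` (coset_set G K \<times> coset_set K H)"
        using C by (auto simp: coset_set_def)
    qed
  qed
  have ne: "coset_set G K \<noteq> {}" "coset_set K H \<noteq> {}"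
    using sub subgrp_0 by (auto simp: coset_set_def)
  show "finite (coset_set G H) \<longleftrightarrow> finite (coset_set G K) \<and> finite (coset_set K H)"
    using bij_betw_finite[OF bij] ne by (simp add: finite_cartesian_product_iff)
  show "idx G H = idx G K * idx K H"
    using bij_betw_same_card[OF bij] by (simp add: idx_def card_cartesian_product)
qed

lemma card_incongruent_le:
  assumes "subgrp H" "finite (coset_set G H)" "S \<subseteq> G"
    and "\<And>x y. x \<in> S \<Longrightarrow> y \<in> S \<Longrightarrow> x - y \<in> H \<Longrightarrow> x = y"
  shows "finite S" "card S \<le> idx G H"
proof -
  have i: "inj_on (\<lambda>x. (+) x ` H) S"
    using assms(4) coset_eq_iff[OF assms(1)] by (auto simp: inj_on_def)
  have s: "(\<lambda>x. (+) x ` H) ` S \<subseteq> coset_set G H"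
    using assms(3) by (auto simp: coset_set_def)
  show "finite S" using inj_on_finite[OF i s assms(2)] .
  show "card S \<le> idx G H" using card_inj_on_le[OF i s assms(2)] by (simp add: idx_def)
qed

lemma idx_leI:
  assumes "subgrp H"
    and "\<And>S. finite S \<Longrightarrow> S \<subseteq> G \<Longrightarrow> (\<And>x y. x \<in> S \<Longrightarrow> y \<in> S \<Longrightarrow> x - y \<in> H \<Longrightarrow> x = y) \<Longrightarrow> card S \<le> Q"
  shows "finite (coset_set G H)" "idx G H \<le> Q"
proof -
  define r where "r C = (SOME x. x \<in> G \<and> C = (+) x ` H)" for C
  have r: "r C \<in> G \<and> C = (+) (r C) ` H" if "C \<in> coset_set G H" for C
    unfolding r_def by (rule someI_ex) (use that in \<open>auto simp: coset_set_def\<close>)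
  have le: "card T \<le> Q" if T: "finite T" "T \<subseteq> coset_set G H" for T
  proof -
    have inj: "inj_on r T" using r that by (metis inj_onI subsetD)
    have "card (r ` T) \<le> Q"
    proof (rule assms(2))
      show "finite (r ` T)" using that by simp
      show "r ` T \<subseteq> G" using r that by blast
      fix x y assume xy: "x \<in> r ` T" "y \<in> r ` T" "x - y \<in> H"
      then obtain C D where CD: "C \<in> coset_set G H" "D \<in> coset_set G H" "x = r C" "y = r D"
        using T by blast
      then have "C = D" using r[OF CD(1)] r[OF CD(2)] xy(3) coset_eq_iff[OF assms(1)] by metis
      then show "x = y" using CD by simp
    qed
    then show ?thesis using card_image[OF inj] by simp
  qed
  show fin: "finite (coset_set G H)"
  proof (rule ccontr)
    assume "infinite (coset_set G H)"
    then obtain T where "T \<subseteq> coset_set G H" "finite T" "card T = Suc Q"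
      by (meson infinite_arbitrarily_large)
    then show False using le[of T] by simp
  qed
  show "idx G H \<le> Q" using le[OF fin] by (simp add: idx_def)
qed

lemma ex_congruent:
  assumes "subgrp H" "finite (coset_set G H)" "finite S" "S \<subseteq> G" "idx G H < card S"
  shows "\<exists>x\<in>S. \<exists>y\<in>S. x \<noteq> y \<and> x - y \<in> H"
  using card_incongruent_le(2)[OF assms(1,2,4)] assms(5) by fastforce

text \<open>A group between W and W' is the union of its W-cosets, hence given by a subset of the at
  most K cosets of W in W'. The crude bound suffices, since only uniformity matters.\<close>

lemma card_intermediate_le:
  assumes W: "subgrp W" and fin: "finite (coset_set W' W)" "idx W' W \<le> K"
    and F: "\<And>J. J \<in> F \<Longrightarrow> subgrp J \<and> W \<subseteq> J \<and> J \<subseteq> W'"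
  shows "finite F" "card F \<le> 2 ^ K"
proof -
  have inj: "inj_on (\<lambda>J. coset_set J W) F"
  proof (rule inj_onI)
    have un: "\<Union>(coset_set J W) = J" if "J \<in> F" for J
    proof
      show "\<Union>(coset_set J W) \<subseteq> J" using F[OF that] subgrp_add by (fastforce simp: coset_set_def)
      show "J \<subseteq> \<Union>(coset_set J W)"
        using subgrp_0[OF W] by (force simp: coset_set_def)
    qed
    fix J1 J2 assume "J1 \<in> F" "J2 \<in> F" "coset_set J1 W = coset_set J2 W"
    then show "J1 = J2" using un by metis
  qed
  have sub: "(\<lambda>J. coset_set J W) ` F \<subseteq> Pow (coset_set W' W)"
    using F by (auto simp: coset_set_def)
  show "finite F" using inj_on_finite[OF inj sub] fin by simp
  have "card F \<le> card (Pow (coset_set W' W))" using card_inj_on_le[OF inj sub] fin by simp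
  also have "\<dots> \<le> 2 ^ K" using fin by (simp add: card_Pow idx_def)
  finally show "card F \<le> 2 ^ K" .
qed

text \<open>Compute (M : f W) once through W and once through f M. Injectivity gives (f M : f W) =
  (M : W), and this finite factor cancels.\<close>

lemma idx_mult_inj:
  assumes sub: "subgrp M" "subgrp W" "W \<subseteq> M" "finite (coset_set M W)"
    and f: "inj f" "\<And>x y. f (x - y) = f x - f y" and fM: "f ` M \<subseteq> M" and fW: "f ` W \<subseteq> W"
    and fin: "finite (coset_set M (f ` M))"
  shows "finite (coset_set W (f ` W))" "idx W (f ` W) = idx M (f ` M)"
proof -
  have sf: "subgrp (f ` Y)" if "subgrp Y" for Y
  proof -
    have "f 0 = 0" using f(2)[of 0 0] by simp
    moreover have "x - y \<in> f ` Y" if xy: "x \<in> f ` Y" "y \<in> f ` Y" for x y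
    proof -
      obtain a b where "x = f a" "a \<in> Y" "y = f b" "b \<in> Y" using xy by blast
      then have "x - y = f (a - b)" "a - b \<in> Y"
        using \<open>subgrp Y\<close> f(2) subgrp_diff by auto
      then show ?thesis by blast
    qed
    ultimately show ?thesis using that unfolding subgrp_def by (metis imageI)
  qed
  have e: "idx M W = idx (f ` M) (f ` W)" "finite (coset_set (f ` M) (f ` W))"
  proof -
    have *: "x - y \<in> W \<longleftrightarrow> f x - f y \<in> f ` W" for x y
      using f by (metis inj_image_mem_iff)
    have **: "\<exists>x\<in>M. f x - y \<in> f ` W" if "y \<in> f ` M" for y
      using that sf[OF sub(2)] subgrp_0 by force
    show "idx M W = idx (f ` M) (f ` W)" "finite (coset_set (f ` M) (f ` W))"
      using idx_hom_eq[OF sub(2) sf[OF sub(2)], of M f "f ` M"] * ** sub(4) by auto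
  qed
  have "idx M (f ` W) = idx M W * idx W (f ` W)"
    using idx_tower(2)[OF sub(1) sub(2) sf[OF sub(2)] fW sub(3)] .
  moreover have "idx M (f ` W) = idx M (f ` M) * idx (f ` M) (f ` W)"
    using idx_tower(2)[OF sub(1) sf[OF sub(1)] sf[OF sub(2)] _ fM] sub(3) by blast
  moreover have "finite (coset_set M (f ` W))"
    using idx_tower(1)[OF sub(1) sf[OF sub(1)] sf[OF sub(2)] _ fM] sub(3) fin e(2) by blast
  then show "finite (coset_set W (f ` W))"
    using idx_tower(1)[OF sub(1) sub(2) sf[OF sub(2)] fW sub(3)] by blast
  ultimately show "idx W (f ` W) = idx M (f ` M)"
    using e idx_pos[OF sub(4) sub(1)] by (metis mult.commute mult_left_cancel not_one_le_zero)
qed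

text \<open>The K + 1 multiples 0, z, ..., K z cannot be pairwise incongruent, so m z lies in H for
  some m between 1 and K, and m divides K!. One multiplier thus serves all pairs of index at most
  K.\<close>

lemma fact_idx_kills:
  fixes c :: "'a::field_char_0 set"
  assumes sub: "subgrp c" "subgrp H" "H \<subseteq> c" "finite (coset_set c H)" "idx c H \<le> K"
    and z: "z \<in> c"
  shows "of_nat (fact K) * z \<in> H"
proof (cases "z = 0")
  case True then show ?thesis using sub subgrp_0 by auto
next
  case False
  have mult: "of_nat n * w \<in> Y" if "w \<in> Y" "subgrp Y" for n w and Y :: "'a set"
    by (induction n) (use that in \<open>auto simp: subgrp_0 subgrp_add algebra_simps\<close>)
  have inj: "inj_on (\<lambda>i. of_nat i * z) {..K}" using False by (auto simp: inj_on_def)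
  have "\<exists>x\<in>(\<lambda>i. of_nat i * z) ` {..K}. \<exists>y\<in>(\<lambda>i. of_nat i * z) ` {..K}. x \<noteq> y \<and> x - y \<in> H"
    by (rule ex_congruent[OF sub(2,4)])
      (use sub(1,5) z mult card_image[OF inj] in auto)
  then obtain i j where ij: "i \<le> K" "j \<le> K" "i \<noteq> j" "of_nat i * z - of_nat j * z \<in> H" by auto
  have "\<exists>i j. i \<le> K \<and> i > j \<and> of_nat i * z - of_nat j * z \<in> H"
  proof (cases "i > j")
    case False
    then show ?thesis using ij subgrp_minus[OF sub(2) ij(4)]
      by (intro exI[of _ j] exI[of _ i]) auto
  qed (use ij in blast)
  then obtain i j where ij: "i \<le> K" "i > j" "of_nat i * z - of_nat j * z \<in> H" by blast
  define m where "m = i - j"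
  have "of_nat m * z \<in> H" using ij by (simp add: m_def of_nat_diff algebra_simps)
  moreover have "m dvd fact K" using ij by (intro dvd_fact) (auto simp: m_def)
  then obtain l where "fact K = l * m" by (metis dvdE mult.commute)
  moreover then have "of_nat (fact K) * z = of_nat l * (of_nat m * z)"
    by (metis mult.assoc of_nat_mult)
  ultimately show ?thesis using mult[OF _ sub(2)] by metis
qed

section \<open>Boxes in an order and principal ideals\<close>

text \<open>An order in the field: the integer span of \<open>w\<close> is a subring with 1, and
  \<open>denom\<close> says that its rational span is everything. Any order will do, so the integral
  closure of the integers is never constructed.\<close>

locale order_basis =
  fixes B :: "'i set" and w :: "'i \<Rightarrow> 'k::field_char_0"
  assumes finite_B: "finite B"
    and indep: "\<And>x :: 'i \<Rightarrow> int. (\<Sum>b\<in>B. of_int (x b) * w b) = 0 \<Longrightarrow> b \<in> B \<Longrightarrow> x b = 0"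
    and denom: "\<And>z. \<exists>D::nat. D > 0 \<and> (\<exists>x :: 'i \<Rightarrow> int. of_nat D * z = (\<Sum>b\<in>B. of_int (x b) * w b))"
    and one: "\<exists>x :: 'i \<Rightarrow> int. 1 = (\<Sum>b\<in>B. of_int (x b) * w b)"
    and mult: "\<And>a a'. a \<in> B \<Longrightarrow> a' \<in> B \<Longrightarrow> \<exists>x :: 'i \<Rightarrow> int. w a * w a' = (\<Sum>b\<in>B. of_int (x b) * w b)"
begin

definition emb :: "('i \<Rightarrow> int) \<Rightarrow> 'k" where
  "emb x = (\<Sum>b\<in>B. of_int (x b) * w b)"

definition A :: "'k set" where "A = range emb"

definition bx :: "nat \<Rightarrow> 'k set" where
  "bx H = {emb x | x. \<forall>b\<in>B. \<bar>x b\<bar> \<le> int H}"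

text \<open>The box for pigeonhole arguments: it is a corner of \<open>bx H\<close>, and differences
  of its elements stay in \<open>bx H\<close>, so that the size is not doubled.\<close>

definition pbx :: "nat \<Rightarrow> 'k set" where
  "pbx H = {emb x | x. \<forall>b\<in>B. 0 \<le> x b \<and> x b \<le> int H}"

lemma emb_diff: "emb x - emb y = emb (\<lambda>b. x b - y b)"
  by (simp add: emb_def sum_subtractf algebra_simps)

lemma emb_add: "emb x + emb y = emb (\<lambda>b. x b + y b)"
  by (simp add: emb_def sum.distrib algebra_simps)

lemma emb_inj: "emb x = emb y \<Longrightarrow> b \<in> B \<Longrightarrow> x b = y b"
  using indep[of "\<lambda>b. x b - y b" b] emb_diff[of x y] by (simp add: emb_def)

lemma emb_scale: "of_int m * emb x = emb (\<lambda>b. m * x b)"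
  by (simp add: emb_def sum_distrib_left mult.assoc)

lemma emb_sum: "finite I \<Longrightarrow> (\<Sum>i\<in>I. emb (f i)) = emb (\<lambda>b. \<Sum>i\<in>I. f i b)"
  unfolding emb_def by (subst sum.swap) (simp add: sum_distrib_right)

lemma subgrp_A: "subgrp A"
proof -
  have "0 = emb (\<lambda>b. 0)" by (simp add: emb_def)
  then show ?thesis unfolding subgrp_def A_def using emb_diff by auto
qed

lemma A_int: "x \<in> A \<Longrightarrow> of_int m * x \<in> A"
  using emb_scale by (auto simp: A_def)

text \<open>Multiplication is bilinear with integer structure constants, and C adds up their
  absolute values; the extra 1 keeps C positive.\<close>

lemma A_mult_bound: "\<exists>C\<ge>1. \<forall>H1 H2. \<forall>x\<in>bx H1. \<forall>y\<in>bx H2. x * y \<in> bx (C * H1 * H2)"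
proof -
  obtain c where c: "\<And>a a'. a \<in> B \<Longrightarrow> a' \<in> B \<Longrightarrow> w a * w a' = emb (c a a')"
    using mult unfolding emb_def by metis
  define C where "C = 1 + (\<Sum>a\<in>B. \<Sum>a'\<in>B. \<Sum>b\<in>B. nat \<bar>c a a' b\<bar>)"
  have "x * y \<in> bx (C * H1 * H2)" if x: "x \<in> bx H1" and y: "y \<in> bx H2" for H1 H2 x y
  proof -
    obtain u where u: "x = emb u" "\<And>b. b \<in> B \<Longrightarrow> \<bar>u b\<bar> \<le> int H1" using x by (auto simp: bx_def)
    obtain v where v: "y = emb v" "\<And>b. b \<in> B \<Longrightarrow> \<bar>v b\<bar> \<le> int H2" using y by (auto simp: bx_def)
    define z where "z b = (\<Sum>a\<in>B. \<Sum>a'\<in>B. u a * v a' * c a a' b)" for b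
    have "x * y = (\<Sum>a\<in>B. \<Sum>a'\<in>B. of_int (u a * v a') * (w a * w a'))"
      unfolding u v emb_def sum_product by (simp add: algebra_simps)
    also have "\<dots> = (\<Sum>a\<in>B. \<Sum>a'\<in>B. emb (\<lambda>b. u a * v a' * c a a' b))"
      by (intro sum.cong refl) (simp only: c emb_scale)
    also have "\<dots> = emb z" using finite_B by (simp add: emb_sum z_def[abs_def])
    finally have "x * y = emb z" .
    moreover have "\<bar>z b\<bar> \<le> int (C * H1 * H2)" if "b \<in> B" for b
    proof -
      have "\<bar>z b\<bar> \<le> (\<Sum>a\<in>B. \<Sum>a'\<in>B. \<bar>u a * v a' * c a a' b\<bar>)"
        unfolding z_def by (intro order_trans[OF sum_abs] sum_mono order_refl)
      also have "\<dots> \<le> (\<Sum>a\<in>B. \<Sum>a'\<in>B. int H1 * int H2 * (\<Sum>b\<in>B. \<bar>c a a' b\<bar>))"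
      proof (intro sum_mono)
        fix a a' assume "a \<in> B" "a' \<in> B"
        then have "\<bar>u a\<bar> * \<bar>v a'\<bar> \<le> int H1 * int H2" using u(2) v(2) by (simp add: mult_mono)
        moreover have "\<bar>c a a' b\<bar> \<le> (\<Sum>b\<in>B. \<bar>c a a' b\<bar>)"
          using that finite_B by (intro member_le_sum) auto
        ultimately show "\<bar>u a * v a' * c a a' b\<bar> \<le> int H1 * int H2 * (\<Sum>b\<in>B. \<bar>c a a' b\<bar>)"
          unfolding abs_mult by (rule mult_mono) auto
      qed
      also have "\<dots> = int H1 * int H2 * (\<Sum>a\<in>B. \<Sum>a'\<in>B. \<Sum>b\<in>B. \<bar>c a a' b\<bar>)"
        by (simp add: sum_distrib_left)
      also have "\<dots> \<le> int H1 * int H2 * int C"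
        unfolding C_def by (intro mult_left_mono) auto
      finally show ?thesis by (simp add: algebra_simps)
    qed
    ultimately show ?thesis by (auto simp: bx_def)
  qed
  then show ?thesis by (intro exI[of _ C]) (auto simp: C_def)
qed

lemma in_bx: "x \<in> A \<Longrightarrow> \<exists>H. x \<in> bx H"
proof -
  assume "x \<in> A"
  then obtain u where u: "x = emb u" by (auto simp: A_def)
  have "\<bar>u b\<bar> \<le> int (\<Sum>b\<in>B. nat \<bar>u b\<bar>)" if "b \<in> B" for b
  proof -
    have "nat \<bar>u b\<bar> \<le> (\<Sum>b\<in>B. nat \<bar>u b\<bar>)"
      using that finite_B by (intro member_le_sum) auto
    then show ?thesis by linarith
  qed
  then have "x \<in> bx (\<Sum>b\<in>B. nat \<bar>u b\<bar>)" using u unfolding bx_def by blast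
  then show ?thesis by blast
qed

lemma bx_A: "bx H \<subseteq> A" by (auto simp: bx_def A_def)
lemma pbx_bx: "pbx H \<subseteq> bx H" unfolding pbx_def bx_def by fastforce
lemma pbx_A: "pbx H \<subseteq> A" using pbx_bx bx_A by blast

lemma bx_mono: "H1 \<le> H2 \<Longrightarrow> bx H1 \<subseteq> bx H2"
  unfolding bx_def by clarify (metis of_nat_mono order_trans)

lemma bx_add:
  assumes "x \<in> bx H1" "y \<in> bx H2" shows "x + y \<in> bx (H1 + H2)"
proof -
  obtain u where u: "x = emb u" "\<And>b. b \<in> B \<Longrightarrow> \<bar>u b\<bar> \<le> int H1" using assms by (auto simp: bx_def)
  obtain v where v: "y = emb v" "\<And>b. b \<in> B \<Longrightarrow> \<bar>v b\<bar> \<le> int H2" using assms by (auto simp: bx_def)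
  have "\<bar>u b + v b\<bar> \<le> int (H1 + H2)" if "b \<in> B" for b using u(2)[OF that] v(2)[OF that] by linarith
  then show ?thesis using emb_add[of u v] unfolding u v bx_def by auto
qed

lemma pbx_diff: "x \<in> pbx H \<Longrightarrow> y \<in> pbx H \<Longrightarrow> x - y \<in> bx H"
proof -
  assume "x \<in> pbx H" "y \<in> pbx H"
  then obtain u v where uv: "x = emb u" "\<forall>b\<in>B. 0 \<le> u b \<and> u b \<le> int H"
    "y = emb v" "\<forall>b\<in>B. 0 \<le> v b \<and> v b \<le> int H" unfolding pbx_def by auto
  have "\<bar>u b - v b\<bar> \<le> int H" if "b \<in> B" for b using uv(2,4) that by fastforce
  then show ?thesis using emb_diff[of u v] unfolding uv bx_def by auto
qed

lemma finite_upper: "finite S \<Longrightarrow> S \<subseteq> A \<Longrightarrow> \<exists>H. S \<subseteq> bx H"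
proof (induction S rule: finite_induct)
  case (insert x S)
  then obtain H where H: "S \<subseteq> bx H" by auto
  have "x \<in> A" using insert by simp
  then obtain H' where "x \<in> bx H'" using in_bx by blast
  with H have "insert x S \<subseteq> bx (max H H')"
    using bx_mono[of H "max H H'"] bx_mono[of H' "max H H'"] by auto
  then show ?case by blast
qed auto

lemma card_box:
  assumes "finite I"
  shows "finite {emb x | x. \<forall>b\<in>B. x b \<in> I}"
    and "card {emb x | x. \<forall>b\<in>B. x b \<in> I} = card I ^ card B"
proof -
  have inj: "inj_on emb (PiE B (\<lambda>_. I))"
    by (rule inj_onI) (metis PiE_ext emb_inj)
  have eq: "{emb x | x. \<forall>b\<in>B. x b \<in> I} = emb ` PiE B (\<lambda>_. I)"
  proof safe
    fix x assume "\<forall>b\<in>B. x b \<in> I"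
    then have "restrict x B \<in> PiE B (\<lambda>_. I)" "emb x = emb (restrict x B)"
      by (auto simp: emb_def)
    then show "emb x \<in> emb ` PiE B (\<lambda>_. I)" by blast
  qed auto
  show "finite {emb x | x. \<forall>b\<in>B. x b \<in> I}"
    unfolding eq using assms finite_B by (simp add: finite_PiE)
  show "card {emb x | x. \<forall>b\<in>B. x b \<in> I} = card I ^ card B"
    unfolding eq card_image[OF inj] using finite_B by (simp add: card_PiE)
qed

lemma bx_eq: "bx H = {emb x | x. \<forall>b\<in>B. x b \<in> {- int H..int H}}"
  by (auto simp: bx_def abs_le_iff; metis minus_le_iff)

lemma pbx_eq: "pbx H = {emb x | x. \<forall>b\<in>B. x b \<in> {0..int H}}"
  by (auto simp: pbx_def)

lemma finite_bx: "finite (bx H)" and card_bx: "card (bx H) = (2 * H + 1) ^ card B"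
proof -
  have "card {- int H..int H} = 2 * H + 1" by simp
  then show "finite (bx H)" "card (bx H) = (2 * H + 1) ^ card B"
    using card_box[OF finite_atLeastAtMost_int[of "- int H" "int H"]] unfolding bx_eq by (simp_all only:)
qed

lemma finite_pbx: "finite (pbx H)" and card_pbx: "card (pbx H) = (H + 1) ^ card B"
proof -
  have "card {0..int H} = H + 1" by simp
  then show "finite (pbx H)" "card (pbx H) = (H + 1) ^ card B"
    using card_box[OF finite_atLeastAtMost_int[of 0 "int H"]] unfolding pbx_eq by (simp_all only:)
qed

lemma bx_0: "bx 0 = {0}"
  by (auto simp: bx_def emb_def intro: exI[of _ "\<lambda>_. 0"])

lemma A_mult: "x \<in> A \<Longrightarrow> y \<in> A \<Longrightarrow> x * y \<in> A"
  using A_mult_bound in_bx bx_A by (meson subsetD)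

lemma A_1: "1 \<in> A" using one by (auto simp: A_def emb_def)

lemma A_of_nat: "of_nat n \<in> A" using A_int[OF A_1, of "int n"] by simp
lemma A_of_int: "of_int n \<in> A" using A_int[OF A_1, of n] by simp

lemma A_power: "x \<in> A \<Longrightarrow> x ^ n \<in> A"
  by (induction n) (auto simp: A_1 A_mult)

lemma A_denom: "\<exists>D::nat. D > 0 \<and> of_nat D * z \<in> A"
  using denom[of z] by (auto simp: A_def emb_def)

lemma finite_denom: "finite S \<Longrightarrow> \<exists>D::nat. D > 0 \<and> (\<forall>x\<in>S. of_nat D * x \<in> A)"
proof (induction S rule: finite_induct)
  case (insert x S)
  then obtain D where D: "D > 0" "\<forall>x\<in>S. of_nat D * x \<in> A" by blast
  obtain D' :: nat where D': "D' > 0" "of_nat D' * x \<in> A" using A_denom by blast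
  have "of_nat (D * D') * y \<in> A" if y: "y \<in> insert x S" for y
  proof (cases "y = x")
    case True
    have "of_nat D * (of_nat D' * y) \<in> A" using A_mult[OF A_of_nat D'(2)] True by simp
    then show ?thesis by (simp add: mult_ac)
  next
    case False
    then have "of_nat D * y \<in> A" using D y by auto
    then have "of_nat D' * (of_nat D * y) \<in> A" using A_mult[OF A_of_nat] by blast
    then show ?thesis by (simp add: mult_ac)
  qed
  then show ?case using D(1) D'(1) by (intro exI[of _ "D * D'"]) auto
qed (auto intro: exI[of _ 1])

lemma card_B_pos: "card B > 0"
  using one finite_B by (auto simp: card_gt_0_iff)

text \<open>Volume comparison: for pairwise incongruent residues \<open>s\<close> in a box \<open>bx T\<close>, the translates
  \<open>s + a * bx T\<close> are disjoint and contained in \<open>bx (T + C * H * T)\<close>.\<close>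

lemma idx_A_mult:
  shows "\<exists>C\<ge>1. \<forall>H\<ge>1. \<forall>a\<in>bx H. a \<noteq> 0 \<longrightarrow>
     finite (coset_set A ((*) a ` A)) \<and> idx A ((*) a ` A) \<le> (C * H) ^ card B"
proof -
  obtain C where C: "C \<ge> 1" "\<And>H1 H2 x y. x \<in> bx H1 \<Longrightarrow> y \<in> bx H2 \<Longrightarrow> x * y \<in> bx (C * H1 * H2)"
    using A_mult_bound by blast
  have "finite (coset_set A ((*) a ` A)) \<and> idx A ((*) a ` A) \<le> ((C + 1) * H) ^ card B"
    if H: "H \<ge> 1" and a: "a \<in> bx H" "a \<noteq> 0" for H a
  proof -
    have "card S \<le> ((C + 1) * H) ^ card B" if S: "finite S" "S \<subseteq> A"
      and inc: "\<And>x y. x \<in> S \<Longrightarrow> y \<in> S \<Longrightarrow> x - y \<in> (*) a ` A \<Longrightarrow> x = y" for S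
    proof -
      obtain T where T: "S \<subseteq> bx T" using finite_upper S by blast
      define f where "f = (\<lambda>(s, x). s + a * x)"
      have "inj_on f (S \<times> bx T)"
      proof (rule inj_onI, clarify)
        fix s x s' x' assume sx: "s \<in> S" "x \<in> bx T" "s' \<in> S" "x' \<in> bx T" "f (s, x) = f (s', x')"
        then have "s - s' = a * (x' - x)" by (simp add: f_def algebra_simps)
        moreover have "x' - x \<in> A" using sx bx_A subgrp_diff[OF subgrp_A] by blast
        ultimately have "s = s'" using inc sx by blast
        then show "s = s' \<and> x = x'" using sx a by (simp add: f_def)
      qed
      moreover have "f ` (S \<times> bx T) \<subseteq> bx (T + C * H * T)"
        using T C(2)[OF a(1)] bx_add by (fastforce simp: f_def)
      ultimately have "card (S \<times> bx T) \<le> card (bx (T + C * H * T))"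
        using finite_bx card_inj_on_le by blast
      then have "card S * (2 * T + 1) ^ card B \<le> (2 * (T + C * H * T) + 1) ^ card B"
        using S by (simp add: card_cartesian_product card_bx)
      \<comment> \<open>As H is at least 1, the first summand is absorbed too. The power of 2 T + 1
        then cancels, and with it the dependence on the box that contains S.\<close>
      also have "\<dots> \<le> ((C + 1) * H * (2 * T + 1)) ^ card B"
      proof (rule power_mono)
        have "1 * (2 * T + 1) \<le> H * (2 * T + 1)" using H by (rule mult_le_mono1)
        moreover have "2 * (C * H * T) \<le> C * H * (2 * T + 1)" by (simp add: algebra_simps)
        ultimately have "2 * (T + C * H * T) + 1 \<le> H * (2 * T + 1) + C * H * (2 * T + 1)"
          by (simp add: algebra_simps)
        then show "2 * (T + C * H * T) + 1 \<le> (C + 1) * H * (2 * T + 1)"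
          by (simp only: distrib_right mult_1 add.commute)
      qed simp
      also have "\<dots> = ((C + 1) * H) ^ card B * (2 * T + 1) ^ card B"
        by (simp only: power_mult_distrib)
      finally show ?thesis by simp
    qed
    moreover have "subgrp ((*) a ` A)"
      using subgrp_A unfolding subgrp_def
      by (auto simp: right_diff_distrib[symmetric])
    ultimately show ?thesis using idx_leI[of "(*) a ` A" A] by blast
  qed
  then show ?thesis by (intro exI[of _ "C + 1"]) auto
qed

end

section \<open>Rings between the order and the field\<close>

lemma subgrp_mult_image: "subgrp Y \<Longrightarrow> subgrp ((*) (a::'a::comm_ring_1) ` Y)"
  unfolding subgrp_def by (force simp: right_diff_distrib[symmetric])

text \<open>All counting is done for an arbitrary ring between A and the field. The S-integers enter
  as one such ring and, for the lower bound, through the shape of their denominators.\<close>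

locale overring = order_basis B w for B :: "'i set" and w :: "'i \<Rightarrow> 'k::field_char_0" +
  fixes R :: "'k set"
  assumes R_A: "A \<subseteq> R" and R_diff: "\<And>x y. x \<in> R \<Longrightarrow> y \<in> R \<Longrightarrow> x - y \<in> R"
    and R_mult: "\<And>x y. x \<in> R \<Longrightarrow> y \<in> R \<Longrightarrow> x * y \<in> R"
begin

lemma subgrp_R: "subgrp R"
  using R_A subgrp_0[OF subgrp_A] R_diff by (auto simp: subgrp_def)

lemma R_1: "1 \<in> R" using A_1 R_A by auto
lemma R_of_nat: "of_nat n \<in> R" using A_of_nat R_A by auto

definition ideal_R :: "'k set \<Rightarrow> bool" where
  "ideal_R c \<longleftrightarrow> subgrp c \<and> c \<subseteq> R \<and> (\<forall>r\<in>R. \<forall>x\<in>c. r * x \<in> c)"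

lemma ideal_principal: "a \<in> R \<Longrightarrow> ideal_R ((*) a ` R)"
  unfolding ideal_R_def using subgrp_mult_image[OF subgrp_R] R_mult
  by (auto simp: mult.left_commute)

text \<open>A finite set S in R has a common denominator D, so it lies in the lattice L of elements
  of R with denominator D. Incongruent modulo a R implies incongruent modulo a L, and (L : a L) = (A
  : a A) by \<open>idx_mult_inj\<close>. The inequality can be strict, since a may be a unit of
  R.\<close>

lemma idx_R_le_idx_A:
  assumes a: "a \<in> A" "a \<noteq> 0"
  shows "finite (coset_set R ((*) a ` R))" "idx R ((*) a ` R) \<le> idx A ((*) a ` A)"
proof -
  have key: "card S \<le> idx A ((*) a ` A)" if S: "finite S" "S \<subseteq> R"
      and inc: "\<And>x y. x \<in> S \<Longrightarrow> y \<in> S \<Longrightarrow> x - y \<in> (*) a ` R \<Longrightarrow> x = y" for S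
  proof -
    obtain D :: nat where D: "D > 0" "\<And>x. x \<in> S \<Longrightarrow> of_nat D * x \<in> A"
      using finite_denom[OF S(1)] by blast
    have D0: "(of_nat D :: 'k) \<noteq> 0" using D by simp
    define L where "L = {x \<in> R. of_nat D * x \<in> A}"
    have sL: "subgrp L" unfolding L_def subgrp_def
      using subgrp_0[OF subgrp_A] subgrp_0[OF subgrp_R] R_diff subgrp_diff[OF subgrp_A]
      by (auto simp: right_diff_distrib)
    have AL: "A \<subseteq> L" using R_A A_mult A_of_nat by (auto simp: L_def)
    have aL: "(*) a ` L \<subseteq> L"
      using a R_A A_mult[OF a(1)] R_mult by (auto simp: L_def mult.left_commute[of "of_nat D"])
    have finA: "finite (coset_set A ((*) x ` A))" if "x \<in> A" "x \<noteq> 0" for x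
    proof -
      obtain H where "x \<in> bx H" using in_bx[OF \<open>x \<in> A\<close>] by blast
      then have "x \<in> bx (max 1 H)" using bx_mono by (meson max.cobounded2 subsetD)
      then show ?thesis using idx_A_mult that by (metis max.cobounded1)
    qed
    have sa: "subgrp ((*) a ` L)" "subgrp ((*) a ` A)"
      using subgrp_mult_image sL subgrp_A by blast+
    \<comment> \<open>Multiplication by D embeds L / A into A / D A.\<close>
    have finLA: "finite (coset_set L A)"
    proof (rule idx_hom_le[of A "(*) (of_nat D) ` A" L "(*) (of_nat D)" A])
      show "subgrp A" by (rule subgrp_A)
      show "subgrp ((*) (of_nat D) ` A)" using subgrp_mult_image subgrp_A by blast
      show "x - y \<in> A \<longleftrightarrow> of_nat D * x - of_nat D * y \<in> (*) (of_nat D) ` A" for x y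
        using D0 by (auto simp: right_diff_distrib[symmetric])
      show "(*) (of_nat D) ` L \<subseteq> A" by (auto simp: L_def)
      show "finite (coset_set A ((*) (of_nat D) ` A))" using finA[OF A_of_nat D0] .
    qed
    have finL: "finite (coset_set L ((*) a ` L))" "idx L ((*) a ` L) = idx A ((*) a ` A)"
    proof -
      have aA: "(*) a ` A \<subseteq> A" using A_mult a by auto
      have f: "inj ((*) a)" "\<And>x y. a * (x - y) = a * x - a * y"
        using a by (auto simp: inj_def right_diff_distrib)
      have "finite (coset_set L ((*) a ` A))"
        using idx_tower(1)[OF sL subgrp_A sa(2) aA AL] finLA finA[OF a] by blast
      then have *: "finite (coset_set L ((*) a ` L))"
        using idx_tower(1)[OF sL sa(1,2) image_mono[OF AL] aL] by blast
      show "finite (coset_set L ((*) a ` L))" by fact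
      show "idx L ((*) a ` L) = idx A ((*) a ` A)"
        using idx_mult_inj(2)[OF sL subgrp_A AL finLA f aL aA *] by simp
    qed
    have "card S \<le> idx L ((*) a ` L)"
    proof (rule card_incongruent_le(2)[OF sa(1) finL(1)])
      show "S \<subseteq> L" using S D by (auto simp: L_def)
      show "x = y" if "x \<in> S" "y \<in> S" "x - y \<in> (*) a ` L" for x y
        using inc that by (auto simp: L_def)
    qed
    then show ?thesis using finL by simp
  qed
  have sub: "subgrp ((*) a ` R)" using subgrp_mult_image subgrp_R by blast
  show "finite (coset_set R ((*) a ` R))" "idx R ((*) a ` R) \<le> idx A ((*) a ` A)"
    using idx_leI[OF sub key] by blast+
qed

lemma idx_R_mult:
  "\<exists>C\<ge>1. \<forall>H\<ge>1. \<forall>a\<in>bx H. a \<noteq> 0 \<longrightarrow>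
     finite (coset_set R ((*) a ` R)) \<and> idx R ((*) a ` R) \<le> (C * H) ^ card B"
proof -
  obtain C where C: "C \<ge> 1" "\<And>H a. H \<ge> 1 \<Longrightarrow> a \<in> bx H \<Longrightarrow> a \<noteq> 0 \<Longrightarrow> idx A ((*) a ` A) \<le> (C * H) ^ card B"
    using idx_A_mult by blast
  then show ?thesis using idx_R_le_idx_A bx_A by (intro exI[of _ C]) (meson le_trans subsetD)
qed

lemma finite_R_mult: "a \<in> A \<Longrightarrow> a \<noteq> 0 \<Longrightarrow> finite (coset_set R ((*) a ` R))"
  using idx_R_le_idx_A by blast

text \<open>By pigeonhole in a box. The bounded index of \<open>a R\<close> in \<open>c\<close> replaces the finiteness of the class group.\<close>

lemma small_element:
  "\<exists>K\<ge>1. \<forall>c. ideal_R c \<and> finite (coset_set R c) \<longrightarrow>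
     (\<exists>H\<ge>1. \<exists>a\<in>c \<inter> bx H. a \<noteq> 0 \<and> H ^ card B \<le> idx R c \<and>
        finite (coset_set c ((*) a ` R)) \<and> idx c ((*) a ` R) \<le> K)"
proof -
  obtain C where C: "C \<ge> 1" "\<And>H a. H \<ge> 1 \<Longrightarrow> a \<in> bx H \<Longrightarrow> a \<noteq> 0 \<Longrightarrow>
      finite (coset_set R ((*) a ` R)) \<and> idx R ((*) a ` R) \<le> (C * H) ^ card B"
    using idx_R_mult by blast
  have "\<exists>H\<ge>1. \<exists>a\<in>c \<inter> bx H. a \<noteq> 0 \<and> H ^ card B \<le> idx R c \<and>
        finite (coset_set c ((*) a ` R)) \<and> idx c ((*) a ` R) \<le> C ^ card B"
    if c: "ideal_R c" "finite (coset_set R c)" for c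
  proof -
    have sc: "subgrp c" "c \<subseteq> R" using c by (auto simp: ideal_R_def)
    have m: "idx R c \<ge> 1" using idx_pos[OF c(2) subgrp_R] .
    \<comment> \<open>The largest H with H ^ card B within the index: the box \<open>pbx H\<close>
      has (H + 1) ^ card B elements, just too many to be incongruent modulo c.\<close>
    define H where "H = (GREATEST H. H ^ card B \<le> idx R c)"
    have bound: "y \<le> idx R c" if "y ^ card B \<le> idx R c" for y
    proof (cases "y = 0")
      case False
      then have "y \<le> y ^ card B" using card_B_pos by (intro self_le_power) auto
      then show ?thesis using that by simp
    qed simp
    have H: "H ^ card B \<le> idx R c"
      unfolding H_def by (rule GreatestI_nat[of _ 1]) (use bound m in auto)
    have H1: "\<not> (H + 1) ^ card B \<le> idx R c"
    proof
      assume "(H + 1) ^ card B \<le> idx R c"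
      then have "H + 1 \<le> H" unfolding H_def by (rule Greatest_le_nat) (use bound in auto)
      then show False by simp
    qed
    have "\<exists>x\<in>pbx H. \<exists>y\<in>pbx H. x \<noteq> y \<and> x - y \<in> c"
      using H1 pbx_A R_A by (intro ex_congruent[OF sc(1) c(2)]) (auto simp: finite_pbx card_pbx)
    then obtain x y where xy: "x \<in> pbx H" "y \<in> pbx H" "x \<noteq> y" "x - y \<in> c" by blast
    define a where "a = x - y"
    have a: "a \<in> c" "a \<noteq> 0" "a \<in> bx H" using xy pbx_diff by (auto simp: a_def)
    have H2: "H \<ge> 1" using a bx_0 by (cases "H = 0") auto
    have aR: "(*) a ` R \<subseteq> c" using c a by (auto simp: ideal_R_def mult.commute)
    have sa: "subgrp ((*) a ` R)" using subgrp_mult_image subgrp_R by blast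
    note tw = idx_tower[OF subgrp_R sc(1) sa aR sc(2)]
    \<comment> \<open>The index of a R exceeds that of c at most by the factor C ^ card B, which is
      the constant K of the statement.\<close>
    have "idx R c * idx c ((*) a ` R) \<le> (C * H) ^ card B" using C(2)[OF H2 a(3,2)] tw by auto
    also have "\<dots> \<le> C ^ card B * idx R c" using H by (simp add: power_mult_distrib)
    finally have "idx c ((*) a ` R) \<le> C ^ card B" using m by simp
    then show ?thesis using a H H2 C(2)[OF H2 a(3,2)] tw by blast
  qed
  then show ?thesis using C(1) by (intro exI[of _ "C ^ card B"]) auto
qed

end

section \<open>Counting shift-invariant submodules\<close>

text \<open>Vectors are functions on all naturals with support below the rank, so that the
  coordinate flag is a chain of actual inclusions and the shift acts on all ranks at once.\<close>

definition sc :: "'k::field \<Rightarrow> (nat \<Rightarrow> 'k) \<Rightarrow> nat \<Rightarrow> 'k" where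
  "sc r v = (\<lambda>i. r * v i)"

definition sh :: "(nat \<Rightarrow> 'k::field) \<Rightarrow> nat \<Rightarrow> 'k" where
  "sh v = (\<lambda>i. v (Suc i))"

lemma sh_diff: "sh (v - u) = sh v - sh u" by (simp add: sh_def fun_eq_iff)
lemma sc_diff: "sc r (v - u) = sc r v - sc r u" by (simp add: sc_def fun_eq_iff right_diff_distrib)
lemma sc_diff_left: "sc (r - r') v = sc r v - sc r' v" by (simp add: sc_def fun_eq_iff left_diff_distrib)

interpretation fv: vector_space "sc :: 'k::field \<Rightarrow> (nat \<Rightarrow> 'k) \<Rightarrow> nat \<Rightarrow> 'k"
  by unfold_locales (simp_all add: sc_def fun_eq_iff algebra_simps)

lemma sum_fiber_le:
  fixes v :: "'a \<Rightarrow> real" and g :: "'b \<Rightarrow> real"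
  assumes fin: "finite F" "finite P" and p: "p ` F \<subseteq> P"
    and v: "\<And>x. x \<in> F \<Longrightarrow> v x \<le> g (p x)" and g: "\<And>y. y \<in> P \<Longrightarrow> 0 \<le> g y"
    and m: "\<And>y. y \<in> P \<Longrightarrow> real (card {x \<in> F. p x = y}) \<le> m y"
  shows "sum v F \<le> (\<Sum>y\<in>P. m y * g y)"
proof -
  have "sum v F = (\<Sum>y\<in>P. \<Sum>x\<in>{x \<in> F. p x = y}. v x)"
    by (rule sum.group[OF fin p, symmetric])
  also have "\<dots> \<le> (\<Sum>y\<in>P. m y * g y)"
  proof (rule sum_mono)
    fix y assume y: "y \<in> P"
    have "(\<Sum>x\<in>{x \<in> F. p x = y}. v x) \<le> (\<Sum>x\<in>{x \<in> F. p x = y}. g y)"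
      using v by (intro sum_mono) auto
    also have "\<dots> \<le> m y * g y"
      using mult_right_mono[OF m[OF y] g[OF y]] by simp
    finally show "(\<Sum>x\<in>{x \<in> F. p x = y}. v x) \<le> m y * g y" .
  qed
  finally show ?thesis .
qed

lemma sum_int_interval_bounded:
  assumes t: "t > 1"
  shows "\<exists>Z. \<forall>T. (\<Sum>n\<in>{- int T..int T}. real_of_int (max 1 \<bar>n\<bar>) powr (- t)) \<le> Z"
proof -
  define h where "h n = real_of_int (max 1 \<bar>n\<bar>) powr (- t)" for n :: int
  have sm: "summable (\<lambda>n. real n powr (- t))"
    using summable_real_powr_iff[of "- t"] t by simp
  \<comment> \<open>Since 0 \<open>powr\<close> anything is 0, the term n = 0 of the sum on the
    right vanishes; the leading 1 stands for the central term of the interval.\<close>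
  have eq: "(\<Sum>n\<in>{- int T..int T}. h n) = 1 + 2 * (\<Sum>n\<le>T. real n powr (- t))" for T
  proof (induction T)
    case 0 then show ?case by (simp add: h_def)
  next
    case (Suc T)
    have "{- int (Suc T)..int (Suc T)} = insert (int (Suc T)) (insert (- int (Suc T)) {- int T..int T})"
      by auto
    then have split: "(\<Sum>n\<in>{- int (Suc T)..int (Suc T)}. h n)
        = h (int (Suc T)) + (h (- int (Suc T)) + (\<Sum>n\<in>{- int T..int T}. h n))"
      by simp
    have "h (int (Suc T)) = real (Suc T) powr (- t)" "h (- int (Suc T)) = real (Suc T) powr (- t)"
      by (simp_all add: h_def max_def add.commute)
    then show ?case unfolding split Suc by simp
  qed
  have "(\<Sum>n\<le>T. real n powr (- t)) \<le> suminf (\<lambda>n. real n powr (- t))" for T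
    using sm by (intro sum_le_suminf) auto
  then show ?thesis unfolding h_def[symmetric] eq
    by (intro exI[of _ "1 + 2 * suminf (\<lambda>n. real n powr (- t))"]) auto
qed

section \<open>The zeta function of the ideals of R\<close>

context overring
begin

text \<open>By \<open>fact_idx_kills\<close> each such c lies between W = a R and W' = W / K!. The
  index of W in W' is at most (W : K! W), and division by a turns this into (R : K! R), which does
  not depend on a.\<close>

lemma card_ideals_with_element:
  assumes a: "a \<in> A" "a \<noteq> 0" and F: "\<And>c. c \<in> F \<Longrightarrow> ideal_R c \<and> a \<in> c \<and>
     finite (coset_set c ((*) a ` R)) \<and> idx c ((*) a ` R) \<le> K"
  shows "finite F" "card F \<le> 2 ^ idx R ((*) (of_nat (fact K)) ` R)"
proof -
  define e :: 'k where "e = of_nat (fact K)"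
  have e: "e \<noteq> 0" "e \<in> A" by (simp_all add: e_def A_of_nat del: of_nat_fact)
  define W where "W = (*) a ` R"
  have W: "subgrp W" unfolding W_def using subgrp_mult_image subgrp_R by blast
  define W' where "W' = {z. e * z \<in> W}"
  have eW: "subgrp ((*) e ` W)" using subgrp_mult_image W by blast
  have i1: "finite (coset_set W ((*) e ` W))" "idx W ((*) e ` W) = idx R ((*) e ` R)"
  proof -
    have "x - y \<in> (*) e ` R \<longleftrightarrow> a * x - a * y \<in> (*) e ` W" for x y
    proof
      assume "x - y \<in> (*) e ` R"
      then obtain r where r: "r \<in> R" "x - y = e * r" by auto
      then have "a * x - a * y = e * (a * r)" by (metis right_diff_distrib mult.left_commute)
      then show "a * x - a * y \<in> (*) e ` W" using r by (auto simp: W_def)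
    next
      assume "a * x - a * y \<in> (*) e ` W"
      then obtain r where r: "r \<in> R" "a * x - a * y = e * (a * r)" by (auto simp: W_def)
      then have "a * (x - y) = a * (e * r)" by (simp add: algebra_simps)
      then show "x - y \<in> (*) e ` R" using a r by auto
    qed
    moreover have "\<exists>x\<in>R. a * x - y \<in> (*) e ` W" if "y \<in> W" for y
      using that subgrp_0[OF eW] by (force simp: W_def)
    moreover have "subgrp ((*) e ` R)" using subgrp_mult_image subgrp_R by blast
    ultimately show "finite (coset_set W ((*) e ` W))" "idx W ((*) e ` W) = idx R ((*) e ` R)"
      using idx_hom_eq[of "(*) e ` R" "(*) e ` W" R "(*) a" W] eW finite_R_mult[OF e(2,1)]
      by (auto simp: W_def)
  qed
  have "finite (coset_set W' W)" "idx W' W \<le> idx W ((*) e ` W)"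
    by (rule idx_hom_le[OF W eW, of W' "(*) e" W];
        use e i1 in \<open>auto simp: W'_def right_diff_distrib[symmetric]\<close>)+
  moreover have "subgrp c \<and> W \<subseteq> c \<and> c \<subseteq> W'" if "c \<in> F" for c
  proof -
    have c: "subgrp c" "W \<subseteq> c" using F[OF that] by (auto simp: ideal_R_def W_def mult.commute)
    moreover have "e * z \<in> W" if z: "z \<in> c" for z
      unfolding e_def using fact_idx_kills[OF c(1) W c(2) _ _ z, of K] F[OF \<open>c \<in> F\<close>] by (auto simp: W_def)
    ultimately show ?thesis by (auto simp: W'_def)
  qed
  ultimately show "finite F" "card F \<le> 2 ^ idx R ((*) (of_nat (fact K)) ` R)"
    using card_intermediate_le[OF W, of W' "idx R ((*) e ` R)" F] i1(2) unfolding e_def by metis+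
qed

text \<open>If x is the coordinate vector of a small element of c, the product of the max 1 |x b| is
  at most H ^ card B and so at most (R : c). The sum over c is thereby dominated by a sum over
  integer vectors, which factors into one-dimensional sums with exponent t, and boundedly many
  ideals share a vector.\<close>

lemma ideal_sum_bounded:
  assumes t: "t > 1"
  shows "\<exists>Z. \<forall>F. finite F \<and> (\<forall>c\<in>F. ideal_R c \<and> finite (coset_set R c)) \<longrightarrow>
            (\<Sum>c\<in>F. real (idx R c) powr (- t)) \<le> Z"
proof -
  from small_element obtain K where K: "\<forall>c. ideal_R c \<and> finite (coset_set R c) \<longrightarrow>
     (\<exists>H\<ge>1. \<exists>a\<in>c \<inter> bx H. a \<noteq> 0 \<and> H ^ card B \<le> idx R c \<and>
        finite (coset_set c ((*) a ` R)) \<and> idx c ((*) a ` R) \<le> K)"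
    by (elim exE conjE) (rule that)
  have "\<exists>x. x \<in> extensional B \<and> emb x \<in> c \<and> emb x \<noteq> 0 \<and>
      finite (coset_set c ((*) (emb x) ` R)) \<and> idx c ((*) (emb x) ` R) \<le> K \<and>
      real (idx R c) powr (- t) \<le> (\<Prod>b\<in>B. real_of_int (max 1 \<bar>x b\<bar>) powr (- t))"
    if c: "ideal_R c \<and> finite (coset_set R c)" for c
  proof -
    obtain H a where Ha: "H \<ge> 1" "a \<in> c" "a \<in> bx H" "a \<noteq> 0" "H ^ card B \<le> idx R c"
        "finite (coset_set c ((*) a ` R))" "idx c ((*) a ` R) \<le> K"
      using K c by blast
    then obtain y where y: "a = emb y" "\<And>b. b \<in> B \<Longrightarrow> \<bar>y b\<bar> \<le> int H" by (auto simp: bx_def)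
    define x where "x = restrict y B"
    have x: "a = emb x" "\<And>b. b \<in> B \<Longrightarrow> \<bar>x b\<bar> \<le> int H" "x \<in> extensional B"
      using y by (auto simp: emb_def x_def)
    have "real (idx R c) powr (- t) \<le> real (H ^ card B) powr (- t)"
      using Ha t by (intro powr_mono2') (auto simp del: of_nat_power)
    also have "\<dots> = (\<Prod>b\<in>B. real H powr (- t))"
      using Ha(1) by (simp add: powr_realpow[symmetric] powr_powr mult.commute powr_power)
    also have "\<dots> \<le> (\<Prod>b\<in>B. real_of_int (max 1 \<bar>x b\<bar>) powr (- t))"
    proof (intro prod_mono conjI)
      fix b assume "b \<in> B"
      then have "max 1 \<bar>x b\<bar> \<le> int H" using x(2) Ha(1) by auto
      then have "real_of_int (max 1 \<bar>x b\<bar>) \<le> real H" by linarith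
      then show "real H powr (- t) \<le> real_of_int (max 1 \<bar>x b\<bar>) powr (- t)"
        using t by (intro powr_mono2') auto
    qed auto
    finally show ?thesis using x Ha by auto
  qed
  then obtain q where q: "\<And>c. ideal_R c \<and> finite (coset_set R c) \<Longrightarrow>
      q c \<in> extensional B \<and> emb (q c) \<in> c \<and> emb (q c) \<noteq> 0 \<and>
      finite (coset_set c ((*) (emb (q c)) ` R)) \<and> idx c ((*) (emb (q c)) ` R) \<le> K \<and>
      real (idx R c) powr (- t) \<le> (\<Prod>b\<in>B. real_of_int (max 1 \<bar>q c b\<bar>) powr (- t))"
    by metis
  define m :: nat where "m = 2 ^ idx R ((*) (of_nat (fact K)) ` R)"
  obtain Z where Z: "\<And>T. (\<Sum>n\<in>{- int T..int T}. real_of_int (max 1 \<bar>n\<bar>) powr (- t)) \<le> Z"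
    using sum_int_interval_bounded[OF t] by blast
  have "(\<Sum>c\<in>F. real (idx R c) powr (- t)) \<le> real m * Z ^ card B"
    if F: "finite F" "\<And>c. c \<in> F \<Longrightarrow> ideal_R c \<and> finite (coset_set R c)" for F
  proof -
    define T where "T = (\<Sum>c\<in>F. \<Sum>b\<in>B. nat \<bar>q c b\<bar>)"
    define P where "P = (\<Pi>\<^sub>E b\<in>B. {- int T..int T})"
    define g where "g x = (\<Prod>b\<in>B. real_of_int (max 1 \<bar>x b\<bar>) powr (- t))" for x :: "'i \<Rightarrow> int"
    have finP: "finite P" unfolding P_def using finite_B by (intro finite_PiE) auto
    have qP: "q ` F \<subseteq> P"
    proof clarify
      fix c assume c: "c \<in> F"
      have "q c b \<in> {- int T..int T}" if b: "b \<in> B" for b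
      proof -
        have "nat \<bar>q c b\<bar> \<le> (\<Sum>b\<in>B. nat \<bar>q c b\<bar>)"
          using b finite_B by (intro member_le_sum) auto
        also have "\<dots> \<le> T" unfolding T_def
          using c F by (intro member_le_sum[of c F "\<lambda>c. \<Sum>b\<in>B. nat \<bar>q c b\<bar>"]) auto
        finally show ?thesis by auto
      qed
      then show "q c \<in> P" using q[OF F(2)[OF c]] by (auto simp: P_def PiE_def)
    qed
    have "(\<Sum>c\<in>F. real (idx R c) powr (- t)) \<le> (\<Sum>x\<in>P. real m * g x)"
    proof (rule sum_fiber_le[OF F(1) finP qP])
      show "real (idx R c) powr (- t) \<le> g (q c)" if "c \<in> F" for c
        using q[OF F(2)[OF that]] by (simp add: g_def)
      show "0 \<le> g x" for x unfolding g_def by (intro prod_nonneg) auto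
      show "real (card {c \<in> F. q c = x}) \<le> real m" for x
      proof (cases "{c \<in> F. q c = x} = {}")
        case False
        then obtain c where "c \<in> F" "q c = x" by blast
        then have x: "emb x \<in> A" "emb x \<noteq> 0" using q[OF F(2)] by (auto simp: A_def)
        have "card {c \<in> F. q c = x} \<le> m" unfolding m_def
          by (rule card_ideals_with_element(2)[OF x]) (use q F in blast)
        then show ?thesis by simp
      next
        case True
        show ?thesis unfolding True by simp
      qed
    qed
    also have "\<dots> = real m * (\<Prod>b\<in>B. \<Sum>n\<in>{- int T..int T}. real_of_int (max 1 \<bar>n\<bar>) powr (- t))"
      unfolding P_def g_def using finite_B
      by (subst prod_sum_PiE) (auto simp: sum_distrib_left)
    also have "\<dots> \<le> real m * Z ^ card B"
    proof (rule mult_left_mono)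
      have "(\<Prod>b\<in>B. \<Sum>n\<in>{- int T..int T}. real_of_int (max 1 \<bar>n\<bar>) powr (- t)) \<le> (\<Prod>b\<in>B. Z)"
        using Z by (intro prod_mono) (auto intro!: sum_nonneg)
      then show "(\<Prod>b\<in>B. \<Sum>n\<in>{- int T..int T}. real_of_int (max 1 \<bar>n\<bar>) powr (- t)) \<le> Z ^ card B"
        by simp
    qed auto
    finally show ?thesis .
  qed
  then show ?thesis by blast
qed

section \<open>Submodules of R^j along the coordinate flag\<close>

definition lat :: "nat \<Rightarrow> (nat \<Rightarrow> 'k) set" where
  "lat j = {v. (\<forall>i<j. v i \<in> R) \<and> (\<forall>i\<ge>j. v i = 0)}"

definition submod :: "(nat \<Rightarrow> 'k) set \<Rightarrow> bool" where
  "submod J \<longleftrightarrow> subgrp J \<and> (\<forall>r\<in>R. \<forall>v\<in>J. sc r v \<in> J)"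

definition fmod :: "nat \<Rightarrow> (nat \<Rightarrow> 'k) set \<Rightarrow> bool" where
  "fmod j J \<longleftrightarrow> submod J \<and> J \<subseteq> lat j \<and> finite (coset_set (lat j) J)"

text \<open>The highest index plays the leading role because \<open>sh\<close> lowers indices and so
  maps each step of the flag into the previous one.\<close>

definition lead :: "nat \<Rightarrow> (nat \<Rightarrow> 'k) set \<Rightarrow> 'k set" where
  "lead j J = (\<lambda>v. v j) ` J"

text \<open>By \<open>fiber_card\<close> below, \<open>tr j J\<close> controls in how many ways \<open>J\<close> extends to the next step of the flag
  once the leading ideal is prescribed.\<close>

definition tr :: "nat \<Rightarrow> (nat \<Rightarrow> 'k) set \<Rightarrow> nat" where
  "tr j J = idx {z \<in> lat j. sh z \<in> J} J"

lemma subgrp_lat: "subgrp (lat j)"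
  using subgrp_0[OF subgrp_R] R_diff by (auto simp: subgrp_def lat_def)

lemma lat_sc: "r \<in> R \<Longrightarrow> v \<in> lat j \<Longrightarrow> sc r v \<in> lat j"
  using R_mult by (auto simp: lat_def sc_def)

lemma lat_mono: "i \<le> j \<Longrightarrow> lat i \<subseteq> lat j"
  using subgrp_0[OF subgrp_R] by (auto simp: lat_def) (metis linorder_not_le)

lemma lat_SucI: "v \<in> lat (Suc j) \<Longrightarrow> v j = 0 \<Longrightarrow> v \<in> lat j"
  by (auto simp: lat_def) (metis le_antisym not_less_eq_eq)

lemma lat_zero: "v \<in> lat j \<Longrightarrow> v j = 0" by (simp add: lat_def)

lemma sh_lat: "v \<in> lat (Suc j) \<Longrightarrow> sh v \<in> lat j" by (auto simp: lat_def sh_def)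

lemma subgrp_sc_image: "subgrp Y \<Longrightarrow> subgrp (sc r ` Y)"
  unfolding subgrp_def by (auto simp: sc_diff[symmetric])

text \<open>Insert L, the vectors whose top coordinate lies in the leading ideal. Then
  \<open>lat (Suc j)\<close> modulo L is R modulo the leading ideal, and L modulo J is
  \<open>lat j\<close> modulo J \<inter> \<open>lat j\<close>, since an element of J corrects any
  vector of L to top coordinate 0.\<close>

lemma lead_index:
  assumes J: "subgrp J" "J \<subseteq> lat (Suc j)"
  shows "finite (coset_set (lat (Suc j)) J) \<longleftrightarrow>
           finite (coset_set R (lead j J)) \<and> finite (coset_set (lat j) (J \<inter> lat j))"
    and "idx (lat (Suc j)) J = idx R (lead j J) * idx (lat j) (J \<inter> lat j)"
proof -
  have sl: "subgrp (lead j J)"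
    unfolding subgrp_def
  proof (intro conjI ballI)
    show "0 \<in> lead j J" unfolding lead_def
      by (rule image_eqI[OF _ subgrp_0[OF J(1)]]) simp
    fix x y assume "x \<in> lead j J" "y \<in> lead j J"
    then obtain u v where uv: "u \<in> J" "v \<in> J" "x = u j" "y = v j" by (auto simp: lead_def)
    show "x - y \<in> lead j J" unfolding lead_def
      by (rule image_eqI[OF _ subgrp_diff[OF J(1) uv(1,2)]]) (simp add: uv)
  qed
  define L where "L = {v \<in> lat (Suc j). v j \<in> lead j J}"
  have sL: "subgrp L"
    using sl subgrp_lat[of "Suc j"] unfolding L_def subgrp_def by auto
  have sI: "subgrp (J \<inter> lat j)" using subgrp_Int[OF J(1) subgrp_lat] .
  have JL: "J \<subseteq> L" using J(2) by (auto simp: L_def lead_def)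
  have LM: "L \<subseteq> lat (Suc j)" by (auto simp: L_def)
  have surj: "\<exists>x\<in>lat (Suc j). x j - y \<in> lead j J" if "y \<in> R" for y
  proof
    show "(\<lambda>i. if i = j then y else 0) \<in> lat (Suc j)"
      using that subgrp_0[OF subgrp_R] by (auto simp: lat_def)
  qed (use subgrp_0[OF sl] in simp)
  have "x - y \<in> L \<longleftrightarrow> x j - y j \<in> lead j J" if "x \<in> lat (Suc j)" "y \<in> lat (Suc j)" for x y
    using subgrp_diff[OF subgrp_lat that] by (auto simp: L_def)
  moreover have "(\<lambda>v. v j) ` lat (Suc j) \<subseteq> R" by (auto simp: lat_def)
  ultimately have 1: "finite (coset_set (lat (Suc j)) L) \<longleftrightarrow> finite (coset_set R (lead j J))"
      "idx (lat (Suc j)) L = idx R (lead j J)"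
    using idx_hom_eq[OF sL sl, of "lat (Suc j)" "\<lambda>v. v j" R] surj by blast+
  have surj2: "\<exists>x\<in>lat j. x - y \<in> J" if y: "y \<in> L" for y
  proof -
    obtain v where v: "v \<in> J" "v j = y j" using y by (auto simp: L_def lead_def)
    have "y - v \<in> lat j"
    proof (rule lat_SucI)
      have "y \<in> lat (Suc j)" "v \<in> lat (Suc j)" using y v J(2) by (auto simp: L_def)
      then show "y - v \<in> lat (Suc j)" by (rule subgrp_diff[OF subgrp_lat])
    qed (simp add: v)
    moreover have "(y - v) - y \<in> J" using subgrp_minus[OF J(1) v(1)] by simp
    ultimately show ?thesis by blast
  qed
  have "x - y \<in> J \<inter> lat j \<longleftrightarrow> x - y \<in> J" if "x \<in> lat j" "y \<in> lat j" for x y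
    using subgrp_diff[OF subgrp_lat that] by blast
  moreover have "(\<lambda>v. v) ` lat j \<subseteq> L"
  proof clarify
    fix x assume x: "x \<in> lat j"
    then show "x \<in> L" using lat_mono[of j "Suc j"] subgrp_0[OF sl] lat_zero[OF x] by (auto simp: L_def)
  qed
  ultimately have 2: "finite (coset_set (lat j) (J \<inter> lat j)) \<longleftrightarrow> finite (coset_set L J)"
      "idx (lat j) (J \<inter> lat j) = idx L J"
    using idx_hom_eq[OF sI J(1), of "lat j" "\<lambda>v. v" L] surj2 by blast+
  show "finite (coset_set (lat (Suc j)) J) \<longleftrightarrow>
           finite (coset_set R (lead j J)) \<and> finite (coset_set (lat j) (J \<inter> lat j))"
    "idx (lat (Suc j)) J = idx R (lead j J) * idx (lat j) (J \<inter> lat j)"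
    using idx_tower[OF subgrp_lat sL J(1) JL LM] 1 2 by auto
qed

lemma lat_0: "lat 0 = {0}"
  by (auto simp: lat_def fun_eq_iff)

lemma finite_lat_scale:
  assumes e: "e \<in> A" "e \<noteq> 0"
  shows "finite (coset_set (lat j) (sc e ` lat j))"
proof (induction j)
  case 0 then show ?case by (simp add: lat_0 coset_set_def)
next
  case (Suc j)
  have "lead j (sc e ` lat (Suc j)) = (*) e ` R"
  proof (intro equalityI subsetI)
    fix x assume "x \<in> (*) e ` R"
    then obtain r where r: "r \<in> R" "x = e * r" by auto
    have "(\<lambda>i. if i = j then r else 0) \<in> lat (Suc j)"
      using r subgrp_0[OF subgrp_R] by (auto simp: lat_def)
    then show "x \<in> lead j (sc e ` lat (Suc j))" unfolding lead_def image_image sc_def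
      by (rule rev_image_eqI) (simp add: r)
  qed (auto simp: lead_def sc_def lat_def)
  moreover have "sc e ` lat (Suc j) \<inter> lat j = sc e ` lat j"
  proof (intro equalityI subsetI)
    fix x assume "x \<in> sc e ` lat (Suc j) \<inter> lat j"
    then obtain v where v: "v \<in> lat (Suc j)" "x = sc e v" "x \<in> lat j" by auto
    then have "v j = 0" using lat_zero[OF v(3)] e by (auto simp: sc_def)
    then show "x \<in> sc e ` lat j" using lat_SucI v by blast
  next
    fix x assume "x \<in> sc e ` lat j"
    then show "x \<in> sc e ` lat (Suc j) \<inter> lat j"
      using lat_mono[of j "Suc j"] lat_sc e R_A by auto
  qed
  moreover have "sc e ` lat (Suc j) \<subseteq> lat (Suc j)" using lat_sc e R_A by auto
  ultimately show ?case
    using lead_index(1)[OF subgrp_sc_image[OF subgrp_lat]] Suc finite_R_mult[OF e] by simp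
qed

text \<open>With T the preimage of J, the shift identifies \<open>lat (Suc j)\<close> modulo T with
  \<open>lat j\<close> modulo J \<inter> \<open>lat j\<close>. Both (T : J) and, by
  \<open>lead_index\<close>, (R : \<open>lead j J\<close>) complete this common index to that of J,
  so they agree.\<close>

lemma tr_Suc:
  assumes J: "fmod (Suc j) J" "\<And>v. v \<in> J \<Longrightarrow> sh v \<in> J"
  shows "tr (Suc j) J = idx R (lead j J)"
proof -
  have sJ: "subgrp J" "J \<subseteq> lat (Suc j)" "finite (coset_set (lat (Suc j)) J)"
    using J(1) by (auto simp: fmod_def submod_def)
  define T where "T = {z \<in> lat (Suc j). sh z \<in> J}"
  have sT: "subgrp T" using sJ(1) subgrp_lat[of "Suc j"]
    by (auto simp: T_def subgrp_def sh_diff) (auto simp: sh_def zero_fun_def)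
  have JT: "J \<subseteq> T" using sJ J(2) by (auto simp: T_def)
  have TM: "T \<subseteq> lat (Suc j)" by (auto simp: T_def)
  have sI: "subgrp (J \<inter> lat j)" using subgrp_Int[OF sJ(1) subgrp_lat] .
  have eq: "x - y \<in> T \<longleftrightarrow> sh x - sh y \<in> J \<inter> lat j" if "x \<in> lat (Suc j)" "y \<in> lat (Suc j)" for x y
    using subgrp_diff[OF subgrp_lat that] sh_lat by (auto simp: T_def sh_diff[symmetric])
  have surj: "\<exists>x\<in>lat (Suc j). sh x - y \<in> J \<inter> lat j" if "y \<in> lat j" for y
  proof
    show "case_nat 0 y \<in> lat (Suc j)"
      using that subgrp_0[OF subgrp_R] by (auto simp: lat_def split: nat.split)
    have "sh (case_nat 0 y) = y" by (simp add: sh_def)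
    then show "sh (case_nat 0 y) - y \<in> J \<inter> lat j" using subgrp_0[OF sI] by simp
  qed
  have shM: "sh ` lat (Suc j) \<subseteq> lat j" using sh_lat by auto
  have 1: "idx (lat (Suc j)) T = idx (lat j) (J \<inter> lat j)"
    using idx_hom_eq(2)[OF sT sI eq shM surj] .
  note tw = idx_tower[OF subgrp_lat sT sJ(1) JT TM]
  have "finite (coset_set (lat (Suc j)) T)" using tw sJ by blast
  then have "idx (lat (Suc j)) T \<ge> 1" using idx_pos[OF _ subgrp_lat] by blast
  moreover have "idx R (lead j J) * idx (lat (Suc j)) T = idx (lat (Suc j)) T * idx T J"
    using lead_index(2)[OF sJ(1,2)] 1 tw(2) by metis
  ultimately have "idx R (lead j J) = idx T J" by simp
  then show ?thesis by (simp add: tr_def T_def)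
qed

text \<open>In each J choose v J with leading coefficient a. By \<open>cross\<close> two choices
  differ by a vector of \<open>lat j\<close> that the shift takes into J', so they fall into
  \<open>tr j J'\<close> classes modulo J'. All J of one class contain the same W = R u + J', and
  since K! carries c into a R, they lie in W / K!; the power of 2 counts the possibilities. The
  shift is visible only through \<open>cross\<close>, which twisted and untwisted submodules both
  provide.\<close>

lemma fiber_card:
  assumes J': "fmod j J'" and a: "a \<in> A" "a \<noteq> 0" "finite (coset_set c ((*) a ` R))" "idx c ((*) a ` R) \<le> K"
    and c: "ideal_R c" "a \<in> c"
    and C: "finite C" "\<And>J. J \<in> C \<Longrightarrow> submod J \<and> J \<subseteq> lat (Suc j) \<and> J \<inter> lat j = J' \<and> lead j J = c"
    and cross: "\<And>J1 J2 v1 v2. J1 \<in> C \<Longrightarrow> J2 \<in> C \<Longrightarrow> v1 \<in> J1 \<Longrightarrow> v2 \<in> J2 \<Longrightarrow> v1 j = v2 j \<Longrightarrow>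
        sh (v1 - v2) \<in> J'"
  shows "card C \<le> tr j J' * 2 ^ idx (lat (Suc j)) (sc (of_nat (fact K)) ` lat (Suc j))"
proof (cases "C = {}")
  case False
  then obtain J0 where J0: "J0 \<in> C" by blast
  define e :: 'k where "e = of_nat (fact K)"
  have e: "e \<noteq> 0" "e \<in> A" by (simp_all add: e_def A_of_nat del: of_nat_fact)
  have sJ': "subgrp J'" "J' \<subseteq> lat j" using J' by (auto simp: fmod_def submod_def)
  have saR: "subgrp ((*) a ` R)" using subgrp_mult_image subgrp_R by blast
  have "\<forall>J\<in>C. \<exists>v\<in>J. v j = a" using C(2) c(2) by (force simp: lead_def)
  then obtain v where v: "\<And>J. J \<in> C \<Longrightarrow> v J \<in> J \<and> v J j = a" by metis
  define T where "T = {z \<in> lat j. sh z \<in> J'}"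
  define p where "p J = (+) (v J - v J0) ` J'" for J
  have finT: "finite (coset_set T J')"
    using idx_mono(1)[OF sJ'(1), of T "lat j"] J' by (auto simp: T_def fmod_def)
  have pT: "p ` C \<subseteq> coset_set T J'"
  proof -
    have "v J - v J0 \<in> T" if "J \<in> C" for J
    proof -
      have "v J \<in> lat (Suc j)" "v J0 \<in> lat (Suc j)"
        using v[OF that] v[OF J0] C(2)[OF that] C(2)[OF J0] by blast+
      then have "v J - v J0 \<in> lat (Suc j)" by (rule subgrp_diff[OF subgrp_lat])
      then have "v J - v J0 \<in> lat j"
        by (rule lat_SucI) (simp add: v that J0)
      moreover have "sh (v J - v J0) \<in> J'"
        by (rule cross[OF that J0]) (simp_all add: v that J0)
      ultimately show ?thesis by (simp add: T_def)
    qed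
    then show ?thesis unfolding p_def coset_set_def by blast
  qed
  have fib: "card {J \<in> C. p J = Q} \<le> 2 ^ idx (lat (Suc j)) (sc e ` lat (Suc j))" for Q
  proof (cases "{J \<in> C. p J = Q} = {}")
    case False
    then obtain J1 where J1: "J1 \<in> C" "p J1 = Q" by blast
    define u where "u = v J1"
    have u: "u \<in> lat (Suc j)" "u j = a" using v[OF J1(1)] C(2)[OF J1(1)] by (auto simp: u_def)
    \<comment> \<open>The part of J that is forced by J' and the chosen lift: it has leading ideal a
      R and trace J', hence finite index.\<close>
    define W where "W = {sc r u + y | r y. r \<in> R \<and> y \<in> J'}"
    have sW: "subgrp W" unfolding subgrp_def
    proof (intro conjI ballI)
      have "sc 0 u + 0 \<in> W" using subgrp_0[OF subgrp_R] subgrp_0[OF sJ'(1)] unfolding W_def by blast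
      then show "0 \<in> W" by (simp add: sc_def zero_fun_def[symmetric])
      fix x y assume "x \<in> W" "y \<in> W"
      then obtain r z r' z' where *: "r \<in> R" "z \<in> J'" "x = sc r u + z" "r' \<in> R" "z' \<in> J'" "y = sc r' u + z'"
        by (auto simp: W_def)
      have "x - y = sc (r - r') u + (z - z')" using * by (simp add: sc_diff_left)
      then show "x - y \<in> W" unfolding W_def using * R_diff subgrp_diff[OF sJ'(1)] by blast
    qed
    have WM: "W \<subseteq> lat (Suc j)"
    proof
      fix x assume "x \<in> W"
      then obtain r y where *: "r \<in> R" "y \<in> J'" "x = sc r u + y" by (auto simp: W_def)
      then have "y \<in> lat (Suc j)" using sJ' lat_mono[of j "Suc j"] by auto
      then show "x \<in> lat (Suc j)" unfolding *(3) by (rule subgrp_add[OF subgrp_lat lat_sc[OF *(1) u(1)]])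
    qed
    have leadW: "lead j W = (*) a ` R"
    proof (intro equalityI subsetI)
      fix x assume "x \<in> lead j W"
      then obtain r y where "r \<in> R" "y \<in> J'" "x = (sc r u + y) j" by (auto simp: lead_def W_def)
      moreover then have "y j = 0" using sJ' lat_zero by blast
      ultimately show "x \<in> (*) a ` R" using u by (auto simp: sc_def mult.commute)
    next
      fix x assume "x \<in> (*) a ` R"
      then obtain r where r: "r \<in> R" "x = a * r" by auto
      have "sc r u + 0 \<in> W" using r subgrp_0[OF sJ'(1)] unfolding W_def by blast
      moreover have "x = (sc r u + 0) j" using r u by (simp add: sc_def)
      ultimately show "x \<in> lead j W" unfolding lead_def by blast
    qed
    have WI: "W \<inter> lat j = J'"
    proof (intro equalityI subsetI)
      fix x assume "x \<in> W \<inter> lat j"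
      then obtain r y where *: "r \<in> R" "y \<in> J'" "x = sc r u + y" "x \<in> lat j" by (auto simp: W_def)
      then have "y j = 0" "x j = 0" using sJ' lat_zero by blast+
      then have "r = 0" using * u a by (auto simp: sc_def)
      then show "x \<in> J'" using * by (simp add: sc_def zero_fun_def[symmetric])
    next
      fix x assume x: "x \<in> J'"
      have "sc 0 u + x \<in> W" using x subgrp_0[OF subgrp_R] unfolding W_def by blast
      then show "x \<in> W \<inter> lat j" using x sJ' by (auto simp: sc_def zero_fun_def[symmetric])
    qed
    have finW: "finite (coset_set (lat (Suc j)) W)"
      using lead_index(1)[OF sW WM] finite_R_mult[OF a(1,2)] J' by (simp add: leadW WI fmod_def)
    have f: "inj (sc e)" "\<And>x y. sc e (x - y) = sc e x - sc e y"
      using e by (auto simp: inj_def sc_diff)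
    have sceW: "sc e ` W \<subseteq> W"
    proof clarify
      fix x assume "x \<in> W"
      then obtain r y where *: "r \<in> R" "y \<in> J'" "x = sc r u + y" by (auto simp: W_def)
      have "sc e x = sc (e * r) u + sc e y" using * by (simp add: sc_def fun_eq_iff algebra_simps)
      moreover have "e * r \<in> R" "sc e y \<in> J'" using * e R_A R_mult J' by (auto simp: fmod_def submod_def)
      ultimately show "sc e x \<in> W" unfolding W_def by blast
    qed
    have sceM: "sc e ` lat (Suc j) \<subseteq> lat (Suc j)" using lat_sc e R_A by auto
    note i1 = idx_mult_inj[OF subgrp_lat sW WM finW f sceM sceW finite_lat_scale[OF e(2,1)]]
    define W' where "W' = {z. sc e z \<in> W}"
    have "z - y \<in> W \<longleftrightarrow> sc e z - sc e y \<in> sc e ` W" for z y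
      unfolding f(2)[symmetric] inj_image_mem_iff[OF f(1)] ..
    moreover have "sc e ` W' \<subseteq> W" by (auto simp: W'_def)
    ultimately have fW': "finite (coset_set W' W)" "idx W' W \<le> idx W (sc e ` W)"
      using idx_hom_le[OF sW subgrp_sc_image[OF sW], where G=W' and f="sc e" and G'=W] i1(1) by blast+
    have mem: "subgrp J \<and> W \<subseteq> J \<and> J \<subseteq> W'" if J: "J \<in> {J \<in> C. p J = Q}" for J
    proof (intro conjI)
      have J: "J \<in> C" "p J = p J1" using J J1 by auto
      note CJ = C(2)[OF J(1)]
      show sJ: "subgrp J" using CJ by (auto simp: submod_def)
      have JJ: "J' \<subseteq> J" using CJ by blast
      have "v J - v J0 - (v J1 - v J0) \<in> J'" using J(2) unfolding p_def coset_eq_iff[OF sJ'(1)] .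
      then have "v J - u \<in> J" using JJ by (auto simp: u_def)
      then have "v J - (v J - u) \<in> J" using v[OF J(1)] subgrp_diff[OF sJ] by blast
      then have uJ: "u \<in> J" by simp
      then show "W \<subseteq> J" using CJ JJ subgrp_add[OF sJ] by (auto simp: W_def submod_def)
      show "J \<subseteq> W'"
      proof
        fix z assume z: "z \<in> J"
        then have "z j \<in> c" using CJ by (auto simp: lead_def)
        then have "e * z j \<in> (*) a ` R" unfolding e_def
          using c a saR by (intro fact_idx_kills) (auto simp: ideal_R_def mult.commute)
        then obtain r where r: "r \<in> R" "e * z j = a * r" by auto
        have "e \<in> R" using e R_A by auto
        then have "sc e z - sc r u \<in> J" using CJ z uJ r subgrp_diff[OF sJ] by (auto simp: submod_def)
        moreover then have "sc e z - sc r u \<in> lat (Suc j)" using CJ by blast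
        then have "sc e z - sc r u \<in> lat j"
          by (rule lat_SucI) (simp add: sc_def r u mult.commute)
        ultimately have "sc e z - sc r u \<in> J'" using CJ by blast
        moreover have "sc e z = sc r u + (sc e z - sc r u)" by simp
        ultimately have "sc e z \<in> W" unfolding W_def using r by blast
        then show "z \<in> W'" by (simp add: W'_def)
      qed
    qed
    show ?thesis
      by (rule card_intermediate_le(2)[OF sW fW'(1) _ mem]) (use fW'(2) i1(2) in simp)
  next
    case True
    then show ?thesis by (simp only: card.empty)
  qed
  have "(\<Sum>J\<in>C. 1) \<le> (\<Sum>Q\<in>coset_set T J'. real (2 ^ idx (lat (Suc j)) (sc e ` lat (Suc j))) * 1)"
    by (rule sum_fiber_le[OF C(1) finT pT]) (use fib in \<open>auto simp del: of_nat_power intro: of_nat_mono\<close>)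
  then have "real (card C) \<le> real (tr j J' * 2 ^ idx (lat (Suc j)) (sc e ` lat (Suc j)))"
    by (simp add: tr_def T_def idx_def)
  then show ?thesis unfolding e_def of_nat_le_iff .
qed simp

lemma fmod_Int:
  assumes "fmod (Suc j) J" shows "fmod j (J \<inter> lat j)"
proof -
  have J: "subgrp J" "J \<subseteq> lat (Suc j)" using assms by (auto simp: fmod_def submod_def)
  then show ?thesis
    using lead_index(1)[OF J] subgrp_Int[OF J(1) subgrp_lat] assms lat_sc
    by (auto simp: fmod_def submod_def)
qed

lemma ideal_lead:
  assumes "fmod (Suc j) J"
  shows "ideal_R (lead j J)" "finite (coset_set R (lead j J))"
proof -
  have J: "subgrp J" "J \<subseteq> lat (Suc j)" "\<And>r v. r \<in> R \<Longrightarrow> v \<in> J \<Longrightarrow> sc r v \<in> J"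
    using assms by (auto simp: fmod_def submod_def)
  show "finite (coset_set R (lead j J))"
    using lead_index(1)[OF J(1,2)] assms by (auto simp: fmod_def)
  have "subgrp (lead j J)" unfolding subgrp_def
  proof (intro conjI ballI)
    show "0 \<in> lead j J" unfolding lead_def
      by (rule image_eqI[OF _ subgrp_0[OF J(1)]]) simp
    fix x y assume "x \<in> lead j J" "y \<in> lead j J"
    then obtain u v where uv: "u \<in> J" "v \<in> J" "x = u j" "y = v j" by (auto simp: lead_def)
    show "x - y \<in> lead j J" unfolding lead_def
      by (rule image_eqI[OF _ subgrp_diff[OF J(1) uv(1,2)]]) (simp add: uv)
  qed
  moreover have "r * x \<in> lead j J" if rx: "r \<in> R" "x \<in> lead j J" for r x
  proof -
    obtain v where v: "v \<in> J" "x = v j" using rx by (auto simp: lead_def)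
    show ?thesis unfolding lead_def
      by (rule image_eqI[OF _ J(3)[OF rx(1) v(1)]]) (simp add: sc_def v)
  qed
  moreover have "lead j J \<subseteq> R" using J(2) by (auto simp: lead_def lat_def)
  ultimately show "ideal_R (lead j J)" by (auto simp: ideal_R_def)
qed

text \<open>The index of J is the product of those of its trace and of its leading ideal c, so after
  weighting with (R : c) the term of J splits into a factor of the trace and (R : c) to the power 1
  - s. Fibres over a pair (J', c) have at most M \<open>tr j J'\<close> elements. The sum is
  therefore bounded by M times the weighted sum one step down times a convergent sum over
  ideals.\<close>

lemma flag_step:
  assumes s: "s > 2"
    and Q: "\<And>J. J \<in> Q \<Longrightarrow> fmod j J"
    and bound: "\<And>F. finite F \<Longrightarrow> F \<subseteq> Q \<Longrightarrow>
        (\<Sum>J\<in>F. real (tr j J) * real (idx (lat j) J) powr (- s)) \<le> Z"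
    and G: "\<And>J. J \<in> G \<Longrightarrow> fmod (Suc j) J \<and> J \<inter> lat j \<in> Q"
    and cross: "\<And>J1 J2 v1 v2. J1 \<in> G \<Longrightarrow> J2 \<in> G \<Longrightarrow> J1 \<inter> lat j = J2 \<inter> lat j \<Longrightarrow>
        v1 \<in> J1 \<Longrightarrow> v2 \<in> J2 \<Longrightarrow> v1 j = v2 j \<Longrightarrow> sh (v1 - v2) \<in> J1 \<inter> lat j"
  shows "\<exists>Z. \<forall>F. finite F \<and> F \<subseteq> G \<longrightarrow>
        (\<Sum>J\<in>F. real (idx R (lead j J)) * real (idx (lat (Suc j)) J) powr (- s)) \<le> Z"
proof -
  from small_element obtain K where K: "\<forall>c. ideal_R c \<and> finite (coset_set R c) \<longrightarrow>
     (\<exists>H\<ge>1. \<exists>a\<in>c \<inter> bx H. a \<noteq> 0 \<and> H ^ card B \<le> idx R c \<and>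
        finite (coset_set c ((*) a ` R)) \<and> idx c ((*) a ` R) \<le> K)"
    by (elim exE conjE) (rule that)
  have "s - 1 > 1" using s by simp
  from ideal_sum_bounded[OF this] obtain Z2 where
    Z2: "\<forall>F. finite F \<and> (\<forall>c\<in>F. ideal_R c \<and> finite (coset_set R c)) \<longrightarrow>
            (\<Sum>c\<in>F. real (idx R c) powr (- (s - 1))) \<le> Z2" by (elim exE) (rule that)
  define M :: nat where "M = 2 ^ idx (lat (Suc j)) (sc (of_nat (fact K)) ` lat (Suc j))"
  have Z0: "Z \<ge> 0" using bound[of "{}"] by simp
  have "(\<Sum>J\<in>F. real (idx R (lead j J)) * real (idx (lat (Suc j)) J) powr (- s)) \<le> real M * (Z * Z2)"
    if F: "finite F" "F \<subseteq> G" for F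
  proof -
    define P1 where "P1 = (\<lambda>J. J \<inter> lat j) ` F"
    define P2 where "P2 = lead j ` F"
    define g1 where "g1 J = real (idx (lat j) J) powr (- s)" for J
    define g2 where "g2 c = real (idx R c) powr (- (s - 1))" for c
    have P1: "finite P1" "P1 \<subseteq> Q" using F G by (auto simp: P1_def)
    have P2: "finite P2" "\<And>c. c \<in> P2 \<Longrightarrow> ideal_R c \<and> finite (coset_set R c)"
      using F G ideal_lead by (auto simp: P2_def)
    have "(\<Sum>J\<in>F. real (idx R (lead j J)) * real (idx (lat (Suc j)) J) powr (- s))
        \<le> (\<Sum>y\<in>P1 \<times> P2. (real (tr j (fst y)) * real M) * (g1 (fst y) * g2 (snd y)))"
    proof (rule sum_fiber_le[where p="\<lambda>J. (J \<inter> lat j, lead j J)"])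
      show "finite F" "finite (P1 \<times> P2)" using F P1 P2 by auto
      show "(\<lambda>J. (J \<inter> lat j, lead j J)) ` F \<subseteq> P1 \<times> P2" by (auto simp: P1_def P2_def)
      show "0 \<le> g1 (fst y) * g2 (snd y)" for y by (simp add: g1_def g2_def)
    next
      fix J assume J: "J \<in> F"
      then have fJ: "fmod (Suc j) J" using F G by auto
      have iR: "idx R (lead j J) \<ge> 1" using idx_pos[OF ideal_lead(2)[OF fJ] subgrp_R] .
      have "idx (lat (Suc j)) J = idx R (lead j J) * idx (lat j) (J \<inter> lat j)"
        using lead_index(2) fJ by (auto simp: fmod_def submod_def)
      then have "real (idx R (lead j J)) * real (idx (lat (Suc j)) J) powr (- s)
          = (real (idx R (lead j J)) powr 1 * real (idx R (lead j J)) powr (- s)) * g1 (J \<inter> lat j)"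
        using iR by (simp add: g1_def powr_mult)
      also have "real (idx R (lead j J)) powr 1 * real (idx R (lead j J)) powr (- s) = g2 (lead j J)"
        by (simp only: powr_add[symmetric] g2_def) simp
      finally show "real (idx R (lead j J)) * real (idx (lat (Suc j)) J) powr (- s)
          \<le> g1 (fst (J \<inter> lat j, lead j J)) * g2 (snd (J \<inter> lat j, lead j J))"
        by (simp add: mult.commute)
    next
      fix y assume y: "y \<in> P1 \<times> P2"
      obtain J' c where Jc: "y = (J', c)" by (cases y)
      have J': "fmod j J'" using y Jc P1 Q by auto
      have c: "ideal_R c" "finite (coset_set R c)" using y Jc P2 by auto
      obtain H a where a: "a \<in> c" "a \<in> bx H" "a \<noteq> 0" "finite (coset_set c ((*) a ` R))" "idx c ((*) a ` R) \<le> K"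
        using K c by blast
      have aA: "a \<in> A" using a bx_A by blast
      define C where "C = {J \<in> F. (J \<inter> lat j, lead j J) = y}"
      have "card C \<le> tr j J' * M" unfolding M_def
      proof (rule fiber_card[OF J' aA a(3-5) c(1) a(1)])
        show "finite C" using F by (simp add: C_def)
        show "submod J \<and> J \<subseteq> lat (Suc j) \<and> J \<inter> lat j = J' \<and> lead j J = c" if "J \<in> C" for J
          using that F G by (auto simp: C_def Jc fmod_def)
        fix J1 J2 v1 v2 assume *: "J1 \<in> C" "J2 \<in> C" "v1 \<in> J1" "v2 \<in> J2" "v1 j = v2 j"
        then have "J1 \<in> G" "J2 \<in> G" "J1 \<inter> lat j = J'" "J2 \<inter> lat j = J'" using F by (auto simp: C_def Jc)
        then show "sh (v1 - v2) \<in> J'" using cross[of J1 J2 v1 v2] * by simp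
      qed
      then have "real (card C) \<le> real (tr j J' * M)" by (rule of_nat_mono)
      then show "real (card {J \<in> F. (J \<inter> lat j, lead j J) = y}) \<le> real (tr j (fst y)) * real M"
        by (simp add: C_def Jc)
    qed
    also have "\<dots> = (\<Sum>J\<in>P1. \<Sum>c\<in>P2. (real (tr j J) * real M) * (g1 J * g2 c))"
      by (simp add: sum.cartesian_product case_prod_unfold)
    also have "\<dots> = real M * ((\<Sum>J\<in>P1. real (tr j J) * g1 J) * (\<Sum>c\<in>P2. g2 c))"
      by (subst sum_product) (simp add: sum_distrib_left mult_ac)
    also have "\<dots> \<le> real M * (Z * Z2)"
    proof (intro mult_left_mono mult_mono)
      show "(\<Sum>J\<in>P1. real (tr j J) * g1 J) \<le> Z" using bound[OF P1] by (simp add: g1_def)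
      show "(\<Sum>c\<in>P2. g2 c) \<le> Z2" using Z2 P2 by (auto simp: g2_def)
    qed (auto simp: g2_def Z0 intro!: sum_nonneg)
    finally show ?thesis .
  qed
  then show ?thesis by blast
qed

definition shmods :: "nat \<Rightarrow> (nat \<Rightarrow> 'k) set set" where
  "shmods j = {J. fmod j J \<and> (\<forall>v\<in>J. sh v \<in> J)}"

text \<open>Invariance is asked of vectors with top coordinate 0, where the twisted shift is the
  plain one, so that the lemma serves both cases.\<close>

lemma shmods_Int:
  assumes "fmod (Suc j) J" "\<And>v. v \<in> J \<Longrightarrow> v j = 0 \<Longrightarrow> sh v \<in> J"
  shows "J \<inter> lat j \<in> shmods j"
proof -
  have "sh v \<in> J \<inter> lat j" if "v \<in> J \<inter> lat j" for v
    using assms(2)[of v] lat_zero[of v j] sh_lat[of v j] lat_mono[of j "Suc j"] that by auto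
  then show ?thesis using fmod_Int[OF assms(1)] by (auto simp: shmods_def)
qed

text \<open>By \<open>tr_Suc\<close> the weight is the index of the leading ideal, so that leading ideals are summed with
  exponent \<open>s - 1 > 1\<close>.\<close>

lemma shmods_sum_bounded:
  assumes s: "s > 2"
  shows "\<exists>Z. \<forall>F. finite F \<and> F \<subseteq> shmods j \<longrightarrow>
        (\<Sum>J\<in>F. real (tr j J) * real (idx (lat j) J) powr (- s)) \<le> Z"
proof (induction j)
  case 0
  have "J = {0}" if "J \<in> shmods 0" for J
    using that subgrp_0 by (auto simp: shmods_def fmod_def lat_0 submod_def)
  then have "F \<subseteq> {{0}}" if "F \<subseteq> shmods 0" for F using that by auto
  then have "(\<Sum>J\<in>F. real (tr 0 J) * real (idx (lat 0) J) powr (- s))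
      \<le> (\<Sum>J\<in>{{0}}. real (tr 0 J) * real (idx (lat 0) J) powr (- s))"
    if "F \<subseteq> shmods 0" for F using that by (intro sum_mono2) auto
  then show ?case by blast
next
  case (Suc j)
  then obtain Z where Z: "\<And>F. finite F \<Longrightarrow> F \<subseteq> shmods j \<Longrightarrow>
        (\<Sum>J\<in>F. real (tr j J) * real (idx (lat j) J) powr (- s)) \<le> Z" by blast
  have ex: "\<exists>Z. \<forall>F. finite F \<and> F \<subseteq> shmods (Suc j) \<longrightarrow>
        (\<Sum>J\<in>F. real (idx R (lead j J)) * real (idx (lat (Suc j)) J) powr (- s)) \<le> Z"
  proof (rule flag_step[OF s _ Z])
    show "fmod j J" if "J \<in> shmods j" for J using that by (simp add: shmods_def)
    show "fmod (Suc j) J \<and> J \<inter> lat j \<in> shmods j" if J: "J \<in> shmods (Suc j)" for J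
    proof
      show fJ: "fmod (Suc j) J" using J by (simp add: shmods_def)
      show "J \<inter> lat j \<in> shmods j" by (rule shmods_Int[OF fJ]) (use J in \<open>simp add: shmods_def\<close>)
    qed
    fix J1 J2 v1 v2 assume *: "J1 \<in> shmods (Suc j)" "J2 \<in> shmods (Suc j)"
      "J1 \<inter> lat j = J2 \<inter> lat j" "v1 \<in> J1" "v2 \<in> J2"
    have sub: "subgrp (J1 \<inter> lat j)"
      using *(1) subgrp_Int[OF _ subgrp_lat] by (auto simp: shmods_def fmod_def submod_def)
    have "sh v \<in> J \<inter> lat j" if "J \<in> shmods (Suc j)" "v \<in> J" for J v
      using that sh_lat by (auto simp: shmods_def fmod_def)
    then have "sh v1 \<in> J1 \<inter> lat j" "sh v2 \<in> J2 \<inter> lat j" using * by blast+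
    then show "sh (v1 - v2) \<in> J1 \<inter> lat j"
      using subgrp_diff[OF sub] *(3) by (simp add: sh_diff)
  qed
  have "tr (Suc j) J = idx R (lead j J)" if "J \<in> shmods (Suc j)" for J
    using that tr_Suc by (simp add: shmods_def)
  then have eq: "(\<Sum>J\<in>F. real (tr (Suc j) J) * real (idx (lat (Suc j)) J) powr (- s)) =
     (\<Sum>J\<in>F. real (idx R (lead j J)) * real (idx (lat (Suc j)) J) powr (- s))"
     if "F \<subseteq> shmods (Suc j)" for F using that by (intro sum.cong) auto
  from ex obtain Z' where "\<forall>F. finite F \<and> F \<subseteq> shmods (Suc j) \<longrightarrow>
        (\<Sum>J\<in>F. real (idx R (lead j J)) * real (idx (lat (Suc j)) J) powr (- s)) \<le> Z'"
    by (elim exE) (rule that)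
  then show ?case by (intro exI[of _ Z']) (simp add: eq)
qed

text \<open>The twist depends on the top coordinate alone: it vanishes on \<open>lat j\<close> and
  cancels between vectors with equal top coordinate. So traces are shift-invariant in the plain
  sense and \<open>flag_step\<close> applies once more. No step follows, and the weight (R : lead)
  \<ge> 1 is dropped.\<close>

lemma twisted_sum_bounded:
  assumes s: "s > 2" and u: "u \<in> lat j"
    and G: "\<And>J. J \<in> G \<Longrightarrow> fmod (Suc j) J \<and> (\<forall>v\<in>J. sh v - sc (v j) u \<in> J)"
  shows "\<exists>Z. \<forall>F. finite F \<and> F \<subseteq> G \<longrightarrow>
        (\<Sum>J\<in>F. real (idx (lat (Suc j)) J) powr (- s)) \<le> Z"
proof -
  obtain Z where Z: "\<And>F. finite F \<Longrightarrow> F \<subseteq> shmods j \<Longrightarrow>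
        (\<Sum>J\<in>F. real (tr j J) * real (idx (lat j) J) powr (- s)) \<le> Z"
    using shmods_sum_bounded[OF s, of j] by blast
  have "\<exists>Z. \<forall>F. finite F \<and> F \<subseteq> G \<longrightarrow>
        (\<Sum>J\<in>F. real (idx R (lead j J)) * real (idx (lat (Suc j)) J) powr (- s)) \<le> Z"
  proof (rule flag_step[OF s _ Z])
    show "fmod j J" if "J \<in> shmods j" for J using that by (simp add: shmods_def)
    have "sh v \<in> J" if "J \<in> G" "v \<in> J" "v j = 0" for J v
    proof -
      have "sh v - sc (v j) u \<in> J" using G that by blast
      then show ?thesis using that by (simp add: sc_def zero_fun_def[symmetric])
    qed
    then show "fmod (Suc j) J \<and> J \<inter> lat j \<in> shmods j" if "J \<in> G" for J
      using that shmods_Int G by blast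
    fix J1 J2 v1 v2 assume *: "J1 \<in> G" "J2 \<in> G"
      "J1 \<inter> lat j = J2 \<inter> lat j" "v1 \<in> J1" "v2 \<in> J2" "v1 j = v2 j"
    have sub: "subgrp (J1 \<inter> lat j)"
      using G[OF *(1)] subgrp_Int[OF _ subgrp_lat] by (auto simp: fmod_def submod_def)
    have mem: "sh v - sc (v j) u \<in> J \<inter> lat j" if "J \<in> G" "v \<in> J" for J v
    proof -
      have v: "v \<in> lat (Suc j)" using G that by (auto simp: fmod_def)
      then have "v j \<in> R" by (auto simp: lat_def)
      then show ?thesis using subgrp_diff[OF subgrp_lat sh_lat[OF v] lat_sc[OF _ u]] G that by blast
    qed
    have "(sh v1 - sc (v1 j) u) - (sh v2 - sc (v2 j) u) \<in> J1 \<inter> lat j"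
      using subgrp_diff[OF sub mem[OF *(1,4)]] mem[OF *(2,5)] *(3) by blast
    then show "sh (v1 - v2) \<in> J1 \<inter> lat j" using *(6) by (simp add: sh_diff)
  qed
  then obtain Z' where Z': "\<And>F. finite F \<Longrightarrow> F \<subseteq> G \<Longrightarrow>
        (\<Sum>J\<in>F. real (idx R (lead j J)) * real (idx (lat (Suc j)) J) powr (- s)) \<le> Z'" by blast
  have "(\<Sum>J\<in>F. real (idx (lat (Suc j)) J) powr (- s)) \<le> Z'" if F: "finite F" "F \<subseteq> G" for F
  proof -
    have "(\<Sum>J\<in>F. real (idx (lat (Suc j)) J) powr (- s))
       \<le> (\<Sum>J\<in>F. real (idx R (lead j J)) * real (idx (lat (Suc j)) J) powr (- s))"
    proof (rule sum_mono)
      fix J assume "J \<in> F"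
      then have "idx R (lead j J) \<ge> 1"
        using idx_pos[OF ideal_lead(2) subgrp_R] F G by blast
      then have "1 \<le> real (idx R (lead j J))" by linarith
      then show "real (idx (lat (Suc j)) J) powr (- s)
          \<le> real (idx R (lead j J)) * real (idx (lat (Suc j)) J) powr (- s)"
        using mult_right_mono[of 1 "real (idx R (lead j J))"] by fastforce
    qed
    then show ?thesis using Z'[OF F] by linarith
  qed
  then show ?thesis by blast
qed

end

section \<open>Number fields and Frobenius congruences\<close>

lemma common_denominator:
  fixes q :: "'a \<Rightarrow> rat"
  assumes "finite I"
  shows "\<exists>D::nat. D > 0 \<and> (\<exists>m. \<forall>i\<in>I. of_nat D * q i = of_int (m i))"
  using assms
proof (induction I)
  case (insert x I)
  then obtain D m where D: "D > 0" "\<And>i. i \<in> I \<Longrightarrow> of_nat D * q i = of_int (m i)" by auto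
  obtain a b where "quotient_of (q x) = (a, b)" by (cases "quotient_of (q x)")
  then have ab: "b > 0" "q x = of_int a / of_int b"
    using quotient_of_denom_pos quotient_of_div by blast+
  define D' where "D' = D * nat b"
  define m' where "m' i = (if i = x then int D * a else m i * b)" for i
  have b: "of_nat (nat b) = (of_int b :: rat)" using ab by simp
  have "of_nat D' * q i = of_int (m' i)" if "i \<in> insert x I" for i
  proof (cases "i = x")
    case True
    then show ?thesis using ab b by (simp add: D'_def m'_def)
  next
    case False
    then have "of_nat D * q i = of_int (m i)" using D that by auto
    then show ?thesis using False b by (simp add: D'_def m'_def mult_ac)
  qed
  then show ?case using D ab by (intro exI[of _ D']) (auto simp: D'_def)
qed (auto intro: exI[of _ 1])

text \<open>Scale all elements other than 1 of a rational basis containing 1 by a common denominator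
  D of the structure constants. In the product D a times D a' one factor D clears the constants and
  the other is absorbed by the scaled basis, so the integer span is a ring.\<close>

lemma number_field_order:
  assumes "number_field TYPE('k::field_char_0)"
  shows "\<exists>(B::'k set) (w::'k \<Rightarrow> 'k). order_basis B w"
proof -
  obtain B0 :: "'k set" where "finite_dimensional_vector_space (\<lambda>q x. of_rat q * x) B0"
    using assms by (auto simp: number_field_def)
  then interpret V: finite_dimensional_vector_space "\<lambda>q x::'k. of_rat q * x" B0 .
  have "V.independent {1}" by simp
  then obtain B where B: "{1} \<subseteq> B" "V.independent B" "UNIV \<subseteq> V.span B"
    by (rule V.maximal_independent_subset_extend[OF subset_UNIV]) (rule that)
  have finB: "finite B" using V.finiteI_independent[OF B(2)] .
  have rep: "\<exists>q. z = (\<Sum>b\<in>B. of_rat (q b) * b)" for z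
    using B(3) V.span_finite[OF finB] by auto
  have "\<forall>z. \<exists>q. z = (\<Sum>b\<in>B. of_rat (q b) * b)" using rep by blast
  from choice[OF this] obtain Q where Q: "\<forall>z. z = (\<Sum>b\<in>B. of_rat (Q z b) * b)" by (rule exE)
  define q where "q a a' = Q (a * a')" for a a'
  have q: "a * a' = (\<Sum>b\<in>B. of_rat (q a a' b) * b)" for a a'
    unfolding q_def by (rule Q[rule_format])
  obtain D m where D: "D > 0" "\<And>a a' b. a \<in> B \<Longrightarrow> a' \<in> B \<Longrightarrow> b \<in> B \<Longrightarrow>
      of_nat D * q a a' b = of_int (m a a' b)"
  proof -
    obtain D m where "D > 0" "\<And>i. i \<in> B \<times> B \<times> B \<Longrightarrow>
      of_nat D * q (fst i) (fst (snd i)) (snd (snd i)) = of_int (m i)"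
      using common_denominator[of "B \<times> B \<times> B" "\<lambda>i. q (fst i) (fst (snd i)) (snd (snd i))"] finB by auto
    then show thesis using that[of D "\<lambda>a a' b. m (a, a', b)"] by fastforce
  qed
  define w where "w b = (if b = 1 then 1 else of_nat D * b)" for b :: 'k
  have conv: "of_nat (D * E) * (\<Sum>b\<in>B. of_rat (r b) * b) =
      (\<Sum>b\<in>B. of_int (if b = 1 then int D * n b else n b) * w b)"
    if rn: "\<And>b. b \<in> B \<Longrightarrow> of_nat E * r b = of_int (n b)" for E r and n :: "'k \<Rightarrow> int"
    unfolding sum_distrib_left
  proof (rule sum.cong[OF refl])
    fix b assume b: "b \<in> B"
    have "of_nat E * of_rat (r b) = (of_rat (of_nat E * r b) :: 'k)" by (simp add: of_rat_mult)
    then have "of_nat E * of_rat (r b) = (of_int (n b) :: 'k)" using rn[OF b] by simp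
    moreover have "of_nat (D * E) * (of_rat (r b) * b) = of_nat D * (of_nat E * of_rat (r b)) * b"
      by (simp add: mult_ac)
    ultimately have "of_nat (D * E) * (of_rat (r b) * b) = of_nat D * of_int (n b) * b" by simp
    moreover have "of_nat D * of_int (n b) * b = of_int (if b = 1 then int D * n b else n b) * w b"
      by (simp add: w_def mult_ac)
    ultimately show "of_nat (D * E) * (of_rat (r b) * b) = of_int (if b = 1 then int D * n b else n b) * w b"
      by (rule trans)
  qed
  have single: "w a = (\<Sum>b\<in>B. of_int (if b = a then 1 else 0) * w b)" if "a \<in> B" for a
    using that finB by (simp add: if_distrib[of of_int] if_distrib[of "\<lambda>y. y * _"] sum.delta cong: if_cong)
  have "order_basis B w"
  proof
    show "finite B" by fact
  next
    fix x :: "'k \<Rightarrow> int" and b assume x: "(\<Sum>b\<in>B. of_int (x b) * w b) = 0" and b: "b \<in> B"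
    define u where "u b = (if b = 1 then of_int (x b) else of_nat D * of_int (x b) :: rat)" for b
    have "(\<Sum>b\<in>B. of_rat (u b) * b) = (\<Sum>b\<in>B. of_int (x b) * w b)"
      by (rule sum.cong) (auto simp: u_def w_def of_rat_mult)
    then have "u b = 0" using V.independentD[OF B(2) finB order_refl _ b, of u] x by simp
    then show "x b = 0" using D by (auto simp: u_def split: if_splits)
  next
    fix z :: 'k
    obtain r where r: "z = (\<Sum>b\<in>B. of_rat (r b) * b)" using rep by blast
    obtain E n where E: "E > 0" "\<And>i. i \<in> B \<Longrightarrow> of_nat E * r i = of_int (n i)"
      using common_denominator[OF finB, of r] by blast
    show "\<exists>D::nat. D > 0 \<and> (\<exists>x :: 'k \<Rightarrow> int. of_nat D * z = (\<Sum>b\<in>B. of_int (x b) * w b))"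
      using conv[OF E(2)] r E(1) D(1) by (intro exI[of _ "D * E"]) auto
  next
    show "\<exists>x :: 'k \<Rightarrow> int. 1 = (\<Sum>b\<in>B. of_int (x b) * w b)"
      using single[of 1] B(1) by (intro exI) (simp add: w_def[of 1])
  next
    fix a a' assume a: "a \<in> B" "a' \<in> B"
    show "\<exists>x :: 'k \<Rightarrow> int. w a * w a' = (\<Sum>b\<in>B. of_int (x b) * w b)"
    proof (cases "a = 1 \<or> a' = 1")
      case True
      then show ?thesis
      proof
        assume "a = 1"
        then have "w a * w a' = w a'" by (simp add: w_def)
        then show ?thesis using single[OF a(2)] by (intro exI) (erule trans)
      next
        assume "a' = 1"
        then have "w a * w a' = w a" by (simp add: w_def)
        then show ?thesis using single[OF a(1)] by (intro exI) (erule trans)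
      qed
    next
      case False
      then have "w a * w a' = of_nat (D * D) * (a * a')" by (simp add: w_def mult_ac)
      also have "\<dots> = of_nat (D * D) * (\<Sum>b\<in>B. of_rat (q a a' b) * b)"
        by (rule arg_cong[OF q])
      also have "\<dots> = (\<Sum>b\<in>B. of_int (if b = 1 then int D * m a a' b else m a a' b) * w b)"
        by (rule conv) (use D a in auto)
      finally show ?thesis
        by (intro exI[of _ "\<lambda>b. if b = 1 then int D * m a a' b else m a a' b"])
    qed
  qed
  then show ?thesis by blast
qed

section \<open>Non-Archimedean absolute values on an order\<close>

lemma nonarch_one: "nonarch_abs_value f \<Longrightarrow> f 1 = 1"
  unfolding nonarch_abs_value_def by (metis mult_cancel_left1 mult_1 one_neq_zero)

lemma nonarch_mult: "nonarch_abs_value f \<Longrightarrow> f (x * y) = f x * f y"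
  unfolding nonarch_abs_value_def by blast

lemma nonarch_nonneg: "nonarch_abs_value f \<Longrightarrow> 0 \<le> f x"
  unfolding nonarch_abs_value_def by blast

lemma nonarch_eq_0: "nonarch_abs_value f \<Longrightarrow> f x = 0 \<longleftrightarrow> x = 0"
  unfolding nonarch_abs_value_def by blast

lemma nonarch_add: "nonarch_abs_value f \<Longrightarrow> f (x + y) \<le> max (f x) (f y)"
  unfolding nonarch_abs_value_def by blast

lemma nonarch_minus: assumes f: "nonarch_abs_value f" shows "f (- x) = f x"
proof -
  have "f (-1) * f (-1) = 1" using nonarch_mult[OF f, of "-1" "-1"] nonarch_one[OF f] by simp
  then have "f (-1) = 1" using nonarch_nonneg[OF f, of "-1"] by (simp add: square_eq_1_iff[of "f (-1)"])
  then show ?thesis using nonarch_mult[OF f, of "-1" x] by simp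
qed

lemma nonarch_power: "nonarch_abs_value f \<Longrightarrow> f (x ^ n) = f x ^ n"
  by (induction n) (auto simp: nonarch_one nonarch_mult)

lemma nonarch_of_nat: assumes f: "nonarch_abs_value f" shows "f (of_nat n) \<le> 1"
proof (induction n)
  case 0 then show ?case using nonarch_eq_0[OF f, of 0] by simp
next
  case (Suc n)
  then show ?case using nonarch_add[OF f, of 1 "of_nat n"] nonarch_one[OF f] by simp
qed

lemma nonarch_of_int: assumes f: "nonarch_abs_value f" shows "f (of_int n) \<le> 1"
  by (cases n rule: int_cases2) (use nonarch_of_nat[OF f] nonarch_minus[OF f] in auto)

lemma nonarch_sum:
  assumes f: "nonarch_abs_value f" and "\<And>i. i \<in> I \<Longrightarrow> f (g i) \<le> c" "c \<ge> 0"
  shows "f (sum g I) \<le> c"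
  using assms(2)
proof (induction I rule: infinite_finite_induct)
  case (insert x I)
  have "f (g x) \<le> c" "f (sum g I) \<le> c" using insert by auto
  then show ?case using nonarch_add[OF f, of "g x" "sum g I"] insert(1,2) by (simp add: max_def split: if_splits)
qed (use nonarch_eq_0[OF f, of 0] \<open>c \<ge> 0\<close> in auto)

context order_basis
begin

text \<open>On A the value is bounded by the sum M of the values of the basis. Since A contains all
  powers of a, a value above 1 would exceed M eventually.\<close>

lemma nonarch_A:
  fixes f :: "'k \<Rightarrow> real"
  assumes f: "nonarch_abs_value f" and a: "a \<in> A" shows "f a \<le> 1"
proof (rule ccontr)
  assume "\<not> f a \<le> 1"
  define M where "M = (\<Sum>b\<in>B. f (w b))"
  have le: "f y \<le> M" if y: "y \<in> A" for y
  proof -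
    obtain x where x: "y = emb x" using y by (auto simp: A_def)
    show ?thesis unfolding x emb_def
    proof (rule nonarch_sum[OF f])
      fix b assume b: "b \<in> B"
      have "f (of_int (x b) * w b) \<le> 1 * f (w b)" unfolding nonarch_mult[OF f]
        by (intro mult_right_mono nonarch_of_int[OF f] nonarch_nonneg[OF f])
      also have "\<dots> \<le> M" unfolding M_def
        using b finite_B nonarch_nonneg[OF f] by (auto intro: member_le_sum)
      finally show "f (of_int (x b) * w b) \<le> M" .
    qed (auto simp: M_def nonarch_nonneg[OF f] intro: sum_nonneg)
  qed
  obtain n where "M < f a ^ n" using \<open>\<not> f a \<le> 1\<close> real_arch_pow[of "f a" M] by auto
  then show False using le[OF A_power[OF a, of n]] nonarch_power[OF f] by simp
qed

text \<open>Otherwise all positive integers have value 1, and clearing denominators gives values at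
  most 1 everywhere. Applied to x and its inverse this forces value 1, against
  nontriviality.\<close>

lemma nonarch_small_nat:
  fixes f :: "'k \<Rightarrow> real"
  assumes f: "nonarch_abs_value f"
  shows "\<exists>n::nat. n > 0 \<and> f (of_nat n) < 1"
proof (rule ccontr)
  assume none: "\<not> (\<exists>n::nat. n > 0 \<and> f (of_nat n) < 1)"
  have one: "f (of_nat n) = 1" if "n > 0" for n :: nat
  proof -
    have "\<not> f (of_nat n) < 1" using none that by blast
    then show ?thesis using nonarch_of_nat[OF f, of n] by simp
  qed
  have le: "f x \<le> 1" for x
  proof -
    obtain D :: nat where "D > 0" "of_nat D * x \<in> A" using A_denom by blast
    then show ?thesis using nonarch_A[OF f, of "of_nat D * x"] one nonarch_mult[OF f] by simp
  qed
  obtain x where x: "x \<noteq> 0" "f x \<noteq> 1" using f unfolding nonarch_abs_value_def by blast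
  have "f x * f (inverse x) = 1"
    using x nonarch_mult[OF f, of x "inverse x"] nonarch_one[OF f] by simp
  moreover have "f x < 1" using le[of x] x by simp
  moreover have "f x * f (inverse x) \<le> f x * 1"
    by (rule mult_left_mono[OF le nonarch_nonneg[OF f]])
  ultimately show False by simp
qed

section \<open>Congruences modulo p and the Frobenius map\<close>

definition pA :: "nat \<Rightarrow> 'k set" where "pA p = (*) (of_nat p) ` A"

lemma subgrp_pA: "subgrp (pA p)"
  unfolding pA_def by (rule subgrp_mult_image[OF subgrp_A])

lemma pA_A: "pA p \<subseteq> A" using A_mult A_of_nat by (auto simp: pA_def)

lemma pA_mult: "x \<in> A \<Longrightarrow> y \<in> pA p \<Longrightarrow> x * y \<in> pA p"
  using A_mult by (auto simp: pA_def mult.left_commute)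

lemma pA_mult_right: "y \<in> pA p \<Longrightarrow> x \<in> A \<Longrightarrow> y * x \<in> pA p"
  using pA_mult by (metis mult.commute)

lemma pA_of_nat: "p dvd n \<Longrightarrow> x \<in> A \<Longrightarrow> of_nat n * x \<in> pA p"
  using A_mult A_of_nat by (auto simp: pA_def dvd_def mult.assoc)

lemma pA_add_cong:
  assumes "x - x' \<in> pA p" "y - y' \<in> pA p" shows "(x + y) - (x' + y') \<in> pA p"
  using subgrp_add[OF subgrp_pA assms] by (simp add: algebra_simps)

lemma pA_mult_cong:
  assumes "x - x' \<in> pA p" "y - y' \<in> pA p" "x' \<in> A" "y \<in> A"
  shows "x * y - x' * y' \<in> pA p"
proof -
  have "x * y - x' * y' = (x - x') * y + x' * (y - y')" by (simp add: algebra_simps)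
  then show ?thesis
    using subgrp_add[OF subgrp_pA pA_mult_right[OF assms(1,4)] pA_mult[OF assms(3,2)]] by simp
qed

lemma pA_power_cong:
  assumes "x - y \<in> pA p" "x \<in> A" "y \<in> A"
  shows "x ^ n - y ^ n \<in> pA p"
proof (induction n)
  case 0 then show ?case using subgrp_0[OF subgrp_pA] by simp
next
  case (Suc n)
  then show ?case using pA_mult_cong[OF assms(1) Suc assms(3) A_power[OF assms(2)]] by simp
qed

lemma pA_trans: "x - y \<in> pA p \<Longrightarrow> y - z \<in> pA p \<Longrightarrow> x - z \<in> pA p"
  using subgrp_add[OF subgrp_pA, of "x - y" p "y - z"] by simp

lemma pA_sym: "x - y \<in> pA p \<Longrightarrow> y - x \<in> pA p"
  using subgrp_minus[OF subgrp_pA, of "x - y" p] by simp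

lemma frobenius:
  assumes p: "Factorial_Ring.prime p" and x: "x \<in> A" and y: "y \<in> A"
  shows "(x + y) ^ p - (x ^ p + y ^ p) \<in> pA p"
proof -
  have p1: "p > 1" using p prime_gt_1_nat by blast
  have "(x + y) ^ p = (\<Sum>k\<le>p. of_nat (p choose k) * x ^ k * y ^ (p - k))"
    by (rule binomial_ring)
  also have "{..p} = insert 0 (insert p {1..<p})" using p1 by auto
  finally have "(x + y) ^ p - (x ^ p + y ^ p) = (\<Sum>k\<in>{1..<p}. of_nat (p choose k) * x ^ k * y ^ (p - k))"
    using p1 by simp
  also have "\<dots> \<in> pA p"
  proof (rule subgrp_sum[OF subgrp_pA])
    fix k assume "k \<in> {1..<p}"
    then have "p dvd (p choose k)" using p by (intro dvd_choose_prime) auto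
    then show "of_nat (p choose k) * x ^ k * y ^ (p - k) \<in> pA p"
      unfolding mult.assoc by (rule pA_of_nat) (intro A_mult A_power x y)
  qed
  finally show ?thesis .
qed

lemma frobenius_iter:
  assumes p: "Factorial_Ring.prime p" and x: "x \<in> A" and y: "y \<in> A"
  shows "(x + y) ^ (p ^ m) - (x ^ (p ^ m) + y ^ (p ^ m)) \<in> pA p"
proof (induction m)
  case 0 then show ?case using subgrp_0[OF subgrp_pA] by simp
next
  case (Suc m)
  have xy: "x + y \<in> A" using x y subgrp_add[OF subgrp_A] by blast
  have "((x + y) ^ (p ^ m)) ^ p - (x ^ (p ^ m) + y ^ (p ^ m)) ^ p \<in> pA p"
    using Suc by (rule pA_power_cong) (auto intro: A_power x y xy subgrp_add[OF subgrp_A])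
  moreover have "(x ^ (p ^ m) + y ^ (p ^ m)) ^ p - ((x ^ (p ^ m)) ^ p + (y ^ (p ^ m)) ^ p) \<in> pA p"
    by (rule frobenius[OF p]) (auto intro: A_power x y)
  ultimately have "((x + y) ^ (p ^ m)) ^ p - ((x ^ (p ^ m)) ^ p + (y ^ (p ^ m)) ^ p) \<in> pA p"
    by (rule pA_trans)
  then show ?case by (simp add: power_mult[symmetric] mult.commute)
qed

lemma fermat_A:
  assumes p: "Factorial_Ring.prime p"
  shows "of_int n ^ (p ^ m) - of_int n \<in> pA p"
proof -
  have nat: "of_nat k ^ (p ^ m) - of_nat k \<in> pA p" for k :: nat
  proof (induction k)
    case 0 then show ?case using subgrp_0[OF subgrp_pA] p prime_gt_0_nat[OF p] by (simp add: zero_power)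
  next
    case (Suc k)
    have "(1 + of_nat k) ^ (p ^ m) - (1 ^ (p ^ m) + of_nat k ^ (p ^ m)) \<in> pA p"
      by (rule frobenius_iter[OF p A_1 A_of_nat])
    moreover have "(1 ^ (p ^ m) + of_nat k ^ (p ^ m)) - (1 + of_nat k) \<in> pA p" using Suc by simp
    ultimately show ?case using pA_trans by fastforce
  qed
  define k where "k = nat (n mod int p)"
  have p0: "int p > 0" using prime_gt_0_nat[OF p] by simp
  have "n - int k = int p * (n div int p)" using p0 by (simp add: k_def minus_mod_eq_mult_div)
  then have "(of_int n :: 'k) - of_nat k = of_nat p * of_int (n div int p)"
    by (metis of_int_diff of_int_mult of_int_of_nat_eq)
  then have *: "of_int n - of_nat k \<in> pA p" using A_of_int by (auto simp: pA_def)
  show ?thesis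
    using pA_trans[OF pA_trans[OF pA_power_cong[OF * A_of_int A_of_nat] nat] pA_sym[OF *]] .
qed

definition ip :: "int poly \<Rightarrow> 'k \<Rightarrow> 'k" where
  "ip f x = poly (map_poly of_int f) x"

lemma ip_pCons: "ip (pCons a f) x = of_int a + x * ip f x"
  by (simp add: ip_def map_poly_pCons)

lemma ip_0: "ip 0 x = 0" by (simp add: ip_def)

lemma ip_add: "ip (f + g) x = ip f x + ip g x"
proof -
  have "map_poly of_int (f + g) = (map_poly of_int f + map_poly of_int g :: 'k poly)"
    by (rule poly_eqI) (simp add: coeff_map_poly)
  then show ?thesis by (simp add: ip_def)
qed

lemma ip_monom: "ip (Polynomial.monom a i) x = of_int a * x ^ i"
  by (simp add: ip_def map_poly_monom poly_monom)

lemma ip_A: "x \<in> A \<Longrightarrow> ip f x \<in> A"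
  by (induction f) (auto simp: ip_0 ip_pCons subgrp_0[OF subgrp_A] subgrp_add[OF subgrp_A] A_mult A_of_int)

lemma ip_taylor:
  assumes x: "x \<in> A" and c: "c \<in> A"
  shows "\<exists>h\<in>A. ip f (x + c) = ip f x + c * ip (pderiv f) x + c^2 * h"
proof (induction f)
  case 0 then show ?case using subgrp_0[OF subgrp_A] by (auto simp: ip_0 intro: bexI[of _ 0])
next
  case (pCons a f)
  then obtain h where h: "h \<in> A" "ip f (x + c) = ip f x + c * ip (pderiv f) x + c^2 * h" by blast
  show ?case
  proof (rule bexI)
    show "x * h + ip (pderiv f) x + c * h \<in> A"
      using x c h ip_A by (auto intro!: subgrp_add[OF subgrp_A] A_mult)
    show "ip (pCons a f) (x + c) = ip (pCons a f) x + c * ip (pderiv (pCons a f)) x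
        + c^2 * (x * h + ip (pderiv f) x + c * h)"
      unfolding pderiv_pCons ip_add ip_pCons h(2) by (simp add: algebra_simps power2_eq_square)
  qed
qed

lemma ip_frobenius:
  assumes p: "Factorial_Ring.prime p" and x: "x \<in> A"
  shows "ip f (x ^ (p ^ m)) - ip f x ^ (p ^ m) \<in> pA p"
proof (induction f)
  case 0 then show ?case
    using subgrp_0[OF subgrp_pA] prime_gt_0_nat[OF p] by (simp add: ip_0 zero_power)
next
  case (pCons a f)
  let ?q = "p ^ m"
  have xf: "x * ip f x \<in> A" using x ip_A A_mult by blast
  have 1: "(of_int a + x * ip f x) ^ ?q - (of_int a ^ ?q + (x * ip f x) ^ ?q) \<in> pA p"
    by (rule frobenius_iter[OF p A_of_int xf])
  have "x ^ ?q * ip f x ^ ?q - x ^ ?q * ip f (x ^ ?q) \<in> pA p"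
    using pA_mult[OF A_power[OF x] pA_sym[OF pCons(2)]] by (simp add: right_diff_distrib)
  then have 2: "(of_int a ^ ?q + (x * ip f x) ^ ?q) - (of_int a + x ^ ?q * ip f (x ^ ?q)) \<in> pA p"
    using pA_add_cong[OF fermat_A[OF p, of a m]] by (simp add: power_mult_distrib)
  show ?case unfolding ip_pCons using pA_sym[OF pA_trans[OF 1 2]] .
qed

text \<open>Pigeonhole with d + 1 integer coefficients against d coordinates: two polynomials with
  coefficients in 0..H take the same value at x, and their difference vanishes there.\<close>

lemma ex_annihilating_poly:
  assumes x: "x \<in> A"
  shows "\<exists>f. f \<noteq> 0 \<and> ip f x = 0"
proof -
  define d where "d = card B"
  have "\<forall>i. \<exists>H. x ^ i \<in> bx H" using in_bx A_power[OF x] by blast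
  then obtain h where h: "\<And>i. x ^ i \<in> bx (h i)" by metis
  define K where "K = (\<Sum>i\<le>d. h i)"
  \<comment> \<open>Values lie in a box of at most ((2 K + 1) (H + 1)) ^ d = H (H + 1) ^ d elements.
    This is less than the number (H + 1) ^ (d + 1) of polynomials exactly because H is this
    power.\<close>
  define H where "H = (2 * K + 1) ^ d"
  define S where "S = (\<Pi>\<^sub>E i\<in>{..d}. {0..int H})"
  define g where "g c = (\<Sum>i\<le>d. of_int (c i) * x ^ i)" for c :: "nat \<Rightarrow> int"
  have scale: "of_int n * y \<in> bx (H * k)" if "y \<in> bx k" "\<bar>n\<bar> \<le> int H" for n y k
  proof -
    obtain u where u: "y = emb u" "\<And>b. b \<in> B \<Longrightarrow> \<bar>u b\<bar> \<le> int k" using \<open>y \<in> bx k\<close> by (auto simp: bx_def)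
    have "\<bar>n * u b\<bar> \<le> int (H * k)" if "b \<in> B" for b
      using u(2)[OF that] \<open>\<bar>n\<bar> \<le> int H\<close> by (simp add: abs_mult mult_mono)
    then show ?thesis unfolding u(1) emb_scale bx_def by blast
  qed
  have bsum: "(\<Sum>i\<in>I. y i) \<in> bx (\<Sum>i\<in>I. k i)" if "finite I" "\<And>i. i \<in> I \<Longrightarrow> y i \<in> bx (k i)"
    for y k and I :: "nat set"
    using that by (induction I) (auto simp: bx_0 intro: bx_add)
  have gS: "g ` S \<subseteq> bx (H * K)"
  proof clarify
    fix c assume "c \<in> S"
    then have "c i \<in> {0..int H}" if "i \<le> d" for i
      using PiE_mem[of c "{..d}" "\<lambda>_. {0..int H}" i] that by (simp add: S_def)
    then have "\<bar>c i\<bar> \<le> int H" if "i \<le> d" for i using that by auto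
    then have "g c \<in> bx (\<Sum>i\<le>d. H * h i)" unfolding g_def
      by (intro bsum scale h) auto
    then show "g c \<in> bx (H * K)" by (simp add: K_def sum_distrib_left)
  qed
  have "card (g ` S) \<le> (2 * (H * K) + 1) ^ d"
    using card_mono[OF finite_bx gS] by (simp add: card_bx d_def)
  also have "\<dots> \<le> ((2 * K + 1) * (H + 1)) ^ d" by (rule power_mono) (auto simp: algebra_simps)
  also have "\<dots> = H * (H + 1) ^ d" by (simp only: power_mult_distrib H_def)
  also have "\<dots> < (H + 1) * (H + 1) ^ d" by simp
  also have "\<dots> = card S" by (simp add: S_def card_PiE nat_add_distrib)
  finally have "\<not> inj_on g S" using card_image by force
  then obtain c c' where c: "c \<in> S" "c' \<in> S" "c \<noteq> c'" "g c = g c'" by (auto simp: inj_on_def)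
  then obtain i where i: "i \<le> d" "c i \<noteq> c' i" unfolding S_def by (metis PiE_ext atMost_iff)
  define f :: "int poly" where "f = (\<Sum>i\<le>d. Polynomial.monom (c i - c' i) i)"
  have "Polynomial.coeff f i = c i - c' i" using i by (simp add: f_def coeff_sum)
  then have "f \<noteq> 0" using i by auto
  moreover have "ip (\<Sum>i\<in>I. Polynomial.monom (e i) i) x = (\<Sum>i\<in>I. of_int (e i) * x ^ i)" if "finite I" for e I
    using that by (induction I) (simp_all add: ip_0 ip_add ip_monom)
  then have "ip f x = g c - g c'" unfolding f_def g_def by (simp add: sum_subtractf left_diff_distrib)
  ultimately show ?thesis using c by auto
qed

text \<open>In characteristic 0 the derivative of an annihilating polynomial of least degree is
  nonzero of smaller degree, so it does not vanish at x. The number r plays the part of a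
  discriminant: modulo primes not dividing it x is a simple root.\<close>

lemma ex_separable_poly:
  assumes x: "x \<in> A"
  shows "\<exists>f g r. g \<in> A \<and> r > 0 \<and> ip f x = 0 \<and> ip (pderiv f) x * g = of_nat r"
proof -
  define f where "f = arg_min Polynomial.degree (\<lambda>f. f \<noteq> 0 \<and> ip f x = 0)"
  have f: "f \<noteq> 0" "ip f x = 0" and min: "\<And>g. g \<noteq> 0 \<Longrightarrow> ip g x = 0 \<Longrightarrow> Polynomial.degree f \<le> Polynomial.degree g"
    using arg_min_nat_lemma[of "\<lambda>f. f \<noteq> 0 \<and> ip f x = 0" _ Polynomial.degree] ex_annihilating_poly[OF x]
    unfolding f_def by blast+
  have "Polynomial.degree f \<noteq> 0"
  proof
    assume "Polynomial.degree f = 0"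
    then obtain a where "f = [:a:]" by (rule degree_eq_zeroE)
    then show False using f by (simp add: ip_pCons ip_0)
  qed
  then have "pderiv f \<noteq> 0" "Polynomial.degree (pderiv f) < Polynomial.degree f"
    by (auto simp: pderiv_eq_0_iff degree_pderiv)
  then have nz: "ip (pderiv f) x \<noteq> 0" using min by fastforce
  obtain r :: nat where r: "r > 0" "of_nat r * (1 / ip (pderiv f) x) \<in> A" using A_denom by blast
  then show ?thesis using f nz
    by (intro exI[of _ f] exI[of _ "of_nat r * (1 / ip (pderiv f) x)"] exI[of _ r]) auto
qed

lemma finite_A_pA: "p > 0 \<Longrightarrow> finite (coset_set A (pA p))"
proof -
  assume "p > 0"
  obtain H where "of_nat p \<in> bx H" using in_bx[OF A_of_nat] by blast
  then have "of_nat p \<in> bx (max 1 H)" using bx_mono by (meson max.cobounded2 subsetD)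
  then show ?thesis unfolding pA_def using idx_A_mult \<open>p > 0\<close>
    by (metis max.cobounded1 of_nat_eq_0_iff not_gr_zero)
qed

lemma bezout_prime:
  assumes p: "Factorial_Ring.prime p" and "\<not> p dvd r"
  shows "\<exists>u v::int. of_int u * of_nat r + of_int v * of_nat p = (1::'k)"
proof -
  have "coprime r p" using assms prime_imp_coprime[of p r] by (simp add: coprime_commute)
  then have "coprime (int r) (int p)" by simp
  then obtain u v where "u * int r + v * int p = 1" using bezout_int[of "int r" "int p"] by auto
  then have "of_int (u * int r + v * int p) = (1::'k)" by simp
  then show ?thesis by (intro exI[of _ u] exI[of _ v]) simp
qed

text \<open>Hensel uniqueness: a nilpotent perturbation of a simple root that is again a root is trivial.\<close>

lemma frobenius_fixes_root:
  assumes p: "Factorial_Ring.prime p" and x: "x \<in> A" and g: "g \<in> A"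
    and f: "ip f x = 0" "ip (pderiv f) x * g = of_nat r" and r: "\<not> p dvd r"
  shows "\<exists>m>0. x ^ (p ^ m) - x \<in> pA p"
proof -
  have p0: "p > 0" using prime_gt_0_nat[OF p] .
  \<comment> \<open>A / p A is finite, so the Frobenius orbit of x repeats at some i < j. For m = j
    - i the difference c between x ^ (p ^ m) and x is then nilpotent modulo p.\<close>
  define F where "F i = (+) (x ^ (p ^ i)) ` pA p" for i :: nat
  have "range F \<subseteq> coset_set A (pA p)" using A_power[OF x] by (auto simp: F_def coset_set_def)
  then have "finite (range F)" using finite_A_pA[OF p0] finite_subset by blast
  then have "\<not> inj F" using finite_imageD infinite_UNIV_nat by blast
  then obtain i j where "F i = F j" "i < j" by (metis injI linorder_neqE_nat)
  then have ij: "x ^ (p ^ i) - x ^ (p ^ j) \<in> pA p" "i < j"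
    unfolding F_def using coset_eq_iff[OF subgrp_pA] by blast+
  define m where "m = j - i"
  define c where "c = x ^ (p ^ m) - x"
  have c: "c \<in> A" using A_power[OF x] x subgrp_diff[OF subgrp_A] by (simp add: c_def)
  have nil: "c ^ (p ^ i) \<in> pA p"
  proof -
    have "(c + x) ^ (p ^ i) = x ^ (p ^ j)"
      using ij(2) by (simp add: c_def m_def power_mult[symmetric] power_add[symmetric])
    then have 1: "x ^ (p ^ j) - (c ^ (p ^ i) + x ^ (p ^ i)) \<in> pA p"
      using frobenius_iter[OF p c x, of i] by simp
    have "c ^ (p ^ i) = - ((x ^ (p ^ i) - x ^ (p ^ j)) + (x ^ (p ^ j) - (c ^ (p ^ i) + x ^ (p ^ i))))"
      by simp
    then show ?thesis
      using subgrp_minus[OF subgrp_pA subgrp_add[OF subgrp_pA ij(1) 1]] by simp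
  qed
  obtain h where h: "h \<in> A" "ip f (x + c) = ip f x + c * ip (pderiv f) x + c^2 * h"
    using ip_taylor[OF x c] by blast
  \<comment> \<open>x + c is x ^ (p ^ m), and Frobenius commutes with integer polynomials modulo p.
    The Taylor expansion leaves c f'(x) + c^2 h in p A; multiplying by g and inverting r modulo p
    gives c = c^2 h' modulo p.\<close>
  have "ip f (x + c) \<in> pA p"
    using ip_frobenius[OF p x, of f m] f p0 by (simp add: c_def zero_power)
  then have "(c * ip (pderiv f) x + c^2 * h) * g \<in> pA p" using h f g pA_mult_right by simp
  then have 2: "of_nat r * c + c^2 * (h * g) \<in> pA p" using f(2) by (simp add: algebra_simps)
  obtain u v where uv: "of_int u * of_nat r + of_int v * of_nat p = (1::'k)"
    using bezout_prime[OF p r] by blast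
  define h' where "h' = - (of_int u * (h * g))"
  have h': "h' \<in> A" unfolding h'_def
    by (intro subgrp_minus[OF subgrp_A] A_mult A_of_int h g)
  have "c - c^2 * h' = of_int u * (of_nat r * c + c^2 * (h * g)) + of_nat p * (of_int v * c)"
  proof -
    have "c = (of_int u * of_nat r + of_int v * of_nat p) * c" using uv by simp
    then show ?thesis by (simp add: h'_def algebra_simps)
  qed
  moreover have "of_nat p * (of_int v * c) \<in> pA p" using A_mult[OF A_of_int c] by (auto simp: pA_def)
  ultimately have 3: "c - c^2 * h' \<in> pA p"
    using subgrp_add[OF subgrp_pA pA_mult[OF A_of_int 2]] by simp
  \<comment> \<open>Iterating c = c^2 h' raises the power of c until it passes the nilpotency
    exponent p ^ i.\<close>
  have "c - c ^ Suc k * h' ^ k \<in> pA p" for k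
  proof (induction k)
    case 0 then show ?case using subgrp_0[OF subgrp_pA] by simp
  next
    case (Suc k)
    have "(c - c^2 * h') * (c ^ k * h' ^ k) \<in> pA p"
      by (intro pA_mult_right[OF 3] A_mult A_power c h')
    then have "c ^ Suc k * h' ^ k - c ^ Suc (Suc k) * h' ^ Suc k \<in> pA p"
      by (simp add: algebra_simps power2_eq_square)
    then show ?case using pA_trans[OF Suc] by blast
  qed
  from this[of "p ^ i"] have "c - c ^ Suc (p ^ i) * h' ^ (p ^ i) \<in> pA p" .
  moreover have eq: "c ^ Suc (p ^ i) * h' ^ (p ^ i) = c ^ (p ^ i) * (c * h' ^ (p ^ i))" by simp
  have "c ^ Suc (p ^ i) * h' ^ (p ^ i) \<in> pA p"
    unfolding eq by (rule pA_mult_right[OF nil A_mult[OF c A_power[OF h']]])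
  ultimately have "c \<in> pA p" using subgrp_add[OF subgrp_pA] by fastforce
  then show ?thesis using ij(2) by (intro exI[of _ m]) (auto simp: c_def m_def)
qed

text \<open>Each basis element is fixed by some power of Frobenius once p avoids its number r; the
  product of the exponents serves all of them, and additivity together with Fermat for the integer
  coefficients extends this to A. The product N of the r b collects the excluded primes.\<close>

lemma frobenius_fixes_A:
  "\<exists>N>0. \<forall>p. Factorial_Ring.prime p \<and> \<not> p dvd N \<longrightarrow>
     (\<exists>m>0. \<forall>a\<in>A. a ^ (p ^ m) - a \<in> pA p)"
proof -
  have wA: "w b \<in> A" if "b \<in> B" for b
  proof -
    have "w b = emb (\<lambda>i. if i = b then 1 else 0)"
      using that finite_B by (simp add: emb_def if_distrib[of of_int] if_distrib[of "\<lambda>y. y * _"] cong: if_cong)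
    then show ?thesis by (auto simp: A_def)
  qed
  have "\<forall>b\<in>B. \<exists>r f g. g \<in> A \<and> r > 0 \<and> ip f (w b) = 0 \<and> ip (pderiv f) (w b) * g = of_nat r"
    using ex_separable_poly wA by blast
  then obtain r where r: "\<And>b. b \<in> B \<Longrightarrow> r b > 0 \<and>
      (\<exists>f g. g \<in> A \<and> ip f (w b) = 0 \<and> ip (pderiv f) (w b) * g = of_nat (r b))" by metis
  define N where "N = (\<Prod>b\<in>B. r b)"
  have N: "N > 0" using r by (simp add: N_def prod_pos)
  have "\<exists>m>0. \<forall>a\<in>A. a ^ (p ^ m) - a \<in> pA p" if p: "Factorial_Ring.prime p" "\<not> p dvd N" for p
  proof -
    have "\<exists>m>0. w b ^ (p ^ m) - w b \<in> pA p" if b: "b \<in> B" for b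
    proof -
      have "r b dvd N" using b finite_B by (simp add: N_def dvd_prodI)
      then have "\<not> p dvd r b" using p(2) dvd_trans by blast
      then show ?thesis using r[OF b] frobenius_fixes_root[OF p(1) wA[OF b]] by blast
    qed
    then obtain mm where mm: "\<And>b. b \<in> B \<Longrightarrow> mm b > 0 \<and> w b ^ (p ^ mm b) - w b \<in> pA p" by metis
    define m where "m = (\<Prod>b\<in>B. mm b)"
    have m0: "m > 0" using mm by (simp add: m_def prod_pos)
    have wm: "w b ^ (p ^ m) - w b \<in> pA p" if b: "b \<in> B" for b
    proof -
      have it: "w b ^ (p ^ (mm b * k)) - w b \<in> pA p" for k
      proof (induction k)
        case 0 then show ?case using subgrp_0[OF subgrp_pA] by simp
      next
        case (Suc k)
        have "(w b ^ (p ^ (mm b * k))) ^ (p ^ mm b) - w b ^ (p ^ mm b) \<in> pA p"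
          by (rule pA_power_cong[OF Suc A_power[OF wA[OF b]] wA[OF b]])
        moreover have "(w b ^ (p ^ (mm b * k))) ^ (p ^ mm b) = w b ^ (p ^ (mm b * Suc k))"
          by (simp add: power_mult[symmetric] power_add[symmetric] add.commute)
        ultimately show ?case using pA_trans mm[OF b] by metis
      qed
      have "mm b dvd m" using b finite_B by (simp add: m_def dvd_prodI)
      then obtain k where "m = mm b * k" by (rule dvdE)
      then show ?thesis using it by simp
    qed
    have "a ^ (p ^ m) - a \<in> pA p" if a: "a \<in> A" for a
    proof -
      obtain y where y: "a = emb y" using a by (auto simp: A_def)
      have tA: "of_int (y b) * w b \<in> A" if "b \<in> B" for b using A_mult[OF A_of_int wA[OF that]] .
      have "(\<Sum>b\<in>I. of_int (y b) * w b) ^ (p ^ m) - (\<Sum>b\<in>I. of_int (y b) * w b) \<in> pA p"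
        if "I \<subseteq> B" for I
        using finite_subset[OF that finite_B] that
      proof (induction I)
        case empty then show ?case
          using subgrp_0[OF subgrp_pA] prime_gt_0_nat[OF p(1)] by (simp add: zero_power)
      next
        case (insert b I)
        define s where "s = (\<Sum>b\<in>I. of_int (y b) * w b)"
        define z where "z = of_int (y b) * w b"
        have z: "z \<in> A" using tA insert by (simp add: z_def)
        have s: "s \<in> A" unfolding s_def using tA insert by (intro subgrp_sum[OF subgrp_A]) auto
        have "z ^ (p ^ m) - z \<in> pA p" unfolding z_def power_mult_distrib
          by (rule pA_mult_cong[OF fermat_A[OF p(1)] wm A_of_int A_power[OF wA]]) (use insert in auto)
        then have "(z ^ (p ^ m) + s ^ (p ^ m)) - (z + s) \<in> pA p"
          using insert by (intro pA_add_cong) (auto simp: s_def)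
        then have "(z + s) ^ (p ^ m) - (z + s) \<in> pA p"
          using pA_trans[OF frobenius_iter[OF p(1) z s]] by blast
        then show ?case using insert by (simp add: s_def z_def)
      qed
      from this[OF order_refl] show ?thesis by (simp add: y emb_def)
    qed
    then show ?thesis using m0 by blast
  qed
  then show ?thesis using N by blast
qed

section \<open>Primes over p and the absolute values they define\<close>

definition ideal_A :: "'k set \<Rightarrow> bool" where
  "ideal_A Q \<longleftrightarrow> subgrp Q \<and> Q \<subseteq> A \<and> (\<forall>y\<in>A. \<forall>x\<in>Q. y * x \<in> Q)"

text \<open>An ideal that is maximal among those containing \<open>pA\<close> but no power of \<open>a\<close> is prime.\<close>

lemma ex_prime_ideal:
  assumes p: "p > 1" and q: "q > 1" and fix_q: "\<And>x. x \<in> A \<Longrightarrow> x ^ q - x \<in> pA p"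
    and a: "a \<in> A" "a \<notin> pA p"
  shows "\<exists>Q. ideal_A Q \<and> pA p \<subseteq> Q \<and> 1 \<notin> Q \<and> a \<notin> Q \<and> (\<forall>x\<in>A. \<forall>y\<in>A. x * y \<in> Q \<longrightarrow> x \<in> Q \<or> y \<in> Q)"
proof -
  \<comment> \<open>A power of a in p A would put a ^ (q ^ k) there as well, but this is congruent
    to a.\<close>
  have pow: "a ^ k \<notin> pA p" for k
  proof
    assume k: "a ^ k \<in> pA p"
    have it: "a ^ (q ^ i) - a \<in> pA p" for i
    proof (induction i)
      case 0 then show ?case using subgrp_0[OF subgrp_pA] by simp
    next
      case (Suc i)
      have "(a ^ (q ^ i)) ^ q - a ^ (q ^ i) \<in> pA p" by (rule fix_q[OF A_power[OF a(1)]])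
      then show ?case using pA_trans[OF _ Suc] by (simp add: power_mult[symmetric] mult.commute)
    qed
    have "k < q ^ k" using q by (induction k) (auto simp: less_Suc_eq_le Suc_le_eq intro: less_le_trans)
    then have "a ^ (q ^ k) = a ^ k * a ^ (q ^ k - k)" by (simp add: power_add[symmetric])
    then have "a ^ (q ^ k) \<in> pA p" using pA_mult_right[OF k A_power[OF a(1)]] by simp
    then have "a ^ (q ^ k) - (a ^ (q ^ k) - a) \<in> pA p" by (rule subgrp_diff[OF subgrp_pA _ it])
    then show False using a(2) by simp
  qed
  define F where "F = {Q. ideal_A Q \<and> pA p \<subseteq> Q \<and> (\<forall>k. a ^ k \<notin> Q)}"
  have "finite F"
    by (rule card_intermediate_le(1)[OF subgrp_pA finite_A_pA[of p] order_refl])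
      (use p in \<open>auto simp: F_def ideal_A_def\<close>)
  moreover have "pA p \<in> F"
    using pow pA_mult subgrp_pA pA_A by (auto simp: F_def ideal_A_def)
  ultimately obtain Q where Q: "Q \<in> F" and max: "\<And>Q'. Q' \<in> F \<Longrightarrow> Q \<subseteq> Q' \<Longrightarrow> Q = Q'"
    using finite_has_maximal[of F] by blast
  have sQ: "subgrp Q" "Q \<subseteq> A" "pA p \<subseteq> Q" and mQ: "\<And>x y. y \<in> A \<Longrightarrow> x \<in> Q \<Longrightarrow> y * x \<in> Q"
    and aQ: "\<And>k. a ^ k \<notin> Q" using Q by (auto simp: F_def ideal_A_def)
  \<comment> \<open>The ideal Q + y A is strictly larger than Q, so by maximality it contains a
    power of a.\<close>
  have ext: "\<exists>k. \<exists>x\<in>Q. \<exists>z\<in>A. a ^ k = x + y * z" if y: "y \<in> A" "y \<notin> Q" for y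
  proof -
    define Q' where "Q' = {x + y * z | x z. x \<in> Q \<and> z \<in> A}"
    have "subgrp Q'" unfolding subgrp_def
    proof (intro conjI ballI)
      have "0 + y * 0 \<in> Q'" unfolding Q'_def using subgrp_0[OF sQ(1)] subgrp_0[OF subgrp_A] by blast
      then show "0 \<in> Q'" by simp
      fix u v assume "u \<in> Q'" "v \<in> Q'"
      then obtain x z x' z' where *: "u = x + y * z" "x \<in> Q" "z \<in> A" "v = x' + y * z'" "x' \<in> Q" "z' \<in> A"
        by (auto simp: Q'_def)
      have "u - v = (x - x') + y * (z - z')" by (simp add: * algebra_simps)
      then show "u - v \<in> Q'" unfolding Q'_def using * subgrp_diff[OF sQ(1)] subgrp_diff[OF subgrp_A] by blast
    qed
    moreover have "Q' \<subseteq> A" using sQ(2) y(1) A_mult subgrp_add[OF subgrp_A] by (auto simp: Q'_def)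
    moreover have "t * u \<in> Q'" if tu: "t \<in> A" "u \<in> Q'" for t u
    proof -
      obtain x z where *: "u = x + y * z" "x \<in> Q" "z \<in> A" using tu by (auto simp: Q'_def)
      have "t * u = t * x + y * (t * z)" by (simp add: * algebra_simps)
      then show ?thesis unfolding Q'_def using * mQ[OF tu(1)] A_mult[OF tu(1)] by blast
    qed
    ultimately have id: "ideal_A Q'" by (auto simp: ideal_A_def)
    have QQ': "Q \<subseteq> Q'"
    proof
      fix x assume "x \<in> Q"
      then have "x + y * 0 \<in> Q'" unfolding Q'_def using subgrp_0[OF subgrp_A] by blast
      then show "x \<in> Q'" by simp
    qed
    have "0 + y * 1 \<in> Q'" unfolding Q'_def using subgrp_0[OF sQ(1)] A_1 by blast
    then have "Q \<noteq> Q'" using y by auto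
    then have "Q' \<notin> F" using max QQ' by blast
    then obtain k where "a ^ k \<in> Q'" using id QQ' sQ by (auto simp: F_def)
    then show ?thesis by (auto simp: Q'_def)
  qed
  have prime: "x \<in> Q \<or> y \<in> Q" if xy: "x \<in> A" "y \<in> A" "x * y \<in> Q" for x y
  proof (rule ccontr)
    assume "\<not> ?thesis"
    then obtain k u z l v z' where *: "u \<in> Q" "z \<in> A" "a ^ k = u + x * z" "v \<in> Q" "z' \<in> A" "a ^ l = v + y * z'"
      using ext[of x] ext[of y] xy by blast
    have vA: "v \<in> A" using * sQ by auto
    have "a ^ (k + l) = (v + y * z') * u + ((x * z) * v + (z * z') * (x * y))"
      unfolding power_add *(3,6) by (simp add: algebra_simps)
    also have "\<dots> \<in> Q"
    proof (intro subgrp_add[OF sQ(1)])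
      show "(v + y * z') * u \<in> Q" using * xy vA by (intro mQ A_mult subgrp_add[OF subgrp_A]) auto
      show "x * z * v \<in> Q" using * xy by (intro mQ A_mult) auto
      show "z * z' * (x * y) \<in> Q" by (rule mQ[OF A_mult xy(3)]) (use * in auto)
    qed
    finally show False using aQ by blast
  qed
  show ?thesis using Q prime aQ[of 0] aQ[of 1] by (intro exI[of _ Q]) (auto simp: F_def)
qed

text \<open>For a prime ideal \<open>Q\<close> over \<open>p\<close> and \<open>x \<in> Q\<close>, the element \<open>1 - x ^ (q - 1)\<close> lies outside \<open>Q\<close> and
  multiplies \<open>x\<close> into \<open>pA\<close>. Hence \<open>p\<close> generates \<open>Q\<close> locally, and the absolute value of \<open>x\<close> is \<open>2\<close> to the
  power \<open>- j\<close> if \<open>s * x = p ^ j * t\<close> with \<open>s\<close> and \<open>t\<close> outside \<open>Q\<close>.\<close>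

lemma ex_nonarch_abs_value:
  assumes p: "Factorial_Ring.prime p" and q: "q > 1" and fix_q: "\<And>x. x \<in> A \<Longrightarrow> x ^ q - x \<in> pA p"
    and a: "a \<in> A" "a \<notin> pA p"
  shows "\<exists>f. nonarch_abs_value f \<and> f (of_nat p) < 1 \<and> f a = 1"
proof -
  have p1: "p > 1" using p prime_gt_1_nat by blast
  obtain Q where Q: "ideal_A Q" "pA p \<subseteq> Q" "1 \<notin> Q" "a \<notin> Q"
    and prime: "\<And>x y. x \<in> A \<Longrightarrow> y \<in> A \<Longrightarrow> x * y \<in> Q \<Longrightarrow> x \<in> Q \<or> y \<in> Q"
    using ex_prime_ideal[OF p1 q fix_q a] by blast
  have sQ: "subgrp Q" "Q \<subseteq> A" and mQ: "\<And>x y. y \<in> A \<Longrightarrow> x \<in> Q \<Longrightarrow> y * x \<in> Q"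
    using Q by (auto simp: ideal_A_def)
  define U where "U = A - Q"
  have U1: "1 \<in> U" using A_1 Q by (simp add: U_def)
  have Um: "x * y \<in> U" if "x \<in> U" "y \<in> U" for x y
    using that A_mult prime by (auto simp: U_def)
  have U0: "x \<noteq> 0" if "x \<in> U" for x using that subgrp_0[OF sQ(1)] by (auto simp: U_def)
  have pQ: "of_nat p * x \<in> Q" if "x \<in> A" for x using that Q(2) by (auto simp: pA_def)
  define \<pi> :: 'k where "\<pi> = of_nat p"
  have \<pi>0: "\<pi> \<noteq> 0" using p1 by (simp add: \<pi>_def)
  have up: "\<exists>u\<in>U. u * x \<in> pA p" if x: "x \<in> Q" for x
  proof
    have xA: "x \<in> A" using x sQ by auto
    have "x ^ (q - 1) = x ^ (q - 2) * x" using q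
      by (metis One_nat_def Suc_1 Suc_diff_Suc diff_Suc_1' diff_diff_left plus_1_eq_Suc power_Suc2)
    then have "x ^ (q - 1) \<in> Q" using mQ[OF A_power[OF xA] x] by simp
    then have "1 - x ^ (q - 1) \<notin> Q" using Q(3) subgrp_add[OF sQ(1)] by fastforce
    then show "1 - x ^ (q - 1) \<in> U" using A_1 A_power[OF xA] subgrp_diff[OF subgrp_A] by (simp add: U_def)
    have "x ^ (q - 1) * x = x ^ q" using q by (metis less_imp_Suc_add diff_Suc_1 power_Suc2 add_Suc)
    then have "(1 - x ^ (q - 1)) * x = x - x ^ q" by (simp add: left_diff_distrib)
    then show "(1 - x ^ (q - 1)) * x \<in> pA p" using pA_sym[OF fix_q[OF xA]] by simp
  qed
  \<comment> \<open>The exponent is well defined: two different ones would make s' t, a product of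
    elements outside Q, a multiple of p.\<close>
  have uniq: False if "i < j" "s \<in> U" "t \<in> U" "s' \<in> U" "t' \<in> A" "s * x = \<pi> powi i * t" "s' * x = \<pi> powi j * t'"
    for i j :: int and s t s' t' x
  proof -
    have "s' * (\<pi> powi i * t) = s * (\<pi> powi j * t')" using that(6,7) by (metis mult.left_commute)
    moreover have "\<pi> powi j = \<pi> powi i * \<pi> powi (j - i)" using power_int_add[of \<pi> i "j - i"] \<pi>0 by simp
    ultimately have "\<pi> powi i * (s' * t) = \<pi> powi i * (\<pi> powi (j - i) * (s * t'))"
      by (simp add: mult_ac)
    then have "s' * t = \<pi> powi (j - i) * (s * t')" using \<pi>0 by simp
    also have "\<pi> powi (j - i) = \<pi> * \<pi> ^ nat (j - i - 1)"
      using that(1) \<pi>0 power_int_add[of \<pi> 1 "j - i - 1"] by (simp add: power_int_def)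
    finally have "s' * t = of_nat p * (\<pi> ^ nat (j - i - 1) * (s * t'))" by (simp add: \<pi>_def mult_ac)
    moreover have "\<pi> ^ nat (j - i - 1) * (s * t') \<in> A"
      using that A_of_nat by (intro A_mult A_power) (auto simp: \<pi>_def U_def)
    ultimately have "s' * t \<in> Q" using pQ by simp
    then show False using Um[OF that(4,3)] by (simp add: U_def)
  qed
  have exA: "\<exists>j s t. s \<in> U \<and> t \<in> U \<and> s * x = \<pi> powi (int j) * t" if x: "x \<in> A" "x \<noteq> 0" for x
  proof -
    obtain D :: nat where D: "D > 0" "of_nat D * (1 / x) \<in> A" using A_denom by blast
    obtain i n where n: "D = p ^ i * n" "\<not> p dvd n"
      by (rule multiplicity_decompose'[of D p]) (use D(1) p prime_gt_1_nat[OF p] in auto)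
    obtain u v where uv: "of_int u * of_nat n + of_int v * of_nat p = (1::'k)"
      using bezout_prime[OF p n(2)] by blast
    have nU: "of_nat n \<in> U"
    proof -
      have "of_nat n \<notin> Q"
      proof
        assume "of_nat n \<in> Q"
        then have "of_int u * of_nat n \<in> Q" using mQ[OF A_of_int] by blast
        moreover have "of_int v * of_nat p \<in> Q" using pQ[OF A_of_int[of v]] by (simp add: mult.commute)
        ultimately show False using uv Q(3) subgrp_add[OF sQ(1)] by fastforce
      qed
      then show ?thesis using A_of_nat by (simp add: U_def)
    qed
    define E where "E = {j. \<exists>s\<in>U. \<exists>t\<in>A. s * x = \<pi> ^ j * t}"
    have "1 * x = \<pi> ^ 0 * x" by simp
    then have E0: "0 \<in> E" using U1 x unfolding E_def by blast
    \<comment> \<open>D is a multiple of x in A, so by \<open>uniq\<close> no exponent of x exceeds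
      that of D, which is the multiplicity i of p because n lies outside Q.\<close>
    have bound: "j \<le> i" if jE: "j \<in> E" for j
    proof (rule ccontr)
      assume "\<not> j \<le> i"
      obtain s t where st: "s \<in> U" "t \<in> A" "s * x = \<pi> ^ j * t" using jE by (auto simp: E_def)
      define y where "y = of_nat D * (1 / x)"
      have "y \<in> A" using D(2) by (simp add: y_def)
      have "of_nat D = x * y" using x by (simp add: y_def)
      then have "s * of_nat D = \<pi> ^ j * (t * y)" using st(3) by (metis mult.assoc)
      then have "(s * of_nat n) * of_nat D = \<pi> ^ j * (of_nat n * (t * y))" by (simp add: mult_ac)
      have 1: "s * (of_nat D) = \<pi> powi (int j) * (t * y)" using \<open>s * of_nat D = \<pi> ^ j * (t * y)\<close> by simp
      have 2: "1 * (of_nat D) = \<pi> powi (int i) * (of_nat n)" by (simp add: n(1) \<pi>_def)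
      show False
        by (rule uniq[OF _ U1 nU st(1) _ 2 1]) (use \<open>\<not> j \<le> i\<close> st \<open>y \<in> A\<close> in \<open>auto intro: A_mult\<close>)
    qed
    define j where "j = Max E"
    have finE: "finite E" using bound by (meson atMost_iff finite_atMost finite_subset subsetI)
    have "j \<in> E" unfolding j_def using Max_in[OF finE] E0 by blast
    then obtain s t where st: "s \<in> U" "t \<in> A" "s * x = \<pi> ^ j * t" by (auto simp: E_def)
    \<comment> \<open>If t were in Q, \<open>up\<close> would split off one more factor p, against
      the maximality of j.\<close>
    have "t \<notin> Q"
    proof
      assume "t \<in> Q"
      then obtain u where u: "u \<in> U" "u * t \<in> pA p" using up by blast
      then obtain t' where t': "t' \<in> A" "u * t = \<pi> * t'" by (auto simp: pA_def \<pi>_def)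
      have "(u * s) * x = u * (\<pi> ^ j * t)" by (simp only: mult.assoc st(3))
      also have "\<dots> = \<pi> ^ j * (u * t)" by (rule mult.left_commute)
      also have "\<dots> = \<pi> ^ Suc j * t'" unfolding t'(2) by (simp only: power_Suc2 mult.assoc)
      finally have "(u * s) * x = \<pi> ^ Suc j * t'" .
      then have "Suc j \<in> E" using Um[OF u(1) st(1)] t'(1) unfolding E_def by blast
      then have "Suc j \<le> j" unfolding j_def using Max_ge[OF finE] by blast
      then show False by simp
    qed
    then show ?thesis using st by (intro exI[of _ j]) (auto simp: U_def)
  qed
  have ex: "\<exists>j s t. s \<in> U \<and> t \<in> U \<and> s * x = \<pi> powi j * t" if x: "x \<noteq> 0" for x
  proof -
    obtain D :: nat where D: "D > 0" "of_nat D * x \<in> A" using A_denom by blast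
    obtain i s t where st: "s \<in> U" "t \<in> U" "s * (of_nat D * x) = \<pi> powi (int i) * t"
      using exA[OF D(2)] x D(1) by auto
    obtain j s' t' where st': "s' \<in> U" "t' \<in> U" "s' * of_nat D = \<pi> powi (int j) * t'"
      using exA[OF A_of_nat[of D]] D(1) by auto
    have "(s * (of_nat D * x)) * s' = (\<pi> powi (int i) * t) * s'" using st(3) by simp
    then have "(s' * of_nat D) * (s * x) = \<pi> powi (int i) * (t * s')" by (simp add: mult_ac)
    then have *: "\<pi> powi (int j) * (t' * s * x) = \<pi> powi (int i) * (t * s')" using st'(3) by (simp add: mult_ac)
    have "\<pi> powi (int i) = \<pi> powi (int j) * \<pi> powi (int i - int j)"
      using power_int_add[of \<pi> "int j" "int i - int j"] \<pi>0 by simp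
    then have "\<pi> powi (int j) * (t' * s * x) = \<pi> powi (int j) * (\<pi> powi (int i - int j) * (t * s'))"
      using * by (simp add: mult.assoc)
    then have "(t' * s) * x = \<pi> powi (int i - int j) * (t * s')" using \<pi>0 by simp
    then show ?thesis using Um st st' by blast
  qed
  define v where "v x = (SOME j. \<exists>s\<in>U. \<exists>t\<in>U. s * x = \<pi> powi j * t)" for x
  have v: "\<exists>s\<in>U. \<exists>t\<in>U. s * x = \<pi> powi v x * t" if "x \<noteq> 0" for x
    unfolding v_def by (rule someI_ex) (use ex[OF that] in blast)
  have le_v: "j \<le> v x" if "x \<noteq> 0" "s \<in> U" "t \<in> A" "s * x = \<pi> powi j * t" for x s t j
    using v[OF that(1)] uniq that(2-4) by (metis not_less)
  have v_eq: "v x = j" if vx: "x \<noteq> 0" "s \<in> U" "t \<in> U" "s * x = \<pi> powi j * t" for x s t j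
  proof -
    have "t \<in> A" using vx by (simp add: U_def)
    then have "j \<le> v x" using le_v vx by blast
    moreover obtain s' t' where "s' \<in> U" "t' \<in> U" "s' * x = \<pi> powi v x * t'" using v[OF vx(1)] by blast
    then have "\<not> j < v x" using uniq[OF _ vx(2,3) _ _ vx(4)] by (auto simp: U_def)
    ultimately show ?thesis by simp
  qed
  define f where "f x = (if x = 0 then 0 else (1/2::real) powi v x)" for x
  have f_anti: "f x \<le> f y" if "x \<noteq> 0" "y \<noteq> 0" "v y \<le> v x" for x y
  proof -
    have "(1/2::real) powi v x = (1/2) powi v y * (1/2) ^ nat (v x - v y)"
      using that(3) power_int_add[of "1/2::real" "v y" "v x - v y"] by (simp add: power_int_def)
    moreover have "(1/2::real) powi v y * (1/2) ^ nat (v x - v y) \<le> (1/2) powi v y * 1"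
      by (intro mult_left_mono power_le_one) auto
    ultimately show ?thesis using that by (simp add: f_def)
  qed
  have "nonarch_abs_value f" unfolding nonarch_abs_value_def
  proof (intro conjI allI)
    fix x y
    show "0 \<le> f x" by (simp add: f_def)
    show "f x = 0 \<longleftrightarrow> x = 0" by (simp add: f_def)
    show "f (x * y) = f x * f y"
    proof (cases "x = 0 \<or> y = 0")
      case False
      then obtain s t s' t' where *: "s \<in> U" "t \<in> U" "s * x = \<pi> powi v x * t"
        "s' \<in> U" "t' \<in> U" "s' * y = \<pi> powi v y * t'" using v by metis
      have "(s * s') * (x * y) = (s * x) * (s' * y)" by (simp add: mult_ac)
      also have "\<dots> = \<pi> powi (v x + v y) * (t * t')"
        unfolding *(3,6) using \<pi>0 by (simp add: power_int_add mult_ac)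
      finally have "v (x * y) = v x + v y" using v_eq[of "x * y" "s * s'" "t * t'"] False Um * by simp
      then show ?thesis using False by (simp add: f_def power_int_add)
    qed (auto simp: f_def)
    show "f (x + y) \<le> max (f x) (f y)"
    proof (cases "x = 0 \<or> y = 0 \<or> x + y = 0")
      case False
      have half: "v x \<le> v (x + y)" if *: "x \<noteq> 0" "y \<noteq> 0" "x + y \<noteq> 0" "v x \<le> v y" for x y
      proof -
        obtain s t s' t' where st: "s \<in> U" "t \<in> U" "s * x = \<pi> powi v x * t"
          "s' \<in> U" "t' \<in> U" "s' * y = \<pi> powi v y * t'" using v *(1,2) by metis
        have "\<pi> powi v y = \<pi> powi v x * \<pi> ^ nat (v y - v x)"
          using *(4) \<pi>0 power_int_add[of \<pi> "v x" "v y - v x"] by (simp add: power_int_def)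
        moreover have "(s * s') * (x + y) = s' * (s * x) + s * (s' * y)" by (simp add: algebra_simps)
        ultimately have "(s * s') * (x + y) = \<pi> powi v x * (s' * t + s * (\<pi> ^ nat (v y - v x) * t'))"
          using st(3,6) by (simp add: algebra_simps)
        moreover have "s' * t + s * (\<pi> ^ nat (v y - v x) * t') \<in> A"
          using st A_of_nat by (intro subgrp_add[OF subgrp_A] A_mult A_power) (auto simp: U_def \<pi>_def)
        ultimately show ?thesis using le_v[OF *(3) Um[OF st(1,4)]] by blast
      qed
      show ?thesis
      proof (cases "v x \<le> v y")
        case True
        then show ?thesis using half[of x y] f_anti[of "x + y" x] False by auto
      next
        case F: False
        then show ?thesis using half[of y x] f_anti[of "x + y" y] False by (auto simp: add.commute)
      qed
    qed (auto simp: f_def le_max_iff_disj)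
  next
    have "v \<pi> = 1" by (rule v_eq[OF \<pi>0 U1 U1]) simp
    then show "\<exists>x. x \<noteq> 0 \<and> f x \<noteq> 1" using \<pi>0 by (intro exI[of _ \<pi>]) (simp add: f_def)
  qed
  moreover have "v \<pi> = 1" by (rule v_eq[OF \<pi>0 U1 U1]) simp
  then have "f (of_nat p) < 1" using \<pi>0 by (simp add: f_def \<pi>_def)
  moreover have aU: "a \<in> U" using a Q by (simp add: U_def)
  then have "v a = 0" by (intro v_eq[OF U0[OF aU] U1 aU]) simp
  then have "f a = 1" using U0[OF aU] by (simp add: f_def)
  ultimately show ?thesis by blast
qed

text \<open>A prime \<open>p\<close> not dividing \<open>N\<close> in the minimal denominator of an \<open>S\<close>-integer would give an absolute
  value above \<open>p\<close>, hence outside \<open>S\<close>, at which the element is not integral.\<close>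

lemma S_integers_denominator:
  fixes S :: "('k \<Rightarrow> real) set set"
  assumes S: "S \<subseteq> nonarch_places" "finite S"
  shows "\<exists>N>0. \<forall>y\<in>carrier (S_integers S). \<exists>j. of_nat N ^ j * y \<in> A"
proof -
  have "\<exists>n::nat. n > 0 \<and> (\<forall>f\<in>v. f (of_nat n) < 1)" if v: "v \<in> S" for v
  proof -
    obtain g where g: "nonarch_abs_value g" "v = abs_value_equiv `` {g}"
      using v S(1) by (auto simp: nonarch_places_def quotient_def)
    obtain n :: nat where n: "n > 0" "g (of_nat n) < 1" using nonarch_small_nat[OF g(1)] by blast
    have "f (of_nat n) < 1" if f: "f \<in> v" for f
    proof -
      obtain c where c: "c > 0" "\<And>x. f x = g x powr c" using f g(2) by (auto simp: abs_value_equiv_def)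
      have "g (of_nat n) powr c < 1 powr c"
        by (rule powr_less_mono2) (use c n nonarch_nonneg[OF g(1)] in auto)
      then show ?thesis using c by simp
    qed
    then show ?thesis using n by blast
  qed
  then obtain n where n: "\<And>v. v \<in> S \<Longrightarrow> n v > (0::nat) \<and> (\<forall>f\<in>v. f (of_nat (n v)) < 1)" by metis
  obtain N0 where N0: "N0 > 0" "\<And>p. Factorial_Ring.prime p \<Longrightarrow> \<not> p dvd N0 \<Longrightarrow>
     (\<exists>m>0. \<forall>a\<in>A. a ^ (p ^ m) - a \<in> pA p)" using frobenius_fixes_A by blast
  \<comment> \<open>The factor N0 excludes the primes where Frobenius fails to be periodic, and the
    n v make N small at every place of S, so that an absolute value with f N = 1 lies outside
    S.\<close>
  define N where "N = N0 * (\<Prod>v\<in>S. n v)"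
  have N: "N > 0" using N0 n by (simp add: N_def prod_pos)
  have "\<exists>j. of_nat N ^ j * y \<in> A" if y: "y \<in> carrier (S_integers S)" for y
  proof -
    \<comment> \<open>Denominators of y up to powers of N; the aim is that the least one is
      1.\<close>
    define E where "E = {D::nat. D > 0 \<and> (\<exists>j. of_nat N ^ j * (of_nat D * y) \<in> A)}"
    obtain D0 :: nat where "D0 > 0" "of_nat D0 * y \<in> A" using A_denom by blast
    then have "of_nat N ^ 0 * (of_nat D0 * y) \<in> A" by simp
    then have "D0 \<in> E" using \<open>D0 > 0\<close> unfolding E_def by blast
    define D where "D = (LEAST D. D \<in> E)"
    have D: "D \<in> E" unfolding D_def using \<open>D0 \<in> E\<close> by (rule LeastI)
    have least: "D \<le> D'" if "D' \<in> E" for D' unfolding D_def using that by (rule Least_le)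
    have "D = 1"
    proof (rule ccontr)
      assume "D \<noteq> 1"
      then obtain p where p: "Factorial_Ring.prime p" "p dvd D" using prime_factor_nat by blast
      then obtain D' where D': "D = p * D'" by (elim dvdE)
      have D'0: "D' > 0" "D' < D" using D D' prime_gt_1_nat[OF p(1)] by (auto simp: E_def)
      obtain j where j: "of_nat N ^ j * (of_nat D * y) \<in> A" using D by (auto simp: E_def)
      have notE: "D' \<notin> E" using least D'0 by fastforce
      show False
      proof (cases "p dvd N")
        \<comment> \<open>A prime factor of N can be moved from D into the power of N.\<close>
        case True
        then obtain N' where N': "N = p * N'" by (elim dvdE)
        have eq: "of_nat N ^ Suc j * (of_nat D' * y) = of_nat N' * (of_nat N ^ j * (of_nat D * y))"
          by (simp add: D' N' mult_ac)
        have "of_nat N ^ Suc j * (of_nat D' * y) \<in> A" unfolding eq by (rule A_mult[OF A_of_nat j])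
        then show False using notE D'0 unfolding E_def by blast
      next
        case False
        define a where "a = of_nat N ^ j * (of_nat D * y)"
        have a: "a \<in> A" using j by (simp add: a_def)
        have aP: "a \<notin> pA p"
        proof
          assume "a \<in> pA p"
          then obtain b where b: "b \<in> A" "a = of_nat p * b" by (auto simp: pA_def)
          have "a = of_nat p * (of_nat N ^ j * (of_nat D' * y))" by (simp add: a_def D' mult_ac)
          then have "of_nat N ^ j * (of_nat D' * y) = b" using b prime_gt_0_nat[OF p(1)] by simp
          then show False using notE D'0 b unfolding E_def by blast
        qed
        have "\<not> p dvd N0" using False by (auto simp: N_def)
        from N0(2)[OF p(1) this] obtain m where m: "m > 0" "\<And>a. a \<in> A \<Longrightarrow> a ^ (p ^ m) - a \<in> pA p"
          by blast
        have q: "p ^ m > 1" by (rule one_less_power[OF prime_gt_1_nat[OF p(1)] m(1)])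
        obtain f where f: "nonarch_abs_value f" "f (of_nat p) < 1" "f a = 1"
          using ex_nonarch_abs_value[OF p(1) q m(2) a aP] by blast
        \<comment> \<open>N and p are coprime, so by Bezout they cannot both have value below
          1.\<close>
        have fN: "f (of_nat N) = 1"
        proof (rule ccontr)
          assume "f (of_nat N) \<noteq> 1"
          then have fN: "f (of_nat N) < 1" using nonarch_of_nat[OF f(1), of N] by simp
          obtain u v where uv: "of_int u * of_nat N + of_int v * of_nat p = (1::'k)"
            using bezout_prime[OF p(1) False] by blast
          have small: "f (of_int u * z) < 1" if "f z < 1" for u z
          proof -
            have "f (of_int u * z) \<le> 1 * f z" unfolding nonarch_mult[OF f(1)]
              by (intro mult_right_mono nonarch_of_int[OF f(1)] nonarch_nonneg[OF f(1)])
            then show ?thesis using that by simp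
          qed
          have "f (of_int u * of_nat N + of_int v * of_nat p) < 1"
            using nonarch_add[OF f(1), of "of_int u * of_nat N" "of_int v * of_nat p"]
              small[OF fN, of u] small[OF f(2), of v] by (simp add: max_def split: if_splits)
          then show False using uv nonarch_one[OF f(1)] by simp
        qed
        have notS: "f \<notin> v" if v: "v \<in> S" for v
        proof
          assume "f \<in> v"
          then have lt: "f (of_nat (n v)) < 1" using n[OF v] by blast
          have "n v dvd N" using v S(2) by (simp add: N_def dvd_prodI dvd_mult)
          then obtain l where "N = n v * l" by (elim dvdE)
          then have "f (of_nat N) = f (of_nat (n v)) * f (of_nat l)" using nonarch_mult[OF f(1)] by simp
          also have "\<dots> \<le> f (of_nat (n v)) * 1"
            by (intro mult_left_mono nonarch_of_nat[OF f(1)] nonarch_nonneg[OF f(1)])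
          finally show False using fN lt by simp
        qed
        define v0 where "v0 = abs_value_equiv `` {f}"
        have fv0: "f \<in> v0" using f(1) nonarch_nonneg[OF f(1)]
          by (auto simp: v0_def abs_value_equiv_def intro!: exI[of _ 1])
        have "v0 \<in> nonarch_places - S" using notS fv0 f(1) by (auto simp: v0_def nonarch_places_def quotient_def)
        then have "place_integral v0 y" using y by (simp add: S_integers_def)
        then have fy: "f y \<le> 1" using fv0 by (simp add: place_integral_def)
        have "f a = f (of_nat p) * (f (of_nat D') * f y)"
          by (simp add: a_def D' nonarch_mult[OF f(1)] nonarch_power[OF f(1)] fN)
        also have "\<dots> \<le> f (of_nat p) * (1 * 1)"
          by (intro mult_left_mono mult_mono nonarch_of_nat[OF f(1)] fy nonarch_nonneg[OF f(1)]) auto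
        finally show False using f by simp
      qed
    qed
    then show ?thesis using D by (auto simp: E_def)
  qed
  then show ?thesis using N by blast
qed

lemma overring_S_integers:
  fixes S :: "('k \<Rightarrow> real) set set"
  assumes "S \<subseteq> nonarch_places"
  shows "overring B w (carrier (S_integers S))"
proof
  have nonarch: "nonarch_abs_value f" if v: "v \<in> nonarch_places - S" "f \<in> v" for f :: "'k \<Rightarrow> real" and v
    using v by (auto simp: nonarch_places_def quotient_def abs_value_equiv_def)
  have mem: "x \<in> carrier (S_integers S) \<longleftrightarrow> (\<forall>v\<in>nonarch_places - S. \<forall>f\<in>v. f x \<le> 1)" for x :: 'k
    by (simp add: S_integers_def place_integral_def)
  show "A \<subseteq> carrier (S_integers S)" using nonarch_A nonarch by (auto simp: mem)
  fix x y assume xy: "x \<in> carrier (S_integers S)" "y \<in> carrier (S_integers S)"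
  have le: "f (x - y) \<le> 1 \<and> f (x * y) \<le> 1" if v: "v \<in> nonarch_places - S" "f \<in> v" for v and f :: "'k \<Rightarrow> real"
  proof
    have f: "nonarch_abs_value f" using nonarch v by blast
    have fxy: "f x \<le> 1" "f y \<le> 1" using xy v mem by blast+
    then show "f (x - y) \<le> 1" using nonarch_add[OF f, of x "- y"] nonarch_minus[OF f, of y] by (simp add: max_def split: if_splits)
    show "f (x * y) \<le> 1" using mult_mono[OF fxy] nonarch_nonneg[OF f] by (simp add: nonarch_mult[OF f])
  qed
  then show "x - y \<in> carrier (S_integers S)" "x * y \<in> carrier (S_integers S)" unfolding mem by blast+
qed

end

section \<open>Generic generators of Lie algebras of maximal class\<close>

text \<open>Let x avoid the first m spaces and z the last one. If x lies in the last space, the line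
  of points z + a x misses it entirely, and it meets each earlier space at most once since its
  direction x is not in it. The field is infinite, so some point is left.\<close>

lemma avoid_subspaces:
  fixes V :: "(nat \<Rightarrow> 'k::field_char_0) set" and C :: "nat \<Rightarrow> (nat \<Rightarrow> 'k) set"
  assumes V: "fv.subspace V"
    and C: "\<And>i. i < m \<Longrightarrow> fv.subspace (C i)" "\<And>i. i < m \<Longrightarrow> \<exists>z\<in>V. z \<notin> C i"
  shows "\<exists>x\<in>V. \<forall>i<m. x \<notin> C i"
  using C
proof (induction m)
  case 0 then show ?case using fv.subspace_0[OF V] by blast
next
  case (Suc m)
  then obtain x where x: "x \<in> V" "\<And>i. i < m \<Longrightarrow> x \<notin> C i" by (metis less_Suc_eq)
  show ?case
  proof (cases "x \<in> C m")
    case False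
    then show ?thesis using x less_Suc_eq by metis
  next
    case True
    obtain z where z: "z \<in> V" "z \<notin> C m" using Suc(3) by blast
    have fin: "finite {a. z + sc a x \<in> C i}" if i: "i < m" for i
    proof -
      have "a = a'" if a: "z + sc a x \<in> C i" "z + sc a' x \<in> C i" for a a'
      proof (rule ccontr)
        assume "a \<noteq> a'"
        have sub: "fv.subspace (C i)" using Suc(2) i by simp
        have "(z + sc a x) - (z + sc a' x) \<in> C i" by (rule fv.subspace_diff[OF sub a])
        then have "sc (a - a') x \<in> C i" by (simp add: sc_diff_left)
        then have "sc (inverse (a - a')) (sc (a - a') x) \<in> C i" by (rule fv.subspace_scale[OF sub])
        then show False using x(2)[OF i] \<open>a \<noteq> a'\<close> by simp
      qed
      then have "{a. z + sc a x \<in> C i} \<subseteq> {a0}" if "z + sc a0 x \<in> C i" for a0 using that by blast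
      then show ?thesis by (cases "\<exists>a0. z + sc a0 x \<in> C i") (auto intro: finite_subset)
    qed
    have "finite (\<Union>i<m. {a. z + sc a x \<in> C i})" using fin by auto
    then obtain a where a: "a \<notin> (\<Union>i<m. {a. z + sc a x \<in> C i})"
      using infinite_UNIV_char_0[where 'a='k] ex_new_if_finite by blast
    have "z + sc a x \<notin> C m"
    proof
      assume *: "z + sc a x \<in> C m"
      have sub: "fv.subspace (C m)" using Suc(2) by simp
      have "(z + sc a x) - sc a x \<in> C m" by (rule fv.subspace_diff[OF sub * fv.subspace_scale[OF sub True]])
      then show False using z by simp
    qed
    moreover have "z + sc a x \<in> V" using V z x by (simp add: fv.subspace_add fv.subspace_scale)
    ultimately show ?thesis using a less_Suc_eq by (metis UN_I lessThan_iff mem_Collect_eq)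
  qed
qed

definition cspace :: "nat \<Rightarrow> (nat \<Rightarrow> 'k::field) set" where
  "cspace n = {v. \<forall>i\<ge>n. v i = 0}"

definition unitv :: "nat \<Rightarrow> nat \<Rightarrow> 'k::field" where
  "unitv i = (\<lambda>j. if j = i then 1 else 0)"

lemma subspace_cspace: "fv.subspace (cspace n)"
  by (auto simp: fv.subspace_def cspace_def sc_def)

lemma cspace_sum: "v \<in> cspace n \<Longrightarrow> v = (\<Sum>i<n. sc (v i) (unitv i))"
proof
  fix j assume "v \<in> cspace n"
  have "(\<Sum>i<n. sc (v i) (unitv i)) j = (\<Sum>i<n. if i = j then v i else 0)"
    by (induction n) (auto simp: sc_def unitv_def)
  then show "v j = (\<Sum>i<n. sc (v i) (unitv i)) j"
    using \<open>v \<in> cspace n\<close> by (auto simp: cspace_def)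
qed

lemma cspace_span: "(cspace n :: (nat \<Rightarrow> 'a::field) set) \<subseteq> fv.span (unitv ` {..<n})"
proof
  fix v :: "nat \<Rightarrow> 'a" assume "v \<in> cspace n"
  then have "v = (\<Sum>i<n. sc (v i) (unitv i))" by (rule cspace_sum)
  also have "\<dots> \<in> fv.span (unitv ` {..<n})"
    by (intro fv.span_sum fv.span_scale fv.span_base) auto
  finally show "v \<in> fv.span (unitv ` {..<n})" .
qed

lemma independent_cspace_card:
  fixes S :: "(nat \<Rightarrow> 'a::field) set"
  assumes "fv.independent S" "S \<subseteq> cspace n"
  shows "finite S" "card S \<le> n"
proof -
  have "finite S \<and> card S \<le> card (unitv ` {..<n} :: (nat \<Rightarrow> 'a) set)"
    by (rule fv.independent_span_bound) (use assms cspace_span in auto)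
  moreover have "card (unitv ` {..<n} :: (nat \<Rightarrow> 'a) set) \<le> n"
    using card_image_le[of "{..<n}" unitv] by simp
  ultimately show "finite S" "card S \<le> n" by auto
qed

text \<open>The lower central series G is given by its universal property \<open>G_br\<close> and
  \<open>G_least\<close>, which passes through a linear isomorphism more easily than a span. The
  bound \<open>c2\<close> records that the algebra is not abelian.\<close>

locale max_class_bracket =
  fixes n c :: nat and br :: "(nat \<Rightarrow> 'k::field_char_0) \<Rightarrow> (nat \<Rightarrow> 'k) \<Rightarrow> nat \<Rightarrow> 'k"
    and G :: "nat \<Rightarrow> (nat \<Rightarrow> 'k) set"
  assumes n_c: "n = c + 1" and c2: "c \<ge> 2"
    and br_closed: "\<And>x y. x \<in> cspace n \<Longrightarrow> y \<in> cspace n \<Longrightarrow> br x y \<in> cspace n"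
    and br_add_left: "\<And>x y z. x \<in> cspace n \<Longrightarrow> y \<in> cspace n \<Longrightarrow> z \<in> cspace n \<Longrightarrow>
        br (x + y) z = br x z + br y z"
    and br_add_right: "\<And>x y z. x \<in> cspace n \<Longrightarrow> y \<in> cspace n \<Longrightarrow> z \<in> cspace n \<Longrightarrow>
        br x (y + z) = br x y + br x z"
    and br_scale_left: "\<And>a x y. x \<in> cspace n \<Longrightarrow> y \<in> cspace n \<Longrightarrow> br (sc a x) y = sc a (br x y)"
    and br_scale_right: "\<And>a x y. x \<in> cspace n \<Longrightarrow> y \<in> cspace n \<Longrightarrow> br x (sc a y) = sc a (br x y)"
    and br_self: "\<And>x. x \<in> cspace n \<Longrightarrow> br x x = 0"
    and G_0: "G 0 = cspace n" and G_subspace: "\<And>j. fv.subspace (G j)"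
    and G_c: "G c = {0}" and G_nonzero: "\<And>j. j < c \<Longrightarrow> G j \<noteq> {0}"
    and G_br: "\<And>j x y. x \<in> G j \<Longrightarrow> y \<in> cspace n \<Longrightarrow> br x y \<in> G (Suc j)"
    and G_least: "\<And>j U. fv.subspace U \<Longrightarrow> U \<subseteq> cspace n \<Longrightarrow>
        (\<And>x y. x \<in> G j \<Longrightarrow> y \<in> cspace n \<Longrightarrow> br x y \<in> U) \<Longrightarrow> G (Suc j) \<subseteq> U"
begin

lemma subspace_V: "fv.subspace (cspace n :: (nat \<Rightarrow> 'k) set)"
  by (rule subspace_cspace)

lemma V_0: "(0 :: nat \<Rightarrow> 'k) \<in> cspace n"
  by (rule fv.subspace_0[OF subspace_V])

lemma br_0: "y \<in> cspace n \<Longrightarrow> br 0 y = 0" "y \<in> cspace n \<Longrightarrow> br y 0 = 0"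
  using br_scale_left[of 0 y 0] br_scale_right[of y 0 0] V_0 by simp_all

lemma G_V: "G j \<subseteq> cspace n" and G_Suc: "G (Suc j) \<subseteq> G j"
proof (induction j)
  case 0
  {
    case 1 show ?case using G_0 by simp
  next
    case 2 show ?case unfolding G_0
      by (rule G_least[OF subspace_V order_refl]) (use G_0 br_closed in auto)
  }
next
  case (Suc j)
  {
    case 1 show ?case using Suc by blast
  next
    case 2 show ?case
      by (rule G_least[OF G_subspace]) (use Suc G_br in blast)+
  }
qed

lemma G_mono: "i \<le> j \<Longrightarrow> G j \<subseteq> G i"
  by (rule lift_Suc_antimono_le[of G]) (rule G_Suc)

text \<open>Once two consecutive terms agree, all later ones agree with them, which is impossible
  because the series first reaches 0 at c.\<close>

lemma G_strict: assumes "j < c" shows "\<exists>x\<in>G j. x \<notin> G (Suc j)"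
proof (rule ccontr)
  assume "\<not> ?thesis"
  then have eq: "G j \<subseteq> G (Suc j)" by blast
  have "G j \<subseteq> G (j + k)" for k
  proof (induction k)
    case (Suc k)
    have "G (Suc j) \<subseteq> G (j + Suc k)"
      by (rule G_least[OF G_subspace G_V]) (use Suc G_br in auto)
    then show ?case using eq by blast
  qed simp
  from this[of "c - j"] have "G j \<subseteq> {0}" using assms G_c by simp
  then show False using G_nonzero[OF assms] fv.subspace_0[OF G_subspace[of j]] by blast
qed

lemma br_anti: assumes "x \<in> cspace n" "y \<in> cspace n" shows "br x y = - br y x"
proof -
  have xy: "x + y \<in> cspace n" using assms fv.subspace_add[OF subspace_V] by blast
  have "0 = br (x + y) (x + y)" by (simp only: br_self[OF xy])
  also have "\<dots> = br x y + br y x"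
    using assms by (simp add: br_add_left[OF assms xy] br_add_right br_self)
  finally show ?thesis by (simp add: eq_neg_iff_add_eq_0)
qed

lemma G_br_right:
  assumes "x \<in> cspace n" "y \<in> G j" shows "br x y \<in> G (Suc j)"
proof -
  have "br x y = - br y x" using assms G_V br_anti by blast
  then show ?thesis using fv.subspace_neg[OF G_subspace G_br[OF assms(2,1)]] by simp
qed

text \<open>If the space were spanned by u modulo G 1, then [u, u] = 0 would place all brackets in G
  2, and the series would be stationary at 1. So the quotient by G 1 has dimension at least
  2.\<close>

lemma not_cyclic_mod_G1:
  assumes u: "u \<in> cspace n" shows "\<exists>z\<in>cspace n. \<forall>a. z - sc a u \<notin> G 1"
proof (rule ccontr)
  assume no: "\<not> ?thesis"
  have "G 1 \<subseteq> G 2" unfolding One_nat_def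
  proof (rule G_least[OF G_subspace G_V], unfold G_0)
    fix x y :: "nat \<Rightarrow> 'k" assume xy: "x \<in> cspace n" "y \<in> cspace n"
    then obtain a b where ab: "x - sc a u \<in> G 1" "y - sc b u \<in> G 1" using no by blast
    define g h where "g = x - sc a u" and "h = y - sc b u"
    have gh: "g \<in> G 1" "h \<in> G 1" "x = sc a u + g" "y = sc b u + h" using ab by (auto simp: g_def h_def)
    have V: "g \<in> cspace n" "h \<in> cspace n" "sc a u \<in> cspace n" "sc b u \<in> cspace n"
      using gh G_V u fv.subspace_scale[OF subspace_V] by blast+
    have "br x y = br (sc a u) (sc b u) + br (sc a u) h + br g y"
      unfolding gh(3) gh(4)[symmetric] using V xy(2)
      by (subst br_add_left) (auto simp: gh(4) br_add_right)
    also have "br (sc a u) (sc b u) = 0"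
      using u V by (simp add: br_scale_left br_scale_right br_self)
    finally have "br x y = br (sc a u) h + br g y" by (simp only: add_0)
    moreover have "br (sc a u) h \<in> G 2" "br g y \<in> G 2"
      using G_br_right[OF V(3) gh(2)] G_br[OF gh(1) xy(2)] by (simp_all add: numeral_2_eq_2)
    ultimately show "br x y \<in> G 2" using fv.subspace_add[OF G_subspace] by metis
  qed
  then show False using G_strict[of 1] c2 by (auto simp: numeral_2_eq_2)
qed

text \<open>The dimensions of the factors \<open>G j / G (j + 1)\<close> add up to \<open>c + 1\<close>, and the first one is
  at least 2, so all others are 1.\<close>

lemma G_thin:
  assumes i: "1 \<le> i" "i < c" and u: "u \<in> G i" "u \<notin> G (Suc i)" and z: "z \<in> G i"
  shows "\<exists>a. z - sc a u \<in> G (Suc i)"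
proof (rule ccontr)
  assume no: "\<nexists>a. z - sc a u \<in> G (Suc i)"
  \<comment> \<open>Lower bounds for dimensions by independent sets: passing from G (j + 1) to G j
    adds one vector, and two where the factor is not a line.\<close>
  define P where "P j m \<longleftrightarrow> (\<exists>S. S \<subseteq> G j \<and> fv.independent S \<and> finite S \<and> card S = m)" for j m
  have span: "fv.span S \<subseteq> G j" if "S \<subseteq> G j" for S j
    using fv.span_minimal[OF that G_subspace] .
  have one: "P j (Suc m)" if P: "P (Suc j) m" and j: "j < c" for j m
  proof -
    obtain S where S: "S \<subseteq> G (Suc j)" "fv.independent S" "finite S" "card S = m" using P by (auto simp: P_def)
    obtain x where x: "x \<in> G j" "x \<notin> G (Suc j)" using G_strict[OF j] by blast
    have "x \<notin> fv.span S" using span[OF S(1)] x by blast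
    then have "fv.independent (insert x S)" "x \<notin> S"
      using S(2) fv.independent_insertI fv.span_base by blast+
    then show ?thesis unfolding P_def using S x G_Suc[of j] by (intro exI[of _ "insert x S"]) auto
  qed
  have two: "P j (Suc (Suc m))" if P: "P (Suc j) m" and xy: "x \<in> G j" "x \<notin> G (Suc j)" "y \<in> G j"
    "\<And>a. y - sc a x \<notin> G (Suc j)" for j m x y
  proof -
    obtain S where S: "S \<subseteq> G (Suc j)" "fv.independent S" "finite S" "card S = m" using P by (auto simp: P_def)
    have "x \<notin> fv.span S" using span[OF S(1)] xy by blast
    then have 1: "fv.independent (insert x S)" "x \<notin> S"
      using S(2) fv.independent_insertI fv.span_base by blast+
    have "y \<notin> fv.span (insert x S)" using span[OF S(1)] xy(4) unfolding fv.span_breakdown_eq by blast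
    then have 2: "fv.independent (insert y (insert x S))" "y \<notin> insert x S"
      using 1 fv.independent_insertI fv.span_base by blast+
    have "insert y (insert x S) \<subseteq> G j" using xy S(1) G_Suc[of j] by blast
    moreover have "card (insert y (insert x S)) = Suc (Suc m)" using 1 2 S by simp
    ultimately show ?thesis unfolding P_def using 2 S(3) by blast
  qed
  have chain: "P j (m + k)" if "P (j + k) m" "j + k \<le> c" for j k m
    using that
  proof (induction k arbitrary: m)
    case (Suc k)
    then have "P (j + k) (Suc m)" using one[of "j + k" m] by simp
    then show ?case using Suc.IH[of "Suc m"] Suc.prems(2) by simp
  qed simp
  have "P c 0" unfolding P_def using fv.independent_empty by (intro exI[of _ "{}"]) auto
  \<comment> \<open>The count: c - i - 1 vectors in G (i + 1), two more at i, one for each of the i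
    - 1 steps down to G 1, and two more at 0. This makes c + 2, which exceeds n = c + 1.\<close>
  then have "P (Suc i) (c - Suc i)" using chain[of "Suc i" "c - Suc i" 0] i by simp
  then have "P i (Suc (Suc (c - Suc i)))" using two[OF _ u z] no by blast
  then have "P (1 + (i - 1)) (Suc (Suc (c - Suc i)))" using i by simp
  then have "P 1 (Suc (Suc (c - Suc i)) + (i - 1))" by (rule chain) (use i in simp)
  moreover have "Suc (Suc (c - Suc i)) + (i - 1) = c" using i by simp
  ultimately have P1: "P (Suc 0) c" by (simp only: One_nat_def)
  obtain x :: "nat \<Rightarrow> 'k" where x: "x \<in> cspace n" "x \<notin> G (Suc 0)" using G_strict[of 0] c2 G_0 by auto
  obtain y where y: "y \<in> cspace n" "\<And>a. y - sc a x \<notin> G (Suc 0)"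
    using not_cyclic_mod_G1[OF x(1)] by auto
  have "P 0 (Suc (Suc c))" by (rule two[OF P1, of x y]) (use x y G_0 in auto)
  then obtain S :: "(nat \<Rightarrow> 'k) set" where "S \<subseteq> cspace n" "fv.independent S" "card S = Suc (Suc c)"
    unfolding P_def G_0 by blast
  then show False using independent_cspace_card(2)[of S n] n_c by simp
qed

text \<open>The two-step centralizers of the theory of maximal class, here including i = 0: the
  elements acting as 0 from G i / G (i + 1) to the next factor. Avoiding all of them makes ad x
  nonzero on every step.\<close>

definition cent :: "nat \<Rightarrow> (nat \<Rightarrow> 'k) set" where
  "cent i = {x \<in> cspace n. \<forall>y\<in>G i. br x y \<in> G (Suc (Suc i))}"

lemma subspace_cent: "fv.subspace (cent i)"
  unfolding fv.subspace_def
proof (intro conjI ballI allI)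
  show "0 \<in> cent i"
    using br_0(1) G_V V_0 fv.subspace_0[OF G_subspace]
    by (auto simp: cent_def subset_iff)
  show "x + y \<in> cent i" if "x \<in> cent i" "y \<in> cent i" for x y
    using that G_V fv.subspace_add[OF subspace_V] fv.subspace_add[OF G_subspace]
    by (auto simp: cent_def br_add_left subset_iff)
  show "sc a x \<in> cent i" if "x \<in> cent i" for a x
    using that G_V fv.subspace_scale[OF subspace_V] fv.subspace_scale[OF G_subspace]
    by (auto simp: cent_def br_scale_left subset_iff)
qed

text \<open>If \<open>cent i\<close> were the whole space, G (i + 1) would lie in G (i + 2), against
  strictness as i + 1 < c. Finitely many proper subspaces are then avoided simultaneously.\<close>

lemma ex_generic: "\<exists>x\<in>cspace n. \<forall>i<c - 1. x \<notin> cent i"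
proof (rule avoid_subspaces[OF subspace_V subspace_cent])
  fix i assume i: "i < c - 1"
  show "\<exists>z\<in>cspace n. z \<notin> cent i"
  proof (rule ccontr)
    assume no: "\<not> ?thesis"
    have "G (Suc i) \<subseteq> G (Suc (Suc i))"
    proof (rule G_least[OF G_subspace G_V])
      fix x y :: "nat \<Rightarrow> 'k" assume xy: "x \<in> G i" "y \<in> cspace n"
      then have "br y x \<in> G (Suc (Suc i))" using no by (auto simp: cent_def)
      moreover have "br x y = - br y x" using xy G_V br_anti by blast
      ultimately show "br x y \<in> G (Suc (Suc i))" using fv.subspace_neg[OF G_subspace] by metis
    qed
    moreover have "Suc i < c" using i by linarith
    ultimately show False using G_strict[of "Suc i"] by blast
  qed
qed

end

text \<open>Coordinates adapted to the flag: \<open>x\<close> carries index \<open>n - 1\<close> and \<open>ad x ^ k y\<close> carries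
  index \<open>n - 2 - k\<close>, so that \<open>ad x\<close> becomes a downward shift.\<close>

locale max_class_generic = max_class_bracket n c br G
  for n c and br :: "(nat \<Rightarrow> 'k::field_char_0) \<Rightarrow> (nat \<Rightarrow> 'k) \<Rightarrow> nat \<Rightarrow> 'k" and G +
  fixes x y :: "nat \<Rightarrow> 'k"
  assumes x: "x \<in> cspace n" "\<And>i. i < c - 1 \<Longrightarrow> x \<notin> cent i"
    and y: "y \<in> cspace n" "br x y \<notin> G 2"
begin

definition f :: "nat \<Rightarrow> nat \<Rightarrow> 'k" where "f k = ((br x) ^^ k) y"

lemma f_0: "f 0 = y" by (simp add: f_def)
lemma f_Suc: "f (Suc k) = br x (f k)" by (simp add: f_def)

lemma f_G: "f k \<in> G k"
  by (induction k) (auto simp: f_0 f_Suc G_0 y x intro: G_br_right)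

lemma f_V: "f k \<in> cspace n" using f_G G_V by blast

lemma y_G1: "y - sc a x \<notin> G 1" and x_G1: "x \<notin> G 1"
proof -
  have "br x x = 0" using br_self x by blast
  show "x \<notin> G 1"
  proof
    assume "x \<in> G 1"
    then have "br x y \<in> G 2" using G_br[OF _ y(1)] by (simp add: numeral_2_eq_2)
    then show False using y by blast
  qed
  show "y - sc a x \<notin> G 1"
  proof
    assume "y - sc a x \<in> G 1"
    then have "br x (y - sc a x) \<in> G 2" using G_br_right[OF x(1)] by (simp add: numeral_2_eq_2)
    moreover have "br x (y + sc (- a) x) = br x y + br x (sc (- a) x)"
      by (rule br_add_right[OF x(1) y(1) fv.subspace_scale[OF subspace_V x(1)]])
    moreover have "br x (sc (- a) x) = 0"
      using br_scale_right[OF x(1) x(1), of "- a"] br_self[OF x(1)] by simp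
    ultimately show False using y by simp
  qed
qed

text \<open>For k > 0 the factor G k / G (k + 1) is the line of f k. If f (k + 1) fell into G (k +
  2), ad x would kill this line and x would lie in \<open>cent k\<close>. The step from 0 to 1 comes
  from the choice of y instead, since the first factor is not a line.\<close>

lemma f_notin: assumes "k < c" shows "f k \<notin> G (Suc k)"
  using assms
proof (induction k)
  case 0 then show ?case using y_G1[of 0] by (simp add: f_0)
next
  case (Suc k)
  show ?case
  proof (cases "k = 0")
    case True then show ?thesis using y by (simp add: f_0 f_Suc numeral_2_eq_2)
  next
    case False
    show ?thesis
    proof
      assume f: "f (Suc k) \<in> G (Suc (Suc k))"
      have "x \<in> cent k" unfolding cent_def
      proof (intro CollectI conjI ballI x)
        fix z assume z: "z \<in> G k"
        obtain a where a: "z - sc a (f k) \<in> G (Suc k)"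
          using G_thin[OF _ _ f_G Suc.IH z] False Suc.prems by auto
        define g where "g = z - sc a (f k)"
        have zg: "z = sc a (f k) + g" "g \<in> G (Suc k)" using a by (auto simp: g_def)
        have "br x z = sc a (f (Suc k)) + br x g"
          unfolding zg(1) f_Suc using zg(2) G_V f_V x fv.subspace_scale[OF subspace_V]
          by (subst br_add_right) (auto simp: br_scale_right)
        then show "br x z \<in> G (Suc (Suc k))"
          using fv.subspace_add[OF G_subspace fv.subspace_scale[OF G_subspace f] G_br_right[OF x(1) zg(2)]]
          by simp
      qed
      then show False using x(2)[of k] Suc.prems by simp
    qed
  qed
qed

lemma f_c: "f c = 0" using f_G[of c] G_c by simp

definition Q :: "(nat \<Rightarrow> 'k) \<Rightarrow> nat \<Rightarrow> 'k" where
  "Q v = sc (v (n - 1)) x + (\<Sum>i<n - 1. sc (v i) (f (n - 2 - i)))"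

lemma Q_add: "Q (u + v) = Q u + Q v"
  by (simp add: Q_def fv.scale_left_distrib sum.distrib)

lemma Q_sc: "Q (sc a v) = sc a (Q v)"
proof -
  have "sc a v i = a * v i" for i by (simp add: sc_def)
  then show ?thesis by (simp add: Q_def fv.scale_right_distrib fv.scale_sum_right)
qed

lemma Q_0: "Q 0 = 0" using Q_sc[of 0 0] by simp

lemma Q_diff: "Q (u - v) = Q u - Q v"
  using Q_add[of u "- v"] Q_sc[of "- 1" v] by simp

lemma Q_V: "Q v \<in> cspace n"
  unfolding Q_def
  by (intro fv.subspace_add[OF subspace_V] fv.subspace_scale[OF subspace_V]
      fv.subspace_sum[OF subspace_V] f_V x)

text \<open>Modulo G 1 only the terms of x and y survive, and these two are independent there. The
  two leading coordinates therefore vanish on commutators, which the lower bound exploits.\<close>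

lemma Q_G1:
  assumes "Q v \<in> G 1" shows "v (n - 1) = 0" "v (n - 2) = 0"
proof -
  define r where "r = (\<Sum>i<n - 2. sc (v i) (f (n - 2 - i)))"
  have "n - 1 = Suc (n - 2)" using n_c c2 by simp
  then have Q: "Q v = sc (v (n - 1)) x + (r + sc (v (n - 2)) y)"
    unfolding Q_def r_def by (simp add: f_0)
  have "r \<in> G 1" unfolding r_def
  proof (intro fv.subspace_sum[OF G_subspace] fv.subspace_scale[OF G_subspace])
    fix i assume "i \<in> {..<n - 2}"
    then have "1 \<le> n - 2 - i" by auto
    then show "f (n - 2 - i) \<in> G 1" using f_G G_mono by blast
  qed
  then have "Q v - r \<in> G 1" using assms fv.subspace_diff[OF G_subspace] by blast
  then have *: "sc (v (n - 1)) x + sc (v (n - 2)) y \<in> G 1" by (simp add: Q algebra_simps)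
  show v2: "v (n - 2) = 0"
  proof (rule ccontr)
    assume nz: "v (n - 2) \<noteq> 0"
    have "sc (1 / v (n - 2)) (sc (v (n - 1)) x + sc (v (n - 2)) y) \<in> G 1"
      by (rule fv.subspace_scale[OF G_subspace *])
    then have "y - sc (- (v (n - 1) / v (n - 2))) x \<in> G 1"
      using nz by (simp add: fv.scale_right_distrib add.commute)
    then show False using y_G1 by blast
  qed
  show "v (n - 1) = 0"
  proof (rule ccontr)
    assume nz: "v (n - 1) \<noteq> 0"
    have "sc (1 / v (n - 1)) (sc (v (n - 1)) x + sc (v (n - 2)) y) \<in> G 1"
      by (rule fv.subspace_scale[OF G_subspace *])
    then show False using nz v2 x_G1 by simp
  qed
qed

text \<open>The largest index i with nonzero coordinate belongs to the f k with the smallest k; all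
  other terms lie in G (k + 1), which does not contain f k. The two top coordinates vanish by
  \<open>Q_G1\<close>.\<close>

lemma Q_inj:
  assumes v: "v \<in> cspace n" and Q: "Q v = 0" shows "v = 0"
proof (rule ccontr)
  assume "v \<noteq> 0"
  have "Q v \<in> G 1" using Q fv.subspace_0[OF G_subspace] by simp
  note v12 = Q_G1[OF this]
  define E where "E = {i. v i \<noteq> 0}"
  have sub: "E \<subseteq> {..<n - 2}"
  proof
    fix i assume "i \<in> E"
    then have "v i \<noteq> 0" by (simp add: E_def)
    then have "i < n" "i \<noteq> n - 1" "i \<noteq> n - 2" using v v12 by (auto simp: cspace_def not_less[symmetric])
    then show "i \<in> {..<n - 2}" by auto
  qed
  then have fin: "finite E" using finite_subset by blast
  have ne: "E \<noteq> {}" using \<open>v \<noteq> 0\<close> by (auto simp: E_def fun_eq_iff)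
  define i where "i = Max E"
  have i: "i \<in> E" "\<And>j. j \<in> E \<Longrightarrow> j \<le> i" using Max_in[OF fin ne] Max_ge[OF fin] by (auto simp: i_def)
  define k where "k = n - 2 - i"
  have k: "k < c" "n - 2 - i = k" using n_c c2 by (auto simp: k_def)
  have in2: "i < n - 2" using i sub by auto
  have "Q v = (\<Sum>j<n - 1. sc (v j) (f (n - 2 - j)))" unfolding Q_def v12(1) by simp
  also have "\<dots> = (\<Sum>j\<in>insert i {..<i}. sc (v j) (f (n - 2 - j)))"
  proof (rule sum.mono_neutral_right)
    show "insert i {..<i} \<subseteq> {..<n - 1}" using in2 by auto
    show "\<forall>j\<in>{..<n - 1} - insert i {..<i}. sc (v j) (f (n - 2 - j)) = 0"
    proof
      fix j assume "j \<in> {..<n - 1} - insert i {..<i}"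
      then have "j \<notin> E" using i(2)[of j] by auto
      then show "sc (v j) (f (n - 2 - j)) = 0" by (simp add: E_def)
    qed
  qed simp
  also have "\<dots> = sc (v i) (f k) + (\<Sum>j<i. sc (v j) (f (n - 2 - j)))" by (simp add: k_def)
  finally have eq: "sc (v i) (f k) = - (\<Sum>j<i. sc (v j) (f (n - 2 - j)))"
    using Q by (simp add: eq_neg_iff_add_eq_0)
  have "(\<Sum>j<i. sc (v j) (f (n - 2 - j))) \<in> G (Suc k)"
  proof (intro fv.subspace_sum[OF G_subspace] fv.subspace_scale[OF G_subspace])
    fix j assume "j \<in> {..<i}"
    then have "Suc k \<le> n - 2 - j" using in2 by (auto simp: k_def)
    then show "f (n - 2 - j) \<in> G (Suc k)" using f_G G_mono by blast
  qed
  then have "sc (v i) (f k) \<in> G (Suc k)" unfolding eq by (rule fv.subspace_neg[OF G_subspace])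
  then have "sc (1 / v i) (sc (v i) (f k)) \<in> G (Suc k)" by (rule fv.subspace_scale[OF G_subspace])
  then show False using i f_notin[OF k(1)] by (simp add: E_def)
qed

lemma Q_inj_on: "inj_on Q (cspace n)"
proof (rule inj_onI)
  fix u v assume "u \<in> cspace n" "v \<in> cspace n" "Q u = Q v"
  then show "u = v" using Q_inj[of "u - v"] Q_diff fv.subspace_diff[OF subspace_V] by auto
qed

lemma Q_sum: "Q (\<Sum>i\<in>I. g i) = (\<Sum>i\<in>I. Q (g i))"
proof (induction I rule: infinite_finite_induct)
  case (infinite I)
  then show ?case using Q_0 by (metis sum.infinite)
next
  case empty
  then show ?case using Q_0 by (metis sum.empty)
next
  case (insert i I)
  have "Q (\<Sum>i\<in>insert i I. g i) = Q (g i + (\<Sum>i\<in>I. g i))"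
    by (rule arg_cong[where f = Q, OF sum.insert[OF insert(1,2)]])
  also have "\<dots> = Q (g i) + (\<Sum>i\<in>I. Q (g i))" using Q_add insert(3) by metis
  also have "\<dots> = (\<Sum>i\<in>insert i I. Q (g i))" by (rule sum.insert[OF insert(1,2), symmetric])
  finally show ?case .
qed

lemma unitv_V: "i < n \<Longrightarrow> unitv i \<in> cspace n" by (auto simp: unitv_def cspace_def)

lemma Q_surj:
  assumes z: "z \<in> cspace n" shows "\<exists>v\<in>cspace n. z = Q v"
proof -
  define S where "S = (\<lambda>i. Q (unitv i)) ` {..<n}"
  have inj: "inj_on (\<lambda>i. Q (unitv i)) {..<n}"
  proof (rule inj_onI)
    fix i j assume ij: "i \<in> {..<n}" "j \<in> {..<n}" "Q (unitv i) = Q (unitv j)"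
    then have "(unitv i :: nat \<Rightarrow> 'k) = unitv j" using Q_inj_on unitv_V by (auto dest: inj_onD)
    then have "(unitv i :: nat \<Rightarrow> 'k) i = unitv j i" by simp
    then show "i = j" by (simp add: unitv_def split: if_splits)
  qed
  have "fv.independent S"
  proof (rule fv.independent_if_scalars_zero)
    show "finite S" by (simp add: S_def)
    fix g s assume g: "(\<Sum>s\<in>S. sc (g s) s) = 0" and s: "s \<in> S"
    define v where "v i = (if i < n then g (Q (unitv i)) else 0)" for i
    have v: "v \<in> cspace n" by (simp add: v_def cspace_def)
    have "Q v = (\<Sum>i<n. sc (v i) (Q (unitv i)))"
      by (subst cspace_sum[OF v]) (simp add: Q_sum Q_sc)
    also have "\<dots> = (\<Sum>s\<in>S. sc (g s) s)"
      unfolding S_def by (subst sum.reindex[OF inj]) (simp add: v_def)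
    finally have "v = 0" using Q_inj[OF v] g by simp
    then have "v i = 0" for i by simp
    moreover obtain i where "i < n" "s = Q (unitv i)" using s by (auto simp: S_def)
    ultimately show "g s = 0" by (metis v_def)
  qed
  have cardS: "card S = n" unfolding S_def using card_image[OF inj] by simp
  have SV: "S \<subseteq> cspace n" using Q_V by (auto simp: S_def)
  have "z \<in> fv.span S"
  proof (rule ccontr)
    assume z': "z \<notin> fv.span S"
    then have "fv.independent (insert z S)" "z \<notin> S"
      using \<open>fv.independent S\<close> fv.independent_insertI fv.span_base by blast+
    then have "card (insert z S) \<le> n" using independent_cspace_card(2)[of "insert z S" n] SV z by simp
    then show False using cardS \<open>z \<notin> S\<close> by (simp add: S_def)
  qed
  also have "fv.span S = range (\<lambda>u. \<Sum>v\<in>S. sc (u v) v)" by (rule fv.span_finite) (simp add: S_def)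
  finally obtain u where "z = (\<Sum>s\<in>S. sc (u s) s)" by blast
  then have "z = (\<Sum>i<n. sc (u (Q (unitv i))) (Q (unitv i)))"
    unfolding S_def by (subst (asm) sum.reindex[OF inj]) simp
  then have "z = Q (\<Sum>i<n. sc (u (Q (unitv i))) (unitv i))" by (simp add: Q_sum Q_sc)
  moreover have "(\<Sum>i<n. sc (u (Q (unitv i))) (unitv i)) \<in> cspace n"
    by (intro fv.subspace_sum[OF subspace_V] fv.subspace_scale[OF subspace_V]) (simp add: unitv_V)
  ultimately show ?thesis by blast
qed

lemma br_sum_right:
  assumes "\<And>i. i \<in> I \<Longrightarrow> g i \<in> cspace n"
  shows "br x (\<Sum>i\<in>I. g i) = (\<Sum>i\<in>I. br x (g i))"
proof -
  show ?thesis using assms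
    by (induction I rule: infinite_finite_induct)
      (auto simp: br_0(2) br_add_right x fv.subspace_sum[OF subspace_V])
qed

text \<open>ad x moves f k to f (k + 1), so it lowers the index by one, and f c = 0 accounts for the
  coordinate that drops out. The plain shift would also send x to y, whereas [x, x] = 0; the
  correction at index n - 2 removes this and is the twist of
  \<open>twisted_sum_bounded\<close>.\<close>

lemma br_Q: "br x (Q v) = Q (sh v - sc (v (n - 1)) (unitv (n - 2)))" if v: "v \<in> cspace n"
proof -
  define m where "m = n - 2"
  have m: "n = Suc (Suc m)" "c = Suc m" using n_c c2 by (auto simp: m_def)
  define u where "u = sh v - sc (v (n - 1)) (unitv (n - 2))"
  have u: "u i = v (Suc i)" if "i < m" for i using that by (simp add: u_def sh_def sc_def unitv_def m)
  have u1: "u m = 0" "u (Suc m) = 0" using v by (auto simp: u_def sh_def sc_def unitv_def m cspace_def)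
  have "br x (Q v) = br x (sc (v (n - 1)) x) + br x (\<Sum>i<n - 1. sc (v i) (f (n - 2 - i)))"
    unfolding Q_def
    by (rule br_add_right) (auto intro!: x fv.subspace_scale[OF subspace_V] fv.subspace_sum[OF subspace_V] f_V)
  also have "\<dots> = (\<Sum>i<n - 1. sc (v i) (f (Suc (n - 2 - i))))"
    using x f_V by (subst br_sum_right) (auto simp: br_scale_right br_self f_Suc fv.subspace_scale[OF subspace_V])
  also have "\<dots> = (\<Sum>i<Suc m. sc (v i) (f (Suc m - i)))"
    by (rule sum.cong) (auto simp: m Suc_diff_le)
  also have "\<dots> = sc (v 0) (f c) + (\<Sum>i<m. sc (v (Suc i)) (f (m - i)))"
    by (simp only: sum.lessThan_Suc_shift) (simp add: m)
  also have "\<dots> = (\<Sum>i<m. sc (u i) (f (m - i)))" using u by (simp add: f_c)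
  also have "\<dots> = Q u" unfolding Q_def by (simp add: m u1)
  finally show ?thesis by (simp add: u_def)
qed

end

section \<open>Counting Lie ideals\<close>

context overring
begin

lemma cspace_denom:
  assumes "finite S" "S \<subseteq> cspace n"
  shows "\<exists>D::nat. D > 0 \<and> (\<forall>v\<in>S. sc (of_nat D) v \<in> lat n)"
proof -
  have "finite ((\<lambda>(v, i). v i) ` (S \<times> {..<n}))" using assms by auto
  then obtain D :: nat where D: "D > 0" "\<forall>z\<in>(\<lambda>(v, i). v i) ` (S \<times> {..<n}). of_nat D * z \<in> A"
    using finite_denom by blast
  have "sc (of_nat D) v \<in> lat n" if "v \<in> S" for v
    using that D(2) R_A assms(2) by (fastforce simp: lat_def sc_def cspace_def)
  then show ?thesis using D(1) by blast
qed

lemma lat_cspace: "lat n \<subseteq> cspace n" by (auto simp: lat_def cspace_def)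

end

locale max_class_order = overring B w R + max_class_generic n c br G x y
  for B :: "'i set" and w :: "'i \<Rightarrow> 'k::field_char_0" and R and n c :: nat
    and br :: "(nat \<Rightarrow> 'k) \<Rightarrow> (nat \<Rightarrow> 'k) \<Rightarrow> nat \<Rightarrow> 'k" and G and x y :: "nat \<Rightarrow> 'k" +
  assumes br_lat: "\<And>u v. u \<in> lat n \<Longrightarrow> v \<in> lat n \<Longrightarrow> br u v \<in> lat n"
    and x_lat: "x \<in> lat n" and y_lat: "y \<in> lat n"
begin

lemma f_lat: "f k \<in> lat n"
  by (induction k) (auto simp: f_0 f_Suc y_lat x_lat br_lat)

lemma Q_lat: "v \<in> lat n \<Longrightarrow> Q v \<in> lat n"
proof -
  assume v: "v \<in> lat n"
  then have vR: "v i \<in> R" for i using subgrp_0[OF subgrp_R] by (cases "i < n") (auto simp: lat_def)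
  show ?thesis unfolding Q_def
    by (intro subgrp_add[OF subgrp_lat] subgrp_sum[OF subgrp_lat] lat_sc vR x_lat f_lat)
qed

lemma ex_Q_denom: "\<exists>D::nat. D > 0 \<and> (\<forall>z\<in>lat n. \<exists>v\<in>lat n. sc (of_nat D) z = Q v)"
proof -
  have "\<forall>i. \<exists>v. i < n \<longrightarrow> v \<in> cspace n \<and> unitv i = Q v"
    using Q_surj unitv_V by blast
  then obtain q where q: "\<And>i. i < n \<Longrightarrow> q i \<in> cspace n \<and> unitv i = Q (q i)" by metis
  have "finite (q ` {..<n})" "q ` {..<n} \<subseteq> cspace n" using q by auto
  then obtain D :: nat where D: "D > 0" "\<forall>v\<in>q ` {..<n}. sc (of_nat D) v \<in> lat n"
    using cspace_denom by blast
  have "\<exists>v\<in>lat n. sc (of_nat D) z = Q v" if z: "z \<in> lat n" for z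
  proof
    define v where "v = (\<Sum>i<n. sc (z i) (sc (of_nat D) (q i)))"
    have zR: "z i \<in> R" for i using z subgrp_0[OF subgrp_R] by (cases "i < n") (auto simp: lat_def)
    show "v \<in> lat n" unfolding v_def
    proof (rule subgrp_sum[OF subgrp_lat], rule lat_sc[OF zR])
      show "sc (of_nat D) (q i) \<in> lat n" if "i \<in> {..<n}" for i using D(2) that by blast
    qed
    have "Q v = (\<Sum>i<n. Q (sc (z i) (sc (of_nat D) (q i))))" unfolding v_def by (rule Q_sum)
    also have "\<dots> = (\<Sum>i<n. sc (of_nat D) (sc (z i) (unitv i)))"
    proof (rule sum.cong[OF refl])
      fix i assume "i \<in> {..<n}"
      then have "Q (q i) = unitv i" using q by auto
      then show "Q (sc (z i) (sc (of_nat D) (q i))) = sc (of_nat D) (sc (z i) (unitv i))"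
        by (simp only: Q_sc fv.scale_left_commute)
    qed
    also have "\<dots> = sc (of_nat D) (\<Sum>i<n. sc (z i) (unitv i))" by (rule fv.scale_sum_right[symmetric])
    also have "(\<Sum>i<n. sc (z i) (unitv i)) = z"
      by (rule cspace_sum[symmetric]) (use z lat_cspace in blast)
    finally show "sc (of_nat D) z = Q v" by (rule sym)
  qed
  then show ?thesis using D(1) by blast
qed

definition brideals :: "(nat \<Rightarrow> 'k) set set" where
  "brideals = {I. fmod n I \<and> (\<forall>u\<in>lat n. \<forall>v\<in>I. br u v \<in> I)}"

text \<open>To I belongs J I, the preimage of e I under Q. The denominator e puts e I inside the
  image of \<open>lat n\<close>, so that I can be recovered from J I. Stability under ad x becomes
  stability under the twisted shift, and the index grows at most by the factor K =
  (\<open>lat n\<close> : e \<open>lat n\<close>), at the cost of K to the power s.\<close>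

lemma ideal_sum_upper:
  assumes s: "s > 2"
  shows "\<exists>Z. \<forall>F. finite F \<and> F \<subseteq> brideals \<longrightarrow> (\<Sum>I\<in>F. real (idx (lat n) I) powr (- s)) \<le> Z"
proof -
  obtain D :: nat where D: "D > 0" "\<And>z. z \<in> lat n \<Longrightarrow> \<exists>v\<in>lat n. sc (of_nat D) z = Q v"
    using ex_Q_denom by blast
  define e :: 'k where "e = of_nat D"
  have e: "e \<in> A" "e \<noteq> 0" "e \<in> R" using D A_of_nat R_of_nat by (auto simp: e_def)
  define J where "J I = {v \<in> lat n. Q v \<in> sc e ` I}" for I
  define K where "K = idx (lat n) (sc e ` lat n)"
  have latn: "lat n = lat (Suc (n - 1))" using n_c by simp
  have ulat: "unitv (n - 2) \<in> lat (n - 1)"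
    using n_c c2 R_1 subgrp_0[OF subgrp_R] by (auto simp: unitv_def lat_def)
  have J_prop: "fmod n (J I) \<and> (\<forall>v\<in>J I. sh v - sc (v (n - 1)) (unitv (n - 2)) \<in> J I)
      \<and> idx (lat n) (J I) \<le> K * idx (lat n) I \<and> sc e ` I = Q ` J I" if I: "I \<in> brideals" for I
  proof -
    have sI: "subgrp I" "I \<subseteq> lat n" "\<And>r v. r \<in> R \<Longrightarrow> v \<in> I \<Longrightarrow> sc r v \<in> I" "finite (coset_set (lat n) I)"
      "\<And>u v. u \<in> lat n \<Longrightarrow> v \<in> I \<Longrightarrow> br u v \<in> I"
      using I by (auto simp: brideals_def fmod_def submod_def)
    have seI: "subgrp (sc e ` I)" by (rule subgrp_sc_image[OF sI(1)])
    have sJ: "subgrp (J I)" unfolding subgrp_def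
    proof (intro conjI ballI)
      show "0 \<in> J I" unfolding J_def using subgrp_0[OF subgrp_lat] subgrp_0[OF seI] Q_0 by simp
      fix u v assume uv: "u \<in> J I" "v \<in> J I"
      then have "Q u - Q v \<in> sc e ` I" using subgrp_diff[OF seI] unfolding J_def by blast
      then show "u - v \<in> J I" using uv subgrp_diff[OF subgrp_lat] Q_diff unfolding J_def by auto
    qed
    have scJ: "sc r v \<in> J I" if rv: "r \<in> R" "v \<in> J I" for r v
    proof -
      obtain z where z: "z \<in> I" "Q v = sc e z" using rv by (auto simp: J_def)
      have "Q (sc r v) = sc e (sc r z)" unfolding Q_sc z(2) by (rule fv.scale_left_commute)
      then have "Q (sc r v) \<in> sc e ` I" using sI(3)[OF rv(1) z(1)] by (rule image_eqI)
      then show ?thesis using rv lat_sc by (simp add: J_def)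
    qed
    have idxe: "finite (coset_set (lat n) (sc e ` I))" "idx (lat n) (sc e ` I) = K * idx (lat n) I"
    proof -
      have inj: "inj (sc e)" using e by (auto simp: inj_def)
      have 1: "a - b \<in> I \<longleftrightarrow> sc e a - sc e b \<in> sc e ` I" for a b
        unfolding sc_diff[symmetric] inj_image_mem_iff[OF inj] ..
      have "\<exists>a\<in>lat n. sc e a - b \<in> sc e ` I" if "b \<in> sc e ` lat n" for b
        using that subgrp_0[OF seI] by force
      then have 2: "finite (coset_set (sc e ` lat n) (sc e ` I))" "idx (sc e ` lat n) (sc e ` I) = idx (lat n) I"
        using idx_hom_eq[OF sI(1) seI, where f="sc e" and G="lat n" and G'="sc e ` lat n"] 1 sI(4) by auto
      have 3: "subgrp (sc e ` lat n)" "sc e ` I \<subseteq> sc e ` lat n" "sc e ` lat n \<subseteq> lat n"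
        using subgrp_sc_image[OF subgrp_lat] sI(2) lat_sc e by auto
      show "finite (coset_set (lat n) (sc e ` I))" "idx (lat n) (sc e ` I) = K * idx (lat n) I"
        using idx_tower[OF subgrp_lat 3(1) seI 3(2,3)] 2 finite_lat_scale[OF e(1,2), of n]
        by (auto simp: K_def)
    qed
    have "a - b \<in> J I \<longleftrightarrow> Q a - Q b \<in> sc e ` I" if "a \<in> lat n" "b \<in> lat n" for a b
      using subgrp_diff[OF subgrp_lat that] by (simp only: J_def Q_diff mem_Collect_eq simp_thms)
    moreover have "Q ` lat n \<subseteq> lat n" using Q_lat by blast
    ultimately have idxJ: "finite (coset_set (lat n) (J I))" "idx (lat n) (J I) \<le> idx (lat n) (sc e ` I)"
      using idx_hom_le[OF sJ seI, where G="lat n" and f=Q and G'="lat n"] idxe(1) by blast+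
    have "sh v - sc (v (n - 1)) (unitv (n - 2)) \<in> J I" if v: "v \<in> J I" for v
    proof -
      have vl: "v \<in> lat n" using v by (simp add: J_def)
      then have vR: "v (n - 1) \<in> R" using n_c by (auto simp: lat_def)
      have "sh v - sc (v (n - 1)) (unitv (n - 2)) \<in> lat (n - 1)"
        using subgrp_diff[OF subgrp_lat sh_lat lat_sc[OF vR ulat]] vl latn by metis
      then have l: "sh v - sc (v (n - 1)) (unitv (n - 2)) \<in> lat n"
        using lat_mono[of "n - 1" n] by auto
      obtain z where z: "z \<in> I" "Q v = sc e z" using v by (auto simp: J_def)
      have "Q (sh v - sc (v (n - 1)) (unitv (n - 2))) = br x (Q v)"
        using br_Q vl lat_cspace by (metis subsetD)
      also have "\<dots> = sc e (br x z)"
        unfolding z(2) by (rule br_scale_right) (use x z sI(2) lat_cspace in blast)+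
      finally have "Q (sh v - sc (v (n - 1)) (unitv (n - 2))) \<in> sc e ` I"
        using sI(5)[OF x_lat z(1)] by (rule image_eqI)
      then show ?thesis using l by (simp add: J_def)
    qed
    moreover have "sc e ` I = Q ` J I"
    proof
      show "sc e ` I \<subseteq> Q ` J I"
      proof clarify
        fix z assume z: "z \<in> I"
        then obtain v where v: "v \<in> lat n" "sc e z = Q v" using D(2) sI(2) unfolding e_def by blast
        then have "v \<in> J I" using z unfolding J_def by (metis (mono_tags) imageI mem_Collect_eq)
        then show "sc e z \<in> Q ` J I" using v by blast
      qed
    qed (auto simp: J_def)
    moreover have "J I \<subseteq> lat n" by (auto simp: J_def)
    ultimately show ?thesis using sJ scJ idxJ idxe(2) unfolding fmod_def submod_def by simp
  qed
  have "fmod (Suc (n - 1)) J' \<and> (\<forall>v\<in>J'. sh v - sc (v (n - 1)) (unitv (n - 2)) \<in> J')"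
    if "J' \<in> J ` brideals" for J' using that J_prop n_c by auto
  then have "\<exists>Z. \<forall>F. finite F \<and> F \<subseteq> J ` brideals \<longrightarrow>
        (\<Sum>I\<in>F. real (idx (lat (Suc (n - 1))) I) powr (- s)) \<le> Z"
    by (rule twisted_sum_bounded[OF s ulat])
  then obtain Z where Z: "\<forall>F. finite F \<and> F \<subseteq> J ` brideals \<longrightarrow>
        (\<Sum>I\<in>F. real (idx (lat n) I) powr (- s)) \<le> Z"
    unfolding latn[symmetric] by (elim exE) (rule that)
  have K1: "K \<ge> 1" unfolding K_def by (rule idx_pos[OF finite_lat_scale[OF e(1,2)] subgrp_lat])
  have inj: "inj_on J brideals"
  proof (rule inj_onI)
    fix I I' assume "I \<in> brideals" "I' \<in> brideals" "J I = J I'"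
    then have "sc e ` I = sc e ` I'" using J_prop by metis
    moreover have "inj (sc e)" using e by (auto simp: inj_def)
    ultimately show "I = I'" by (simp add: inj_image_eq_iff)
  qed
  have "(\<Sum>I\<in>F. real (idx (lat n) I) powr (- s)) \<le> real K powr s * Z" if F: "finite F" "F \<subseteq> brideals" for F
  proof -
    have "(\<Sum>I\<in>F. real (idx (lat n) I) powr (- s)) \<le> (\<Sum>I\<in>F. real K powr s * real (idx (lat n) (J I)) powr (- s))"
    proof (rule sum_mono)
      fix I assume "I \<in> F"
      then have I: "I \<in> brideals" using F by blast
      have i: "idx (lat n) (J I) \<ge> 1" "idx (lat n) (J I) \<le> K * idx (lat n) I"
        using J_prop[OF I] idx_pos[OF _ subgrp_lat] by (auto simp: fmod_def)
      have "(real (K * idx (lat n) I)) powr (- s) \<le> real (idx (lat n) (J I)) powr (- s)"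
        using i s by (intro powr_mono2') (auto simp del: of_nat_mult)
      then have "real K powr s * (real K powr (- s) * real (idx (lat n) I) powr (- s))
          \<le> real K powr s * real (idx (lat n) (J I)) powr (- s)"
        by (intro mult_left_mono) (simp_all add: powr_mult)
      moreover have "real K powr s * real K powr (- s) = 1" using K1 by (simp add: powr_add[symmetric])
      ultimately show "real (idx (lat n) I) powr (- s) \<le> real K powr s * real (idx (lat n) (J I)) powr (- s)"
        by (simp add: mult.assoc[symmetric])
    qed
    also have "\<dots> = real K powr s * (\<Sum>I\<in>J ` F. real (idx (lat n) I) powr (- s))"
      by (subst sum.reindex[OF inj_on_subset[OF inj F(2)]]) (simp add: sum_distrib_left)
    also have "\<dots> \<le> real K powr s * Z"
      using F by (intro mult_left_mono Z[rule_format]) auto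
    finally show ?thesis .
  qed
  then show ?thesis by blast
qed

text \<open>The ideals are \<open>{z. W z (n - 1) - t * W z (n - 2) \<in> \<alpha> R}\<close>, where \<open>W\<close> gives the coordinates with respect to the
  generic basis; the two leading coordinates vanish on commutators. Here \<open>\<alpha>\<close> and \<open>t\<close> run through boxes
  and \<open>\<alpha>\<close> is congruent to 1 modulo a multiple of \<open>N\<close>, so that \<open>\<alpha> R\<close> and \<open>\<alpha> A\<close> meet \<open>A\<close> in the same set
  and different pairs are told apart by size.\<close>

lemma many_ideals:
  assumes N: "N > 0" "\<And>z. z \<in> R \<Longrightarrow> \<exists>j. of_nat N ^ j * z \<in> A"
  shows "\<exists>K>0. \<forall>b::nat. \<exists>F. finite F \<and> F \<subseteq> brideals \<and> card F = (b + 1) ^ (2 * card B) \<and>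
           (\<forall>I\<in>F. idx (lat n) I \<le> (K * (b + 1)) ^ card B)"
proof -
  obtain D :: nat where D: "D > 0" "\<And>z. z \<in> lat n \<Longrightarrow> \<exists>v\<in>lat n. sc (of_nat D) z = Q v"
    using ex_Q_denom by blast
  define e :: 'k where "e = of_nat D"
  have e: "e \<in> A" "e \<noteq> 0" "e \<in> R" using D A_of_nat R_of_nat by (auto simp: e_def)
  \<comment> \<open>Coordinates with respect to the generic basis, multiplied by e so that they are
    integral on \<open>lat n\<close>.\<close>
  define W where "W z = inv_into (cspace n) Q (sc e z)" for z
  have W_eq: "W z = v" if "v \<in> cspace n" "sc e z = Q v" for z v
    unfolding W_def that(2) by (rule inv_into_f_f[OF Q_inj_on that(1)])
  have W: "W z \<in> lat n" "Q (W z) = sc e z" if z: "z \<in> lat n" for z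
  proof -
    obtain v where v: "v \<in> lat n" "sc e z = Q v" using D(2)[OF z] by (auto simp: e_def)
    then have "W z = v" using W_eq lat_cspace by blast
    then show "W z \<in> lat n" "Q (W z) = sc e z" using v by auto
  qed
  have W_diff: "W (z - z') = W z - W z'" if z: "z \<in> lat n" "z' \<in> lat n" for z z'
  proof (rule W_eq)
    show "W z - W z' \<in> cspace n" using subgrp_diff[OF subgrp_lat W(1) W(1)] z lat_cspace by blast
    show "sc e (z - z') = Q (W z - W z')" unfolding Q_diff W(2)[OF z(1)] W(2)[OF z(2)] by (rule sc_diff)
  qed
  have W_sc: "W (sc r z) = sc r (W z)" if "z \<in> lat n" for r z
  proof (rule W_eq)
    show "sc r (W z) \<in> cspace n" using W(1)[OF that] lat_cspace fv.subspace_scale[OF subspace_V] by blast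
    show "sc e (sc r z) = Q (sc r (W z))" unfolding Q_sc W(2)[OF that] by (rule fv.scale_left_commute)
  qed
  have W_br: "W (br u v) (n - 1) = 0" "W (br u v) (n - 2) = 0" if "u \<in> lat n" "v \<in> lat n" for u v
  proof -
    have "br u v \<in> G 1" using G_br[of u 0 v] G_0 that lat_cspace by (auto simp: subset_iff)
    then have "Q (W (br u v)) \<in> G 1"
      unfolding W(2)[OF br_lat[OF that]] by (rule fv.subspace_scale[OF G_subspace])
    then show "W (br u v) (n - 1) = 0" "W (br u v) (n - 2) = 0" using Q_G1 by blast+
  qed
  have n2: "n - 2 < n - 1" "n - 1 < n" using n_c c2 by auto
  have Qx: "Q (unitv (n - 1)) = x"
  proof -
    have "(\<Sum>i<n - 1. sc (unitv (n - 1) i) (f (n - 2 - i))) = (\<Sum>i<n - 1. 0)"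
      by (rule sum.cong) (auto simp: unitv_def)
    then show ?thesis unfolding Q_def by (simp add: unitv_def)
  qed
  have Qy: "Q (unitv (n - 2)) = y"
  proof -
    have "(\<Sum>i<n - 1. sc (unitv (n - 2) i) (f (n - 2 - i))) = (\<Sum>i\<in>{n - 2}. sc (unitv (n - 2) i) (f (n - 2 - i)))"
      by (rule sum.mono_neutral_right) (use n2 in \<open>auto simp: unitv_def\<close>)
    also have "\<dots> = y" by (simp add: unitv_def f_0)
    finally show ?thesis unfolding Q_def using n2 by (simp add: unitv_def)
  qed
  have eV: "sc e (unitv i) \<in> cspace n" if "i < n" for i
    by (rule fv.subspace_scale[OF subspace_V unitv_V[OF that]])
  have Wx: "W x = sc e (unitv (n - 1))"
    by (rule W_eq) (use n2 eV in \<open>auto simp only: Q_sc Qx\<close>)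
  have Wy: "W y = sc e (unitv (n - 2))"
    by (rule W_eq) (use n2 eV[of "n - 2"] in \<open>auto simp only: Q_sc Qy\<close>)
  \<comment> \<open>The factor N makes powers of M clear denominators of R, and the factor D makes e
    invertible modulo any element congruent to 1 modulo M.\<close>
  define M where "M = N * D"
  have M: "M > 0" "of_nat M \<in> A" using N D A_of_nat[of M] by (auto simp: M_def)
  have M_den: "\<exists>j. of_nat M ^ j * z \<in> A" if z: "z \<in> R" for z
  proof -
    obtain j where "of_nat N ^ j * z \<in> A" using N(2)[OF z] by blast
    then have "of_nat D ^ j * (of_nat N ^ j * z) \<in> A" using A_mult A_power A_of_nat by blast
    then show ?thesis by (intro exI[of _ j]) (simp add: M_def power_mult_distrib mult_ac)
  qed
  obtain C where C: "C \<ge> 1" "\<And>H1 H2 x y. x \<in> bx H1 \<Longrightarrow> y \<in> bx H2 \<Longrightarrow> x * y \<in> bx (C * H1 * H2)"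
    using A_mult_bound by blast
  obtain K1 where K1: "1 \<in> bx K1" using in_bx[OF A_1] by blast
  obtain C2 where C2: "C2 \<ge> 1" "\<And>H a. H \<ge> 1 \<Longrightarrow> a \<in> bx H \<Longrightarrow> a \<noteq> 0 \<Longrightarrow>
      finite (coset_set R ((*) a ` R)) \<and> idx R ((*) a ` R) \<le> (C2 * H) ^ card B"
    using idx_R_mult by blast
  have bx_scale: "of_nat m * z \<in> bx (m * k)" if z: "z \<in> bx k" for m k z
  proof -
    obtain u where u: "z = emb u" "\<And>b. b \<in> B \<Longrightarrow> \<bar>u b\<bar> \<le> int k" using z by (auto simp: bx_def)
    have "\<bar>int m * u b\<bar> \<le> int (m * k)" if "b \<in> B" for b using u(2)[OF that] by (simp add: abs_mult mult_left_mono)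
    moreover have "of_nat m * z = emb (\<lambda>b. int m * u b)" using emb_scale[of "int m" u] u by simp
    ultimately show ?thesis unfolding bx_def by blast
  qed
  \<comment> \<open>Chosen so that al \<beta> lies in \<open>bx (K3 * (b + 1))\<close>: its integer
    part m needs m K1, as 1 lies in \<open>bx K1\<close>, and its variable part needs M b. The last
    1 keeps K3 positive.\<close>
  define K3 where "K3 = (1 + 2 * M * C) * K1 + M + 1"
  have "\<exists>F. finite F \<and> F \<subseteq> brideals \<and> card F = (b + 1) ^ (2 * card B) \<and>
           (\<forall>I\<in>F. idx (lat n) I \<le> (C2 * K3 * (b + 1)) ^ card B)" for b :: nat
  proof -
    \<comment> \<open>The summand 1 makes al \<beta> congruent to 1 modulo M. The rest makes the
      integer m outweigh the part M \<beta>, whose effect on coordinates is at most M C b, while al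
      \<beta> remains of order b.\<close>
    define m where "m = 1 + 2 * M * C * b"
    define al where "al \<beta> = of_nat m + of_nat M * \<beta>" for \<beta> :: 'k
    define ga where "ga \<beta> = of_nat (2 * C * b) + \<beta>" for \<beta> :: 'k
    have al_ga: "al \<beta> = 1 + of_nat M * ga \<beta>" for \<beta> by (simp add: al_def ga_def m_def algebra_simps)
    have pA: "\<beta> \<in> A" if "\<beta> \<in> pbx b" for \<beta> using that pbx_A by blast
    have gaA: "ga \<beta> \<in> A" if "\<beta> \<in> pbx b" for \<beta>
      unfolding ga_def using pA[OF that] A_of_nat subgrp_add[OF subgrp_A] by blast
    have alA: "al \<beta> \<in> A" if "\<beta> \<in> pbx b" for \<beta>
      unfolding al_def using pA[OF that] A_of_nat A_mult M(2) subgrp_add[OF subgrp_A] by blast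
    \<comment> \<open>At a coordinate where z attains its maximum h, the integer part of al \<beta>
      contributes m h. The part M \<beta> z is at most M C b h there and the product at most M C b,
      and m exceeds twice M C b.\<close>
    have large: "z = 0" if \<beta>: "\<beta> \<in> pbx b" and z: "z \<in> A" "al \<beta> * z \<in> bx (M * C * b)" for \<beta> z
    proof (rule ccontr)
      assume "z \<noteq> 0"
      obtain \<zeta> where \<zeta>: "z = emb \<zeta>" using z by (auto simp: A_def)
      have B: "B \<noteq> {}" using card_B_pos by auto
      define h where "h = Max ((\<lambda>b. nat \<bar>\<zeta> b\<bar>) ` B)"
      have "h \<in> (\<lambda>b. nat \<bar>\<zeta> b\<bar>) ` B" unfolding h_def using finite_B B by (intro Max_in) auto
      then obtain b0 where b0: "b0 \<in> B" "h = nat \<bar>\<zeta> b0\<bar>" by blast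
      have le: "\<bar>\<zeta> b\<bar> \<le> int h" if "b \<in> B" for b
      proof -
        have "nat \<bar>\<zeta> b\<bar> \<le> h" unfolding h_def using finite_B that by (intro Max_ge) auto
        then show ?thesis by linarith
      qed
      have zh: "z \<in> bx h" using \<zeta> le unfolding bx_def by blast
      have h1: "h \<ge> 1"
      proof (rule ccontr)
        assume "\<not> h \<ge> 1"
        then have "z \<in> bx 0" using zh by (cases h) auto
        then show False using bx_0 \<open>z \<noteq> 0\<close> by simp
      qed
      have "of_nat M * (\<beta> * z) \<in> bx (M * (C * b * h))"
        using \<beta> pbx_bx C(2)[OF _ zh] by (intro bx_scale) blast
      then obtain \<psi> where \<psi>: "of_nat M * (\<beta> * z) = emb \<psi>" "\<And>i. i \<in> B \<Longrightarrow> \<bar>\<psi> i\<bar> \<le> int (M * (C * b * h))"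
        by (auto simp: bx_def)
      obtain \<phi> where \<phi>: "al \<beta> * z = emb \<phi>" "\<And>i. i \<in> B \<Longrightarrow> \<bar>\<phi> i\<bar> \<le> int (M * C * b)"
        using z(2) by (auto simp: bx_def)
      have "al \<beta> * z = of_int (int m) * z + of_nat M * (\<beta> * z)" by (simp add: al_def algebra_simps)
      then have "emb \<phi> = emb (\<lambda>i. int m * \<zeta> i + \<psi> i)"
        unfolding \<phi>(1) \<psi>(1) unfolding \<zeta> emb_scale emb_add .
      then have eq: "\<phi> b0 = int m * \<zeta> b0 + \<psi> b0" using emb_inj b0(1) by blast
      have "int m * int h = \<bar>int m * \<zeta> b0\<bar>" using b0 by (simp add: abs_mult)
      also have "\<dots> \<le> \<bar>\<phi> b0\<bar> + \<bar>\<psi> b0\<bar>" using eq by linarith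
      also have "\<dots> \<le> int (M * C * b) + int (M * (C * b * h))" using \<phi>(2) \<psi>(2) b0(1) by (intro add_mono) auto
      finally have "int (m * h) \<le> int (M * C * b + M * (C * b * h))" by simp
      then have "m * h \<le> M * C * b + M * C * b * h" by (simp only: of_nat_le_iff mult.assoc)
      moreover have "M * C * b * 1 \<le> M * C * b * h" by (rule mult_le_mono2[OF h1])
      ultimately have "m * h \<le> 2 * (M * C * b * h)" by linarith
      moreover have "m * h = h + 2 * (M * C * b * h)" by (simp add: m_def algebra_simps)
      ultimately show False using h1 by simp
    qed
    have al0: "al \<beta> \<noteq> 0" if "\<beta> \<in> pbx b" for \<beta>
    proof
      assume "al \<beta> = 0"
      then have "al \<beta> * 1 \<in> bx (M * C * b)" using bx_mono[of 0 "M * C * b"] bx_0 by auto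
      then show False using large[OF that A_1] by simp
    qed
    \<comment> \<open>As al \<beta> = 1 + M ga \<beta>, the element M^j z is a combination of al
      \<beta> z and M^(j+1) z over A. Descending in j removes the denominator of z.\<close>
    have down: "z \<in> A" if \<beta>: "\<beta> \<in> pbx b" and z: "z \<in> R" "al \<beta> * z \<in> A" for \<beta> z
    proof -
      have *: "of_nat M ^ j * z \<in> A \<Longrightarrow> z \<in> A" for j
      proof (induction j)
        case (Suc j)
        have "of_nat M ^ j * z = of_nat M ^ j * (al \<beta> * z) - ga \<beta> * (of_nat M ^ Suc j * z)"
          unfolding al_ga by (simp add: algebra_simps)
        also have "\<dots> \<in> A"
          by (intro subgrp_diff[OF subgrp_A] A_mult A_power M z gaA[OF \<beta>] Suc.prems)
        finally show ?case by (rule Suc.IH)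
      qed simp
      then show ?thesis using M_den[OF z(1)] by blast
    qed
    have inc: "t = t'" if \<beta>: "\<beta> \<in> pbx b" and t: "t - t' \<in> bx (M * C * b)" "t - t' \<in> (*) (al \<beta>) ` R" for \<beta> t t'
    proof -
      obtain z where z: "z \<in> R" "t - t' = al \<beta> * z" using t(2) by blast
      then have zA: "z \<in> A" using down[OF \<beta> z(1)] t(1) bx_A by auto
      then have "z = 0" using large[OF \<beta> zA] z(2) t(1) by simp
      then show ?thesis using z by simp
    qed
    have bM: "bx b \<subseteq> bx (M * C * b)" using M C(1) by (intro bx_mono) (simp add: Suc_leI)
    have inc1: "t = t'" if "\<beta> \<in> pbx b" "t \<in> pbx b" "t' \<in> pbx b" "t - t' \<in> (*) (al \<beta>) ` R" for \<beta> t t'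
      using inc[OF that(1) _ that(4)] pbx_diff[OF that(2,3)] bM by blast
    \<comment> \<open>Equal ideals contain the difference of their generators, which is M (\<beta> -
      \<beta>') and thus small enough for \<open>inc\<close> to make it 0.\<close>
    have inc2: "\<beta> = \<beta>'" if \<beta>: "\<beta> \<in> pbx b" "\<beta>' \<in> pbx b" and eq: "(*) (al \<beta>) ` R = (*) (al \<beta>') ` R" for \<beta> \<beta>'
    proof -
      have "al \<beta>'' * 1 \<in> (*) (al \<beta>'') ` R" for \<beta>'' using R_1 by blast
      then have "al \<beta> \<in> (*) (al \<beta>) ` R" "al \<beta>' \<in> (*) (al \<beta>) ` R" using eq by auto
      then have 1: "al \<beta> - al \<beta>' \<in> (*) (al \<beta>) ` R"
        using subgrp_diff[OF subgrp_mult_image[OF subgrp_R]] by blast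
      have "al \<beta> - al \<beta>' = of_nat M * (\<beta> - \<beta>')" by (simp add: al_def algebra_simps)
      moreover have "of_nat M * (\<beta> - \<beta>') \<in> bx (M * b)" by (rule bx_scale[OF pbx_diff[OF \<beta>]])
      moreover have "bx (M * b) \<subseteq> bx (M * C * b)" using C(1) by (intro bx_mono) simp
      ultimately have "al \<beta> = al \<beta>'" using inc[OF \<beta>(1) _ 1] by auto
      then show ?thesis using M by (simp add: al_def)
    qed
    define I where "I \<beta> t = {z \<in> lat n. W z (n - 1) - t * W z (n - 2) \<in> (*) (al \<beta>) ` R}" for \<beta> t
    \<comment> \<open>e divides M and al \<beta> is 1 modulo M, so e is invertible modulo al \<beta>
      R.\<close>
    have eunit: "r \<in> (*) (al \<beta>) ` R" if \<beta>: "\<beta> \<in> pbx b" and r: "r \<in> R" "r * e \<in> (*) (al \<beta>) ` R" for \<beta> r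
    proof -
      obtain q where q: "q \<in> R" "r * e = al \<beta> * q" using r(2) by blast
      have "r = r * al \<beta> - (r * e) * (of_nat N * ga \<beta>)"
        by (simp add: al_ga M_def e_def algebra_simps)
      also have "\<dots> = al \<beta> * (r - q * (of_nat N * ga \<beta>))" unfolding q(2) by (simp add: algebra_simps)
      finally have "r = al \<beta> * (r - q * (of_nat N * ga \<beta>))" .
      moreover have "ga \<beta> \<in> R" using gaA[OF \<beta>] R_A by blast
      then have "r - q * (of_nat N * ga \<beta>) \<in> R" by (intro R_diff R_mult r q R_of_nat)
      ultimately show ?thesis by (rule image_eqI)
    qed
    have I_mem: "I \<beta> t \<in> brideals \<and> idx (lat n) (I \<beta> t) \<le> (C2 * K3 * (b + 1)) ^ card B"
      if \<beta>: "\<beta> \<in> pbx b" and t: "t \<in> pbx b" for \<beta> t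
    proof -
      define P where "P = (*) (al \<beta>) ` R"
      define g where "g z = W z (n - 1) - t * W z (n - 2)" for z
      have P: "ideal_R P" unfolding P_def using ideal_principal alA[OF \<beta>] R_A by blast
      have sP: "subgrp P" and mP: "\<And>r z. r \<in> R \<Longrightarrow> z \<in> P \<Longrightarrow> r * z \<in> P" using P by (auto simp: ideal_R_def)
      have tR: "t \<in> R" using pA[OF t] R_A by blast
      have WR: "W z i \<in> R" if "z \<in> lat n" "i < n" for z i using W(1)[OF that(1)] that(2) by (simp add: lat_def)
      have gR: "g ` lat n \<subseteq> R" unfolding g_def using WR n2 tR R_diff R_mult by auto
      have g_diff: "g (z - z') = g z - g z'" if "z \<in> lat n" "z' \<in> lat n" for z z'
        by (simp add: g_def W_diff[OF that] algebra_simps)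
      have g_sc: "g (sc r z) = r * g z" if "z \<in> lat n" for r z
        using W_sc[OF that, of r] by (simp add: g_def sc_def algebra_simps)
      have I_eq: "I \<beta> t = {z \<in> lat n. g z \<in> P}" by (simp add: I_def g_def P_def)
      have sI: "subgrp (I \<beta> t)" unfolding subgrp_def
      proof (intro conjI ballI)
        have "g (0 - 0) = g 0 - g 0" by (rule g_diff) (rule subgrp_0[OF subgrp_lat])+
        then have "g 0 = 0" by simp
        then show "0 \<in> I \<beta> t" using subgrp_0[OF subgrp_lat] subgrp_0[OF sP] by (simp add: I_eq)
        fix u v assume "u \<in> I \<beta> t" "v \<in> I \<beta> t"
        then show "u - v \<in> I \<beta> t" using subgrp_diff[OF subgrp_lat] subgrp_diff[OF sP] g_diff by (auto simp: I_eq)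
      qed
      have scI: "sc r z \<in> I \<beta> t" if "r \<in> R" "z \<in> I \<beta> t" for r z
        using that lat_sc mP g_sc by (auto simp: I_eq)
      have brI: "br u z \<in> I \<beta> t" if "u \<in> lat n" "z \<in> I \<beta> t" for u z
      proof -
        have "z \<in> lat n" using that by (simp add: I_eq)
        then show ?thesis using that(1) br_lat W_br subgrp_0[OF sP] by (simp add: I_eq g_def)
      qed
      have alH: "al \<beta> \<in> bx (K3 * (b + 1))"
      proof -
        have "of_nat m * 1 + of_nat M * \<beta> \<in> bx (m * K1 + M * b)"
          using \<beta> pbx_bx K1 by (intro bx_add bx_scale) auto
        moreover have "m * K1 + M * b \<le> K3 * (b + 1)" by (simp add: m_def K3_def algebra_simps)
        ultimately show ?thesis using bx_mono by (auto simp: al_def)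
      qed
      have P2: "finite (coset_set R P)" "idx R P \<le> (C2 * (K3 * (b + 1))) ^ card B"
        using C2(2)[OF _ alH al0[OF \<beta>]] unfolding P_def by (auto simp: K3_def)
      have "a - a' \<in> I \<beta> t \<longleftrightarrow> g a - g a' \<in> P" if "a \<in> lat n" "a' \<in> lat n" for a a'
        using subgrp_diff[OF subgrp_lat that] g_diff[OF that] by (simp add: I_eq)
      then have "finite (coset_set (lat n) (I \<beta> t))" "idx (lat n) (I \<beta> t) \<le> idx R P"
        using idx_hom_le[OF sI sP, where G="lat n" and f=g and G'=R] gR P2(1) by blast+
      moreover from this(2) P2(2) have "idx (lat n) (I \<beta> t) \<le> (C2 * K3 * (b + 1)) ^ card B"
        unfolding mult.assoc by (rule order_trans)
      moreover have "I \<beta> t \<subseteq> lat n" by (auto simp: I_eq)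
      ultimately show ?thesis using sI scI brI unfolding brideals_def fmod_def submod_def by blast
    qed
    have I_inj: "\<beta> = \<beta>' \<and> t = t'" if \<beta>: "\<beta> \<in> pbx b" "\<beta>' \<in> pbx b" and t: "t \<in> pbx b" "t' \<in> pbx b"
      and eq: "I \<beta> t = I \<beta>' t'" for \<beta> \<beta>' t t'
    proof -
      have tR: "t \<in> R" "t' \<in> R" using t pA R_A by blast+
      have u: "unitv (n - 1) (n - 1) = (1::'k)" "unitv (n - 1) (n - 2) = (0::'k)"
        "unitv (n - 2) (n - 1) = (0::'k)" "unitv (n - 2) (n - 2) = (1::'k)"
        using n2 by (auto simp: unitv_def)
      \<comment> \<open>The multiples of x inside the ideal recover al \<beta> R, and with it
        \<beta>.\<close>
      have mem: "sc r x \<in> I \<beta> t \<longleftrightarrow> r \<in> (*) (al \<beta>) ` R" if "\<beta> \<in> pbx b" "r \<in> R" for r \<beta> t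
      proof -
        have "W (sc r x) = sc r (sc e (unitv (n - 1)))" using W_sc[OF x_lat] Wx by simp
        then have "sc r x \<in> I \<beta> t \<longleftrightarrow> r * e \<in> (*) (al \<beta>) ` R"
          using lat_sc[OF that(2) x_lat] by (simp add: I_def sc_def u del: One_nat_def)
        also have "\<dots> \<longleftrightarrow> r \<in> (*) (al \<beta>) ` R"
        proof
          assume "r \<in> (*) (al \<beta>) ` R"
          then obtain q where "q \<in> R" "r = al \<beta> * q" by blast
          then show "r * e \<in> (*) (al \<beta>) ` R" using R_mult e(3) by (auto simp: mult.assoc)
        qed (use eunit that in blast)
        finally show ?thesis .
      qed
      have "(*) (al \<beta>'') ` R \<subseteq> R" if "\<beta>'' \<in> pbx b" for \<beta>'' using alA[OF that] R_A R_mult by auto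
      then have "(*) (al \<beta>) ` R = (*) (al \<beta>') ` R" using mem[OF \<beta>(1)] mem[OF \<beta>(2)] eq \<beta> by blast
      then have \<beta>\<beta>: "\<beta> = \<beta>'" by (rule inc2[OF \<beta>])
      \<comment> \<open>This is t x + y, with leading coordinates t e and e, so it lies in
        \<open>I \<beta> t\<close>. Lying in \<open>I \<beta> t'\<close> as well forces t and t' to
        be congruent modulo al \<beta> R.\<close>
      define z where "z = sc t x - sc (- 1) y"
      have mR: "- 1 \<in> R" using subgrp_minus[OF subgrp_R R_1] .
      have zl: "z \<in> lat n" unfolding z_def
        by (intro subgrp_diff[OF subgrp_lat] lat_sc tR mR x_lat y_lat)
      have "W z = sc t (sc e (unitv (n - 1))) - sc (- 1) (sc e (unitv (n - 2)))"
        unfolding z_def W_diff[OF lat_sc[OF tR(1) x_lat] lat_sc[OF mR y_lat]] W_sc[OF x_lat] W_sc[OF y_lat] Wx Wy ..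
      then have Wz: "W z (n - 1) = t * e" "W z (n - 2) = e" by (simp_all add: sc_def u del: One_nat_def)
      have "z \<in> I \<beta> t" using zl Wz subgrp_0[OF subgrp_mult_image[OF subgrp_R]]
        by (simp add: I_def del: One_nat_def)
      then have "z \<in> I \<beta> t'" using eq \<beta>\<beta> by simp
      then have "(t - t') * e \<in> (*) (al \<beta>) ` R" by (simp add: I_def Wz left_diff_distrib del: One_nat_def)
      then have "t - t' \<in> (*) (al \<beta>) ` R" using eunit[OF \<beta>(1)] R_diff tR by blast
      then show ?thesis using inc1[OF \<beta>(1) t] \<beta>\<beta> by blast
    qed
    define F where "F = (\<lambda>(\<beta>, t). I \<beta> t) ` (pbx b \<times> pbx b)"
    have "inj_on (\<lambda>(\<beta>, t). I \<beta> t) (pbx b \<times> pbx b)" using I_inj by (fastforce simp: inj_on_def)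
    then have "card F = card (pbx b \<times> pbx b)" unfolding F_def by (rule card_image)
    also have "\<dots> = (b + 1) ^ (2 * card B)"
      by (simp add: card_cartesian_product card_pbx power_add[symmetric] mult_2)
    finally have "card F = (b + 1) ^ (2 * card B)" .
    moreover have "finite F" unfolding F_def using finite_pbx by simp
    moreover have "F \<subseteq> brideals" "\<forall>I\<in>F. idx (lat n) I \<le> (C2 * K3 * (b + 1)) ^ card B"
      using I_mem by (auto simp: F_def)
    ultimately show ?thesis by blast
  qed
  moreover have "C2 * K3 > 0" using C2(1) by (simp add: K3_def)
  ultimately show ?thesis by blast
qed

text \<open>With d = \<open>card B\<close> there are (b + 1) ^ (2 d) ideals of index at most (K (b +
  1)) ^ d. Their terms add up to at least a constant times (b + 1) to the power d (2 - s), which is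
  unbounded for s < 2.\<close>

lemma ideal_sum_lower:
  assumes N: "N > 0" "\<And>z. z \<in> R \<Longrightarrow> \<exists>j. of_nat N ^ j * z \<in> A"
    and s: "0 \<le> s" "s < 2"
  shows "\<exists>F. finite F \<and> F \<subseteq> brideals \<and> (\<Sum>I\<in>F. real (idx (lat n) I) powr (- s)) > Z"
proof -
  define d where "d = card B"
  have d: "d > 0" using card_B_pos by (simp add: d_def)
  obtain K where K: "K > 0" and ex: "\<And>b::nat. \<exists>F. finite F \<and> F \<subseteq> brideals \<and> card F = (b + 1) ^ (2 * d) \<and>
           (\<forall>I\<in>F. idx (lat n) I \<le> (K * (b + 1)) ^ d)" using many_ideals[OF N] unfolding d_def by blast
  define a where "a = real d * (2 - s)"
  have a: "a > 0" using d s by (simp add: a_def)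
  define k where "k = (real K ^ d) powr (- s)"
  have k: "k > 0" using K by (simp add: k_def)
  define Y where "Y = (\<bar>Z\<bar> + 1) / k"
  have Y: "Y > 0" using k by (simp add: Y_def)
  obtain b :: nat where b: "real b > Y powr (1 / a)" using reals_Archimedean2 by blast
  have "Y = (Y powr (1 / a)) powr a" using a Y by (simp add: powr_powr)
  also have "\<dots> < real (b + 1) powr a" using b a by (intro powr_less_mono2) auto
  finally have big: "Y < real (b + 1) powr a" .
  obtain F where F: "finite F" "F \<subseteq> brideals" "card F = (b + 1) ^ (2 * d)"
    "\<And>I. I \<in> F \<Longrightarrow> idx (lat n) I \<le> (K * (b + 1)) ^ d" using ex[of b] by blast
  have "Z < k * Y" using k by (simp add: Y_def)
  also have "\<dots> < k * real (b + 1) powr a" using big k by simp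
  also have "\<dots> = real (card F) * (real ((K * (b + 1)) ^ d)) powr (- s)"
  proof -
    have b0: "real (b + 1) > 0" by simp
    have p: "real (b + 1) ^ e = real (b + 1) powr real e" for e
      by (rule powr_realpow[OF b0, symmetric])
    have "real (card F) * (real ((K * (b + 1)) ^ d)) powr (- s)
        = real (b + 1) ^ (2 * d) * (real K ^ d * real (b + 1) ^ d) powr (- s)"
      unfolding F(3) by (simp only: of_nat_power of_nat_mult power_mult_distrib)
    also have "\<dots> = real (b + 1) powr real (2 * d) * (k * real (b + 1) powr (real d * (- s)))"
      unfolding p k_def by (simp add: powr_mult powr_powr del: of_nat_add)
    also have "\<dots> = k * (real (b + 1) powr real (2 * d) * real (b + 1) powr (real d * (- s)))"
      by simp
    also have "\<dots> = k * real (b + 1) powr a"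
      unfolding powr_add[symmetric] by (simp add: a_def algebra_simps)
    finally show ?thesis by (rule sym)
  qed
  also have "\<dots> = (\<Sum>I\<in>F. (real ((K * (b + 1)) ^ d)) powr (- s))" by simp
  also have "\<dots> \<le> (\<Sum>I\<in>F. real (idx (lat n) I) powr (- s))"
  proof (rule sum_mono)
    fix I assume I: "I \<in> F"
    have "idx (lat n) I \<ge> 1" using I F(2) idx_pos[OF _ subgrp_lat] by (auto simp: brideals_def fmod_def)
    then show "(real ((K * (b + 1)) ^ d)) powr (- s) \<le> real (idx (lat n) I) powr (- s)"
      using F(4)[OF I] s by (intro powr_mono2') (auto simp del: of_nat_power of_nat_mult of_nat_add)
  qed
  finally show ?thesis using F by blast
qed

end

text \<open>Generic elements can be scaled into the lattice.\<close>

lemma max_class_order_exists: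
  assumes "overring B w R" and "max_class_bracket n c br G"
    and br_lat: "\<And>u v. u \<in> overring.lat R n \<Longrightarrow> v \<in> overring.lat R n \<Longrightarrow> br u v \<in> overring.lat R n"
  shows "\<exists>x y. max_class_order B w R n c br G x y"
proof -
  interpret overring B w R by fact
  interpret max_class_bracket n c br G by fact
  obtain x0 where x0: "x0 \<in> cspace n" "\<And>i. i < c - 1 \<Longrightarrow> x0 \<notin> cent i" using ex_generic by blast
  \<comment> \<open>Since c \<ge> 2, the space \<open>cent 0\<close> is among those avoided, and a
    witness for this is the second generator.\<close>
  have "x0 \<notin> cent 0" using x0(2)[of 0] c2 by simp
  then obtain y0 where y0: "y0 \<in> cspace n" "br x0 y0 \<notin> G 2"
    using x0(1) by (auto simp: cent_def G_0 numeral_2_eq_2)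
  obtain D :: nat where D: "D > 0" "sc (of_nat D) x0 \<in> lat n" "sc (of_nat D) y0 \<in> lat n"
    using cspace_denom[of "{x0, y0}" n] x0 y0 by auto
  define e :: 'b where "e = of_nat D"
  have e: "e \<noteq> 0" using D by (simp add: e_def)
  have unsc: "v \<in> U" if "fv.subspace U" "sc e v \<in> U" for U v
    using fv.subspace_scale[OF that, of "1 / e"] e by simp
  have "max_class_order B w R n c br G (sc e x0) (sc e y0)"
  proof unfold_locales
    show "sc e x0 \<in> cspace n" "sc e y0 \<in> cspace n"
      using x0 y0 fv.subspace_scale[OF subspace_V] by blast+
    show "sc e x0 \<notin> cent i" if "i < c - 1" for i
      using x0(2)[OF that] unsc[OF subspace_cent] by blast
    have "br (sc e x0) (sc e y0) = sc e (sc e (br x0 y0))"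
      using x0 y0 fv.subspace_scale[OF subspace_V] by (simp only: br_scale_left br_scale_right)
    then show "br (sc e x0) (sc e y0) \<notin> G 2" using y0(2) unsc[OF G_subspace] by metis
    show "br u v \<in> lat n" if "u \<in> lat n" "v \<in> lat n" for u v using br_lat that .
    show "sc e x0 \<in> lat n" "sc e y0 \<in> lat n" using D by (simp_all add: e_def)
  qed
  then show ?thesis by blast
qed

section \<open>Coordinates of free modules\<close>

lemma field_ring_simps [simp]:
  "carrier (field_ring :: 'k::field_char_0 ring) = UNIV"
  "a \<otimes>\<^bsub>field_ring\<^esub> b = a * b" "a \<oplus>\<^bsub>field_ring\<^esub> b = a + b"
  "\<zero>\<^bsub>field_ring\<^esub> = (0::'k)" "\<one>\<^bsub>field_ring\<^esub> = (1::'k)"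
  by (simp_all add: field_ring_def ring_of_type_algebra_def)

text \<open>Covers both the S-integers and the whole field as coefficient rings: both carry the
  operations of the field, so coordinates of either kind are computed there.\<close>

locale subring_module = Module.module R L
  for R :: "('k::field_char_0, 'm) ring_scheme" (structure) and L :: "('k, 'b, 'n) module_scheme" (structure) +
  assumes R_ops: "\<And>a b. a \<oplus>\<^bsub>R\<^esub> b = a + b" "\<And>a b. a \<otimes>\<^bsub>R\<^esub> b = a * b" "\<zero>\<^bsub>R\<^esub> = 0" "\<one>\<^bsub>R\<^esub> = 1"
begin

lemma finsum_support:
  assumes "finite Y" "Z \<subseteq> Y" "Y \<subseteq> carrier L" "\<And>b. b \<in> Y \<Longrightarrow> c b \<in> carrier R" "\<And>b. b \<in> Y - Z \<Longrightarrow> c b = 0"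
  shows "(\<Oplus>\<^bsub>L\<^esub>b\<in>Z. c b \<odot>\<^bsub>L\<^esub> b) = (\<Oplus>\<^bsub>L\<^esub>b\<in>Y. c b \<odot>\<^bsub>L\<^esub> b)"
proof (rule M.add.finprod_mono_neutral_cong_left[OF assms(1,2)])
  show "c b \<odot>\<^bsub>L\<^esub> b = \<zero>\<^bsub>L\<^esub>" if "b \<in> Y - Z" for b
    using assms(3) assms(5)[OF that] smult_l_null[of b] that by (auto simp: R_ops)
qed (use assms in auto)

text \<open>\<open>module_basis\<close> speaks of extensional functions and of sums over the exact
  support. Linearity is easier for coordinates that are 0 off B and for sums over any finite set
  containing the support, since supports of sums can shrink.\<close>

lemma basis_coordinates:
  assumes B: "module_basis R L B"
  shows "\<exists>co. (\<forall>x\<in>carrier L. (\<forall>b. co x b \<in> carrier R) \<and> (\<forall>b. b \<notin> B \<longrightarrow> co x b = 0) \<and> finite {b. co x b \<noteq> 0}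
        \<and> (\<forall>Y. finite Y \<and> {b. co x b \<noteq> 0} \<subseteq> Y \<and> Y \<subseteq> B \<longrightarrow> x = (\<Oplus>\<^bsub>L\<^esub>b\<in>Y. co x b \<odot>\<^bsub>L\<^esub> b)))
    \<and> (\<forall>c Y. finite Y \<and> {b. c b \<noteq> 0} \<subseteq> Y \<and> Y \<subseteq> B \<and> (\<forall>b. c b \<in> carrier R) \<longrightarrow>
        co (\<Oplus>\<^bsub>L\<^esub>b\<in>Y. c b \<odot>\<^bsub>L\<^esub> b) = c)"
proof -
  have BL: "B \<subseteq> carrier L" and uniq: "\<And>x. x \<in> carrier L \<Longrightarrow> \<exists>!c. c \<in> B \<rightarrow>\<^sub>E carrier R \<and>
      finite {b \<in> B. c b \<noteq> \<zero>\<^bsub>R\<^esub>} \<and> x = (\<Oplus>\<^bsub>L\<^esub> b \<in> {b \<in> B. c b \<noteq> \<zero>\<^bsub>R\<^esub>}. c b \<odot>\<^bsub>L\<^esub> b)"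
    using B by (auto simp: module_basis_def)
  have R0: "0 \<in> carrier R" using R.zero_closed by (simp add: R_ops)
  define P where "P x c \<longleftrightarrow> c \<in> B \<rightarrow>\<^sub>E carrier R \<and>
      finite {b \<in> B. c b \<noteq> 0} \<and> x = (\<Oplus>\<^bsub>L\<^esub> b \<in> {b \<in> B. c b \<noteq> 0}. c b \<odot>\<^bsub>L\<^esub> b)" for x c
  have uP: "\<exists>!c. P x c" if "x \<in> carrier L" for x
    using uniq[OF that] unfolding P_def R_ops .
  define co where "co x b = (if b \<in> B then (THE c. P x c) b else 0)" for x b
  have P_co: "P x (restrict (co x) B)" if x: "x \<in> carrier L" for x
  proof -
    have P: "P x (THE c. P x c)" by (rule theI'[OF uP[OF x]])
    then have PiE: "(THE c. P x c) \<in> B \<rightarrow>\<^sub>E carrier R" unfolding P_def by blast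
    have "restrict (co x) B = (THE c. P x c)"
    proof
      fix b show "restrict (co x) B b = (THE c. P x c) b"
        using PiE_arb[OF PiE, of b] by (cases "b \<in> B") (simp_all add: co_def)
    qed
    then show ?thesis using P by simp
  qed
  have P_unique: "c1 = c2" if "x \<in> carrier L" "P x c1" "P x c2" for x c1 c2
    by (rule ex1E[OF uP[OF that(1)]]) (use that in blast)
  have supp: "{b \<in> B. restrict c B b \<noteq> 0} = {b. c b \<noteq> 0}" if "\<And>b. b \<notin> B \<Longrightarrow> c b = 0" for c :: "'b \<Rightarrow> 'k"
    using that by auto
  have off: "b \<notin> B \<Longrightarrow> co x b = 0" for x b by (simp add: co_def)
  have restr: "(\<Oplus>\<^bsub>L\<^esub>b\<in>Y. restrict c B b \<odot>\<^bsub>L\<^esub> b) = (\<Oplus>\<^bsub>L\<^esub>b\<in>Y. c b \<odot>\<^bsub>L\<^esub> b)"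
    if "Y \<subseteq> B" "\<And>b. c b \<in> carrier R" for Y and c :: "'b \<Rightarrow> 'k"
    by (rule M.add.finprod_cong') (use that BL in auto)
  have A: "co x b \<in> carrier R" "finite {b. co x b \<noteq> 0}"
      "finite Y \<Longrightarrow> {b. co x b \<noteq> 0} \<subseteq> Y \<Longrightarrow> Y \<subseteq> B \<Longrightarrow> x = (\<Oplus>\<^bsub>L\<^esub>b\<in>Y. co x b \<odot>\<^bsub>L\<^esub> b)"
    if x: "x \<in> carrier L" for x b Y
  proof -
    have sp: "{b \<in> B. restrict (co x) B b \<noteq> 0} = {b. co x b \<noteq> 0}" by (rule supp) (rule off)
    have P: "restrict (co x) B \<in> B \<rightarrow>\<^sub>E carrier R" "finite {b. co x b \<noteq> 0}"
      "x = (\<Oplus>\<^bsub>L\<^esub>b\<in>{b. co x b \<noteq> 0}. restrict (co x) B b \<odot>\<^bsub>L\<^esub> b)"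
      using P_co[OF x] unfolding P_def sp by blast+
    have c: "co x b \<in> carrier R" for b
      using PiE_mem[OF P(1), of b] off R0 by (cases "b \<in> B") auto
    have sub: "{b. co x b \<noteq> 0} \<subseteq> B" using off by blast
    have "(\<Oplus>\<^bsub>L\<^esub>b\<in>{b. co x b \<noteq> 0}. restrict (co x) B b \<odot>\<^bsub>L\<^esub> b)
        = (\<Oplus>\<^bsub>L\<^esub>b\<in>{b. co x b \<noteq> 0}. co x b \<odot>\<^bsub>L\<^esub> b)" by (rule restr[OF sub c])
    with P(3) have eq: "x = (\<Oplus>\<^bsub>L\<^esub>b\<in>{b. co x b \<noteq> 0}. co x b \<odot>\<^bsub>L\<^esub> b)" by (rule trans)
    show "co x b \<in> carrier R" by (rule c)
    show "finite {b. co x b \<noteq> 0}" by (rule P(2))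
    assume Y: "finite Y" "{b. co x b \<noteq> 0} \<subseteq> Y" "Y \<subseteq> B"
    have "(\<Oplus>\<^bsub>L\<^esub>b\<in>{b. co x b \<noteq> 0}. co x b \<odot>\<^bsub>L\<^esub> b) = (\<Oplus>\<^bsub>L\<^esub>b\<in>Y. co x b \<odot>\<^bsub>L\<^esub> b)"
      by (rule finsum_support) (use Y BL c in auto)
    with eq show "x = (\<Oplus>\<^bsub>L\<^esub>b\<in>Y. co x b \<odot>\<^bsub>L\<^esub> b)" by (rule trans)
  qed
  have U: "co (\<Oplus>\<^bsub>L\<^esub>b\<in>Y. c b \<odot>\<^bsub>L\<^esub> b) = c"
    if Y: "finite Y" "{b. c b \<noteq> 0} \<subseteq> Y" "Y \<subseteq> B" "\<And>b. c b \<in> carrier R" for c Y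
  proof -
    define x where "x = (\<Oplus>\<^bsub>L\<^esub>b\<in>Y. c b \<odot>\<^bsub>L\<^esub> b)"
    have x: "x \<in> carrier L" unfolding x_def using Y BL by (intro M.finsum_closed) auto
    have offc: "b \<notin> B \<Longrightarrow> c b = 0" for b using Y by blast
    have sub: "{b. c b \<noteq> 0} \<subseteq> B" using Y by blast
    have "(\<Oplus>\<^bsub>L\<^esub>b\<in>{b. c b \<noteq> 0}. c b \<odot>\<^bsub>L\<^esub> b) = x" unfolding x_def
      by (rule finsum_support) (use Y BL in auto)
    moreover have "(\<Oplus>\<^bsub>L\<^esub>b\<in>{b. c b \<noteq> 0}. restrict c B b \<odot>\<^bsub>L\<^esub> b)
        = (\<Oplus>\<^bsub>L\<^esub>b\<in>{b. c b \<noteq> 0}. c b \<odot>\<^bsub>L\<^esub> b)" by (rule restr[OF sub Y(4)])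
    moreover have sp: "{b \<in> B. restrict c B b \<noteq> 0} = {b. c b \<noteq> 0}" by (rule supp) (rule offc)
    moreover have "restrict c B \<in> B \<rightarrow>\<^sub>E carrier R" using Y(4) by auto
    ultimately have "P x (restrict c B)"
      unfolding P_def using finite_subset[OF Y(2,1)] by simp
    then have eq: "restrict c B = restrict (co x) B" by (rule P_unique[OF x _ P_co[OF x]])
    have "co x b = c b" for b
    proof (cases "b \<in> B")
      case True
      show ?thesis using fun_cong[OF eq, of b] unfolding restrict_apply'[OF True] by (rule sym)
    next
      case False
      show ?thesis unfolding off[OF False] offc[OF False] ..
    qed
    then show ?thesis unfolding x_def by (rule ext)
  qed
  show ?thesis
  proof (intro exI[of _ co] conjI ballI allI impI)
    fix c Y assume "finite Y \<and> {b. c b \<noteq> 0} \<subseteq> Y \<and> Y \<subseteq> B \<and> (\<forall>b. c b \<in> carrier R)"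
    then show "co (\<Oplus>\<^bsub>L\<^esub>b\<in>Y. c b \<odot>\<^bsub>L\<^esub> b) = c" by (intro U) auto
  next
    fix x Y assume "x \<in> carrier L" "finite Y \<and> {b. co x b \<noteq> 0} \<subseteq> Y \<and> Y \<subseteq> B"
    then show "x = (\<Oplus>\<^bsub>L\<^esub>b\<in>Y. co x b \<odot>\<^bsub>L\<^esub> b)" using A(3)[of x Y] by blast
  qed (simp_all add: A(1,2) off)
qed

end

locale based_module = subring_module R L
  for R :: "('k::field_char_0, 'm) ring_scheme" (structure) and L :: "('k, 'b, 'n) module_scheme" (structure) +
  fixes B :: "'b set"
  assumes basis: "module_basis R L B"
begin

definition co :: "'b \<Rightarrow> 'b \<Rightarrow> 'k" where
  "co = (SOME co. (\<forall>x\<in>carrier L. (\<forall>b. co x b \<in> carrier R) \<and> (\<forall>b. b \<notin> B \<longrightarrow> co x b = 0) \<and> finite {b. co x b \<noteq> 0}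
        \<and> (\<forall>Y. finite Y \<and> {b. co x b \<noteq> 0} \<subseteq> Y \<and> Y \<subseteq> B \<longrightarrow> x = (\<Oplus>\<^bsub>L\<^esub>b\<in>Y. co x b \<odot>\<^bsub>L\<^esub> b)))
    \<and> (\<forall>c Y. finite Y \<and> {b. c b \<noteq> 0} \<subseteq> Y \<and> Y \<subseteq> B \<and> (\<forall>b. c b \<in> carrier R) \<longrightarrow>
        co (\<Oplus>\<^bsub>L\<^esub>b\<in>Y. c b \<odot>\<^bsub>L\<^esub> b) = c))"

lemma co_R: "x \<in> carrier L \<Longrightarrow> co x b \<in> carrier R"
  and co_off: "x \<in> carrier L \<Longrightarrow> b \<notin> B \<Longrightarrow> co x b = 0"
  and co_finite: "x \<in> carrier L \<Longrightarrow> finite {b. co x b \<noteq> 0}"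
  and co_sum: "x \<in> carrier L \<Longrightarrow> finite Y \<Longrightarrow> {b. co x b \<noteq> 0} \<subseteq> Y \<Longrightarrow> Y \<subseteq> B \<Longrightarrow>
      x = (\<Oplus>\<^bsub>L\<^esub>b\<in>Y. co x b \<odot>\<^bsub>L\<^esub> b)"
  and co_unique: "finite Y \<Longrightarrow> {b. c b \<noteq> 0} \<subseteq> Y \<Longrightarrow> Y \<subseteq> B \<Longrightarrow> (\<And>b. c b \<in> carrier R) \<Longrightarrow>
        co (\<Oplus>\<^bsub>L\<^esub>b\<in>Y. c b \<odot>\<^bsub>L\<^esub> b) = c"
  using someI_ex[OF basis_coordinates[OF basis], folded co_def] by blast+

lemma basis_carrier: "B \<subseteq> carrier L" using basis by (simp add: module_basis_def)

lemma co_supp: "x \<in> carrier L \<Longrightarrow> {b. co x b \<noteq> 0} \<subseteq> B" using co_off by blast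

lemma co_add:
  assumes x: "x \<in> carrier L" and y: "y \<in> carrier L"
  shows "co (x \<oplus>\<^bsub>L\<^esub> y) b = co x b + co y b"
proof -
  define Y where "Y = {b. co x b \<noteq> 0} \<union> {b. co y b \<noteq> 0}"
  have Y: "finite Y" "Y \<subseteq> B" using co_finite co_supp x y by (auto simp: Y_def)
  have YL: "b \<in> Y \<Longrightarrow> b \<in> carrier L" for b using Y basis_carrier by blast
  have "x = (\<Oplus>\<^bsub>L\<^esub>b\<in>Y. co x b \<odot>\<^bsub>L\<^esub> b)" "y = (\<Oplus>\<^bsub>L\<^esub>b\<in>Y. co y b \<odot>\<^bsub>L\<^esub> b)"
    using co_sum[OF x Y(1) _ Y(2)] co_sum[OF y Y(1) _ Y(2)] by (auto simp: Y_def)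
  then have "x \<oplus>\<^bsub>L\<^esub> y = (\<Oplus>\<^bsub>L\<^esub>b\<in>Y. co x b \<odot>\<^bsub>L\<^esub> b) \<oplus>\<^bsub>L\<^esub> (\<Oplus>\<^bsub>L\<^esub>b\<in>Y. co y b \<odot>\<^bsub>L\<^esub> b)" by (rule arg_cong2)
  also have "\<dots> = (\<Oplus>\<^bsub>L\<^esub>b\<in>Y. co x b \<odot>\<^bsub>L\<^esub> b \<oplus>\<^bsub>L\<^esub> co y b \<odot>\<^bsub>L\<^esub> b)"
    by (rule M.finsum_addf[symmetric]) (use YL co_R x y in auto)
  also have "\<dots> = (\<Oplus>\<^bsub>L\<^esub>b\<in>Y. (co x b + co y b) \<odot>\<^bsub>L\<^esub> b)"
    by (rule M.add.finprod_cong')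
      (use YL co_R x y smult_l_distr R.add.m_closed in \<open>auto simp: R_ops\<close>)
  finally have "co (x \<oplus>\<^bsub>L\<^esub> y) = co (\<Oplus>\<^bsub>L\<^esub>b\<in>Y. (co x b + co y b) \<odot>\<^bsub>L\<^esub> b)" by (rule arg_cong)
  also have "\<dots> = (\<lambda>b. co x b + co y b)"
    by (rule co_unique[OF Y(1) _ Y(2)])
      (use co_R[OF x] co_R[OF y] R.add.m_closed in \<open>auto simp: Y_def R_ops\<close>)
  finally show ?thesis by simp
qed

lemma co_smult:
  assumes r: "r \<in> carrier R" and x: "x \<in> carrier L"
  shows "co (r \<odot>\<^bsub>L\<^esub> x) b = r * co x b"
proof -
  define Y where "Y = {b. co x b \<noteq> 0}"
  have Y: "finite Y" "Y \<subseteq> B" using co_finite co_supp x by (auto simp: Y_def)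
  have YL: "b \<in> Y \<Longrightarrow> b \<in> carrier L" for b using Y basis_carrier by blast
  have "x = (\<Oplus>\<^bsub>L\<^esub>b\<in>Y. co x b \<odot>\<^bsub>L\<^esub> b)" using co_sum[OF x Y(1) _ Y(2)] by (auto simp: Y_def)
  then have "r \<odot>\<^bsub>L\<^esub> x = r \<odot>\<^bsub>L\<^esub> (\<Oplus>\<^bsub>L\<^esub>b\<in>Y. co x b \<odot>\<^bsub>L\<^esub> b)" by (rule arg_cong)
  also have "\<dots> = (\<Oplus>\<^bsub>L\<^esub>b\<in>Y. r \<odot>\<^bsub>L\<^esub> (co x b \<odot>\<^bsub>L\<^esub> b))"
    by (rule finsum_smult_ldistr[OF Y(1) r]) (use YL co_R x in auto)
  also have "\<dots> = (\<Oplus>\<^bsub>L\<^esub>b\<in>Y. (r * co x b) \<odot>\<^bsub>L\<^esub> b)"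
    by (rule M.add.finprod_cong')
      (use YL co_R x r smult_assoc1 R.m_closed in \<open>auto simp: R_ops\<close>)
  finally have "co (r \<odot>\<^bsub>L\<^esub> x) = co (\<Oplus>\<^bsub>L\<^esub>b\<in>Y. (r * co x b) \<odot>\<^bsub>L\<^esub> b)" by (rule arg_cong)
  also have "\<dots> = (\<lambda>b. r * co x b)"
    by (rule co_unique[OF Y(1) _ Y(2)])
      (use co_R[OF x] r R.m_closed in \<open>auto simp: Y_def R_ops\<close>)
  finally show ?thesis by simp
qed

lemma co_basis: "b \<in> B \<Longrightarrow> co b b' = (if b' = b then 1 else 0)"
proof -
  assume b: "b \<in> B"
  then have bL: "b \<in> carrier L" using basis_carrier by blast
  have R1: "0 \<in> carrier R" "1 \<in> carrier R" using R.zero_closed R.one_closed by (simp_all add: R_ops)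
  have "(\<Oplus>\<^bsub>L\<^esub>i\<in>{b}. (if i = b then 1 else 0) \<odot>\<^bsub>L\<^esub> i) = b"
    using bL smult_one[OF bL] by (simp add: R_ops)
  moreover have "co (\<Oplus>\<^bsub>L\<^esub>i\<in>{b}. (if i = b then 1 else 0) \<odot>\<^bsub>L\<^esub> i) = (\<lambda>i. if i = b then 1 else 0)"
    by (rule co_unique) (use b R1 in auto)
  ultimately show ?thesis by simp
qed

text \<open>For a finite basis enumerated by \<open>bs\<close>, \<open>crd\<close> identifies the module with
  the vectors of length \<open>p\<close> over \<open>R\<close>.\<close>

definition crd :: "(nat \<Rightarrow> 'b) \<Rightarrow> nat \<Rightarrow> 'b \<Rightarrow> nat \<Rightarrow> 'k" where
  "crd bs p x = (\<lambda>i. if i < p then co x (bs i) else 0)"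

lemma crd_add: "x \<in> carrier L \<Longrightarrow> y \<in> carrier L \<Longrightarrow> crd bs p (x \<oplus>\<^bsub>L\<^esub> y) = crd bs p x + crd bs p y"
  by (auto simp: crd_def co_add fun_eq_iff)

lemma crd_smult: "r \<in> carrier R \<Longrightarrow> x \<in> carrier L \<Longrightarrow> crd bs p (r \<odot>\<^bsub>L\<^esub> x) = sc r (crd bs p x)"
  by (auto simp: crd_def co_smult sc_def fun_eq_iff)

lemma crd_bij:
  assumes bs: "bij_betw bs {..<p} B"
  shows "bij_betw (crd bs p) (carrier L) {v. (\<forall>i<p. v i \<in> carrier R) \<and> (\<forall>i\<ge>p. v i = 0)}"
  unfolding bij_betw_def
proof
  have finB: "finite B" using bij_betw_finite[OF bs] by simp
  have bsB: "bs i \<in> B" if "i < p" for i using bs that by (auto simp: bij_betw_def)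
  show "inj_on (crd bs p) (carrier L)"
  proof (rule inj_onI)
    fix x y assume xy: "x \<in> carrier L" "y \<in> carrier L" "crd bs p x = crd bs p y"
    have "co x b = co y b" for b
    proof (cases "b \<in> B")
      case True
      then obtain i where i: "i < p" "b = bs i" using bs by (auto simp: bij_betw_def)
      then show ?thesis using fun_cong[OF xy(3), of i] by (simp add: crd_def)
    qed (use co_off xy in simp)
    then have "co x = co y" by (rule ext)
    then show "x = y" using co_sum[OF xy(1) finB co_supp[OF xy(1)] order_refl]
        co_sum[OF xy(2) finB co_supp[OF xy(2)] order_refl] by simp
  qed
  show "crd bs p ` carrier L = {v. (\<forall>i<p. v i \<in> carrier R) \<and> (\<forall>i\<ge>p. v i = 0)}"
  proof (intro equalityI subsetI)
    fix v assume v: "v \<in> {v. (\<forall>i<p. v i \<in> carrier R) \<and> (\<forall>i\<ge>p. v i = 0)}"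
    define c where "c b = (if b \<in> B then v (the_inv_into {..<p} bs b) else 0)" for b
    have inv: "the_inv_into {..<p} bs (bs i) = i" if "i < p" for i
      using the_inv_into_f_f[of bs "{..<p}" i] bs that by (auto simp: bij_betw_def)
    have R0: "0 \<in> carrier R" using R.zero_closed by (simp add: R_ops)
    have cR: "c b \<in> carrier R" for b
    proof (cases "b \<in> B")
      case True
      then obtain i where "i < p" "b = bs i" using bs by (auto simp: bij_betw_def)
      then show ?thesis using v inv True by (simp add: c_def)
    qed (simp add: c_def R0)
    have "co (\<Oplus>\<^bsub>L\<^esub>b\<in>B. c b \<odot>\<^bsub>L\<^esub> b) = c"
      by (rule co_unique) (use finB cR in \<open>auto simp: c_def\<close>)
    then have "crd bs p (\<Oplus>\<^bsub>L\<^esub>b\<in>B. c b \<odot>\<^bsub>L\<^esub> b) = v"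
      using v inv bsB by (auto simp: crd_def c_def fun_eq_iff)
    moreover have "(\<Oplus>\<^bsub>L\<^esub>b\<in>B. c b \<odot>\<^bsub>L\<^esub> b) \<in> carrier L"
      using cR basis_carrier by (intro M.finsum_closed) auto
    ultimately show "v \<in> crd bs p ` carrier L" by (rule rev_image_eqI[rotated, OF sym])
  qed (auto simp: crd_def co_R)
qed

end

text \<open>T is controlled on \<open>cspace p\<close> alone and not linear on the whole function
  type, so the independence of the images of the unit vectors is checked by hand.\<close>

lemma linear_inj_dim_le:
  fixes T :: "(nat \<Rightarrow> 'k::field) \<Rightarrow> nat \<Rightarrow> 'k"
  assumes add: "\<And>u v. u \<in> cspace p \<Longrightarrow> v \<in> cspace p \<Longrightarrow> T (u + v) = T u + T v"
    and scale: "\<And>a v. v \<in> cspace p \<Longrightarrow> T (sc a v) = sc a (T v)"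
    and into: "\<And>v. v \<in> cspace p \<Longrightarrow> T v \<in> cspace m"
    and inj: "\<And>v. v \<in> cspace p \<Longrightarrow> T v = 0 \<Longrightarrow> v = 0"
  shows "p \<le> m"
proof -
  have V0: "(0::nat \<Rightarrow> 'k) \<in> cspace p" by (rule fv.subspace_0[OF subspace_cspace])
  have T0: "T 0 = 0" using scale[OF V0, of 0] by simp
  have uV: "unitv i \<in> cspace p" if "i < p" for i using that by (auto simp: unitv_def cspace_def)
  have Tsum: "T (\<Sum>i\<in>I. sc (a i) (unitv i)) = (\<Sum>i\<in>I. sc (a i) (T (unitv i))) \<and>
      (\<Sum>i\<in>I. sc (a i) (unitv i)) \<in> cspace p" if "finite I" "I \<subseteq> {..<p}" for I a
    using that
  proof (induction I rule: finite_induct)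
    case empty
    have 1: "(\<Sum>i\<in>{}. sc (a i) (unitv i)) = (0::nat \<Rightarrow> 'k)" by (rule sum.empty)
    have 2: "(\<Sum>i\<in>{}. sc (a i) (T (unitv i))) = (0::nat \<Rightarrow> 'k)" by (rule sum.empty)
    have "T (\<Sum>i\<in>{}. sc (a i) (unitv i)) = (\<Sum>i\<in>{}. sc (a i) (T (unitv i)))"
      by (rule trans[OF arg_cong[where f = T, OF 1] trans[OF T0 2[symmetric]]])
    moreover have "(\<Sum>i\<in>{}. sc (a i) (unitv i)) \<in> cspace p"
      by (rule ssubst[where P = "\<lambda>z. z \<in> cspace p", OF 1 V0])
    ultimately show ?case by (rule conjI)
  next
    case (insert i I)
    have ip: "i < p" using insert by simp
    have i: "sc (a i) (unitv i) \<in> cspace p" by (rule fv.subspace_scale[OF subspace_cspace uV[OF ip]])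
    have I: "(\<Sum>i\<in>I. sc (a i) (unitv i)) \<in> cspace p" using insert by simp
    have "T (\<Sum>i\<in>insert i I. sc (a i) (unitv i)) = T (sc (a i) (unitv i) + (\<Sum>i\<in>I. sc (a i) (unitv i)))"
      by (rule arg_cong[where f = T, OF sum.insert[OF insert(1,2)]])
    also have "\<dots> = T (sc (a i) (unitv i)) + T (\<Sum>i\<in>I. sc (a i) (unitv i))" by (rule add[OF i I])
    also have "\<dots> = sc (a i) (T (unitv i)) + (\<Sum>i\<in>I. sc (a i) (T (unitv i)))"
      by (rule arg_cong2[where f = plus]) (use scale[OF uV[OF ip]] insert in auto)
    also have "\<dots> = (\<Sum>i\<in>insert i I. sc (a i) (T (unitv i)))" by (rule sum.insert[OF insert(1,2), symmetric])
    finally have "T (\<Sum>i\<in>insert i I. sc (a i) (unitv i)) = (\<Sum>i\<in>insert i I. sc (a i) (T (unitv i)))" .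
    moreover have "(\<Sum>i\<in>insert i I. sc (a i) (unitv i)) \<in> cspace p"
      unfolding sum.insert[OF insert(1,2)] by (rule fv.subspace_add[OF subspace_cspace i I])
    ultimately show ?case by (rule conjI)
  qed
  define S where "S = (\<lambda>i. T (unitv i)) ` {..<p}"
  have key: "v i = 0" if "(\<Sum>i<p. sc (v i) (T (unitv i))) = 0" "i < p" for v i
  proof -
    define u where "u = (\<Sum>i<p. sc (v i) (unitv i))"
    have "u \<in> cspace p" "T u = 0" using Tsum[of "{..<p}" v] that by (auto simp: u_def)
    then have "u = 0" using inj by blast
    moreover have "u j = (\<Sum>i<p. if i = j then v i else 0)" for j
      unfolding u_def by (induction p) (auto simp: sc_def unitv_def)
    ultimately have "(\<Sum>l<p. if l = i then v l else 0) = 0" by (metis zero_fun_apply)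
    then show ?thesis using that(2) by (simp add: sum.delta)
  qed
  have injS: "inj_on (\<lambda>i. T (unitv i)) {..<p}"
  proof (rule inj_onI, rule ccontr)
    fix i j assume ij: "i \<in> {..<p}" "j \<in> {..<p}" "T (unitv i) = T (unitv j)" "i \<noteq> j"
    define v where "v l = (if l = i then 1 else if l = j then - 1 else 0 :: 'k)" for l
    have "(\<Sum>l<p. sc (v l) (T (unitv l))) = (\<Sum>l\<in>{i, j}. sc (v l) (T (unitv l)))"
      by (rule sum.mono_neutral_right) (use ij in \<open>auto simp: v_def\<close>)
    also have "\<dots> = sc (v i) (T (unitv i)) + sc (v j) (T (unitv j))" using ij(4) by simp
    also have "\<dots> = 0" using ij by (simp add: v_def)
    finally have "v i = 0" using key ij(1) by blast
    then show False by (simp add: v_def)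
  qed
  have "fv.independent S"
  proof (rule fv.independent_if_scalars_zero)
    show "finite S" by (simp add: S_def)
    fix g s assume g: "(\<Sum>s\<in>S. sc (g s) s) = 0" and s: "s \<in> S"
    have "(\<Sum>i<p. sc (g (T (unitv i))) (T (unitv i))) = (\<Sum>s\<in>S. sc (g s) s)"
      unfolding S_def by (subst sum.reindex[OF injS]) simp
    then have "g (T (unitv i)) = 0" if "i < p" for i using key[of "\<lambda>i. g (T (unitv i))"] that g by simp
    then show "g s = 0" using s by (auto simp: S_def)
  qed
  moreover have "S \<subseteq> cspace m" using into uV by (auto simp: S_def)
  ultimately have "card S \<le> m" by (rule independent_cspace_card(2))
  then show ?thesis using card_image[OF injS] by (simp add: S_def)
qed

section \<open>The tensor product in coordinates\<close>

text \<open>Scalar multiplication and bracket of \<open>scalar_extension\<close> are unions over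
  representatives; they are evaluated by showing that every representative yields the same
  coset.\<close>

lemma UN_eq_const: "(\<And>z. z \<in> C \<Longrightarrow> f z = D) \<Longrightarrow> c \<in> C \<Longrightarrow> (\<Union>z\<in>C. f z) = D"
  by auto

lemma frag_extend_fun_diff:
  "frag_extend (\<lambda>i. f i - g i) z = frag_extend f z - frag_extend g z"
proof -
  have "Poly_Mapping.keys z \<subseteq> UNIV" by simp
  then show ?thesis
    by (induction z rule: frag_induction) (simp_all add: frag_extend_diff)
qed

locale lie_form_data = based_module R L B + lie_algebra R L + M: lie_algebra field_ring M
  for R :: "'k::field_char_0 ring" and L :: "('k, 'b) lie_alg" and B :: "'b set"
    and M :: "('k, 'h) lie_alg" +
  fixes \<phi> :: "('b \<times> 'k \<Rightarrow>\<^sub>0 int) set \<Rightarrow> 'h"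
  assumes \<phi>_bij: "bij_betw \<phi> (carrier (scalar_extension R field_ring L)) (carrier M)"
    and \<phi>_add: "\<And>x y. x \<in> carrier (scalar_extension R field_ring L) \<Longrightarrow>
        y \<in> carrier (scalar_extension R field_ring L) \<Longrightarrow>
        \<phi> (x \<oplus>\<^bsub>scalar_extension R field_ring L\<^esub> y) = \<phi> x \<oplus>\<^bsub>M\<^esub> \<phi> y"
    and \<phi>_smult: "\<And>a x. x \<in> carrier (scalar_extension R field_ring L) \<Longrightarrow>
        \<phi> (a \<odot>\<^bsub>scalar_extension R field_ring L\<^esub> x) = a \<odot>\<^bsub>M\<^esub> \<phi> x"
    and \<phi>_bracket: "\<And>x y. x \<in> carrier (scalar_extension R field_ring L) \<Longrightarrow>
        y \<in> carrier (scalar_extension R field_ring L) \<Longrightarrow>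
        \<phi> (bracket (scalar_extension R field_ring L) x y) = bracket M (\<phi> x) (\<phi> y)"
begin

definition Fg :: "('b \<times> 'k \<Rightarrow>\<^sub>0 int) monoid" where
  "Fg = free_Abelian_group (carrier L \<times> UNIV)"

definition H :: "('b \<times> 'k \<Rightarrow>\<^sub>0 int) set" where "H = tensor_relations R field_ring L"

lemma Fg_iff: "z \<in> carrier Fg \<longleftrightarrow> Poly_Mapping.keys z \<subseteq> carrier L \<times> UNIV"
  by (simp add: Fg_def)

lemma Fg_frag: "x \<in> carrier L \<Longrightarrow> frag_of (x, a) \<in> carrier Fg"
  by (simp add: Fg_iff keys_frag_of)

lemma Fg_group: "group Fg" by (simp add: Fg_def)

lemma Fg_ops: "x \<otimes>\<^bsub>Fg\<^esub> y = x + y" "\<one>\<^bsub>Fg\<^esub> = 0" "z \<in> carrier Fg \<Longrightarrow> inv\<^bsub>Fg\<^esub> z = - z"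
  by (simp_all add: Fg_def)

lemma subgrp_Fg: "subgrp (carrier Fg)"
  unfolding subgrp_def
proof (intro conjI ballI)
  fix z w assume "z \<in> carrier Fg" "w \<in> carrier Fg"
  then show "z - w \<in> carrier Fg" unfolding Fg_iff using keys_diff[of z w] by blast
qed (simp add: Fg_iff)

definition Rel :: "('b \<times> 'k \<Rightarrow>\<^sub>0 int) set" where
  "Rel = {frag_of (x \<oplus>\<^bsub>L\<^esub> y, a) - frag_of (x, a) - frag_of (y, a) | x y a.
         x \<in> carrier L \<and> y \<in> carrier L \<and> a \<in> carrier (field_ring :: 'k ring)} \<union>
      {frag_of (x, a \<oplus>\<^bsub>field_ring\<^esub> b) - frag_of (x, a) - frag_of (x, b) | x a b.
         x \<in> carrier L \<and> a \<in> carrier (field_ring :: 'k ring) \<and> b \<in> carrier (field_ring :: 'k ring)} \<union>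
      {frag_of (r \<odot>\<^bsub>L\<^esub> x, a) - frag_of (x, r \<otimes>\<^bsub>field_ring\<^esub> a) | r x a.
         r \<in> carrier R \<and> x \<in> carrier L \<and> a \<in> carrier (field_ring :: 'k ring)}"

lemma H_generate: "H = generate Fg Rel"
  unfolding H_def Fg_def Rel_def tensor_relations_def by (simp only: field_ring_simps(1))

lemma Rel_cases:
  assumes "z \<in> Rel"
  obtains x y a where "x \<in> carrier L" "y \<in> carrier L" "z = frag_of (x \<oplus>\<^bsub>L\<^esub> y, a) - frag_of (x, a) - frag_of (y, a)"
    | x a b where "x \<in> carrier L" "z = frag_of (x, a + b) - frag_of (x, a) - frag_of (x, b)"
    | r x a where "r \<in> carrier R" "x \<in> carrier L" "z = frag_of (r \<odot>\<^bsub>L\<^esub> x, a) - frag_of (x, r * a)"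
  using assms unfolding Rel_def by auto

lemma Rel_Fg: "Rel \<subseteq> carrier Fg"
proof
  fix z assume "z \<in> Rel"
  then show "z \<in> carrier Fg"
    by (cases rule: Rel_cases) (auto intro!: subgrp_diff[OF subgrp_Fg] Fg_frag)
qed

lemma H_Fg: "H \<subseteq> carrier Fg"
  unfolding H_generate using group.generate_incl[OF Fg_group Rel_Fg] .

lemma subgrp_H: "subgrp H"
  unfolding subgrp_def
proof (intro conjI ballI)
  show "0 \<in> H" using generate.one[of Fg Rel] by (simp add: H_generate Fg_ops)
  fix x y assume xy: "x \<in> H" "y \<in> H"
  then have "inv\<^bsub>Fg\<^esub> y \<in> H" unfolding H_generate
    by (intro group.generate_m_inv_closed[OF Fg_group Rel_Fg])
  moreover have "inv\<^bsub>Fg\<^esub> y = - y" by (rule Fg_ops(3)) (use xy H_Fg in blast)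
  ultimately have "- y \<in> H" by simp
  with xy(1) have "x \<otimes>\<^bsub>Fg\<^esub> - y \<in> H" unfolding H_generate by (rule generate.eng)
  then show "x - y \<in> H" by (simp add: Fg_ops)
qed

lemma H_incl: "Rel \<subseteq> H" unfolding H_generate by (rule subsetI) (rule generate.incl)

text \<open>Induction over the tensor relations: an additively closed property need only be checked
  on the three families of generators.\<close>

lemma H_least:
  assumes U: "subgrp U" "Rel \<subseteq> U" shows "H \<subseteq> U"
proof
  fix z assume "z \<in> H"
  then have "z \<in> generate Fg Rel" by (simp add: H_generate)
  then show "z \<in> U"
  proof (induction rule: generate.induct)
    case one then show ?case using subgrp_0[OF U(1)] by (simp add: Fg_ops)
  next
    case (incl h) then show ?case using U(2) by blast
  next
    case (inv h)
    have "inv\<^bsub>Fg\<^esub> h = - h" by (rule Fg_ops(3)) (use inv Rel_Fg in blast)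
    moreover have "h \<in> U" using inv U(2) by blast
    ultimately show ?case using subgrp_minus[OF U(1)] by simp
  next
    case (eng h1 h2) then show ?case using subgrp_add[OF U(1)] by (simp add: Fg_ops)
  qed
qed

lemma Rel_add_left: "x \<in> carrier L \<Longrightarrow> y \<in> carrier L \<Longrightarrow>
    frag_of (x \<oplus>\<^bsub>L\<^esub> y, a) - frag_of (x, a) - frag_of (y, a) \<in> H"
  by (rule subsetD[OF H_incl]) (auto simp: Rel_def)

lemma Rel_add_right: "x \<in> carrier L \<Longrightarrow> frag_of (x, a + b) - frag_of (x, a) - frag_of (x, b) \<in> H"
  by (rule subsetD[OF H_incl]) (force simp: Rel_def)

lemma Rel_smult: "r \<in> carrier R \<Longrightarrow> x \<in> carrier L \<Longrightarrow> frag_of (r \<odot>\<^bsub>L\<^esub> x, a) - frag_of (x, r * a) \<in> H"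
  by (rule subsetD[OF H_incl]) (force simp: Rel_def)

definition cl :: "('b \<times> 'k \<Rightarrow>\<^sub>0 int) \<Rightarrow> ('b \<times> 'k \<Rightarrow>\<^sub>0 int) set" where "cl z = (+) z ` H"

lemma cl_eq: "cl z = cl z' \<longleftrightarrow> z - z' \<in> H"
  unfolding cl_def by (rule coset_eq_iff[OF subgrp_H])

lemma cl_self: "z \<in> cl z"
  unfolding cl_def by (rule image_eqI[OF _ subgrp_0[OF subgrp_H]]) simp

lemma cl_mem: "z' \<in> cl z \<Longrightarrow> z' - z \<in> H" by (auto simp: cl_def)

lemma r_coset_cl: "H #>\<^bsub>Fg\<^esub> z = cl z"
  by (auto simp: r_coset_def cl_def Fg_ops add.commute)

abbreviation "T \<equiv> scalar_extension R field_ring L"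

lemma T_carrier: "carrier T = cl ` carrier Fg"
  unfolding scalar_extension_def Let_def FactGroup_def RCOSETS_def
  by (auto simp: H_def[symmetric] Fg_def[symmetric] r_coset_cl)

lemma T_closed: "z \<in> carrier Fg \<Longrightarrow> cl z \<in> carrier T" by (simp add: T_carrier)

lemma T_add: "cl z \<oplus>\<^bsub>T\<^esub> cl w = cl (z + w)"
proof -
  have "cl z \<oplus>\<^bsub>T\<^esub> cl w = cl z <#>\<^bsub>Fg\<^esub> cl w"
    unfolding scalar_extension_def Let_def FactGroup_def
    by (simp add: H_def[symmetric] Fg_def)
  also have "\<dots> = cl (z + w)"
  proof (intro equalityI subsetI)
    fix u assume "u \<in> cl z <#>\<^bsub>Fg\<^esub> cl w"
    then obtain h k where "h \<in> H" "k \<in> H" "u = (z + h) + (w + k)"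
      by (auto simp: set_mult_def cl_def Fg_ops)
    then show "u \<in> cl (z + w)" unfolding cl_def
      by (intro image_eqI[of _ _ "h + k"] subgrp_add[OF subgrp_H]) (auto simp: algebra_simps)
  next
    fix u assume "u \<in> cl (z + w)"
    then obtain h where h: "h \<in> H" "u = z + w + h" by (auto simp: cl_def)
    then have "u = z \<otimes>\<^bsub>Fg\<^esub> (w + h)" by (simp add: Fg_ops add.assoc)
    moreover have "z \<in> cl z" "w + h \<in> cl w" using cl_self h(1) by (auto simp: cl_def)
    ultimately show "u \<in> cl z <#>\<^bsub>Fg\<^esub> cl w" unfolding set_mult_def by blast
  qed
  finally show ?thesis .
qed

definition sm :: "'k \<Rightarrow> ('b \<times> 'k \<Rightarrow>\<^sub>0 int) \<Rightarrow> ('b \<times> 'k \<Rightarrow>\<^sub>0 int)" where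
  "sm a = frag_extend (\<lambda>(x, b). frag_of (x, a * b))"

lemma sm_diff: "sm a (z - w) = sm a z - sm a w" by (simp add: sm_def frag_extend_diff)
lemma sm_frag: "sm a (frag_of (x, b)) = frag_of (x, a * b)" by (simp add: sm_def)

lemma sm_H: "z \<in> H \<Longrightarrow> sm a z \<in> H"
proof -
  have "H \<subseteq> {z. sm a z \<in> H}"
  proof (rule H_least)
    have "sm a 0 = 0" by (simp add: sm_def)
    then show "subgrp {z. sm a z \<in> H}"
      using subgrp_0[OF subgrp_H] subgrp_diff[OF subgrp_H] by (auto simp: subgrp_def sm_diff)
    show "Rel \<subseteq> {z. sm a z \<in> H}"
    proof clarify
      fix z assume "z \<in> Rel"
      then show "sm a z \<in> H"
      proof (cases rule: Rel_cases)
        case (1 x y b) then show ?thesis using Rel_add_left by (simp add: sm_diff sm_frag)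
      next
        case (2 x b b') then show ?thesis using Rel_add_right by (simp add: sm_diff sm_frag distrib_left)
      next
        case (3 r x b) then show ?thesis
          using Rel_smult[of r x "a * b"] by (simp add: sm_diff sm_frag mult.left_commute)
      qed
    qed
  qed
  then show "z \<in> H \<Longrightarrow> sm a z \<in> H" by blast
qed

lemma T_smult: "a \<odot>\<^bsub>T\<^esub> cl z = cl (sm a z)"
proof -
  have "a \<odot>\<^bsub>T\<^esub> cl z = (\<Union>z'\<in>cl z. cl (sm a z'))"
    unfolding scalar_extension_def Let_def
    by (simp add: H_def[symmetric] Fg_def[symmetric] r_coset_cl sm_def)
  moreover have "cl (sm a z') = cl (sm a z)" if "z' \<in> cl z" for z'
    unfolding cl_eq sm_diff[symmetric] by (rule sm_H[OF cl_mem[OF that]])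
  then have "(\<Union>z'\<in>cl z. cl (sm a z')) = cl (sm a z)" by (rule UN_eq_const[OF _ cl_self[of z]])
  ultimately show ?thesis by (rule trans)
qed

definition be :: "('b \<times> 'k \<Rightarrow>\<^sub>0 int) \<Rightarrow> ('b \<times> 'k \<Rightarrow>\<^sub>0 int) \<Rightarrow> ('b \<times> 'k \<Rightarrow>\<^sub>0 int)" where
  "be z w = frag_extend (\<lambda>(x, a). frag_extend (\<lambda>(y, b). frag_of (bracket L x y, a * b)) w) z"

lemma be_diff_left: "be (z - z') w = be z w - be z' w" by (simp add: be_def frag_extend_diff)

lemma be_diff_right: "be z (w - w') = be z w - be z w'"
  unfolding be_def frag_extend_diff frag_extend_fun_diff[symmetric]
  by (rule frag_extend_eq) auto

lemma be_frag: "be (frag_of (x, a)) (frag_of (y, b)) = frag_of (bracket L x y, a * b)"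
  by (simp add: be_def)

lemma be_0: "be 0 w = 0" "be z 0 = 0"
  using be_diff_left[of 0 0 w] be_diff_right[of z 0 0] by simp_all

lemma be_right_H:
  assumes x: "x \<in> carrier L" and h: "h \<in> H" shows "be (frag_of (x, a)) h \<in> H"
proof -
  have "H \<subseteq> {h. be (frag_of (x, a)) h \<in> H}"
  proof (rule H_least)
    show "subgrp {h. be (frag_of (x, a)) h \<in> H}"
      using subgrp_0[OF subgrp_H] subgrp_diff[OF subgrp_H] by (auto simp: subgrp_def be_diff_right be_0)
    show "Rel \<subseteq> {h. be (frag_of (x, a)) h \<in> H}"
    proof clarify
      fix z assume "z \<in> Rel"
      then show "be (frag_of (x, a)) z \<in> H"
      proof (cases rule: Rel_cases)
        case (1 y y' b) then show ?thesis
          using Rel_add_left[of "bracket L x y" "bracket L x y'"] x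
          by (simp add: be_diff_right be_frag bracket_add_right bracket_closed)
      next
        case (2 y b b') then show ?thesis
          using Rel_add_right[of "bracket L x y"] x
          by (simp add: be_diff_right be_frag bracket_closed distrib_left)
      next
        case (3 r y b) then show ?thesis
          using Rel_smult[of r "bracket L x y" "a * b"] x
          by (simp add: be_diff_right be_frag bracket_smult_right bracket_closed mult.left_commute)
      qed
    qed
  qed
  then show ?thesis using h by blast
qed

text \<open>Here the fixed argument w is a sum of generators and not a single one as in
  \<open>be_right_H\<close>, so on each relation a second induction over w reduces to one
  generator.\<close>

lemma be_left_H:
  assumes h: "h \<in> H" and w: "w \<in> carrier Fg" shows "be h w \<in> H"
proof -
  have "H \<subseteq> {h. \<forall>w\<in>carrier Fg. be h w \<in> H}"
  proof (rule H_least)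
    show "subgrp {h. \<forall>w\<in>carrier Fg. be h w \<in> H}"
      using subgrp_0[OF subgrp_H] subgrp_diff[OF subgrp_H] by (auto simp: subgrp_def be_diff_left be_0)
    show "Rel \<subseteq> {h. \<forall>w\<in>carrier Fg. be h w \<in> H}"
    proof clarify
      fix z w assume z: "z \<in> Rel" and w: "w \<in> carrier Fg"
      have "Poly_Mapping.keys w \<subseteq> carrier L \<times> UNIV" using w by (simp add: Fg_iff)
      then show "be z w \<in> H"
      proof (induction w rule: frag_induction)
        case zero then show ?case using subgrp_0[OF subgrp_H] by (simp add: be_0)
      next
        case (diff a b) then show ?case using subgrp_diff[OF subgrp_H] by (simp add: be_diff_right)
      next
        case (one yb)
        obtain y b where yb: "yb = (y, b)" "y \<in> carrier L" using one by auto
        have "be z (frag_of (y, b)) \<in> H" using z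
        proof (cases rule: Rel_cases)
          case (1 x x' a) then show ?thesis
            using Rel_add_left[of "bracket L x y" "bracket L x' y"] yb
            by (simp add: be_diff_left be_frag bracket_add_left bracket_closed)
        next
          case (2 x a a') then show ?thesis
            using Rel_add_right[of "bracket L x y"] yb
            by (simp add: be_diff_left be_frag bracket_closed distrib_right)
        next
          case (3 r x a) then show ?thesis
            using Rel_smult[of r "bracket L x y" "a * b"] yb
            by (simp add: be_diff_left be_frag bracket_smult_left bracket_closed mult.assoc)
        qed
        then show ?case by (simp add: yb)
      qed
    qed
  qed
  then show ?thesis using h w by blast
qed

lemma T_bracket:
  assumes x: "x \<in> carrier L" and y: "y \<in> carrier L"
  shows "bracket T (cl (frag_of (x, a))) (cl (frag_of (y, b))) = cl (frag_of (bracket L x y, a * b))"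
proof -
  have "bracket T (cl (frag_of (x, a))) (cl (frag_of (y, b))) =
      (\<Union>z\<in>cl (frag_of (x, a)). \<Union>w\<in>cl (frag_of (y, b)). cl (be z w))"
    unfolding scalar_extension_def Let_def
    by (simp add: H_def[symmetric] Fg_def[symmetric] r_coset_cl be_def)
  moreover have eq: "cl (be z w) = cl (frag_of (bracket L x y, a * b))"
    if z: "z \<in> cl (frag_of (x, a))" and w: "w \<in> cl (frag_of (y, b))" for z w
  proof -
    have wH: "w - frag_of (y, b) \<in> H" by (rule cl_mem[OF w])
    have "w = (w - frag_of (y, b)) + frag_of (y, b)" by simp
    moreover have "w - frag_of (y, b) \<in> carrier Fg" using wH H_Fg by blast
    ultimately have wF: "w \<in> carrier Fg" using subgrp_add[OF subgrp_Fg _ Fg_frag[OF y]] by metis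
    have "be z w - be (frag_of (x, a)) (frag_of (y, b))
        = be (z - frag_of (x, a)) w + be (frag_of (x, a)) (w - frag_of (y, b))"
      by (simp add: be_diff_left be_diff_right)
    also have "\<dots> \<in> H"
      by (rule subgrp_add[OF subgrp_H be_left_H[OF cl_mem[OF z] wF] be_right_H[OF x wH]])
    finally show ?thesis unfolding cl_eq be_frag .
  qed
  have "(\<Union>w\<in>cl (frag_of (y, b)). cl (be z w)) = cl (frag_of (bracket L x y, a * b))"
    if "z \<in> cl (frag_of (x, a))" for z by (rule UN_eq_const[OF eq[OF that] cl_self])
  then have "(\<Union>z\<in>cl (frag_of (x, a)). \<Union>w\<in>cl (frag_of (y, b)). cl (be z w))
      = cl (frag_of (bracket L x y, a * b))"
    by (rule UN_eq_const[OF _ cl_self[of "frag_of (x, a)"]])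
  ultimately show ?thesis by (rule trans)
qed

lemma frag_finsum:
  assumes "finite Y" "Y \<subseteq> B" "\<And>b. b \<in> Y \<Longrightarrow> c b \<in> carrier R"
  shows "frag_of (\<Oplus>\<^bsub>L\<^esub>b\<in>Y. c b \<odot>\<^bsub>L\<^esub> b, a) - (\<Sum>b\<in>Y. frag_of (b, c b * a)) \<in> H"
  using assms
proof (induction Y rule: finite_induct)
  case empty
  have z: "\<zero>\<^bsub>L\<^esub> \<in> carrier L" using M.zero_closed by simp
  have "frag_of (\<zero>\<^bsub>L\<^esub> \<oplus>\<^bsub>L\<^esub> \<zero>\<^bsub>L\<^esub>, a) - frag_of (\<zero>\<^bsub>L\<^esub>, a) - frag_of (\<zero>\<^bsub>L\<^esub>, a) \<in> H"
    by (rule Rel_add_left) simp_all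
  then have "- frag_of (\<zero>\<^bsub>L\<^esub>, a) \<in> H" by simp
  then have "frag_of (\<zero>\<^bsub>L\<^esub>, a) \<in> H" using subgrp_minus[OF subgrp_H] by fastforce
  then show ?case by simp
next
  case (insert b Y)
  have bL: "b \<in> carrier L" "Y \<subseteq> carrier L" using insert basis_carrier by auto
  define s where "s = (\<Oplus>\<^bsub>L\<^esub>b\<in>Y. c b \<odot>\<^bsub>L\<^esub> b)"
  have s: "s \<in> carrier L" unfolding s_def using bL insert by (intro finsum_closed) auto
  have cb: "c b \<odot>\<^bsub>L\<^esub> b \<in> carrier L" using bL insert by simp
  have "(\<Oplus>\<^bsub>L\<^esub>b\<in>insert b Y. c b \<odot>\<^bsub>L\<^esub> b) = c b \<odot>\<^bsub>L\<^esub> b \<oplus>\<^bsub>L\<^esub> s"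
    unfolding s_def using insert bL cb by (intro finsum_insert) auto
  then have "frag_of (\<Oplus>\<^bsub>L\<^esub>b\<in>insert b Y. c b \<odot>\<^bsub>L\<^esub> b, a) - (\<Sum>b\<in>insert b Y. frag_of (b, c b * a))
     = (frag_of (c b \<odot>\<^bsub>L\<^esub> b \<oplus>\<^bsub>L\<^esub> s, a) - frag_of (c b \<odot>\<^bsub>L\<^esub> b, a) - frag_of (s, a))
      + (frag_of (c b \<odot>\<^bsub>L\<^esub> b, a) - frag_of (b, c b * a))
      + (frag_of (s, a) - (\<Sum>b\<in>Y. frag_of (b, c b * a)))"
    using insert by simp
  also have "\<dots> \<in> H"
    using insert bL by (intro subgrp_add[OF subgrp_H] Rel_add_left Rel_smult cb s) (auto simp: s_def)
  finally show ?case .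
qed

lemma \<phi>_cl_add: "z \<in> carrier Fg \<Longrightarrow> w \<in> carrier Fg \<Longrightarrow> \<phi> (cl (z + w)) = \<phi> (cl z) \<oplus>\<^bsub>M\<^esub> \<phi> (cl w)"
  using \<phi>_add[OF T_closed T_closed] by (simp add: T_add)

lemma \<phi>_cl_closed: "z \<in> carrier Fg \<Longrightarrow> \<phi> (cl z) \<in> carrier M"
  using \<phi>_bij T_closed by (auto simp: bij_betw_def)

lemma \<phi>_cl_0: "\<phi> (cl 0) = \<zero>\<^bsub>M\<^esub>"
proof -
  have 0: "0 \<in> carrier Fg" by (rule subgrp_0[OF subgrp_Fg])
  have "\<phi> (cl 0) \<oplus>\<^bsub>M\<^esub> \<phi> (cl 0) = \<phi> (cl 0)" using \<phi>_cl_add[OF 0 0] by simp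
  then show ?thesis using \<phi>_cl_closed[OF 0] M.M.add.r_cancel_one' by metis
qed

text \<open>A representative of the sum of the tensors of bs i with v i. The map \<open>E\<close>
  then carries it to the algebra M and gives coordinates there.\<close>

definition Zs :: "(nat \<Rightarrow> 'b) \<Rightarrow> nat \<Rightarrow> (nat \<Rightarrow> 'k) \<Rightarrow> ('b \<times> 'k \<Rightarrow>\<^sub>0 int)" where
  "Zs bs p v = (\<Sum>i<p. frag_of (bs i, v i))"

definition E :: "(nat \<Rightarrow> 'b) \<Rightarrow> nat \<Rightarrow> (nat \<Rightarrow> 'k) \<Rightarrow> 'h" where
  "E bs p v = \<phi> (cl (Zs bs p v))"

text \<open>The family bs need not exhaust B in what follows: that B is finite is itself deduced
  later from the injectivity of \<open>E\<close> on finite pieces.\<close>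

context
  fixes bs :: "nat \<Rightarrow> 'b" and p :: nat
  assumes bs: "inj_on bs {..<p}" "bs ` {..<p} \<subseteq> B"
begin

lemma bs_L: "i < p \<Longrightarrow> bs i \<in> carrier L" using bs basis_carrier by blast

lemma Zs_Fg: "Zs bs p v \<in> carrier Fg"
  unfolding Zs_def by (intro subgrp_sum[OF subgrp_Fg] Fg_frag bs_L) simp

lemma E_closed: "E bs p v \<in> carrier M" unfolding E_def by (rule \<phi>_cl_closed[OF Zs_Fg])

lemma Zs_add: "Zs bs p (u + v) - (Zs bs p u + Zs bs p v) \<in> H"
proof -
  have "Zs bs p (u + v) - (Zs bs p u + Zs bs p v)
      = (\<Sum>i<p. frag_of (bs i, u i + v i) - frag_of (bs i, u i) - frag_of (bs i, v i))"
    by (simp add: Zs_def sum_subtractf)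
  also have "\<dots> \<in> H" by (intro subgrp_sum[OF subgrp_H] Rel_add_right bs_L) simp
  finally show ?thesis .
qed

lemma E_add: "E bs p (u + v) = E bs p u \<oplus>\<^bsub>M\<^esub> E bs p v"
proof -
  have "cl (Zs bs p (u + v)) = cl (Zs bs p u + Zs bs p v)" unfolding cl_eq by (rule Zs_add)
  then show ?thesis unfolding E_def using \<phi>_cl_add[OF Zs_Fg Zs_Fg] by metis
qed

lemma E_sc: "E bs p (sc a v) = a \<odot>\<^bsub>M\<^esub> E bs p v"
proof -
  have "sm a (Zs bs p v) = Zs bs p (sc a v)"
    by (simp add: Zs_def sm_def frag_extend_sum sc_def)
  then show ?thesis unfolding E_def using \<phi>_smult[OF T_closed[OF Zs_Fg], of a v] by (simp add: T_smult)
qed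

text \<open>The functional sending x tensor a to a times the coordinate of x at bs j respects all
  relations, hence vanishes on H, and on the sum in question it takes the value v j.\<close>

lemma E_inj:
  assumes v: "v \<in> cspace p" and Ev: "E bs p v = \<zero>\<^bsub>M\<^esub>" shows "v = 0"
proof
  fix j
  have 0: "0 \<in> carrier Fg" by (rule subgrp_0[OF subgrp_Fg])
  have "\<phi> (cl (Zs bs p v)) = \<phi> (cl 0)" using Ev \<phi>_cl_0 by (simp add: E_def)
  then have "cl (Zs bs p v) = cl 0"
    using \<phi>_bij T_closed[OF Zs_Fg] T_closed[OF 0] by (auto simp: bij_betw_def dest: inj_onD)
  then have ZH: "Zs bs p v \<in> H" unfolding cl_eq by simp
  show "v j = 0 j"
  proof (cases "j < p")
    case False then show ?thesis using v by (simp add: cspace_def)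
  next
    case True
    define g where "g = (\<lambda>(x, a). co x (bs j) * a)"
    obtain h where h: "h \<in> hom (free_Abelian_group (carrier L \<times> UNIV)) (add_monoid (field_ring :: 'k ring))"
      "\<And>x. x \<in> carrier L \<times> UNIV \<Longrightarrow> h (frag_of x) = g x"
      using comm_group.free_Abelian_group_universal[OF M.R.a_comm_group, of g "carrier L \<times> UNIV"]
      by auto
    have h_add: "h (z + w) = h z + h w" if "z \<in> carrier Fg" "w \<in> carrier Fg" for z w
      using hom_mult[OF h(1), of z w] that by (simp add: Fg_def)
    have h_diff: "h (z - w) = h z - h w" if "z \<in> carrier Fg" "w \<in> carrier Fg" for z w
      using h_add[OF subgrp_diff[OF subgrp_Fg that] that(2)] by simp
    have h0: "h 0 = 0" using h_diff[OF 0 0] by simp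
    have h_frag: "h (frag_of (x, a)) = co x (bs j) * a" if "x \<in> carrier L" for x a
      using h(2)[of "(x, a)"] that by (simp add: g_def)
    have "H \<subseteq> {z \<in> carrier Fg. h z = 0}"
    proof (rule H_least)
      show "subgrp {z \<in> carrier Fg. h z = 0}"
        using 0 h0 h_diff subgrp_diff[OF subgrp_Fg] by (auto simp: subgrp_def)
      show "Rel \<subseteq> {z \<in> carrier Fg. h z = 0}"
      proof clarify
        fix z assume z: "z \<in> Rel"
        have "h z = 0" using z
        proof (cases rule: Rel_cases)
          case (1 x y a)
          then show ?thesis
            by (simp add: h_diff h_frag Fg_frag subgrp_diff[OF subgrp_Fg] co_add distrib_right)
        next
          case (2 x a b)
          then show ?thesis
            by (simp add: h_diff h_frag Fg_frag subgrp_diff[OF subgrp_Fg] distrib_left)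
        next
          case (3 r x a)
          then show ?thesis
            by (simp add: h_diff h_frag Fg_frag co_smult mult_ac)
        qed
        then show "z \<in> carrier Fg \<and> h z = 0" using z Rel_Fg by blast
      qed
    qed
    then have "h (Zs bs p v) = 0" using ZH by blast
    moreover have "h (\<Sum>i\<in>I. frag_of (bs i, v i)) = (\<Sum>i\<in>I. if i = j then v i else 0)" if "I \<subseteq> {..<p}" for I
      using finite_subset[OF that finite_lessThan] that
    proof (induction I rule: finite_induct)
      case (insert i I)
      have "(\<Sum>i\<in>I. frag_of (bs i, v i)) \<in> carrier Fg"
        using insert by (intro subgrp_sum[OF subgrp_Fg] Fg_frag bs_L) auto
      moreover have "co (bs i) (bs j) = (if i = j then 1 else 0)"
      proof -
        have "bs i \<in> B" "bs j = bs i \<longleftrightarrow> j = i"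
          using bs True insert inj_on_eq_iff[OF bs(1), of j i] by auto
        then show ?thesis using co_basis[of "bs i" "bs j"] by auto
      qed
      ultimately show ?case using insert bs_L by (auto simp: h_add Fg_frag h_frag)
    qed (simp add: h0)
    from this[of "{..<p}"] have "h (Zs bs p v) = v j" using True by (simp add: Zs_def sum.delta)
    ultimately show ?thesis by simp
  qed
qed

end

lemma frag_crd:
  assumes bs: "bij_betw bs {..<p} B" and x: "x \<in> carrier L"
  shows "frag_of (x, a) - Zs bs p (sc a (crd bs p x)) \<in> H"
proof -
  have finB: "finite B" using bij_betw_finite[OF bs] by simp
  have "x = (\<Oplus>\<^bsub>L\<^esub>b\<in>B. co x b \<odot>\<^bsub>L\<^esub> b)" by (rule co_sum[OF x finB co_supp[OF x] order_refl])
  then have "frag_of (x, a) - (\<Sum>b\<in>B. frag_of (b, co x b * a)) \<in> H"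
    using frag_finsum[OF finB order_refl, of "co x" a] co_R[OF x] by simp
  also have "(\<Sum>b\<in>B. frag_of (b, co x b * a)) = (\<Sum>i<p. frag_of (bs i, co x (bs i) * a))"
    by (rule sum.reindex_bij_betw[OF bs, symmetric])
  also have "\<dots> = Zs bs p (sc a (crd bs p x))"
    unfolding Zs_def by (rule sum.cong) (auto simp: sc_def crd_def mult.commute)
  finally show ?thesis .
qed

lemma E_crd:
  assumes bs: "bij_betw bs {..<p} B" and x: "x \<in> carrier L"
  shows "E bs p (crd bs p x) = \<phi> (cl (frag_of (x, 1)))"
proof -
  have "cl (frag_of (x, 1)) = cl (Zs bs p (crd bs p x))"
    unfolding cl_eq using frag_crd[OF bs x, of 1] by simp
  then show ?thesis by (simp add: E_def)
qed

lemma E_surj: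
  assumes bs: "bij_betw bs {..<p} B" and m: "m \<in> carrier M"
  shows "\<exists>v\<in>cspace p. m = E bs p v"
proof -
  have bs': "inj_on bs {..<p}" "bs ` {..<p} \<subseteq> B" using bs by (auto simp: bij_betw_def)
  obtain z where z: "z \<in> carrier Fg" "m = \<phi> (cl z)"
    using \<phi>_bij m by (auto simp: bij_betw_def T_carrier)
  have "Poly_Mapping.keys z \<subseteq> carrier L \<times> UNIV" using z by (simp add: Fg_iff)
  then have "\<exists>v\<in>cspace p. z - Zs bs p v \<in> H"
  proof (induction z rule: frag_induction)
    case zero
    have "Zs bs p 0 \<in> H"
    proof -
      have "Zs bs p 0 - Zs bs p 0 - Zs bs p 0 \<in> H" using Zs_add[OF bs', of 0 0] by (simp add: algebra_simps)
      then have "- Zs bs p 0 \<in> H" by simp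
      then show ?thesis using subgrp_minus[OF subgrp_H] by fastforce
    qed
    then have "0 - Zs bs p 0 \<in> H" by (rule subgrp_diff[OF subgrp_H subgrp_0[OF subgrp_H]])
    moreover have "(0 :: nat \<Rightarrow> 'k) \<in> cspace p" by (rule fv.subspace_0[OF subspace_cspace])
    ultimately show ?case by blast
  next
    case (one xa)
    obtain x a where xa: "xa = (x, a)" "x \<in> carrier L" using one by auto
    have "sc a (crd bs p x) \<in> cspace p" by (auto simp: cspace_def sc_def crd_def)
    then show ?case using frag_crd[OF bs xa(2), of a] xa(1) by blast
  next
    case (diff z w)
    then obtain u v where uv: "u \<in> cspace p" "z - Zs bs p u \<in> H" "v \<in> cspace p" "w - Zs bs p v \<in> H" by blast
    have "u - v + v = u" by simp
    then have "Zs bs p u - (Zs bs p (u - v) + Zs bs p v) \<in> H" using Zs_add[OF bs', of "u - v" v] by metis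
    then have "((z - Zs bs p u) - (w - Zs bs p v)) + (Zs bs p u - (Zs bs p (u - v) + Zs bs p v)) \<in> H"
      using uv subgrp_add[OF subgrp_H] subgrp_diff[OF subgrp_H] by blast
    then have "(z - w) - Zs bs p (u - v) \<in> H" by (simp add: algebra_simps)
    then show ?case using fv.subspace_diff[OF subspace_cspace uv(1,3)] by blast
  qed
  then obtain v where v: "v \<in> cspace p" "z - Zs bs p v \<in> H" by blast
  then have "cl z = cl (Zs bs p v)" unfolding cl_eq by blast
  then show ?thesis using v z by (auto simp: E_def)
qed

lemma E_bracket:
  assumes bs: "bij_betw bs {..<p} B" and x: "x \<in> carrier L" and y: "y \<in> carrier L"
  shows "bracket M (E bs p (crd bs p x)) (E bs p (crd bs p y)) = E bs p (crd bs p (bracket L x y))"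
  unfolding E_crd[OF bs x] E_crd[OF bs y] E_crd[OF bs bracket_closed[OF x y]]
  using \<phi>_bracket[OF T_closed[OF Fg_frag[OF x]] T_closed[OF Fg_frag[OF y]], of 1 1]
  by (simp add: T_bracket[OF x y])

end

section \<open>Lower central series as submodules\<close>

context lie_algebra
begin

lemma submodule_span_submodule:
  assumes "Y \<subseteq> carrier L"
  shows "submodule (submodule_span R L Y) R L"
proof -
  have mem: "z \<in> submodule_span R L Y \<longleftrightarrow> (\<forall>N. submodule N R L \<and> Y \<subseteq> N \<longrightarrow> z \<in> N)" for z
    by (auto simp: submodule_span_def hull_def)
  show ?thesis
  proof (rule submoduleI)
    show "submodule_span R L Y \<subseteq> carrier L"
      using carrier_is_submodule assms by (auto simp: mem)
    show "\<zero>\<^bsub>L\<^esub> \<in> submodule_span R L Y"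
      unfolding mem using subgroup.one_closed[OF submodule.axioms(1)] by fastforce
    show "\<And>a. a \<in> submodule_span R L Y \<Longrightarrow> \<ominus>\<^bsub>L\<^esub> a \<in> submodule_span R L Y"
      unfolding mem using submoduleE(3) by blast
    show "\<And>a b. a \<in> submodule_span R L Y \<Longrightarrow> b \<in> submodule_span R L Y \<Longrightarrow> a \<oplus>\<^bsub>L\<^esub> b \<in> submodule_span R L Y"
      unfolding mem using submoduleE(5) by blast
    show "\<And>a x. a \<in> carrier R \<Longrightarrow> x \<in> submodule_span R L Y \<Longrightarrow> a \<odot>\<^bsub>L\<^esub> x \<in> submodule_span R L Y"
      unfolding mem using submoduleE(4) by blast
  qed
qed

lemma lower_central_submodule: "submodule (lower_central R L j) R L"
proof (induction j)
  case (Suc j)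
  have "lower_central R L j \<subseteq> carrier L" by (rule submoduleE(1)[OF Suc])
  then show ?case unfolding lower_central.simps
    by (intro submodule_span_submodule) (auto intro: bracket_closed)
qed (simp add: carrier_is_submodule)

lemma lower_central_subset: "lower_central R L j \<subseteq> carrier L"
  by (rule submoduleE(1)[OF lower_central_submodule])

lemma lower_central_bracket:
  "x \<in> lower_central R L j \<Longrightarrow> y \<in> carrier L \<Longrightarrow> bracket L x y \<in> lower_central R L (Suc j)"
  unfolding lower_central.simps submodule_span_def by (rule hull_inc) blast

lemma lower_central_least:
  assumes "submodule U R L" "\<And>x y. x \<in> lower_central R L j \<Longrightarrow> y \<in> carrier L \<Longrightarrow> bracket L x y \<in> U"
  shows "lower_central R L (Suc j) \<subseteq> U"
  unfolding lower_central.simps submodule_span_def by (rule hull_minimal) (use assms in auto)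

lemma class_ge_2_if_not_abelian:
  assumes "nilpotent_of_class R L c" "\<not> lie_abelian L"
  shows "c \<ge> 2"
proof (rule ccontr)
  assume "\<not> c \<ge> 2"
  then consider "c = 0" | "c = Suc 0" by linarith
  then have "lie_abelian L"
  proof cases
    case 1
    then have "carrier L = {\<zero>\<^bsub>L\<^esub>}" using assms(1) by (simp add: nilpotent_of_class_def)
    then show ?thesis using bracket_self by (auto simp: lie_abelian_def)
  next
    case 2
    then have "lower_central R L (Suc 0) = {\<zero>\<^bsub>L\<^esub>}" using assms(1) by (simp add: nilpotent_of_class_def)
    then show ?thesis using lower_central_bracket[of _ 0] by (auto simp: lie_abelian_def)
  qed
  with assms(2) show False by blast
qed

end

section \<open>The form and its extension in common coordinates\<close>

context lie_form_data
begin

lemma E_zero: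
  assumes "inj_on bs {..<p}" "bs ` {..<p} \<subseteq> B"
  shows "E bs p 0 = \<zero>\<^bsub>M\<^esub>"
proof -
  have "E bs p (sc 0 0) = 0 \<odot>\<^bsub>M\<^esub> E bs p 0" by (rule E_sc[OF assms])
  moreover have "0 \<odot>\<^bsub>M\<^esub> E bs p 0 = \<zero>\<^bsub>M\<^esub>" using M.smult_l_null[OF E_closed[OF assms]] by simp
  moreover have "sc 0 0 = (0 :: nat \<Rightarrow> 'k)" by (simp add: sc_def fun_eq_iff)
  ultimately show ?thesis by simp
qed

lemma E_bij:
  assumes bs: "bij_betw bs {..<p} B"
  shows "bij_betw (E bs p) (cspace p) (carrier M)"
  unfolding bij_betw_def
proof
  have bs': "inj_on bs {..<p}" "bs ` {..<p} \<subseteq> B" using bs by (auto simp: bij_betw_def)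
  show "inj_on (E bs p) (cspace p)"
  proof (rule inj_onI)
    fix u v assume uv: "u \<in> cspace p" "v \<in> cspace p" "E bs p u = E bs p v"
    have "u - v + v = u" by simp
    then have "E bs p (u - v) \<oplus>\<^bsub>M\<^esub> E bs p v = E bs p v" using E_add[OF bs', of "u - v" v] uv(3) by metis
    then have "E bs p (u - v) = \<zero>\<^bsub>M\<^esub>"
      using E_closed[OF bs'] M.M.add.r_cancel_one by simp
    then have "u - v = 0" by (rule E_inj[OF bs' fv.subspace_diff[OF subspace_cspace uv(1,2)]])
    then show "u = v" by simp
  qed
  show "E bs p ` cspace p = carrier M" using E_closed[OF bs'] E_surj[OF bs] by blast
qed

text \<open>An infinite B would contain m + 1 elements, and \<open>E\<close> would embed a space of
  dimension m + 1 into one of dimension m. Once B is finite, \<open>E\<close> is bijective and its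
  inverse gives the other inequality.\<close>

lemma basis_card:
  assumes B': "module_basis field_ring M B'" "finite B'"
  shows "finite B \<and> card B = card B'"
proof -
  interpret M': based_module field_ring M B' by unfold_locales (simp_all add: B'(1))
  define m where "m = card B'"
  obtain bs' where bs': "bij_betw bs' {..<m} B'"
    using ex_bij_betw_nat_finite[OF B'(2)] by (auto simp: m_def atLeast0LessThan)
  define \<psi> where "\<psi> = M'.crd bs' m"
  have \<psi>_bij: "bij_betw \<psi> (carrier M) (cspace m)"
    using M'.crd_bij[OF bs'] by (simp add: \<psi>_def cspace_def)
  have \<psi>_add: "\<psi> (x \<oplus>\<^bsub>M\<^esub> y) = \<psi> x + \<psi> y" if "x \<in> carrier M" "y \<in> carrier M" for x y
    unfolding \<psi>_def by (rule M'.crd_add[OF that])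
  have \<psi>_sc: "\<psi> (a \<odot>\<^bsub>M\<^esub> x) = sc a (\<psi> x)" if "x \<in> carrier M" for a x
    unfolding \<psi>_def by (rule M'.crd_smult) (use that in simp_all)
  have \<psi>_cl: "\<psi> x \<in> cspace m" if "x \<in> carrier M" for x
    using bij_betw_apply[OF \<psi>_bij that] .
  have \<psi>_inj: "x = y" if "x \<in> carrier M" "y \<in> carrier M" "\<psi> x = \<psi> y" for x y
    using \<psi>_bij that by (auto simp: bij_betw_def inj_on_def)
  have \<psi>_0: "\<psi> \<zero>\<^bsub>M\<^esub> = 0"
  proof -
    have z: "\<zero>\<^bsub>M\<^esub> \<in> carrier M" by (rule M.M.zero_closed)
    have "\<psi> \<zero>\<^bsub>M\<^esub> = \<psi> (0 \<odot>\<^bsub>M\<^esub> \<zero>\<^bsub>M\<^esub>)" using M.smult_l_null[OF z] by simp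
    also have "\<dots> = sc 0 (\<psi> \<zero>\<^bsub>M\<^esub>)" by (rule \<psi>_sc[OF z])
    also have "\<dots> = 0" by (simp add: sc_def fun_eq_iff)
    finally show ?thesis .
  qed
  have le: "p \<le> m" if bs: "inj_on bs {..<p}" "bs ` {..<p} \<subseteq> B" for bs p
  proof (rule linear_inj_dim_le[where T = "\<lambda>v. \<psi> (E bs p v)"])
    show "\<psi> (E bs p (u + v)) = \<psi> (E bs p u) + \<psi> (E bs p v)" for u v
      unfolding E_add[OF bs] by (rule \<psi>_add[OF E_closed[OF bs] E_closed[OF bs]])
    show "\<psi> (E bs p (sc a v)) = sc a (\<psi> (E bs p v))" for a v
      unfolding E_sc[OF bs] by (rule \<psi>_sc[OF E_closed[OF bs]])
    show "\<psi> (E bs p v) \<in> cspace m" for v by (rule \<psi>_cl[OF E_closed[OF bs]])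
    show "v = 0" if "v \<in> cspace p" "\<psi> (E bs p v) = 0" for v
      using E_inj[OF bs that(1)] \<psi>_inj[OF E_closed[OF bs] M.M.zero_closed, of v] \<psi>_0 that(2) by simp
  qed
  have fin: "finite B"
  proof (rule ccontr)
    assume "infinite B"
    then obtain Y where Y: "finite Y" "card Y = Suc m" "Y \<subseteq> B"
      using infinite_arbitrarily_large by blast
    obtain bs where "bij_betw bs {..<Suc m} Y"
      using ex_bij_betw_nat_finite[OF Y(1)] Y(2) by (auto simp: atLeast0LessThan)
    then have "Suc m \<le> m" using Y(3) by (intro le[of bs]) (auto simp: bij_betw_def)
    then show False by simp
  qed
  define p where "p = card B"
  obtain bs where bs: "bij_betw bs {..<p} B"
    using ex_bij_betw_nat_finite[OF fin] by (auto simp: p_def atLeast0LessThan)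
  then have bs2: "inj_on bs {..<p}" "bs ` {..<p} \<subseteq> B" by (auto simp: bij_betw_def)
  define e where "e = inv_into (cspace p) (E bs p)"
  have e: "e x \<in> cspace p" "E bs p (e x) = x" if "x \<in> carrier M" for x
    using bij_betw_inv_into_right[OF E_bij[OF bs] that] bij_betw_apply[OF bij_betw_inv_into[OF E_bij[OF bs]] that]
    by (auto simp: e_def)
  have e_eq: "e x = v" if "v \<in> cspace p" "E bs p v = x" for v x
    using bij_betw_inv_into_left[OF E_bij[OF bs] that(1)] that(2) by (simp add: e_def)
  define f where "f = inv_into (carrier M) \<psi>"
  have f: "f v \<in> carrier M" "\<psi> (f v) = v" if "v \<in> cspace m" for v
    using bij_betw_inv_into_right[OF \<psi>_bij that] bij_betw_apply[OF bij_betw_inv_into[OF \<psi>_bij] that]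
    by (auto simp: f_def)
  have f_eq: "f v = x" if "x \<in> carrier M" "\<psi> x = v" for v x
    using bij_betw_inv_into_left[OF \<psi>_bij that(1)] that(2) by (simp add: f_def)
  have "m \<le> p"
  proof (rule linear_inj_dim_le[where T = "\<lambda>v. e (f v)"])
    show "e (f (u + v)) = e (f u) + e (f v)" if uv: "u \<in> cspace m" "v \<in> cspace m" for u v
    proof -
      have "f (u + v) = f u \<oplus>\<^bsub>M\<^esub> f v"
        by (rule f_eq) (simp_all add: \<psi>_add f uv)
      moreover have "e (f u \<oplus>\<^bsub>M\<^esub> f v) = e (f u) + e (f v)"
        by (rule e_eq) (simp_all add: E_add[OF bs2] e f uv fv.subspace_add[OF subspace_cspace])
      ultimately show ?thesis by simp
    qed
    show "e (f (sc a v)) = sc a (e (f v))" if v: "v \<in> cspace m" for a v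
    proof -
      have "f (sc a v) = a \<odot>\<^bsub>M\<^esub> f v"
        by (rule f_eq) (simp_all add: \<psi>_sc f v M.smult_closed)
      moreover have "e (a \<odot>\<^bsub>M\<^esub> f v) = sc a (e (f v))"
        by (rule e_eq) (simp_all add: E_sc[OF bs2] e f v fv.subspace_scale[OF subspace_cspace])
      ultimately show ?thesis by simp
    qed
    show "e (f v) \<in> cspace p" if "v \<in> cspace m" for v by (rule e(1)[OF f(1)[OF that]])
    show "v = 0" if v: "v \<in> cspace m" and 0: "e (f v) = 0" for v
    proof -
      have "f v = \<zero>\<^bsub>M\<^esub>" using e(2)[OF f(1)[OF v]] 0 E_zero[OF bs2] by simp
      then show ?thesis using f(2)[OF v] \<psi>_0 by simp
    qed
  qed
  then show ?thesis using fin le[OF bs2] by (simp add: p_def m_def)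
qed

text \<open>Bracket and lower central series of M are pulled back along \<open>E\<close>.
  Coordinates of L lie in R^n, and \<open>E\<close> sends those of x to the image of x tensor 1, so
  the bracket of L is the restriction of br.\<close>

lemma ex_max_class_bracket:
  assumes mc: "maximal_class field_ring M" and na: "\<not> lie_abelian M"
  shows "\<exists>n c br G \<kappa>. max_class_bracket n c br G \<and>
    bij_betw \<kappa> (carrier L) {v. (\<forall>i<n. v i \<in> carrier R) \<and> (\<forall>i\<ge>n. v i = 0)} \<and>
    (\<forall>x\<in>carrier L. \<forall>y\<in>carrier L. \<kappa> (x \<oplus>\<^bsub>L\<^esub> y) = \<kappa> x + \<kappa> y) \<and>
    (\<forall>r\<in>carrier R. \<forall>x\<in>carrier L. \<kappa> (r \<odot>\<^bsub>L\<^esub> x) = sc r (\<kappa> x)) \<and>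
    (\<forall>x\<in>carrier L. \<forall>y\<in>carrier L. \<kappa> (bracket L x y) = br (\<kappa> x) (\<kappa> y))"
proof -
  obtain B' c where B': "finite B'" "module_basis field_ring M B'" "card B' = c + 1"
    and nil: "nilpotent_of_class field_ring M c"
    using mc by (auto simp: maximal_class_def)
  define n where "n = card B"
  have fin: "finite B" and nc: "n = c + 1" using basis_card[OF B'(2,1)] B'(3) by (simp_all add: n_def)
  obtain bs where bs: "bij_betw bs {..<n} B"
    using ex_bij_betw_nat_finite[OF fin] by (auto simp: n_def atLeast0LessThan)
  then have bs': "inj_on bs {..<n}" "bs ` {..<n} \<subseteq> B" by (auto simp: bij_betw_def)
  define e where "e = E bs n"
  define f where "f = inv_into (cspace n) e"
  have e_bij: "bij_betw e (cspace n) (carrier M)" unfolding e_def by (rule E_bij[OF bs])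
  have e_cl: "e v \<in> carrier M" for v unfolding e_def by (rule E_closed[OF bs'])
  have e_add: "e (u + v) = e u \<oplus>\<^bsub>M\<^esub> e v" for u v unfolding e_def by (rule E_add[OF bs'])
  have e_sc: "e (sc a v) = a \<odot>\<^bsub>M\<^esub> e v" for a v unfolding e_def by (rule E_sc[OF bs'])
  have e_0: "e 0 = \<zero>\<^bsub>M\<^esub>" unfolding e_def by (rule E_zero[OF bs'])
  have f_cl: "f x \<in> cspace n" and ef: "e (f x) = x" if "x \<in> carrier M" for x
    using bij_betw_inv_into_right[OF e_bij that] bij_betw_apply[OF bij_betw_inv_into[OF e_bij] that]
    by (auto simp: f_def)
  have f_eq: "f x = v" if "v \<in> cspace n" "e v = x" for v x
    using bij_betw_inv_into_left[OF e_bij that(1)] that(2) by (simp add: f_def)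
  define br where "br u v = f (bracket M (e u) (e v))" for u v
  define G where "G j = {v \<in> cspace n. e v \<in> lower_central field_ring M j}" for j
  have e_br: "e (br u v) = bracket M (e u) (e v)" for u v
    unfolding br_def by (rule ef[OF M.bracket_closed[OF e_cl e_cl]])
  have br_cl: "br u v \<in> cspace n" for u v
    unfolding br_def by (rule f_cl[OF M.bracket_closed[OF e_cl e_cl]])
  have br_eq: "br u v = z" if "z \<in> cspace n" "e z = bracket M (e u) (e v)" for u v z
    unfolding br_def by (rule f_eq[OF that])
  have sub: "submodule (lower_central field_ring M j) field_ring M" for j
    by (rule M.lower_central_submodule)
  have V0: "(0 :: nat \<Rightarrow> 'k) \<in> cspace n" by (rule fv.subspace_0[OF subspace_cspace])
  have lc_0: "\<zero>\<^bsub>M\<^esub> \<in> lower_central field_ring M j" for j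
    using subgroup.one_closed[OF submodule.axioms(1)[OF sub]] by simp
  have single: "G j = {0} \<longleftrightarrow> lower_central field_ring M j = {\<zero>\<^bsub>M\<^esub>}" for j
  proof
    assume G: "G j = {0}"
    have "x = \<zero>\<^bsub>M\<^esub>" if x: "x \<in> lower_central field_ring M j" for x
    proof -
      have xM: "x \<in> carrier M" using M.lower_central_subset x by blast
      then have "f x \<in> G j" using f_cl ef x by (simp add: G_def)
      then have "f x = 0" using G by blast
      then show ?thesis using ef[OF xM] e_0 by simp
    qed
    then show "lower_central field_ring M j = {\<zero>\<^bsub>M\<^esub>}" using lc_0 by blast
  next
    assume lc: "lower_central field_ring M j = {\<zero>\<^bsub>M\<^esub>}"
    have "v = 0" if "v \<in> cspace n" "e v = \<zero>\<^bsub>M\<^esub>" for v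
      using f_eq[OF that] f_eq[OF V0 e_0] by simp
    then show "G j = {0}" using lc V0 e_0 by (auto simp: G_def)
  qed
  have "max_class_bracket n c br G"
  proof
    show "n = c + 1" by (rule nc)
    show "c \<ge> 2" by (rule M.class_ge_2_if_not_abelian[OF nil na])
    show "br x y \<in> cspace n" for x y by (rule br_cl)
    show "br (x + y) z = br x z + br y z" for x y z
      by (rule br_eq) (simp_all add: e_add e_br M.bracket_add_left e_cl fv.subspace_add[OF subspace_cspace] br_cl)
    show "br x (y + z) = br x y + br x z" for x y z
      by (rule br_eq) (simp_all add: e_add e_br M.bracket_add_right e_cl fv.subspace_add[OF subspace_cspace] br_cl)
    show "br (sc a x) y = sc a (br x y)" for a x y
      by (rule br_eq) (simp_all add: e_sc e_br M.bracket_smult_left e_cl fv.subspace_scale[OF subspace_cspace] br_cl)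
    show "br x (sc a y) = sc a (br x y)" for a x y
      by (rule br_eq) (simp_all add: e_sc e_br M.bracket_smult_right e_cl fv.subspace_scale[OF subspace_cspace] br_cl)
    show "br x x = 0" for x
      by (rule br_eq) (simp_all add: V0 e_0 M.bracket_self e_cl)
    show "G 0 = cspace n" using e_cl by (auto simp: G_def)
    show "fv.subspace (G j)" for j
      unfolding fv.subspace_def
    proof (intro conjI ballI allI)
      show "0 \<in> G j" using V0 lc_0 e_0 by (simp add: G_def)
      show "x + y \<in> G j" if "x \<in> G j" "y \<in> G j" for x y
        using that by (simp add: G_def e_add fv.subspace_add[OF subspace_cspace] M.submoduleE(5)[OF sub])
      show "sc a x \<in> G j" if "x \<in> G j" for a x
        using that by (simp add: G_def e_sc fv.subspace_scale[OF subspace_cspace] M.submoduleE(4)[OF sub])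
    qed
    show "G c = {0}" unfolding single using nil by (simp add: nilpotent_of_class_def)
    show "G j \<noteq> {0}" if "j < c" for j unfolding single using nil that by (simp add: nilpotent_of_class_def)
    show "br x y \<in> G (Suc j)" if "x \<in> G j" for j x y
    proof -
      have "bracket M (e x) (e y) \<in> lower_central field_ring M (Suc j)"
        by (rule M.lower_central_bracket) (use that e_cl in \<open>auto simp: G_def\<close>)
      then show ?thesis unfolding G_def mem_Collect_eq e_br using br_cl by blast
    qed
    show "G (Suc j) \<subseteq> U"
      if U: "fv.subspace U" "U \<subseteq> cspace n" "\<And>x y. x \<in> G j \<Longrightarrow> y \<in> cspace n \<Longrightarrow> br x y \<in> U" for j U
    proof -
      have "submodule (e ` U) field_ring M"
      proof (rule M.submoduleI)
        show "e ` U \<subseteq> carrier M" using e_cl by blast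
        show "\<zero>\<^bsub>M\<^esub> \<in> e ` U" using fv.subspace_0[OF U(1)] e_0 by (metis imageI)
        show add: "a \<oplus>\<^bsub>M\<^esub> b \<in> e ` U" if ab: "a \<in> e ` U" "b \<in> e ` U" for a b
        proof -
          obtain u v where uv: "u \<in> U" "v \<in> U" "a = e u" "b = e v" using ab by blast
          show ?thesis unfolding uv e_add[symmetric] by (rule imageI[OF fv.subspace_add[OF U(1) uv(1,2)]])
        qed
        show sm: "a \<odot>\<^bsub>M\<^esub> x \<in> e ` U" if x: "x \<in> e ` U" for a x
        proof -
          obtain u where u: "u \<in> U" "x = e u" using x by blast
          show ?thesis unfolding u e_sc[symmetric] by (rule imageI[OF fv.subspace_scale[OF U(1) u(1)]])
        qed
        show "\<ominus>\<^bsub>M\<^esub> a \<in> e ` U" if a: "a \<in> e ` U" for a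
        proof -
          obtain u where u: "u \<in> U" "a = e u" using a by blast
          have "u + sc (- 1) u = 0" by (simp add: sc_def fun_eq_iff)
          then have "a \<oplus>\<^bsub>M\<^esub> e (sc (- 1) u) = \<zero>\<^bsub>M\<^esub>" unfolding u e_add[symmetric] by (simp add: e_0)
          then have "\<ominus>\<^bsub>M\<^esub> a = e (sc (- 1) u)"
            using e_cl u by (intro M.M.minus_equality) (simp_all add: M.M.a_comm)
          then show ?thesis using fv.subspace_scale[OF U(1) u(1)] by blast
        qed
      qed
      moreover have "bracket M x y \<in> e ` U" if x: "x \<in> lower_central field_ring M j" and y: "y \<in> carrier M" for x y
      proof -
        have xM: "x \<in> carrier M" using x M.lower_central_subset by blast
        have "f x \<in> G j" using x f_cl[OF xM] ef[OF xM] by (simp add: G_def)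
        then have "br (f x) (f y) \<in> U" using U(3) f_cl[OF y] by blast
        moreover have "e (br (f x) (f y)) = bracket M x y" unfolding e_br ef[OF xM] ef[OF y] ..
        ultimately show ?thesis by (metis imageI)
      qed
      ultimately have le: "lower_central field_ring M (Suc j) \<subseteq> e ` U" by (rule M.lower_central_least)
      show ?thesis
      proof
        fix v assume "v \<in> G (Suc j)"
        then have v: "v \<in> cspace n" "e v \<in> e ` U" using le by (auto simp: G_def)
        from v(2) obtain u where u: "u \<in> U" "e v = e u" by blast
          have "f (e v) = v" by (rule f_eq[OF v(1) refl])
          moreover have "f (e v) = u" by (rule f_eq) (use u U(2) in auto)
          ultimately show "v \<in> U" using u(1) by simp
      qed
    qed
  qed
  moreover have "crd bs n (bracket L x y) = br (crd bs n x) (crd bs n y)"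
    if "x \<in> carrier L" "y \<in> carrier L" for x y
    by (rule br_eq[symmetric]) (use that E_bracket[OF bs that] in \<open>auto simp: e_def crd_def cspace_def\<close>)
  ultimately show ?thesis
    by (intro exI[of _ n] exI[of _ c] exI[of _ br] exI[of _ G] exI[of _ "crd bs n"])
      (simp add: crd_bij[OF bs] crd_add crd_smult)
qed

end

section \<open>The abscissa\<close>

text \<open>The passage from ideals and cosets of the algebra record to subgroups of a type-class
  group, where all counting has taken place.\<close>

lemma (in lie_algebra) ideal_transport:
  fixes \<kappa> :: "'b \<Rightarrow> 'v::ab_group_add" and \<sigma> :: "'a \<Rightarrow> 'v \<Rightarrow> 'v"
  assumes bij: "bij_betw \<kappa> (carrier L) \<Lambda>"
    and add: "\<And>x y. x \<in> carrier L \<Longrightarrow> y \<in> carrier L \<Longrightarrow> \<kappa> (x \<oplus>\<^bsub>L\<^esub> y) = \<kappa> x + \<kappa> y"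
    and smult: "\<And>r x. r \<in> carrier R \<Longrightarrow> x \<in> carrier L \<Longrightarrow> \<kappa> (r \<odot>\<^bsub>L\<^esub> x) = \<sigma> r (\<kappa> x)"
    and brk: "\<And>x y. x \<in> carrier L \<Longrightarrow> y \<in> carrier L \<Longrightarrow> \<kappa> (bracket L x y) = br (\<kappa> x) (\<kappa> y)"
  shows "bij_betw ((`) \<kappa>) (finite_index_ideals R L)
      {J. subgrp J \<and> (\<forall>r\<in>carrier R. \<forall>v\<in>J. \<sigma> r v \<in> J) \<and> J \<subseteq> \<Lambda> \<and> finite (coset_set \<Lambda> J) \<and>
        (\<forall>u\<in>\<Lambda>. \<forall>v\<in>J. br u v \<in> J)}" (is "bij_betw _ _ ?T")
    and "I \<in> finite_index_ideals R L \<Longrightarrow> card (a_rcosets\<^bsub>L\<^esub> I) = idx \<Lambda> (\<kappa> ` I)"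
proof -
  have inj: "inj_on \<kappa> (carrier L)" and im: "\<kappa> ` carrier L = \<Lambda>" using bij by (auto simp: bij_betw_def)
  have \<kappa>0: "\<kappa> \<zero>\<^bsub>L\<^esub> = 0" using add[of "\<zero>\<^bsub>L\<^esub>" "\<zero>\<^bsub>L\<^esub>"] by simp
  have neg: "\<kappa> (\<ominus>\<^bsub>L\<^esub> x) = - \<kappa> x" if "x \<in> carrier L" for x
    using add[OF that M.a_inv_closed[OF that]] that \<kappa>0 by (simp add: M.r_neg eq_neg_iff_add_eq_0 add.commute)
  have coset: "\<kappa> ` (I +>\<^bsub>L\<^esub> x) = (+) (\<kappa> x) ` \<kappa> ` I" if I: "I \<subseteq> carrier L" and x: "x \<in> carrier L" for I x
  proof -
    have "I +>\<^bsub>L\<^esub> x = (\<lambda>h. h \<oplus>\<^bsub>L\<^esub> x) ` I" by (auto simp: a_r_coset_def')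
    then show ?thesis using I x by (auto simp: image_image add add.commute subset_iff intro!: image_cong)
  qed
  have cosets: "coset_set \<Lambda> (\<kappa> ` I) = (`) \<kappa> ` (a_rcosets\<^bsub>L\<^esub> I)" and coset_inj: "inj_on ((`) \<kappa>) (a_rcosets\<^bsub>L\<^esub> I)"
    if I: "I \<subseteq> carrier L" for I
  proof -
    have eq: "a_rcosets\<^bsub>L\<^esub> I = (\<lambda>x. I +>\<^bsub>L\<^esub> x) ` carrier L" by (auto simp: A_RCOSETS_def')
    show "coset_set \<Lambda> (\<kappa> ` I) = (`) \<kappa> ` (a_rcosets\<^bsub>L\<^esub> I)"
      unfolding coset_set_def eq im[symmetric] image_image
      by (rule image_cong[OF refl]) (use coset[OF I] in \<open>simp add: image_image\<close>)
    show "inj_on ((`) \<kappa>) (a_rcosets\<^bsub>L\<^esub> I)"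
    proof (rule inj_on_image, rule inj_on_subset[OF inj])
      show "\<Union> (a_rcosets\<^bsub>L\<^esub> I) \<subseteq> carrier L"
        unfolding eq using I by (auto simp: a_r_coset_def')
    qed
  qed
  have sub: "I \<subseteq> carrier L" if "I \<in> finite_index_ideals R L" for I
    using that submoduleE(1) by (simp add: finite_index_ideals_def lie_ideal_def)
  show "card (a_rcosets\<^bsub>L\<^esub> I) = idx \<Lambda> (\<kappa> ` I)" if "I \<in> finite_index_ideals R L"
    unfolding idx_def cosets[OF sub[OF that]] by (rule card_image[OF coset_inj[OF sub[OF that]], symmetric])
  show "bij_betw ((`) \<kappa>) (finite_index_ideals R L) ?T"
    unfolding bij_betw_def
  proof
    show "inj_on ((`) \<kappa>) (finite_index_ideals R L)"
      by (rule inj_on_image, rule inj_on_subset[OF inj]) (use sub in blast)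
    show "(`) \<kappa> ` finite_index_ideals R L = ?T"
    proof (intro equalityI subsetI)
      fix J assume "J \<in> (`) \<kappa> ` finite_index_ideals R L"
      then obtain I where I: "I \<in> finite_index_ideals R L" and J: "J = \<kappa> ` I" by blast
      have IL: "I \<subseteq> carrier L" by (rule sub[OF I])
      have sm: "submodule I R L" and ideal: "\<And>x y. x \<in> carrier L \<Longrightarrow> y \<in> I \<Longrightarrow> bracket L x y \<in> I"
        and fin: "finite (a_rcosets\<^bsub>L\<^esub> I)"
        using I by (auto simp: finite_index_ideals_def lie_ideal_def)
      have "subgrp J"
        unfolding subgrp_def J
      proof (intro conjI ballI)
        have "\<zero>\<^bsub>L\<^esub> \<in> I" using subgroup.one_closed[OF submodule.axioms(1)[OF sm]] by simp
        then show "0 \<in> \<kappa> ` I" using \<kappa>0 by (metis imageI)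
        fix u v assume "u \<in> \<kappa> ` I" "v \<in> \<kappa> ` I"
        then obtain x y where xy: "x \<in> I" "y \<in> I" "u = \<kappa> x" "v = \<kappa> y" by blast
        have xyL: "x \<in> carrier L" "y \<in> carrier L" using xy IL by blast+
        have "x \<oplus>\<^bsub>L\<^esub> \<ominus>\<^bsub>L\<^esub> y \<in> I" using submoduleE(3,5)[OF sm] xy by blast
        moreover have "\<kappa> (x \<oplus>\<^bsub>L\<^esub> \<ominus>\<^bsub>L\<^esub> y) = u - v"
          using add[OF xyL(1) M.a_inv_closed[OF xyL(2)]] neg[OF xyL(2)] xy by simp
        ultimately show "u - v \<in> \<kappa> ` I" by (metis imageI)
      qed
      moreover have "\<sigma> r v \<in> J" if r: "r \<in> carrier R" and v: "v \<in> J" for r v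
      proof -
        obtain x where x: "x \<in> I" "v = \<kappa> x" using v J by blast
        then have "\<sigma> r v = \<kappa> (r \<odot>\<^bsub>L\<^esub> x)" using smult[OF r, of x] IL by auto
        then show ?thesis using submoduleE(4)[OF sm r x(1)] J by blast
      qed
      moreover have "br u v \<in> J" if u: "u \<in> \<Lambda>" and v: "v \<in> J" for u v
      proof -
        obtain x where x: "x \<in> I" "v = \<kappa> x" using v J by blast
        obtain y where y: "y \<in> carrier L" "u = \<kappa> y" using u im by blast
        have "br u v = \<kappa> (bracket L y x)" using brk[of y x] IL x y by auto
        then show ?thesis using ideal[OF y(1) x(1)] J by blast
      qed
      moreover have "finite (coset_set \<Lambda> J)" unfolding J cosets[OF IL] using fin by simp
      moreover have "J \<subseteq> \<Lambda>" using IL im J by blast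
      ultimately show "J \<in> ?T" by blast
    next
      fix J assume J: "J \<in> ?T"
      define I where "I = {x \<in> carrier L. \<kappa> x \<in> J}"
      have IL: "I \<subseteq> carrier L" by (auto simp: I_def)
      have \<kappa>I: "\<kappa> ` I = J" using J im by (auto simp: I_def)
      have sg: "subgrp J" using J by blast
      have "submodule I R L"
      proof (rule submoduleI)
        show "I \<subseteq> carrier L" by (rule IL)
        show "\<zero>\<^bsub>L\<^esub> \<in> I" using \<kappa>0 subgrp_0[OF sg] by (simp add: I_def)
        show "\<ominus>\<^bsub>L\<^esub> a \<in> I" if "a \<in> I" for a
          using that neg subgrp_minus[OF sg] by (simp add: I_def)
        show "a \<oplus>\<^bsub>L\<^esub> b \<in> I" if "a \<in> I" "b \<in> I" for a b
          using that add subgrp_add[OF sg] by (simp add: I_def)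
        show "a \<odot>\<^bsub>L\<^esub> x \<in> I" if "a \<in> carrier R" "x \<in> I" for a x
          using that smult J by (simp add: I_def)
      qed
      moreover have "bracket L x y \<in> I" if x: "x \<in> carrier L" and y: "y \<in> I" for x y
      proof -
        have y': "y \<in> carrier L" "\<kappa> y \<in> J" using y by (auto simp: I_def)
        have "br (\<kappa> x) (\<kappa> y) \<in> J" using J y'(2) im x by blast
        then show ?thesis using brk[OF x y'(1)] bracket_closed[OF x y'(1)] by (simp add: I_def)
      qed
      moreover have "finite (a_rcosets\<^bsub>L\<^esub> I)"
      proof (rule finite_imageD[OF _ coset_inj[OF IL]])
        show "finite ((`) \<kappa> ` (a_rcosets\<^bsub>L\<^esub> I))" using J unfolding cosets[OF IL, symmetric] \<kappa>I by blast
      qed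
      ultimately have "I \<in> finite_index_ideals R L" by (auto simp: finite_index_ideals_def lie_ideal_def)
      then show "J \<in> (`) \<kappa> ` finite_index_ideals R L" using \<kappa>I by blast
    qed
  qed
qed

theorem proposition6p2:
  fixes S :: "('k::field_char_0 \<Rightarrow> real) set set"
    and \<gg> :: "('k, 'g) lie_alg"
    and \<hh> :: "('k, 'h) lie_alg"
  assumes "number_field TYPE('k)"
    and "S \<subseteq> nonarch_places" and "finite S"
    and "lie_algebra (field_ring :: 'k ring) \<hh>"
    and "maximal_class field_ring \<hh>"
    and "\<not> lie_abelian \<hh>"
    and "lie_form (S_integers S) field_ring \<gg> \<hh>"
  shows "ideal_zeta_abscissa (S_integers S) \<gg> = 2"
proof -
  define R where "R = carrier (S_integers S)"
  obtain B :: "'k set" and w :: "'k \<Rightarrow> 'k" where B: "order_basis B w"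
    using number_field_order[OF assms(1)] by blast
  interpret overring B w R unfolding R_def by (rule order_basis.overring_S_integers[OF B assms(2)])
  have lie: "lie_algebra (S_integers S) \<gg>" and free: "free_module (S_integers S) \<gg>"
    and iso: "lie_iso field_ring (scalar_extension (S_integers S) field_ring \<gg>) \<hh>"
    using assms(7) by (auto simp: lie_form_def)
  interpret g: lie_algebra "S_integers S" \<gg> by (rule lie)
  obtain C where C: "module_basis (S_integers S) \<gg> C" using free by (auto simp: free_module_def)
  obtain \<phi> where \<phi>: "bij_betw \<phi> (carrier (scalar_extension (S_integers S) field_ring \<gg>)) (carrier \<hh>)"
    "\<And>x y. x \<in> carrier (scalar_extension (S_integers S) field_ring \<gg>) \<Longrightarrow>
        y \<in> carrier (scalar_extension (S_integers S) field_ring \<gg>) \<Longrightarrow>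
        \<phi> (x \<oplus>\<^bsub>scalar_extension (S_integers S) field_ring \<gg>\<^esub> y) = \<phi> x \<oplus>\<^bsub>\<hh>\<^esub> \<phi> y"
    "\<And>a x. x \<in> carrier (scalar_extension (S_integers S) field_ring \<gg>) \<Longrightarrow>
        \<phi> (a \<odot>\<^bsub>scalar_extension (S_integers S) field_ring \<gg>\<^esub> x) = a \<odot>\<^bsub>\<hh>\<^esub> \<phi> x"
    "\<And>x y. x \<in> carrier (scalar_extension (S_integers S) field_ring \<gg>) \<Longrightarrow>
        y \<in> carrier (scalar_extension (S_integers S) field_ring \<gg>) \<Longrightarrow>
        \<phi> (bracket (scalar_extension (S_integers S) field_ring \<gg>) x y) = bracket \<hh> (\<phi> x) (\<phi> y)"
    using iso unfolding lie_iso_def by (elim exE conjE) (rule that, auto)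
  interpret h: lie_algebra field_ring \<hh> by (rule assms(4))
  interpret form: lie_form_data "S_integers S" \<gg> C \<hh> \<phi>
  proof unfold_locales
    show "a \<oplus>\<^bsub>S_integers S\<^esub> b = a + b" "a \<otimes>\<^bsub>S_integers S\<^esub> b = a * b"
      "\<zero>\<^bsub>S_integers S\<^esub> = 0" "\<one>\<^bsub>S_integers S\<^esub> = 1" for a b
      by (simp_all add: S_integers_def)
  qed (fact C \<phi>)+
  obtain n c br G \<kappa> where mcb: "max_class_bracket n c br G"
    and \<kappa>: "bij_betw \<kappa> (carrier \<gg>) {v. (\<forall>i<n. v i \<in> R) \<and> (\<forall>i\<ge>n. v i = 0)}"
    "\<forall>x\<in>carrier \<gg>. \<forall>y\<in>carrier \<gg>. \<kappa> (x \<oplus>\<^bsub>\<gg>\<^esub> y) = \<kappa> x + \<kappa> y"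
    "\<forall>r\<in>R. \<forall>x\<in>carrier \<gg>. \<kappa> (r \<odot>\<^bsub>\<gg>\<^esub> x) = sc r (\<kappa> x)"
    "\<forall>x\<in>carrier \<gg>. \<forall>y\<in>carrier \<gg>. \<kappa> (bracket \<gg> x y) = br (\<kappa> x) (\<kappa> y)"
    using form.ex_max_class_bracket[OF assms(5,6), folded R_def]
    by (elim exE conjE) (rule that)
  have \<kappa>_lat: "bij_betw \<kappa> (carrier \<gg>) (lat n)" using \<kappa>(1) by (simp add: lat_def)
  have br_lat: "br u v \<in> lat n" if uv: "u \<in> lat n" "v \<in> lat n" for u v
  proof -
    have "u \<in> \<kappa> ` carrier \<gg>" "v \<in> \<kappa> ` carrier \<gg>" using bij_betw_imp_surj_on[OF \<kappa>_lat] uv by simp_all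
    then obtain x y where xy: "x \<in> carrier \<gg>" "y \<in> carrier \<gg>" "u = \<kappa> x" "v = \<kappa> y" by blast
    then have "br u v = \<kappa> (bracket \<gg> x y)" using \<kappa>(4) by simp
    then show ?thesis using bij_betw_apply[OF \<kappa>_lat g.bracket_closed[OF xy(1,2)]] by simp
  qed
  obtain x y where "max_class_order B w R n c br G x y"
    using max_class_order_exists[OF overring_axioms mcb br_lat] by blast
  then interpret max_class_order B w R n c br G x y .
  define \<I> where "\<I> = finite_index_ideals (S_integers S) \<gg>"
  have "{J. subgrp J \<and> (\<forall>r\<in>carrier (S_integers S). \<forall>v\<in>J. sc r v \<in> J) \<and> J \<subseteq> lat n \<and> finite (coset_set (lat n) J) \<and>
        (\<forall>u\<in>lat n. \<forall>v\<in>J. br u v \<in> J)} = brideals"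
    unfolding R_def[symmetric] by (auto simp: brideals_def fmod_def submod_def)
  then have \<I>_bij: "bij_betw ((`) \<kappa>) \<I> brideals"
    using g.ideal_transport(1)[OF \<kappa>_lat \<kappa>(2)[rule_format] \<kappa>(3)[unfolded R_def, rule_format] \<kappa>(4)[rule_format]] by (simp add: \<I>_def)
  have \<I>_card: "card (a_rcosets\<^bsub>\<gg>\<^esub> I) = idx (lat n) (\<kappa> ` I)" if "I \<in> \<I>" for I
    using g.ideal_transport(2)[OF \<kappa>_lat \<kappa>(2)[rule_format] \<kappa>(3)[unfolded R_def, rule_format] \<kappa>(4)[rule_format]] that by (simp add: \<I>_def)
  have norm_term: "norm (ideal_zeta_term \<gg> s I) = real (idx (lat n) (\<kappa> ` I)) powr (- Re s)" if "I \<in> \<I>" for s I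
    unfolding ideal_zeta_term_def \<I>_card[OF that] by (subst norm_powr_real_powr) auto
  have sum_term: "(\<Sum>I\<in>F. norm (ideal_zeta_term \<gg> s I)) = (\<Sum>J\<in>(`) \<kappa> ` F. real (idx (lat n) J) powr (- Re s))"
    if F: "F \<subseteq> \<I>" for F s
  proof -
    have "inj_on ((`) \<kappa>) F" using \<I>_bij F by (auto simp: bij_betw_def intro: inj_on_subset)
    then show ?thesis using norm_term F by (auto simp: sum.reindex intro!: sum.cong)
  qed
  have conv: "ideal_zeta_term \<gg> s summable_on \<I>" if s: "Re s > 2" for s
  proof -
    obtain Z where Z: "\<And>F. finite F \<and> F \<subseteq> brideals \<Longrightarrow> (\<Sum>J\<in>F. real (idx (lat n) J) powr (- Re s)) \<le> Z"
      using ideal_sum_upper[OF s] by blast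
    have "(\<lambda>I. norm (ideal_zeta_term \<gg> s I)) summable_on \<I>"
      unfolding abs_summable_iff_bdd_above
    proof (rule bdd_aboveI2)
      fix F assume "F \<in> {F. F \<subseteq> \<I> \<and> finite F}"
      then have F: "F \<subseteq> \<I>" "finite F" by auto
      have "(`) \<kappa> ` F \<subseteq> brideals" using \<I>_bij F(1) by (auto simp: bij_betw_def)
      then show "(\<Sum>I\<in>F. norm (ideal_zeta_term \<gg> s I)) \<le> Z"
        unfolding sum_term[OF F(1)] using F(2) by (intro Z) simp
    qed
    then show ?thesis by (rule abs_summable_summable)
  qed
  \<comment> \<open>Real s suffices to refute convergence on a half-plane, and s \<ge> 0 makes the
    terms decrease in the index, as the lower bound requires.\<close>
  have div: "\<not> ideal_zeta_term \<gg> (complex_of_real s) summable_on \<I>" if s: "0 \<le> s" "s < 2" for s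
  proof
    assume "ideal_zeta_term \<gg> (complex_of_real s) summable_on \<I>"
    \<comment> \<open>Unordered summability of complex terms is absolute, so it bounds all finite
      sums of norms.\<close>
    then have "bdd_above (sum (\<lambda>I. norm (ideal_zeta_term \<gg> (complex_of_real s) I)) ` {F. F \<subseteq> \<I> \<and> finite F})"
      unfolding summable_on_iff_abs_summable_on_complex abs_summable_iff_bdd_above .
    then obtain Z where Z: "\<And>F. F \<subseteq> \<I> \<Longrightarrow> finite F \<Longrightarrow> (\<Sum>I\<in>F. norm (ideal_zeta_term \<gg> (complex_of_real s) I)) \<le> Z"
      unfolding bdd_above_def by auto
    obtain N :: nat where N: "N > 0" "\<And>z. z \<in> R \<Longrightarrow> \<exists>j. of_nat N ^ j * z \<in> A"
      using S_integers_denominator[OF assms(2,3)] unfolding R_def by blast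
    obtain F where F: "finite F" "F \<subseteq> brideals" "(\<Sum>J\<in>F. real (idx (lat n) J) powr (- s)) > Z"
      using ideal_sum_lower[OF N s, of Z] by blast
    define F' where "F' = {I \<in> \<I>. \<kappa> ` I \<in> F}"
    have "F \<subseteq> (`) \<kappa> ` \<I>" using F(2) bij_betw_imp_surj_on[OF \<I>_bij] by simp
    then have im: "(`) \<kappa> ` F' = F" unfolding F'_def by blast
    have sub: "F' \<subseteq> \<I>" by (auto simp: F'_def)
    have "inj_on ((`) \<kappa>) F'" using \<I>_bij sub by (auto simp: bij_betw_def intro: inj_on_subset)
    then have "finite F'" using im F(1) by (metis finite_imageD)
    then have "(\<Sum>I\<in>F'. norm (ideal_zeta_term \<gg> (complex_of_real s) I)) \<le> Z" by (rule Z[OF sub])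
    then show False using F(3) unfolding sum_term[OF sub] im by simp
  qed
  show ?thesis
    unfolding ideal_zeta_abscissa_def \<I>_def[symmetric]
  proof (rule antisym)
    have "ereal 2 \<in> {ereal \<sigma> |\<sigma>. \<forall>s. Re s > \<sigma> \<longrightarrow> ideal_zeta_term \<gg> s summable_on \<I>}"
      using conv by blast
    then show "Inf {ereal \<sigma> |\<sigma>. \<forall>s. Re s > \<sigma> \<longrightarrow> ideal_zeta_term \<gg> s summable_on \<I>} \<le> 2"
      by (simp add: Inf_lower)
    show "2 \<le> Inf {ereal \<sigma> |\<sigma>. \<forall>s. Re s > \<sigma> \<longrightarrow> ideal_zeta_term \<gg> s summable_on \<I>}"
    proof (rule Inf_greatest, clarify)
      fix \<sigma> assume \<sigma>: "\<forall>s. Re s > \<sigma> \<longrightarrow> ideal_zeta_term \<gg> s summable_on \<I>"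
      have "2 \<le> \<sigma>"
      proof (rule ccontr)
        assume "\<not> 2 \<le> \<sigma>"
        \<comment> \<open>The midpoint of max \<sigma> 1 and 2 lies above \<sigma> and below 2, and
          it is nonnegative even if \<sigma> is not.\<close>
        then have "0 \<le> (max \<sigma> 1 + 2) / 2" "(max \<sigma> 1 + 2) / 2 < 2" "\<sigma> < (max \<sigma> 1 + 2) / 2" by auto
        then show False using div[of "(max \<sigma> 1 + 2) / 2"] \<sigma> by (metis Re_complex_of_real)
      qed
      then show "2 \<le> ereal \<sigma>" by simp
    qed
  qed
qed

end
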